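(* Let $X$ be a compact Hausdorff space, $\mathcal E \to X$ a vector bundle, and $G \subseteq \mathbf U\mathcal E$ a closed group. Then there is an isomorphism of tensor $C^*$-categories $\widehat{\sigma}_G \simeq \widehat G$.
   Context: $\mathcal E\to X$ is a complex Hermitian vector bundle of rank $d\in\mathbb N$. $\mathcal E^r$ is the $r$-fold tensor power, $\iota := \mathcal E^0 := X\times\mathbb C$. $(\mathcal E^r,\mathcal E^s)$ is the Banach $C(X)$-bimodule of vector bundle morphisms $\mathcal E^r\to\mathcal E^s$ (over $\mathrm{id}_X$); $(\iota,\mathcal E^r)$ is identified with the module of continuous sections of $\mathcal E^r$, and $(\iota,\iota)=C(X)$. Cuntz–Pimsner algebra $\mathcal O_{\mathcal E}$ : embed $(\mathcal E^r,\mathcal E^s)\hookrightarrow(\mathcal E^{r+1},\mathcal E^{s+1})$ by $t\mapsto t\otimes 1$ ($1$ the identity of $\mathcal E$); for $k\in\mathbb Z$ let $\mathcal O^k$ be the inductive limit of $(\mathcal E^r,\mathcal E^{r+k})$ over $r$; composition and adjoint make $\bigoplus_k\mathcal O^k$ a $*$-algebra, and $\mathcal O_{\mathcal E}$ is its closure in the unique $C^*$-norm for which the circle action $t\mapsto z^kt$ ($t\in\mathcal O^k$, $z\in\mathbb T$) is isometric. The spaces $(\mathcal E^r,\mathcal E^s)$ are regarded inside $\mathcal O_{\mathcal E}$. The canonical endomorphism $\sigma$ of $\mathcal O_{\mathcal E}$ is $\sigma(t):=1\otimes t\in(\mathcal E^{r+1},\mathcal E^{s+1})$ for $t\in(\mathcal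 E^r,\mathcal E^s)$. $\mathbf U\mathcal E$ is the group of unitary elements of $(\mathcal E,\mathcal E)$. Each $g\in\mathbf U\mathcal E$ defines an automorphism $\widehat g$ of $\mathcal O_{\mathcal E}$ by $\widehat g(t):=g^{\otimes s}\, t\, (g^* )^{\otimes r}$, $t\in(\mathcal E^r,\mathcal E^s)$. Put $(\mathcal E^r,\mathcal E^s)_G:=\{y\in(\mathcal E^r,\mathcal E^s):\widehat g(y)=y,\ g\in G\}$; $\mathcal O_G\subseteq\mathcal O_{\mathcal E}$ is the $C^*$-subalgebra generated by all $(\mathcal E^r,\mathcal E^s)_G$, $r,s\in\mathbb N$ (including $0$); $\sigma$ restricts to $\sigma_G\in\mathbf{end}\,\mathcal O_G$. The dual $\widehat G$ is the symmetric tensor $C^*$-category with objects the tensor powers $\mathcal E^r$, $r\in\mathbb N$, and arrows the spaces $(\mathcal E^r,\mathcal E^s)_G$. For an endomorphism $\rho$ of a $C^*$-algebra $\mathcal A$, $\widehat\rho$ is the tensor $C^*$-category with objects $\rho^r$, $r\in\mathbb N$ ($\rho^0=$ identity), arrows $(\rho^r,\rho^s):=\{t\in\mathcal A: t\rho^r(a)=\rho^s(a)t,\ a\in\mathcal A\}$, tensor product $\rho^r\times\rho^s:=\rho^{r+s}$ on objects and $t\times t':=t\rho^r(t')$ on arrows, $t\in(\rho^r,\rho^s)$.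
   Formalization: The vector bundle is assumed to have rank d ≥ 2; for d = 1 (X a point, G trivial) one has O_G = C(T) and σ_G = id, so (σ⁰,σ⁰) = C(T) while (ι,ι)_G = ℂ, and for d = 0 over nonempty X, O_E = 0, so the claim fails. *)

theory Defs
  imports "HOL-Analysis.Analysis"
begin

section \<open>C*-algebras\<close>

text \<open>Units are not part of the class: the zero algebra, which is the Cuntz-Pimsner algebra over
  the empty space, is then not excluded.\<close>

class cstar_algebra = real_normed_algebra + banach +
  fixes scaleC :: "complex \<Rightarrow> 'a \<Rightarrow> 'a"
    and star :: "'a \<Rightarrow> 'a"
  assumes scaleC_add_right: "scaleC c (x + y) = scaleC c x + scaleC c y"
    and scaleC_add_left: "scaleC (c + c') x = scaleC c x + scaleC c' x"
    and scaleC_scaleC: "scaleC c (scaleC c' x) = scaleC (c * c') x"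
    and scaleC_of_real: "scaleC (complex_of_real a) x = scaleR a x"
    and mult_scaleC_left: "scaleC c x * y = scaleC c (x * y)"
    and mult_scaleC_right: "x * scaleC c y = scaleC c (x * y)"
    and norm_scaleC: "norm (scaleC c x) = cmod c * norm x"
    and star_add: "star (x + y) = star x + star y"
    and star_scaleC: "star (scaleC c x) = scaleC (cnj c) (star x)"
    and star_mult: "star (x * y) = star y * star x"
    and star_star: "star (star x) = x"
    and norm_star_mult: "norm (star x * x) = (norm x)\<^sup>2"

definition cstar_subalgebra :: "'a::cstar_algebra set \<Rightarrow> bool" where
  "cstar_subalgebra B \<longleftrightarrow> closed B \<and> 0 \<in> B \<and>
     (\<forall>x\<in>B. \<forall>y\<in>B. x + y \<in> B \<and> x * y \<in> B) \<and>
     (\<forall>x\<in>B. star x \<in> B \<and> (\<forall>c. scaleC c x \<in> B))"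

definition cstar_generated :: "'a::cstar_algebra set \<Rightarrow> 'a set" where
  "cstar_generated S = \<Inter>{B. cstar_subalgebra B \<and> S \<subseteq> B}"

definition algebra_unit :: "'a::cstar_algebra set \<Rightarrow> 'a" where
  "algebra_unit B = (THE u. u \<in> B \<and> (\<forall>a\<in>B. u * a = a \<and> a * u = a))"


section \<open>Tensor C*-categories\<close>

text \<open>An arrow is an element of \<open>Arr r s\<close> together with its source \<open>r\<close> and its target \<open>s\<close>; the
  sets \<open>Arr r s\<close> need not be disjoint, so the operations take the objects as arguments.
  \<open>Cmp r s u t' t\<close> is \<open>t'\<close> after \<open>t\<close>, for \<open>t\<close> from \<open>r\<close> to \<open>s\<close> and \<open>t'\<close> from \<open>s\<close> to \<open>u\<close>;
  \<open>TAr r s r' s' t t'\<close> is the tensor product of \<open>t\<close> from \<open>r\<close> to \<open>s\<close> and \<open>t'\<close> from \<open>r'\<close> to \<open>s'\<close>.\<close>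

record ('o, 'm) tensor_cat =
  Obj :: "'o set"
  Arr :: "'o \<Rightarrow> 'o \<Rightarrow> 'm set"
  Cmp :: "'o \<Rightarrow> 'o \<Rightarrow> 'o \<Rightarrow> 'm \<Rightarrow> 'm \<Rightarrow> 'm"
  Idt :: "'o \<Rightarrow> 'm"
  Add :: "'o \<Rightarrow> 'o \<Rightarrow> 'm \<Rightarrow> 'm \<Rightarrow> 'm"
  Scl :: "'o \<Rightarrow> 'o \<Rightarrow> complex \<Rightarrow> 'm \<Rightarrow> 'm"
  Nrm :: "'o \<Rightarrow> 'o \<Rightarrow> 'm \<Rightarrow> real"
  Adj :: "'o \<Rightarrow> 'o \<Rightarrow> 'm \<Rightarrow> 'm"
  TUn :: "'o"
  TOb :: "'o \<Rightarrow> 'o \<Rightarrow> 'o"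
  TAr :: "'o \<Rightarrow> 'o \<Rightarrow> 'o \<Rightarrow> 'o \<Rightarrow> 'm \<Rightarrow> 'm \<Rightarrow> 'm"

definition Sub :: "('o, 'm) tensor_cat \<Rightarrow> 'o \<Rightarrow> 'o \<Rightarrow> 'm \<Rightarrow> 'm \<Rightarrow> 'm" where
  "Sub C r s t t' = Add C r s t (Scl C r s (-1) t')"

text \<open>The tensor product is strictly associative and unital, as in the theory of Doplicher and
  Roberts. The assumption \<open>adj_comp_positive\<close> says that the spectrum of \<open>t* t\<close> is contained in
  the half line of nonnegative reals.\<close>

locale tensor_cstar_category =
  fixes C :: "('o, 'm) tensor_cat"
  assumes
    add_closed: "\<lbrakk>r \<in> Obj C; s \<in> Obj C; t \<in> Arr C r s; t' \<in> Arr C r s\<rbrakk> \<Longrightarrow> Add C r s t t' \<in> Arr C r s"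
    and scale_closed: "\<lbrakk>r \<in> Obj C; s \<in> Obj C; t \<in> Arr C r s\<rbrakk> \<Longrightarrow> Scl C r s c t \<in> Arr C r s"
    and add_assoc: "\<lbrakk>r \<in> Obj C; s \<in> Obj C; t \<in> Arr C r s; t' \<in> Arr C r s; t'' \<in> Arr C r s\<rbrakk> \<Longrightarrow>
      Add C r s (Add C r s t t') t'' = Add C r s t (Add C r s t' t'')"
    and add_commute: "\<lbrakk>r \<in> Obj C; s \<in> Obj C; t \<in> Arr C r s; t' \<in> Arr C r s\<rbrakk> \<Longrightarrow>
      Add C r s t t' = Add C r s t' t"
    and zero_exists: "\<lbrakk>r \<in> Obj C; s \<in> Obj C\<rbrakk> \<Longrightarrow>
      \<exists>z\<in>Arr C r s. \<forall>t\<in>Arr C r s. Add C r s t z = t \<and> Sub C r s t t = z"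
    and scale_one: "\<lbrakk>r \<in> Obj C; s \<in> Obj C; t \<in> Arr C r s\<rbrakk> \<Longrightarrow> Scl C r s 1 t = t"
    and scale_scale: "\<lbrakk>r \<in> Obj C; s \<in> Obj C; t \<in> Arr C r s\<rbrakk> \<Longrightarrow>
      Scl C r s c (Scl C r s c' t) = Scl C r s (c * c') t"
    and scale_add_left: "\<lbrakk>r \<in> Obj C; s \<in> Obj C; t \<in> Arr C r s\<rbrakk> \<Longrightarrow>
      Scl C r s (c + c') t = Add C r s (Scl C r s c t) (Scl C r s c' t)"
    and scale_add_right: "\<lbrakk>r \<in> Obj C; s \<in> Obj C; t \<in> Arr C r s; t' \<in> Arr C r s\<rbrakk> \<Longrightarrow>
      Scl C r s c (Add C r s t t') = Add C r s (Scl C r s c t) (Scl C r s c t')"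
    and norm_definite: "\<lbrakk>r \<in> Obj C; s \<in> Obj C; t \<in> Arr C r s\<rbrakk> \<Longrightarrow>
      0 \<le> Nrm C r s t \<and> (Nrm C r s t = 0 \<longrightarrow> t = Scl C r s 0 t)"
    and norm_scale: "\<lbrakk>r \<in> Obj C; s \<in> Obj C; t \<in> Arr C r s\<rbrakk> \<Longrightarrow>
      Nrm C r s (Scl C r s c t) = cmod c * Nrm C r s t"
    and norm_triangle: "\<lbrakk>r \<in> Obj C; s \<in> Obj C; t \<in> Arr C r s; t' \<in> Arr C r s\<rbrakk> \<Longrightarrow>
      Nrm C r s (Add C r s t t') \<le> Nrm C r s t + Nrm C r s t'"
    and norm_complete: "\<lbrakk>r \<in> Obj C; s \<in> Obj C; \<And>n::nat. f n \<in> Arr C r s;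
        \<And>e. e > 0 \<Longrightarrow> \<exists>N. \<forall>m\<ge>N. \<forall>n\<ge>N. Nrm C r s (Sub C r s (f m) (f n)) < e\<rbrakk> \<Longrightarrow>
      \<exists>t\<in>Arr C r s. (\<lambda>n. Nrm C r s (Sub C r s (f n) t)) \<longlonglongrightarrow> 0"
    and comp_closed: "\<lbrakk>r \<in> Obj C; s \<in> Obj C; u \<in> Obj C; t \<in> Arr C r s; t' \<in> Arr C s u\<rbrakk> \<Longrightarrow>
      Cmp C r s u t' t \<in> Arr C r u"
    and comp_assoc: "\<lbrakk>r \<in> Obj C; s \<in> Obj C; u \<in> Obj C; w \<in> Obj C;
        t \<in> Arr C r s; t' \<in> Arr C s u; t'' \<in> Arr C u w\<rbrakk> \<Longrightarrow>
      Cmp C r u w t'' (Cmp C r s u t' t) = Cmp C r s w (Cmp C s u w t'' t') t"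
    and id_closed: "r \<in> Obj C \<Longrightarrow> Idt C r \<in> Arr C r r"
    and comp_id: "\<lbrakk>r \<in> Obj C; s \<in> Obj C; t \<in> Arr C r s\<rbrakk> \<Longrightarrow>
      Cmp C r s s (Idt C s) t = t \<and> Cmp C r r s t (Idt C r) = t"
    and comp_add_right: "\<lbrakk>r \<in> Obj C; s \<in> Obj C; u \<in> Obj C;
        t1 \<in> Arr C r s; t2 \<in> Arr C r s; t' \<in> Arr C s u\<rbrakk> \<Longrightarrow>
      Cmp C r s u t' (Add C r s t1 t2) = Add C r u (Cmp C r s u t' t1) (Cmp C r s u t' t2)"
    and comp_add_left: "\<lbrakk>r \<in> Obj C; s \<in> Obj C; u \<in> Obj C;
        t \<in> Arr C r s; t1 \<in> Arr C s u; t2 \<in> Arr C s u\<rbrakk> \<Longrightarrow>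
      Cmp C r s u (Add C s u t1 t2) t = Add C r u (Cmp C r s u t1 t) (Cmp C r s u t2 t)"
    and comp_scale: "\<lbrakk>r \<in> Obj C; s \<in> Obj C; u \<in> Obj C; t \<in> Arr C r s; t' \<in> Arr C s u\<rbrakk> \<Longrightarrow>
      Cmp C r s u t' (Scl C r s c t) = Scl C r u c (Cmp C r s u t' t) \<and>
      Cmp C r s u (Scl C s u c t') t = Scl C r u c (Cmp C r s u t' t)"
    and norm_comp: "\<lbrakk>r \<in> Obj C; s \<in> Obj C; u \<in> Obj C; t \<in> Arr C r s; t' \<in> Arr C s u\<rbrakk> \<Longrightarrow>
      Nrm C r u (Cmp C r s u t' t) \<le> Nrm C s u t' * Nrm C r s t"
    and adj_closed: "\<lbrakk>r \<in> Obj C; s \<in> Obj C; t \<in> Arr C r s\<rbrakk> \<Longrightarrow> Adj C r s t \<in> Arr C s r"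
    and adj_adj: "\<lbrakk>r \<in> Obj C; s \<in> Obj C; t \<in> Arr C r s\<rbrakk> \<Longrightarrow> Adj C s r (Adj C r s t) = t"
    and adj_add: "\<lbrakk>r \<in> Obj C; s \<in> Obj C; t \<in> Arr C r s; t' \<in> Arr C r s\<rbrakk> \<Longrightarrow>
      Adj C r s (Add C r s t t') = Add C s r (Adj C r s t) (Adj C r s t')"
    and adj_scale: "\<lbrakk>r \<in> Obj C; s \<in> Obj C; t \<in> Arr C r s\<rbrakk> \<Longrightarrow>
      Adj C r s (Scl C r s c t) = Scl C s r (cnj c) (Adj C r s t)"
    and adj_comp: "\<lbrakk>r \<in> Obj C; s \<in> Obj C; u \<in> Obj C; t \<in> Arr C r s; t' \<in> Arr C s u\<rbrakk> \<Longrightarrow>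
      Adj C r u (Cmp C r s u t' t) = Cmp C u s r (Adj C r s t) (Adj C s u t')"
    and cstar_identity: "\<lbrakk>r \<in> Obj C; s \<in> Obj C; t \<in> Arr C r s\<rbrakk> \<Longrightarrow>
      Nrm C r r (Cmp C r s r (Adj C r s t) t) = (Nrm C r s t)\<^sup>2"
    and adj_comp_positive: "\<lbrakk>r \<in> Obj C; s \<in> Obj C; t \<in> Arr C r s; \<not> (Im c = 0 \<and> Re c \<ge> 0);
        p = Sub C r r (Cmp C r s r (Adj C r s t) t) (Scl C r r c (Idt C r))\<rbrakk> \<Longrightarrow>
      \<exists>q\<in>Arr C r r. Cmp C r r r q p = Idt C r \<and> Cmp C r r r p q = Idt C r"
    and tunit_closed: "TUn C \<in> Obj C"
    and tobj_closed: "\<lbrakk>r \<in> Obj C; s \<in> Obj C\<rbrakk> \<Longrightarrow> TOb C r s \<in> Obj C"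
    and tobj_assoc: "\<lbrakk>r \<in> Obj C; s \<in> Obj C; u \<in> Obj C\<rbrakk> \<Longrightarrow>
      TOb C (TOb C r s) u = TOb C r (TOb C s u)"
    and tobj_unit: "r \<in> Obj C \<Longrightarrow> TOb C (TUn C) r = r \<and> TOb C r (TUn C) = r"
    and tens_closed: "\<lbrakk>r \<in> Obj C; s \<in> Obj C; r' \<in> Obj C; s' \<in> Obj C; t \<in> Arr C r s; t' \<in> Arr C r' s'\<rbrakk> \<Longrightarrow>
      TAr C r s r' s' t t' \<in> Arr C (TOb C r r') (TOb C s s')"
    and tens_assoc: "\<lbrakk>r \<in> Obj C; s \<in> Obj C; r' \<in> Obj C; s' \<in> Obj C; r'' \<in> Obj C; s'' \<in> Obj C;
        t \<in> Arr C r s; t' \<in> Arr C r' s'; t'' \<in> Arr C r'' s''\<rbrakk> \<Longrightarrow>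
      TAr C (TOb C r r') (TOb C s s') r'' s'' (TAr C r s r' s' t t') t'' =
      TAr C r s (TOb C r' r'') (TOb C s' s'') t (TAr C r' s' r'' s'' t' t'')"
    and tens_unit: "\<lbrakk>r \<in> Obj C; s \<in> Obj C; t \<in> Arr C r s\<rbrakk> \<Longrightarrow>
      TAr C (TUn C) (TUn C) r s (Idt C (TUn C)) t = t \<and>
      TAr C r s (TUn C) (TUn C) t (Idt C (TUn C)) = t"
    and tens_id: "\<lbrakk>r \<in> Obj C; s \<in> Obj C\<rbrakk> \<Longrightarrow>
      TAr C r r s s (Idt C r) (Idt C s) = Idt C (TOb C r s)"
    and tens_comp: "\<lbrakk>r \<in> Obj C; s \<in> Obj C; u \<in> Obj C; r' \<in> Obj C; s' \<in> Obj C; u' \<in> Obj C;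
        t1 \<in> Arr C r s; t2 \<in> Arr C s u; t1' \<in> Arr C r' s'; t2' \<in> Arr C s' u'\<rbrakk> \<Longrightarrow>
      TAr C r u r' u' (Cmp C r s u t2 t1) (Cmp C r' s' u' t2' t1') =
      Cmp C (TOb C r r') (TOb C s s') (TOb C u u') (TAr C s u s' u' t2 t2') (TAr C r s r' s' t1 t1')"
    and tens_adj: "\<lbrakk>r \<in> Obj C; s \<in> Obj C; r' \<in> Obj C; s' \<in> Obj C; t \<in> Arr C r s; t' \<in> Arr C r' s'\<rbrakk> \<Longrightarrow>
      Adj C (TOb C r r') (TOb C s s') (TAr C r s r' s' t t') =
      TAr C s r s' r' (Adj C r s t) (Adj C r' s' t')"
    and tens_add_left: "\<lbrakk>r \<in> Obj C; s \<in> Obj C; r' \<in> Obj C; s' \<in> Obj C;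
        t1 \<in> Arr C r s; t2 \<in> Arr C r s; t' \<in> Arr C r' s'\<rbrakk> \<Longrightarrow>
      TAr C r s r' s' (Add C r s t1 t2) t' =
      Add C (TOb C r r') (TOb C s s') (TAr C r s r' s' t1 t') (TAr C r s r' s' t2 t')"
    and tens_add_right: "\<lbrakk>r \<in> Obj C; s \<in> Obj C; r' \<in> Obj C; s' \<in> Obj C;
        t \<in> Arr C r s; t1 \<in> Arr C r' s'; t2 \<in> Arr C r' s'\<rbrakk> \<Longrightarrow>
      TAr C r s r' s' t (Add C r' s' t1 t2) =
      Add C (TOb C r r') (TOb C s s') (TAr C r s r' s' t t1) (TAr C r s r' s' t t2)"
    and tens_scale: "\<lbrakk>r \<in> Obj C; s \<in> Obj C; r' \<in> Obj C; s' \<in> Obj C; t \<in> Arr C r s; t' \<in> Arr C r' s'\<rbrakk> \<Longrightarrow>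
      TAr C r s r' s' (Scl C r s c t) t' =
        Scl C (TOb C r r') (TOb C s s') c (TAr C r s r' s' t t') \<and>
      TAr C r s r' s' t (Scl C r' s' c t') =
        Scl C (TOb C r r') (TOb C s s') c (TAr C r s r' s' t t')"

definition tensor_cstar_isomorphism ::
  "('o, 'm) tensor_cat \<Rightarrow> ('p, 'n) tensor_cat \<Rightarrow> ('o \<Rightarrow> 'p) \<Rightarrow> ('o \<Rightarrow> 'o \<Rightarrow> 'm \<Rightarrow> 'n) \<Rightarrow> bool" where
  "tensor_cstar_isomorphism C D Fo Fa \<longleftrightarrow>
     bij_betw Fo (Obj C) (Obj D) \<and>
     Fo (TUn C) = TUn D \<and>
     (\<forall>r\<in>Obj C. Fa r r (Idt C r) = Idt D (Fo r)) \<and>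
     (\<forall>r\<in>Obj C. \<forall>s\<in>Obj C.
        Fo (TOb C r s) = TOb D (Fo r) (Fo s) \<and>
        bij_betw (Fa r s) (Arr C r s) (Arr D (Fo r) (Fo s)) \<and>
        (\<forall>t\<in>Arr C r s.
           Fa s r (Adj C r s t) = Adj D (Fo r) (Fo s) (Fa r s t) \<and>
           Nrm D (Fo r) (Fo s) (Fa r s t) = Nrm C r s t \<and>
           (\<forall>c. Fa r s (Scl C r s c t) = Scl D (Fo r) (Fo s) c (Fa r s t)) \<and>
           (\<forall>t'\<in>Arr C r s. Fa r s (Add C r s t t') = Add D (Fo r) (Fo s) (Fa r s t) (Fa r s t')) \<and>
           (\<forall>u\<in>Obj C. \<forall>t'\<in>Arr C s u.
              Fa r u (Cmp C r s u t' t) = Cmp D (Fo r) (Fo s) (Fo u) (Fa s u t') (Fa r s t)) \<and>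
           (\<forall>r'\<in>Obj C. \<forall>s'\<in>Obj C. \<forall>t'\<in>Arr C r' s'.
              Fa (TOb C r r') (TOb C s s') (TAr C r s r' s' t t') =
              TAr D (Fo r) (Fo s) (Fo r') (Fo s') (Fa r s t) (Fa r' s' t'))))"

definition tensor_cstar_isomorphic :: "('o, 'm) tensor_cat \<Rightarrow> ('p, 'n) tensor_cat \<Rightarrow> bool" where
  "tensor_cstar_isomorphic C D \<longleftrightarrow>
     tensor_cstar_category C \<and> tensor_cstar_category D \<and>
     (\<exists>Fo Fa. tensor_cstar_isomorphism C D Fo Fa)"

text \<open>The tensor C*-category of the powers of an endomorphism \<open>\<rho>\<close> of \<open>B\<close>. The object \<open>\<rho>\<^sup>r\<close> is
  represented by the exponent \<open>r\<close>.\<close>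

definition endo_category :: "'a::cstar_algebra set \<Rightarrow> ('a \<Rightarrow> 'a) \<Rightarrow> (nat, 'a) tensor_cat" where
  "endo_category B \<rho> =
    \<lparr> Obj = UNIV,
      Arr = (\<lambda>r s. {t \<in> B. \<forall>a\<in>B. t * (\<rho> ^^ r) a = (\<rho> ^^ s) a * t}),
      Cmp = (\<lambda>r s u t' t. t' * t),
      Idt = (\<lambda>r. algebra_unit B),
      Add = (\<lambda>r s t t'. t + t'),
      Scl = (\<lambda>r s c t. scaleC c t),
      Nrm = (\<lambda>r s t. norm t),
      Adj = (\<lambda>r s t. star t),
      TUn = 0,
      TOb = (\<lambda>r s. r + s),
      TAr = (\<lambda>r s r' s' t t'. t * (\<rho> ^^ r) t') \<rparr>"


section \<open>Hermitian vector bundles and their morphisms\<close>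

text \<open>The algebraic operations are only meaningful for vectors in the same fibre. The Hermitian
  form is conjugate linear in its first argument.\<close>

record ('x, 'e) hbundle =
  bbase :: "'x topology"
  btotal :: "'e topology"
  bproj :: "'e \<Rightarrow> 'x"
  brank :: nat
  badd :: "'e \<Rightarrow> 'e \<Rightarrow> 'e"
  bscale :: "complex \<Rightarrow> 'e \<Rightarrow> 'e"
  bherm :: "'e \<Rightarrow> 'e \<Rightarrow> complex"

definition fibre :: "('x, 'e) hbundle \<Rightarrow> 'x \<Rightarrow> 'e set" where
  "fibre E x = {v \<in> topspace (btotal E). bproj E v = x}"

definition cspace :: "'i set \<Rightarrow> ('i \<Rightarrow> complex) topology" where
  "cspace I = product_topology (\<lambda>_. euclidean) I"

definition unit_vec :: "nat \<Rightarrow> nat \<Rightarrow> nat \<Rightarrow> complex" where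
  "unit_vec d i = (\<lambda>k\<in>{..<d}. if k = i then 1 else 0)"

definition local_triv :: "('x, 'e) hbundle \<Rightarrow> 'x set \<Rightarrow> ('x \<times> (nat \<Rightarrow> complex) \<Rightarrow> 'e) \<Rightarrow> bool" where
  "local_triv E U \<phi> \<longleftrightarrow>
     openin (bbase E) U \<and>
     homeomorphic_map (prod_topology (subtopology (bbase E) U) (cspace {..<brank E}))
       (subtopology (btotal E) {v \<in> topspace (btotal E). bproj E v \<in> U}) \<phi> \<and>
     (\<forall>y\<in>U. \<forall>c\<in>topspace (cspace {..<brank E}).
        bproj E (\<phi> (y, c)) = y \<and>
        (\<forall>a. \<phi> (y, \<lambda>i\<in>{..<brank E}. a * c i) = bscale E a (\<phi> (y, c))) \<and>
        (\<forall>c'\<in>topspace (cspace {..<brank E}).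
           \<phi> (y, \<lambda>i\<in>{..<brank E}. c i + c' i) = badd E (\<phi> (y, c)) (\<phi> (y, c'))))"

text \<open>The vector space axioms on the fibres follow from the existence of fibrewise linear
  trivializations.\<close>

definition hermitian_bundle :: "('x, 'e) hbundle \<Rightarrow> bool" where
  "hermitian_bundle E \<longleftrightarrow>
     continuous_map (btotal E) (bbase E) (bproj E) \<and>
     (\<forall>x\<in>topspace (bbase E). \<exists>U \<phi>. x \<in> U \<and> local_triv E U \<phi>) \<and>
     (\<forall>x\<in>topspace (bbase E). \<forall>v\<in>fibre E x.
        0 \<le> Re (bherm E v v) \<and> (bherm E v v = 0 \<longrightarrow> v = bscale E 0 v) \<and>
        (\<forall>w\<in>fibre E x. bherm E w v = cnj (bherm E v w) \<and>
           (\<forall>a. bherm E v (bscale E a w) = a * bherm E v w) \<and>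
           (\<forall>w'\<in>fibre E x. bherm E v (badd E w w') = bherm E v w + bherm E v w'))) \<and>
     continuous_map
       (subtopology (prod_topology (btotal E) (btotal E)) {(v, w). bproj E v = bproj E w})
       euclidean (\<lambda>(v, w). bherm E v w)"

text \<open>Morphisms over the identity of the base; extensionality makes a morphism determined by its
  values on the total space.\<close>

definition bmor :: "('x, 'e) hbundle \<Rightarrow> ('x, 'f) hbundle \<Rightarrow> ('e \<Rightarrow> 'f) set" where
  "bmor E F = {t \<in> extensional (topspace (btotal E)).
     continuous_map (btotal E) (btotal F) t \<and>
     (\<forall>x\<in>topspace (bbase E). \<forall>v\<in>fibre E x.
        t v \<in> fibre F x \<and>
        (\<forall>a. t (bscale E a v) = bscale F a (t v)) \<and>
        (\<forall>w\<in>fibre E x. t (badd E v w) = badd F (t v) (t w)))}"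

definition mid :: "('x, 'e) hbundle \<Rightarrow> 'e \<Rightarrow> 'e" where
  "mid E = (\<lambda>v\<in>topspace (btotal E). v)"

definition mcomp :: "('x, 'e) hbundle \<Rightarrow> ('f \<Rightarrow> 'g) \<Rightarrow> ('e \<Rightarrow> 'f) \<Rightarrow> 'e \<Rightarrow> 'g" where
  "mcomp E t' t = (\<lambda>v\<in>topspace (btotal E). t' (t v))"

definition madd :: "('x, 'e) hbundle \<Rightarrow> ('x, 'f) hbundle \<Rightarrow> ('e \<Rightarrow> 'f) \<Rightarrow> ('e \<Rightarrow> 'f) \<Rightarrow> 'e \<Rightarrow> 'f" where
  "madd E F t t' = (\<lambda>v\<in>topspace (btotal E). badd F (t v) (t' v))"

definition mscale :: "('x, 'e) hbundle \<Rightarrow> ('x, 'f) hbundle \<Rightarrow> complex \<Rightarrow> ('e \<Rightarrow> 'f) \<Rightarrow> 'e \<Rightarrow> 'f" where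
  "mscale E F a t = (\<lambda>v\<in>topspace (btotal E). bscale F a (t v))"

definition madj :: "('x, 'e) hbundle \<Rightarrow> ('x, 'f) hbundle \<Rightarrow> ('e \<Rightarrow> 'f) \<Rightarrow> 'f \<Rightarrow> 'e" where
  "madj E F t = (THE u. u \<in> bmor F E \<and>
     (\<forall>x\<in>topspace (bbase E). \<forall>v\<in>fibre E x. \<forall>w\<in>fibre F x. bherm E (u w) v = bherm F w (t v)))"

definition bnorm :: "('x, 'e) hbundle \<Rightarrow> 'e \<Rightarrow> real" where
  "bnorm E v = sqrt (Re (bherm E v v))"

text \<open>Supremum over the base of the operator norms on the fibres; inserting \<open>0\<close> only matters for
  the empty base.\<close>

definition mnorm :: "('x, 'e) hbundle \<Rightarrow> ('x, 'f) hbundle \<Rightarrow> ('e \<Rightarrow> 'f) \<Rightarrow> real" where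
  "mnorm E F t = Sup (insert 0 {bnorm F (t v) | v. v \<in> topspace (btotal E) \<and> bnorm E v \<le> 1})"


section \<open>Tensor powers\<close>

text \<open>The \<open>r\<close>-fold tensor power of a (finite-dimensional) Hilbert space is realized, as in Reed and
  Simon, on the conjugate-multilinear forms in \<open>r\<close> arguments: \<open>v\<^sub>1 \<otimes> \<dots> \<otimes> v\<^sub>r\<close> is the form
  sending \<open>(w\<^sub>1, \<dots>, w\<^sub>r)\<close> to the product of the inner products of \<open>w\<^sub>i\<close> and \<open>v\<^sub>i\<close>, and the tensor
  power is the linear span of these. Forms are functions on lists, zero outside their domain. With
  this model the tensor product of vectors is strictly associative.\<close>

type_synonym 'e tensor = "'e list \<Rightarrow> complex"

definition simple_tensor :: "('x, 'e) hbundle \<Rightarrow> 'x \<Rightarrow> 'e list \<Rightarrow> 'e tensor" where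
  "simple_tensor E x vs = (\<lambda>ws. if length ws = length vs \<and> set ws \<subseteq> fibre E x
     then (\<Prod>i<length vs. bherm E (ws ! i) (vs ! i)) else 0)"

definition tensor_fibre :: "('x, 'e) hbundle \<Rightarrow> nat \<Rightarrow> 'x \<Rightarrow> 'e tensor set" where
  "tensor_fibre E r x = {\<lambda>ws. \<Sum>i<n. c i * simple_tensor E x (vs i) ws | (n::nat) c vs.
     \<forall>i<n. length (vs i) = r \<and> set (vs i) \<subseteq> fibre E x}"

definition orthonormal_basis :: "('x, 'e) hbundle \<Rightarrow> 'x \<Rightarrow> 'e set \<Rightarrow> bool" where
  "orthonormal_basis E x B \<longleftrightarrow> finite B \<and> B \<subseteq> fibre E x \<and>
     (\<forall>b\<in>B. \<forall>b'\<in>B. bherm E b b' = (if b = b' then 1 else 0)) \<and>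
     (\<forall>v\<in>fibre E x. (\<forall>b\<in>B. bherm E b v = 0) \<longrightarrow> bherm E v v = 0)"

text \<open>As \<open>T (b\<^sub>1, \<dots>, b\<^sub>r)\<close> is the inner product of \<open>b\<^sub>1 \<otimes> \<dots> \<otimes> b\<^sub>r\<close> and \<open>T\<close>, this is the inner
  product with value \<open>\<Prod>\<^sub>i \<langle>v\<^sub>i, w\<^sub>i\<rangle>\<close> on simple tensors; it does not depend on the basis.\<close>

definition tensor_herm :: "('x, 'e) hbundle \<Rightarrow> nat \<Rightarrow> 'x \<Rightarrow> 'e tensor \<Rightarrow> 'e tensor \<Rightarrow> complex" where
  "tensor_herm E r x S T = (let B = (SOME B. orthonormal_basis E x B) in
     \<Sum>bs | length bs = r \<and> set bs \<subseteq> B. cnj (S bs) * T bs)"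

definition multi_index :: "nat \<Rightarrow> nat \<Rightarrow> nat list set" where
  "multi_index d r = {I. length I = r \<and> set I \<subseteq> {..<d}}"

definition tensor_chart ::
  "('x, 'e) hbundle \<Rightarrow> nat \<Rightarrow> ('x \<times> (nat \<Rightarrow> complex) \<Rightarrow> 'e) \<Rightarrow> 'x \<times> (nat list \<Rightarrow> complex) \<Rightarrow> 'x \<times> 'e tensor" where
  "tensor_chart E r \<phi> = (\<lambda>(y, c). (y, \<lambda>ws. \<Sum>I\<in>multi_index (brank E) r.
     c I * simple_tensor E y (map (\<lambda>i. \<phi> (y, unit_vec (brank E) i)) I) ws))"

text \<open>The topology of the tensor power is the one for which the charts induced by local
  trivializations of \<open>E\<close> are homeomorphisms onto open sets.\<close>

definition tensor_topology :: "('x, 'e) hbundle \<Rightarrow> nat \<Rightarrow> ('x \<times> 'e tensor) topology" where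
  "tensor_topology E r = topology (\<lambda>W.
     W \<subseteq> (SIGMA x:topspace (bbase E). tensor_fibre E r x) \<and>
     (\<forall>U \<phi>. local_triv E U \<phi> \<longrightarrow>
        openin (prod_topology (subtopology (bbase E) U) (cspace (multi_index (brank E) r)))
          {p \<in> U \<times> topspace (cspace (multi_index (brank E) r)). tensor_chart E r \<phi> p \<in> W}))"

definition tpow :: "('x, 'e) hbundle \<Rightarrow> nat \<Rightarrow> ('x, 'x \<times> 'e tensor) hbundle" where
  "tpow E r =
    \<lparr> bbase = bbase E,
      btotal = tensor_topology E r,
      bproj = fst,
      brank = brank E ^ r,
      badd = (\<lambda>(x, S) (y, T). (x, \<lambda>ws. S ws + T ws)),
      bscale = (\<lambda>a (x, S). (x, \<lambda>ws. a * S ws)),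
      bherm = (\<lambda>(x, S) (y, T). tensor_herm E r x S T) \<rparr>"

abbreviation thom :: "('x, 'e) hbundle \<Rightarrow> nat \<Rightarrow> nat \<Rightarrow> ('x \<times> 'e tensor \<Rightarrow> 'x \<times> 'e tensor) set" where
  "thom E r s \<equiv> bmor (tpow E r) (tpow E s)"

definition tensor_vec :: "nat \<Rightarrow> 'e tensor \<Rightarrow> 'e tensor \<Rightarrow> 'e tensor" where
  "tensor_vec r S T = (\<lambda>ws. S (take r ws) * T (drop r ws))"

definition mtensor :: "('x, 'e) hbundle \<Rightarrow> nat \<Rightarrow> nat \<Rightarrow> nat \<Rightarrow> nat \<Rightarrow>
    ('x \<times> 'e tensor \<Rightarrow> 'x \<times> 'e tensor) \<Rightarrow> ('x \<times> 'e tensor \<Rightarrow> 'x \<times> 'e tensor) \<Rightarrow>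
    'x \<times> 'e tensor \<Rightarrow> 'x \<times> 'e tensor" where
  "mtensor E r s r' s' t t' = (THE u. u \<in> thom E (r + r') (s + s') \<and>
     (\<forall>x\<in>topspace (bbase E). \<forall>S\<in>tensor_fibre E r x. \<forall>T\<in>tensor_fibre E r' x.
        u (x, tensor_vec r S T) = (x, tensor_vec s (snd (t (x, S))) (snd (t' (x, T))))))"

definition mpow :: "('x, 'e) hbundle \<Rightarrow> nat \<Rightarrow> ('e \<Rightarrow> 'e) \<Rightarrow> 'x \<times> 'e tensor \<Rightarrow> 'x \<times> 'e tensor" where
  "mpow E r g = (THE u. u \<in> thom E r r \<and>
     (\<forall>x\<in>topspace (bbase E). \<forall>vs. length vs = r \<and> set vs \<subseteq> fibre E x \<longrightarrow>
        u (x, simple_tensor E x vs) = (x, simple_tensor E x (map g vs))))"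


section \<open>Groups of unitaries and their duals\<close>

definition unitaries :: "('x, 'e) hbundle \<Rightarrow> ('e \<Rightarrow> 'e) set" where
  "unitaries E = {g \<in> bmor E E. mcomp E (madj E E g) g = mid E \<and> mcomp E g (madj E E g) = mid E}"

text \<open>The topology on the unitary group is the norm topology.\<close>

definition closed_unitary_group :: "('x, 'e) hbundle \<Rightarrow> ('e \<Rightarrow> 'e) set \<Rightarrow> bool" where
  "closed_unitary_group E G \<longleftrightarrow> G \<subseteq> unitaries E \<and> mid E \<in> G \<and>
     (\<forall>g\<in>G. madj E E g \<in> G) \<and> (\<forall>g\<in>G. \<forall>h\<in>G. mcomp E g h \<in> G) \<and>
     (\<forall>u\<in>unitaries E.
        (\<forall>e>0. \<exists>g\<in>G. mnorm E E (madd E E u (mscale E E (-1) g)) < e) \<longrightarrow> u \<in> G)"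

definition hat :: "('x, 'e) hbundle \<Rightarrow> nat \<Rightarrow> nat \<Rightarrow> ('e \<Rightarrow> 'e) \<Rightarrow>
    ('x \<times> 'e tensor \<Rightarrow> 'x \<times> 'e tensor) \<Rightarrow> 'x \<times> 'e tensor \<Rightarrow> 'x \<times> 'e tensor" where
  "hat E r s g t =
     mcomp (tpow E r) (mpow E s g) (mcomp (tpow E r) t (mpow E r (madj E E g)))"

definition invariant_hom :: "('x, 'e) hbundle \<Rightarrow> ('e \<Rightarrow> 'e) set \<Rightarrow> nat \<Rightarrow> nat \<Rightarrow>
    ('x \<times> 'e tensor \<Rightarrow> 'x \<times> 'e tensor) set" where
  "invariant_hom E G r s = {t \<in> thom E r s. \<forall>g\<in>G. hat E r s g t = t}"

text \<open>The object given by the \<open>r\<close>-fold tensor power is represented by \<open>r\<close>.\<close>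

definition dual_category :: "('x, 'e) hbundle \<Rightarrow> ('e \<Rightarrow> 'e) set \<Rightarrow>
    (nat, 'x \<times> 'e tensor \<Rightarrow> 'x \<times> 'e tensor) tensor_cat" where
  "dual_category E G =
    \<lparr> Obj = UNIV,
      Arr = invariant_hom E G,
      Cmp = (\<lambda>r s u t' t. mcomp (tpow E r) t' t),
      Idt = (\<lambda>r. mid (tpow E r)),
      Add = (\<lambda>r s. madd (tpow E r) (tpow E s)),
      Scl = (\<lambda>r s. mscale (tpow E r) (tpow E s)),
      Nrm = (\<lambda>r s. mnorm (tpow E r) (tpow E s)),
      Adj = (\<lambda>r s. madj (tpow E r) (tpow E s)),
      TUn = 0,
      TOb = (\<lambda>r s. r + s),
      TAr = mtensor E \<rparr>"


section \<open>The Cuntz-Pimsner algebra\<close>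

text \<open>The algebra is characterized rather than constructed: the C*-algebra given by the type \<open>'a\<close>,
  with maps \<open>j r s\<close> from the spaces of morphisms, is a Cuntz-Pimsner algebra of \<open>E\<close>
  if the \<open>j\<close> exhibit the *-algebra \<open>\<Oplus>\<^sub>k O\<^sup>k\<close>, with \<open>O\<^sup>k\<close> the inductive limit of the Banach spaces of
  morphisms along \<open>t \<mapsto> t \<otimes> 1\<close>, as a dense *-subalgebra on whose graded pieces the circle acts by
  isometries. The last clause also makes the sum of the spaces \<open>O\<^sup>k\<close> direct. Since the C*-norm is
  unique, any two such algebras are isomorphic. Isometry of the \<open>j\<close> is the inductive limit norm,
  provided the connecting maps are isometric, which requires \<open>brank E \<noteq> 0\<close>.\<close>

definition cp_grade :: "('x, 'e) hbundle \<Rightarrow>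
    (nat \<Rightarrow> nat \<Rightarrow> ('x \<times> 'e tensor \<Rightarrow> 'x \<times> 'e tensor) \<Rightarrow> 'a::cstar_algebra) \<Rightarrow> int \<Rightarrow> 'a set" where
  "cp_grade E j k = {j r s t | r s t. int s - int r = k \<and> t \<in> thom E r s}"

definition cuntz_pimsner :: "('x, 'e) hbundle \<Rightarrow>
    (nat \<Rightarrow> nat \<Rightarrow> ('x \<times> 'e tensor \<Rightarrow> 'x \<times> 'e tensor) \<Rightarrow> 'a::cstar_algebra) \<Rightarrow> bool" where
  "cuntz_pimsner E j \<longleftrightarrow>
     (\<forall>r s. \<forall>t\<in>thom E r s.
        j (Suc r) (Suc s) (mtensor E r s 1 1 t (mid (tpow E 1))) = j r s t \<and>
        norm (j r s t) = mnorm (tpow E r) (tpow E s) t \<and>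
        j s r (madj (tpow E r) (tpow E s) t) = star (j r s t) \<and>
        (\<forall>a. j r s (mscale (tpow E r) (tpow E s) a t) = scaleC a (j r s t)) \<and>
        (\<forall>t'\<in>thom E r s. j r s (madd (tpow E r) (tpow E s) t t') = j r s t + j r s t') \<and>
        (\<forall>u. \<forall>t'\<in>thom E s u. j r u (mcomp (tpow E r) t' t) = j s u t' * j r s t)) \<and>
     closure {\<Sum>k\<in>K. a k | K a. finite K \<and> (\<forall>k\<in>K. a k \<in> cp_grade E j k)} = UNIV \<and>
     (\<forall>K a z. finite K \<and> (\<forall>k\<in>K. a k \<in> cp_grade E j k) \<and> cmod z = 1 \<longrightarrow>
        norm (\<Sum>k\<in>K. scaleC (z powi k) (a k)) = norm (\<Sum>k\<in>K. a k))"

text \<open>The continuous *-endomorphism extending \<open>t \<mapsto> 1 \<otimes> t\<close>; it is unique by density.\<close>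

definition canonical_endomorphism :: "('x, 'e) hbundle \<Rightarrow>
    (nat \<Rightarrow> nat \<Rightarrow> ('x \<times> 'e tensor \<Rightarrow> 'x \<times> 'e tensor) \<Rightarrow> 'a::cstar_algebra) \<Rightarrow> ('a \<Rightarrow> 'a) \<Rightarrow> bool" where
  "canonical_endomorphism E j \<sigma> \<longleftrightarrow>
     continuous_on UNIV \<sigma> \<and>
     (\<forall>a b. \<sigma> (a + b) = \<sigma> a + \<sigma> b \<and> \<sigma> (a * b) = \<sigma> a * \<sigma> b) \<and>
     (\<forall>a. \<sigma> (star a) = star (\<sigma> a) \<and> (\<forall>c. \<sigma> (scaleC c a) = scaleC c (\<sigma> a))) \<and>
     (\<forall>r s. \<forall>t\<in>thom E r s.
        \<sigma> (j r s t) = j (Suc r) (Suc s) (mtensor E 1 1 r s (mid (tpow E 1)) t))"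

definition invariant_algebra :: "('x, 'e) hbundle \<Rightarrow>
    (nat \<Rightarrow> nat \<Rightarrow> ('x \<times> 'e tensor \<Rightarrow> 'x \<times> 'e tensor) \<Rightarrow> 'a::cstar_algebra) \<Rightarrow> ('e \<Rightarrow> 'e) set \<Rightarrow> 'a set" where
  "invariant_algebra E j G = cstar_generated (\<Union>r s. j r s ` invariant_hom E G r s)"

end

theory Submission imports Defs begin

text \<open>A morphism \<open>E\<^sup>r \<rightarrow> E\<^sup>s\<close> is handled through its kernel, the function of \<open>r + s\<close> vectors given by its
  matrix coefficients at simple tensors. The point is that the intertwiners of \<open>\<sigma>\<^sub>G\<^sup>r\<close> and \<open>\<sigma>\<^sub>G\<^sup>s\<close> are
  exactly the elements of \<open>(E\<^sup>r, E\<^sup>s)\<^sub>G\<close>; only flips of tensor factors, which lie in \<open>O\<^sub>G\<close>, are needed as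
  test elements. Approximate an intertwiner \<open>t\<close> by a finite sum of homogeneous invariant elements.

  Let \<open>y\<close> be the component of degree \<open>k \<noteq> s - r\<close> and \<open>w\<close> a far translate \<open>\<sigma>\<^sup>m(f)\<close> of the flip \<open>f\<close>. Since
  \<open>t \<sigma>\<^sup>r(w) = \<sigma>\<^sup>s(w) t\<close>, the element \<open>y \<sigma>\<^sup>r(w) - \<sigma>\<^sup>s(w) y\<close> is small, while \<open>\<sigma>\<^sup>s(w) y = y \<sigma>\<^sup>s\<^sup>-\<^sup>k(w)\<close> exactly. So
  \<open>y\<close> almost annihilates the difference of two distinct translates of \<open>f\<close> acting beyond its slots, which
  has norm at least \<open>1\<close> because the rank is at least \<open>2\<close>; hence \<open>y\<close> is small. Fejer means bound the
  number of components to be removed, and \<open>t\<close> is approximated by elements of degree \<open>s - r\<close> alone. If such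
  an element acts on \<open>n\<close> slots too many, it nearly commutes with the flip that exchanges these with the
  next \<open>n\<close> slots, so it is close to its partial trace over them, a morphism \<open>E\<^sup>r \<rightarrow> E\<^sup>s\<close>. The image of the
  morphisms is closed, and invariance passes to the limit.

  The embeddings of the morphisms are isometric and respect all operations. The axioms of a tensor
  C*-category hold for the intertwiners, where only positivity of \<open>t\<^sup>* t\<close> needs an argument (on the fibres,
  followed by a Neumann series), and they are carried over to the dual along the embeddings.\<close>

section \<open>Continuous Gram--Schmidt orthonormalization\<close>

text \<open>Tensor products, tensor powers of unitaries and adjoints are definite descriptions:
  nothing can be computed with them before a continuous morphism with the required values is
  exhibited. In addition, the basis behind the inner product of tensors is chosen point by point,
  without continuity. Orthonormal frames and kernels remove both difficulties: continuity is
  continuity of finitely many matrix entries, and identities are checked on lists of vectors. The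
  circle is only known to act isometrically on finite sums, so Fejer means are taken of finite sums.
  The number of terms of an approximating sum may grow with its accuracy; hence the cut-off of the
  means has to be fixed before the accuracy. Rank 1 is a genuine obstruction: for the trivial line
  bundle over a nonempty base and the trivial group, the canonical endomorphism is the identity of a
  commutative algebra, and every element intertwines every pair of powers. The flips serve as test
  elements for all groups at once, since a unitary acts in the same way on every slot.\<close>

lemma continuous_map_mult':
  fixes f g :: "'a \<Rightarrow> 'b::real_normed_algebra"
  shows "continuous_map X euclidean f \<Longrightarrow> continuous_map X euclidean g \<Longrightarrow>
    continuous_map X euclidean (\<lambda>x. f x * g x)"
  by (simp add: continuous_map_atin tendsto_mult)

lemma continuous_map_prod':
  fixes f :: "'a \<Rightarrow> 'b \<Rightarrow> 'c::{real_normed_algebra,comm_ring_1}"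
  shows "(\<And>i. i \<in> I \<Longrightarrow> continuous_map X euclidean (\<lambda>x. f x i)) \<Longrightarrow>
    continuous_map X euclidean (\<lambda>x. prod (f x) I)"
  by (simp add: continuous_map_atin tendsto_prod)

lemma continuous_map_cnj:
  "continuous_map X euclidean f \<Longrightarrow> continuous_map X euclidean (\<lambda>x. cnj (f x))"
  by (simp add: continuous_map_atin tendsto_cnj)

lemma continuous_map_Re:
  "continuous_map X euclidean f \<Longrightarrow> continuous_map X euclidean (\<lambda>x. Re (f x))"
  by (simp add: continuous_map_atin tendsto_Re)

lemma continuous_map_of_real':
  "continuous_map X euclideanreal f \<Longrightarrow> continuous_map X euclidean (\<lambda>x. complex_of_real (f x))"
  by (simp add: continuous_map_atin tendsto_of_real)

lemma continuous_map_divide':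
  fixes f g :: "'a \<Rightarrow> 'b::real_normed_field"
  shows "continuous_map X euclidean f \<Longrightarrow> continuous_map X euclidean g \<Longrightarrow>
    (\<And>x. x \<in> topspace X \<Longrightarrow> g x \<noteq> 0) \<Longrightarrow> continuous_map X euclidean (\<lambda>x. f x / g x)"
  by (simp add: continuous_map_atin tendsto_divide)

lemma continuous_map_sum':
  fixes f :: "'a \<Rightarrow> 'b \<Rightarrow> 'c::real_normed_vector"
  shows "(\<And>i. i \<in> I \<Longrightarrow> continuous_map X euclidean (\<lambda>x. f x i)) \<Longrightarrow>
    continuous_map X euclidean (\<lambda>x. sum (f x) I)"
  by (simp add: continuous_map_atin tendsto_sum)

lemmas continuous_map_arith = continuous_map_mult' continuous_map_prod' continuous_map_cnj
  continuous_map_Re continuous_map_of_real' continuous_map_sum' continuous_map_add continuous_map_diff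

definition gram_form :: "nat \<Rightarrow> (nat \<Rightarrow> nat \<Rightarrow> complex) \<Rightarrow> (nat \<Rightarrow> complex) \<Rightarrow> (nat \<Rightarrow> complex) \<Rightarrow> complex" where
  "gram_form d h c c' = (\<Sum>i<d. \<Sum>j<d. cnj (c i) * c' j * h i j)"

lemma gram_form_add_right: "gram_form d h c (\<lambda>k. u k + v k) = gram_form d h c u + gram_form d h c v"
  by (simp add: gram_form_def algebra_simps sum.distrib)

lemma gram_form_scale_right: "gram_form d h c (\<lambda>k. a * v k) = a * gram_form d h c v"
  by (simp add: gram_form_def sum_distrib_left mult_ac)

lemma gram_form_scale_left: "gram_form d h (\<lambda>k. a * v k) c = cnj a * gram_form d h v c"
  by (simp add: gram_form_def sum_distrib_left mult_ac)

lemma gram_form_sum_right: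
  "finite A \<Longrightarrow> gram_form d h c (\<lambda>k. \<Sum>l\<in>A. a l * p l k) = (\<Sum>l\<in>A. a l * gram_form d h c (p l))"
  by (induction A rule: finite_induct)
    (simp_all add: gram_form_add_right gram_form_scale_right, simp add: gram_form_def)

lemma gram_form_cnj:
  assumes "\<And>i j. i < d \<Longrightarrow> j < d \<Longrightarrow> h j i = cnj (h i j)"
  shows "gram_form d h c' c = cnj (gram_form d h c c')"
proof -
  have "gram_form d h c' c = (\<Sum>i<d. \<Sum>j<d. cnj (cnj (c j) * c' i * h j i))"
    unfolding gram_form_def
  proof (intro sum.cong refl)
    fix i j assume "i \<in> {..<d}" "j \<in> {..<d}"
    then show "cnj (c' i) * c j * h i j = cnj (cnj (c j) * c' i * h j i)"
      using assms[of j i] by simp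
  qed
  also have "\<dots> = cnj (gram_form d h c c')"
    unfolding gram_form_def by (subst sum.swap) simp
  finally show ?thesis .
qed

text \<open>The triangular shape is carried through the induction: it keeps the new vector from
  degenerating, and later it lets completeness of the basis be proved by substitution instead of a
  dimension count or a matrix inverse. Only the normalization divides, by the square root of a
  function that is positive everywhere.\<close>

lemma continuous_gram_schmidt:
  assumes cont: "\<And>i j. i < d \<Longrightarrow> j < d \<Longrightarrow> continuous_map Y euclidean (\<lambda>y. h y i j)"
    and herm: "\<And>y i j. y \<in> topspace Y \<Longrightarrow> i < d \<Longrightarrow> j < d \<Longrightarrow> h y j i = cnj (h y i j)"
    and pos: "\<And>y c k. y \<in> topspace Y \<Longrightarrow> k < d \<Longrightarrow> c k \<noteq> 0 \<Longrightarrow> 0 < Re (gram_form d (h y) c c)"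
  shows "n \<le> d \<Longrightarrow> \<exists>p. (\<forall>k<n. \<forall>i. continuous_map Y euclidean (\<lambda>y. p k y i)) \<and>
     (\<forall>y\<in>topspace Y. \<forall>k<n. p k y k \<noteq> 0 \<and> (\<forall>i>k. p k y i = 0)) \<and>
     (\<forall>y\<in>topspace Y. \<forall>k<n. \<forall>l<n. gram_form d (h y) (p k y) (p l y) = (if k = l then 1 else 0))"
proof (induction n)
  case 0
  show ?case by simp
next
  case (Suc n)
  then obtain p where *: "\<forall>k<n. \<forall>i. continuous_map Y euclidean (\<lambda>y. p k y i)"
    "\<forall>y\<in>topspace Y. \<forall>k<n. p k y k \<noteq> 0 \<and> (\<forall>i>k. p k y i = 0)"
    "\<forall>y\<in>topspace Y. \<forall>k<n. \<forall>l<n. gram_form d (h y) (p k y) (p l y) = (if k = l then 1 else 0)"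
    using Suc_leD by blast
  have p: "\<And>k i. k < n \<Longrightarrow> continuous_map Y euclidean (\<lambda>y. p k y i)"
    "\<And>y k. y \<in> topspace Y \<Longrightarrow> k < n \<Longrightarrow> p k y k \<noteq> 0"
    "\<And>y k i. y \<in> topspace Y \<Longrightarrow> k < n \<Longrightarrow> i > k \<Longrightarrow> p k y i = 0"
    "\<And>y k l. y \<in> topspace Y \<Longrightarrow> k < n \<Longrightarrow> l < n \<Longrightarrow>
      gram_form d (h y) (p k y) (p l y) = (if k = l then 1 else 0)"
    using * by blast+
  have nd: "n < d" using Suc.prems by simp
  define e where "e = (\<lambda>i. if i = n then 1 else 0 :: complex)"
  define q where "q y i = e i + (\<Sum>k<n. (- gram_form d (h y) (p k y) e) * p k y i)" for y i
  have qeq: "q y = (\<lambda>i. e i + (\<Sum>k<n. (- gram_form d (h y) (p k y) e) * p k y i))" for y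
    by (rule ext) (rule q_def)
  define N where "N y = Re (gram_form d (h y) (q y) (q y))" for y
  \<comment> \<open>The earlier vectors vanish at position \<open>n\<close>, so \<open>q\<close>
    inherits the entry 1 of the standard vector \<open>e\<close>; one nonzero coordinate is all that
    the positivity hypothesis asks for.\<close>
  have qn: "q y n = 1" if "y \<in> topspace Y" for y
    using p(3)[OF that] by (simp add: q_def e_def sum.neutral)
  have N: "N y > 0" if "y \<in> topspace Y" for y
    unfolding N_def by (rule pos[OF that nd]) (simp add: qn that)
  have qq: "gram_form d (h y) (q y) (q y) = of_real (N y)" if "y \<in> topspace Y" for y
  proof -
    have "gram_form d (h y) (q y) (q y) = cnj (gram_form d (h y) (q y) (q y))"
      by (rule gram_form_cnj) (rule herm[OF that])
    from arg_cong[OF this, of Im] show ?thesis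
      by (simp add: complex_eq_iff N_def)
  qed
  have orth: "gram_form d (h y) (p l y) (q y) = 0" if "y \<in> topspace Y" "l < n" for y l
  proof -
    have "gram_form d (h y) (p l y) (q y) = gram_form d (h y) (p l y) e +
        (\<Sum>k<n. (- gram_form d (h y) (p k y) e) * gram_form d (h y) (p l y) (p k y))"
      unfolding qeq gram_form_add_right by (subst gram_form_sum_right) (rule finite_lessThan, rule refl)
    also have "(\<Sum>k<n. (- gram_form d (h y) (p k y) e) * gram_form d (h y) (p l y) (p k y)) =
        (\<Sum>k<n. if l = k then - gram_form d (h y) (p k y) e else 0)"
      using that by (intro sum.cong refl) (auto simp: p(4))
    also have "\<dots> = - gram_form d (h y) (p l y) e"
      using that by simp
    finally show ?thesis by simp
  qed
  have cg: "continuous_map Y euclidean (\<lambda>y. gram_form d (h y) (u y) (v y))"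
    if "\<And>i. continuous_map Y euclidean (\<lambda>y. u y i)" "\<And>i. continuous_map Y euclidean (\<lambda>y. v y i)" for u v
    unfolding gram_form_def by (intro continuous_map_arith cont that) auto
  have cq: "continuous_map Y euclidean (\<lambda>y. q y i)" for i
    unfolding q_def by (intro continuous_map_arith continuous_map_minus cg p(1)) auto
  define r where "r y i = inverse (complex_of_real (sqrt (N y))) * q y i" for y i
  have req: "r y = (\<lambda>i. inverse (complex_of_real (sqrt (N y))) * q y i)" for y
    by (rule ext) (rule r_def)
  have cr: "continuous_map Y euclidean (\<lambda>y. r y i)" for i
  proof -
    have "continuous_map Y euclidean (\<lambda>y. complex_of_real (sqrt (N y)))"
      unfolding N_def by (intro continuous_map_arith continuous_map_sqrt cg cq)
    moreover have "complex_of_real (sqrt (N y)) \<noteq> 0" if "y \<in> topspace Y" for y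
      using N[OF that] by simp
    ultimately have "continuous_map Y euclidean (\<lambda>y. 1 / complex_of_real (sqrt (N y)))"
      by (intro continuous_map_divide') simp_all
    then show ?thesis
      unfolding r_def inverse_eq_divide by (intro continuous_map_mult' cq)
  qed
  have rr: "gram_form d (h y) (r y) (r y) = 1" if "y \<in> topspace Y" for y
  proof -
    have "gram_form d (h y) (r y) (r y) =
        complex_of_real (inverse (sqrt (N y)) * (inverse (sqrt (N y)) * N y))"
      unfolding req gram_form_scale_right gram_form_scale_left qq[OF that] by simp
    also have "inverse (sqrt (N y)) * (inverse (sqrt (N y)) * N y) = 1"
      using N[OF that] by (simp add: field_simps)
    finally show ?thesis by simp
  qed
  have pr: "gram_form d (h y) (p l y) (r y) = 0" if "y \<in> topspace Y" "l < n" for y l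
    using orth[OF that] unfolding req gram_form_scale_right by simp
  have rp: "gram_form d (h y) (r y) (p l y) = 0" if "y \<in> topspace Y" "l < n" for y l
  proof -
    have "gram_form d (h y) (r y) (p l y) = cnj (gram_form d (h y) (p l y) (r y))"
      by (rule gram_form_cnj) (rule herm[OF that(1)])
    then show ?thesis using pr[OF that] by simp
  qed
  have q0: "q y i = 0" if "y \<in> topspace Y" "i > n" for y i
    using that p(3)[OF that(1)] by (simp add: q_def e_def)
  have rn: "r y n \<noteq> 0" if "y \<in> topspace Y" for y
    using N[OF that] qn[OF that] by (simp add: r_def)
  define p' where "p' = p(n := r)"
  have p'n [simp]: "p' n = r" and p'k [simp]: "k < n \<Longrightarrow> p' k = p k" for k
    by (simp_all add: p'_def)
  have "continuous_map Y euclidean (\<lambda>y. p' k y i)" if "k < Suc n" for k i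
    using that p(1) cr by (cases "k = n") auto
  moreover have "p' k y k \<noteq> 0 \<and> (\<forall>i>k. p' k y i = 0)" if "y \<in> topspace Y" "k < Suc n" for y k
  proof (cases "k = n")
    case True
    then show ?thesis using rn[OF that(1)] q0[OF that(1)] by (simp add: r_def)
  next
    case False
    then show ?thesis using that p(2,3)[OF that(1)] by simp
  qed
  moreover have "gram_form d (h y) (p' k y) (p' l y) = (if k = l then 1 else 0)"
    if "y \<in> topspace Y" "k < Suc n" "l < Suc n" for y k l
    using that p(4)[OF that(1)] rr[OF that(1)] pr[OF that(1)] rp[OF that(1)]
    by (cases "k = n"; cases "l = n") auto
  ultimately show ?case by blast
qed

text \<open>Orthogonality to the \<open>p k\<close> is a triangular linear system with nonzero
  diagonal for the entries of \<open>h\<close> applied to \<open>v\<close>, so these vanish one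
  after the other.\<close>

lemma gram_form_complete:
  assumes tri: "\<And>k. k < d \<Longrightarrow> p k k \<noteq> 0" "\<And>k i. k < d \<Longrightarrow> i > k \<Longrightarrow> p k i = 0"
    and orth: "\<And>k. k < d \<Longrightarrow> gram_form d h (p k) v = 0"
  shows "gram_form d h v v = 0"
proof -
  have e: "k < d \<Longrightarrow> (\<Sum>j<d. v j * h k j) = 0" for k
  proof (induction k rule: less_induct)
    case (less k)
    have "0 = (\<Sum>i<d. cnj (p k i) * (\<Sum>j<d. v j * h i j))"
      using orth[OF less.prems] by (simp add: gram_form_def sum_distrib_left mult_ac)
    also have "\<dots> = (\<Sum>i<d. if i = k then cnj (p k k) * (\<Sum>j<d. v j * h k j) else 0)"
      using less by (intro sum.cong refl) (auto simp: tri(2) neq_iff)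
    also have "\<dots> = cnj (p k k) * (\<Sum>j<d. v j * h k j)"
      using less.prems by simp
    finally show ?case using tri(1)[OF less.prems] by simp
  qed
  have "gram_form d h v v = (\<Sum>i<d. cnj (v i) * (\<Sum>j<d. v j * h i j))"
    by (simp add: gram_form_def sum_distrib_left mult_ac)
  then show ?thesis using e by simp
qed

section \<open>Hermitian bundles in orthonormal frames\<close>

definition coord :: "('x, 'f) hbundle \<Rightarrow> 'i set \<Rightarrow> ('i \<Rightarrow> 'x \<Rightarrow> 'f) \<Rightarrow> 'f \<Rightarrow> 'x \<times> ('i \<Rightarrow> complex)" where
  "coord F I b v = (bproj F v, \<lambda>i\<in>I. bherm F (b i (bproj F v)) v)"

text \<open>The index set has arbitrary type so that one notion covers \<open>E\<close>, indexed by
  numbers below the rank, and its tensor powers, indexed by multi-indices. The homeomorphism is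
  directed from the total space to the coordinates because inner products give it
  explicitly.\<close>

definition frame :: "('x, 'f) hbundle \<Rightarrow> 'i set \<Rightarrow> 'x set \<Rightarrow> ('i \<Rightarrow> 'x \<Rightarrow> 'f) \<Rightarrow> bool" where
  "frame F I U b \<longleftrightarrow> openin (bbase F) U \<and>
     (\<forall>y\<in>U. \<forall>i\<in>I. b i y \<in> fibre F y \<and> (\<forall>j\<in>I. bherm F (b i y) (b j y) = (if i = j then 1 else 0))) \<and>
     (\<forall>y\<in>U. \<forall>v\<in>fibre F y. \<forall>w\<in>fibre F y.
        bherm F v w = (\<Sum>i\<in>I. cnj (bherm F (b i y) v) * bherm F (b i y) w)) \<and>
     homeomorphic_map (subtopology (btotal F) {v \<in> topspace (btotal F). bproj F v \<in> U})
       (prod_topology (subtopology (bbase F) U) (cspace I)) (coord F I b)"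

lemma topspace_cspace: "topspace (cspace I) = extensional I"
  by (auto simp: cspace_def PiE_def)

lemma continuous_map_into_cspace:
  assumes "\<And>i. i \<in> I \<Longrightarrow> continuous_map Y euclidean (\<lambda>y. f y i)" "\<And>y. y \<in> topspace Y \<Longrightarrow> f y \<in> extensional I"
  shows "continuous_map Y (cspace I) f"
  unfolding cspace_def
  by (rule continuous_map_coordinatewise_then_product) (use assms in \<open>auto simp: extensional_def\<close>)

lemma continuous_map_cspace_component:
  "i \<in> I \<Longrightarrow> continuous_map (cspace I) euclidean (\<lambda>c. c i)"
  unfolding cspace_def by (rule continuous_map_product_coordinates)

lemma gram_form_cong:
  assumes "\<And>i. i < d \<Longrightarrow> c i = c' i" "\<And>i. i < d \<Longrightarrow> v i = v' i"
  shows "gram_form d h c v = gram_form d h c' v'"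
  unfolding gram_form_def by (intro sum.cong refl) (use assms in auto)

lemma hermitian_bundleD:
  assumes "hermitian_bundle E" "x \<in> topspace (bbase E)" "v \<in> fibre E x"
  shows "0 \<le> Re (bherm E v v)" "bherm E v v = 0 \<Longrightarrow> v = bscale E 0 v"
    "w \<in> fibre E x \<Longrightarrow> bherm E w v = cnj (bherm E v w)"
    "w \<in> fibre E x \<Longrightarrow> bherm E v (bscale E a w) = a * bherm E v w"
    "w \<in> fibre E x \<Longrightarrow> w' \<in> fibre E x \<Longrightarrow> bherm E v (badd E w w') = bherm E v w + bherm E v w'"
  using assms unfolding hermitian_bundle_def by blast+

lemma fibre_base:
  "hermitian_bundle E \<Longrightarrow> v \<in> fibre E x \<Longrightarrow> x \<in> topspace (bbase E)"
  unfolding hermitian_bundle_def fibre_def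
  by (metis (mono_tags, lifting) continuous_map_image_subset_topspace image_subset_iff mem_Collect_eq)

text \<open>Gram--Schmidt turns any local trivialization into one whose frame is orthonormal. For such a
  trivialization the inverse is given by the coordinate map, so no matrix has to be inverted.\<close>

lemma orthonormal_local_triv:
  fixes E :: "('x, 'e) hbundle"
  assumes E: "hermitian_bundle E" and x: "x \<in> topspace (bbase E)"
  shows "\<exists>U \<phi>. x \<in> U \<and> local_triv E U \<phi> \<and>
    frame E {..<brank E} U (\<lambda>i y. \<phi> (y, unit_vec (brank E) i))"
proof -
  define X where "X = topspace (bbase E)"
  define d where "d = brank E"
  obtain U \<phi> where xU: "x \<in> U" and triv: "local_triv E U \<phi>"
    using E x unfolding hermitian_bundle_def by blast
  have opU: "openin (bbase E) U" using triv by (simp add: local_triv_def)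
  then have UX: "U \<subseteq> topspace (bbase E)" by (rule openin_subset)
  define XU where "XU = subtopology (bbase E) U"
  have tXU: "topspace XU = U" using UX by (auto simp: XU_def)
  define TU where "TU = subtopology (btotal E) {v \<in> topspace (btotal E). bproj E v \<in> U}"
  have tTU: "topspace TU = {v \<in> topspace (btotal E). bproj E v \<in> U}" by (auto simp: TU_def)
  have hom: "homeomorphic_map (prod_topology XU (cspace {..<d})) TU \<phi>"
    using triv by (simp add: local_triv_def XU_def TU_def d_def)
  have cont\<phi>: "continuous_map (prod_topology XU (cspace {..<d})) TU \<phi>"
    by (rule homeomorphic_imp_continuous_map[OF hom])
  have tprod: "topspace (prod_topology XU (cspace {..<d})) = U \<times> extensional {..<d}"
    by (simp add: tXU topspace_cspace)
  have inj: "inj_on \<phi> (U \<times> extensional {..<d})"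
    using homeomorphic_imp_injective_map[OF hom] by (simp only: tprod)
  have surj: "\<phi> ` (U \<times> extensional {..<d}) = {v \<in> topspace (btotal E). bproj E v \<in> U}"
    using homeomorphic_imp_surjective_map[OF hom] by (simp only: tprod tTU)
  have tr: "bproj E (\<phi> (y, c)) = y"
    "\<phi> (y, \<lambda>i\<in>{..<d}. a * c i) = bscale E a (\<phi> (y, c))"
    "c' \<in> extensional {..<d} \<Longrightarrow> \<phi> (y, \<lambda>i\<in>{..<d}. c i + c' i) = badd E (\<phi> (y, c)) (\<phi> (y, c'))"
    if "y \<in> U" "c \<in> extensional {..<d}" for y c c' a
    using triv that unfolding local_triv_def d_def topspace_cspace by blast+
  have \<phi>_fib: "\<phi> (y, c) \<in> fibre E y" if "y \<in> U" "c \<in> extensional {..<d}" for y c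
    using that surj tr(1)[OF that] unfolding fibre_def by blast
  have \<phi>_surj: "\<exists>c\<in>extensional {..<d}. v = \<phi> (y, c)" if v: "v \<in> fibre E y" and y: "y \<in> U" for v y
  proof -
    have "v \<in> {v \<in> topspace (btotal E). bproj E v \<in> U}" "bproj E v = y" using v y by (auto simp: fibre_def)
    then obtain y' c where c: "y' \<in> U" "c \<in> extensional {..<d}" "v = \<phi> (y', c)"
      unfolding surj[symmetric] by auto
    with tr(1)[OF c(1,2)] \<open>bproj E v = y\<close> show ?thesis by auto
  qed
  note H = hermitian_bundleD[OF E subsetD[OF UX]]
  define e where "e = unit_vec d"
  have e_ext: "e i \<in> extensional {..<d}" for i by (simp add: e_def unit_vec_def)
  define f where "f i y = \<phi> (y, e i)" for i y
  have f_fib: "f i y \<in> fibre E y" if "y \<in> U" for i y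
    unfolding f_def by (rule \<phi>_fib[OF that e_ext])
  have expand: "bherm E v (\<phi> (y, c)) = (\<Sum>j<d. c j * bherm E v (f j y))"
    if y: "y \<in> U" and v: "v \<in> fibre E y" and c: "c \<in> extensional {..<d}" for y v c
  proof -
    \<comment> \<open>Truncations of \<open>c\<close> to a set of indices: a trivialization is only
      known to respect sums and multiples of coordinate vectors, so the expansion is obtained one
      index at a time.\<close>
    define cA where "cA A = (\<lambda>i\<in>{..<d}. if i \<in> A then c i else 0)" for A
    have cA_ext: "cA A \<in> extensional {..<d}" for A by (simp add: cA_def)
    have "finite A \<Longrightarrow> A \<subseteq> {..<d} \<Longrightarrow> bherm E v (\<phi> (y, cA A)) = (\<Sum>j\<in>A. c j * bherm E v (f j y))" for A
    proof (induction A rule: finite_induct)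
      case empty
      have "cA {} = (\<lambda>i\<in>{..<d}. 0 * c i)" by (simp add: cA_def)
      then have "\<phi> (y, cA {}) = bscale E 0 (\<phi> (y, c))" by (simp only: tr(2)[OF y c])
      then show ?case using H(4)[OF y v \<phi>_fib[OF y c]] by simp
    next
      case (insert a A)
      define g where "g = (\<lambda>i\<in>{..<d}. c a * e a i)"
      have g: "g \<in> extensional {..<d}" by (simp add: g_def)
      have "cA (insert a A) = (\<lambda>i\<in>{..<d}. cA A i + g i)"
        using insert by (auto simp: cA_def g_def e_def unit_vec_def fun_eq_iff)
      then have "\<phi> (y, cA (insert a A)) = badd E (\<phi> (y, cA A)) (\<phi> (y, g))"
        by (simp only: tr(3)[OF y cA_ext g])
      also have "\<phi> (y, g) = bscale E (c a) (f a y)"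
        unfolding g_def f_def by (rule tr(2)[OF y e_ext])
      finally have "bherm E v (\<phi> (y, cA (insert a A))) = bherm E v (\<phi> (y, cA A)) + bherm E v (\<phi> (y, g))"
        by (simp only: H(5)[OF y v \<phi>_fib[OF y cA_ext] \<phi>_fib[OF y g]] \<open>\<phi> (y, g) = _\<close>[symmetric])
      also have "bherm E v (\<phi> (y, g)) = c a * bherm E v (f a y)"
        unfolding \<open>\<phi> (y, g) = _\<close> by (rule H(4)[OF y v f_fib[OF y]])
      finally show ?case using insert by (simp add: add.commute)
    qed
    from this[of "{..<d}"] have "bherm E v (\<phi> (y, cA {..<d})) = (\<Sum>j<d. c j * bherm E v (f j y))" by simp
    moreover have "cA {..<d} = c" using c by (auto simp: cA_def fun_eq_iff extensional_def)
    ultimately show ?thesis by simp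
  qed
  define h where "h y i j = bherm E (f i y) (f j y)" for y i j
  have gram: "bherm E (\<phi> (y, c)) (\<phi> (y, c')) = gram_form d (h y) c c'"
    if y: "y \<in> U" and c: "c \<in> extensional {..<d}" "c' \<in> extensional {..<d}" for y c c'
  proof -
    have "bherm E (\<phi> (y, c)) (\<phi> (y, c')) = (\<Sum>j<d. c' j * bherm E (\<phi> (y, c)) (f j y))"
      by (rule expand[OF y \<phi>_fib[OF y c(1)] c(2)])
    also have "\<dots> = (\<Sum>j<d. c' j * cnj (bherm E (f j y) (\<phi> (y, c))))"
      using H(3)[OF y f_fib[OF y] \<phi>_fib[OF y c(1)]] by simp
    also have "\<dots> = (\<Sum>j<d. c' j * cnj (\<Sum>i<d. c i * bherm E (f j y) (f i y)))"
      by (simp only: expand[OF y f_fib[OF y] c(1)])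
    also have "\<dots> = (\<Sum>j<d. \<Sum>i<d. cnj (c i) * c' j * h y i j)"
    proof (rule sum.cong[OF refl])
      fix j
      have "cnj (bherm E (f j y) (f i y)) = h y i j" for i
        unfolding h_def using H(3)[OF y f_fib[OF y] f_fib[OF y], of j i] by simp
      then show "c' j * cnj (\<Sum>i<d. c i * bherm E (f j y) (f i y)) = (\<Sum>i<d. cnj (c i) * c' j * h y i j)"
        by (simp add: sum_distrib_left mult_ac)
    qed
    also have "\<dots> = gram_form d (h y) c c'"
      unfolding gram_form_def by (rule sum.swap)
    finally show ?thesis .
  qed
  \<comment> \<open>A vector with vanishing square is \<open>0\<close> times itself, hence the image
    of zero coordinates; injectivity of the trivialization carries this back to the
    coefficients.\<close>
  have pos: "0 < Re (gram_form d (h y) c c)" if y: "y \<in> U" and k: "k < d" "c k \<noteq> 0" for y c k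
  proof -
    define c' where "c' = restrict c {..<d}"
    have c': "c' \<in> extensional {..<d}" by (simp add: c'_def)
    have eq: "gram_form d (h y) c c = bherm E (\<phi> (y, c')) (\<phi> (y, c'))"
      unfolding gram[OF y c' c'] by (rule gram_form_cong) (simp_all add: c'_def)
    have "bherm E (\<phi> (y, c')) (\<phi> (y, c')) \<noteq> 0"
    proof
      assume "bherm E (\<phi> (y, c')) (\<phi> (y, c')) = 0"
      then have "\<phi> (y, c') = \<phi> (y, \<lambda>i\<in>{..<d}. 0 * c' i)"
        using H(2)[OF y \<phi>_fib[OF y c']] by (simp only: tr(2)[OF y c'])
      then have "c' = (\<lambda>i\<in>{..<d}. 0 * c' i)"
        using inj_onD[OF inj, of "(y, c')"] y c' by auto
      then have "c' k = 0" using k(1) by (metis lessThan_iff mult_zero_left restrict_apply')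
      with k show False by (simp add: c'_def)
    qed
    moreover have "Im (bherm E (\<phi> (y, c')) (\<phi> (y, c'))) = 0"
      using arg_cong[OF H(3)[OF y \<phi>_fib[OF y c'] \<phi>_fib[OF y c']], of Im] by simp
    ultimately show ?thesis
      using H(1)[OF y \<phi>_fib[OF y c']] unfolding eq by (simp add: complex_eq_iff less_le)
  qed
  have cont\<phi>E: "continuous_map (prod_topology XU (cspace {..<d})) (btotal E) \<phi>"
    using cont\<phi> unfolding TU_def by (rule continuous_map_into_fulltopology)
  have cpair: "continuous_map XU (btotal E) (\<lambda>y. \<phi> (y, g y))"
    if "continuous_map XU (cspace {..<d}) g" for g
    using continuous_map_compose[OF continuous_map_pairedI[OF continuous_map_id[unfolded id_def] that] cont\<phi>E]
    by (simp add: o_def)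
  have hermc: "continuous_map Y euclidean (\<lambda>z. bherm E (u z) (v z))"
    if "continuous_map Y (btotal E) u" "continuous_map Y (btotal E) v"
      "\<And>z. z \<in> topspace Y \<Longrightarrow> bproj E (u z) = bproj E (v z)" for Y and u v :: "'z \<Rightarrow> 'e"
  proof -
    have "continuous_map Y (subtopology (prod_topology (btotal E) (btotal E)) {(v, w). bproj E v = bproj E w})
        (\<lambda>z. (u z, v z))"
      by (intro continuous_map_into_subtopology continuous_map_pairedI that) (auto simp: that(3))
    moreover have "continuous_map
       (subtopology (prod_topology (btotal E) (btotal E)) {(v, w). bproj E v = bproj E w})
       euclidean (\<lambda>(v, w). bherm E v w)"
      using E unfolding hermitian_bundle_def by blast
    ultimately show ?thesis
      using continuous_map_compose by (fastforce simp: o_def)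
  qed
  have f_cont: "continuous_map XU (btotal E) (f i)" for i
    unfolding f_def by (rule cpair) (simp add: topspace_cspace e_ext)
  have h_cont: "continuous_map XU euclidean (\<lambda>y. h y i j)" for i j
    unfolding h_def using f_fib by (intro hermc f_cont) (auto simp: tXU fibre_def)
  have h_herm: "h y j i = cnj (h y i j)" if "y \<in> topspace XU" for y i j
    using H(3)[of y "f i y" "f j y"] f_fib[of y] that by (simp add: h_def tXU)
  obtain p where pc: "\<forall>k<d. \<forall>i. continuous_map XU euclidean (\<lambda>y. p k y i)"
    and ptri: "\<forall>y\<in>U. \<forall>k<d. p k y k \<noteq> 0 \<and> (\<forall>i>k. p k y i = 0)"
    and porth: "\<forall>y\<in>U. \<forall>k<d. \<forall>l<d. gram_form d (h y) (p k y) (p l y) = (if k = l then 1 else 0)"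
  proof -
    have "\<exists>p. (\<forall>k<d. \<forall>i. continuous_map XU euclidean (\<lambda>y. p k y i)) \<and>
     (\<forall>y\<in>topspace XU. \<forall>k<d. p k y k \<noteq> 0 \<and> (\<forall>i>k. p k y i = 0)) \<and>
     (\<forall>y\<in>topspace XU. \<forall>k<d. \<forall>l<d. gram_form d (h y) (p k y) (p l y) = (if k = l then 1 else 0))"
    proof (rule continuous_gram_schmidt)
      show "0 < Re (gram_form d (h y) c c)" if "y \<in> topspace XU" "k < d" "c k \<noteq> 0" for y c k
        using pos[of y k c] that by (simp add: tXU)
    qed (rule h_cont, rule h_herm, assumption, rule order_refl)
    then show ?thesis using that unfolding tXU by blast
  qed
  \<comment> \<open>\<open>P y c\<close> are the old coordinates of the vector with coordinates
    \<open>c\<close> in the new basis; \<psi> is thus the trivialization whose frame is the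
    orthonormalized one.\<close>
  define P where "P y c = (\<lambda>i\<in>{..<d}. \<Sum>k<d. c k * p k y i)" for y c
  have P_ext: "P y c \<in> extensional {..<d}" for y c by (simp add: P_def)
  define \<psi> where "\<psi> = (\<lambda>(y, c). \<phi> (y, P y c))"
  have \<psi>_fib: "\<psi> (y, c) \<in> fibre E y" if "y \<in> U" for y c
    unfolding \<psi>_def using \<phi>_fib[OF that P_ext] by simp
  define b where "b k y = \<psi> (y, e k)" for k y
  have b_eq: "b k y = \<phi> (y, \<lambda>i\<in>{..<d}. p k y i)" if "k < d" for k y
  proof -
    have "P y (e k) = (\<lambda>i\<in>{..<d}. p k y i)"
    proof
      fix i
      have "(\<Sum>l<d. e k l * p l y i) = (\<Sum>l<d. if l = k then p k y i else 0)"
        by (rule sum.cong) (auto simp: e_def unit_vec_def)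
      then show "P y (e k) i = (\<lambda>i\<in>{..<d}. p k y i) i"
        using that by (auto simp: P_def)
    qed
    then show ?thesis by (simp add: b_def \<psi>_def)
  qed
  have b_fib: "b k y \<in> fibre E y" if "y \<in> U" for k y
    unfolding b_def by (rule \<psi>_fib[OF that])
  have b_gram: "bherm E (b k y) (\<phi> (y, c)) = gram_form d (h y) (p k y) c"
    if "y \<in> U" "k < d" "c \<in> extensional {..<d}" for y k c
    unfolding b_eq[OF that(2)] using gram[OF that(1) _ that(3), of "\<lambda>i\<in>{..<d}. p k y i"]
    by (auto intro!: gram_form_cong)
  have b_orth: "bherm E (b k y) (b l y) = (if k = l then 1 else 0)" if "y \<in> U" "k < d" "l < d" for y k l
  proof -
    have "bherm E (b k y) (b l y) = gram_form d (h y) (p k y) (\<lambda>i\<in>{..<d}. p l y i)"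
      unfolding b_eq[OF that(3)] by (rule b_gram[OF that(1,2)]) simp
    also have "\<dots> = gram_form d (h y) (p k y) (p l y)"
      by (rule gram_form_cong) simp_all
    finally show ?thesis using porth that by simp
  qed
  have gram_P: "gram_form d (h y) u (P y c) = (\<Sum>l<d. c l * gram_form d (h y) u (p l y))" for y u c
  proof -
    have "gram_form d (h y) u (P y c) = gram_form d (h y) u (\<lambda>i. \<Sum>k<d. c k * p k y i)"
      by (rule gram_form_cong) (simp_all add: P_def)
    then show ?thesis by (simp add: gram_form_sum_right)
  qed
  have coord_\<psi>: "bherm E (b k y) (\<psi> (y, c)) = c k" if "y \<in> U" "k < d" for y k c
  proof -
    have "bherm E (b k y) (\<psi> (y, c)) = (\<Sum>l<d. c l * gram_form d (h y) (p k y) (p l y))"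
      unfolding \<psi>_def using b_gram[OF that P_ext] by (simp add: gram_P)
    also have "\<dots> = (\<Sum>l<d. if l = k then c k else 0)"
      using porth that by (intro sum.cong) auto
    finally show ?thesis using that by simp
  qed
  have \<psi>_coord: "\<psi> (y, \<lambda>k\<in>{..<d}. bherm E (b k y) v) = v" if y: "y \<in> U" and v: "v \<in> fibre E y" for y v
  proof -
    obtain c0 where c0: "c0 \<in> extensional {..<d}" "v = \<phi> (y, c0)" using \<phi>_surj[OF v y] by blast
    define c where "c = (\<lambda>k\<in>{..<d}. bherm E (b k y) v)"
    \<comment> \<open>The old coordinates of \<open>v\<close> minus those of the vector rebuilt from
      its inner products. They are orthogonal to every \<open>p k\<close>, hence null by
      completeness and zero by positivity.\<close>
    define g where "g = (\<lambda>i. c0 i + (- 1) * P y c i)"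
    have "gram_form d (h y) g g = 0"
    proof (rule gram_form_complete[where p = "\<lambda>k. p k y"])
      show "p k y k \<noteq> 0" if "k < d" for k using ptri y that by blast
      show "p k y i = 0" if "k < d" "i > k" for k i using ptri y that by blast
      fix k assume k: "k < d"
      have "gram_form d (h y) (p k y) g = gram_form d (h y) (p k y) c0 - gram_form d (h y) (p k y) (P y c)"
        unfolding g_def gram_form_add_right gram_form_scale_right by simp
      also have "gram_form d (h y) (p k y) c0 = c k"
        using b_gram[OF y k c0(1)] k by (simp add: c_def c0(2))
      also have "gram_form d (h y) (p k y) (P y c) = c k"
        using coord_\<psi>[OF y k, of c] b_gram[OF y k P_ext, of y c] by (simp add: \<psi>_def)
      finally show "gram_form d (h y) (p k y) g = 0" by simp
    qed
    then have "g k = 0" if "k < d" for k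
      using pos[OF y that, of g] by (cases "g k = 0") auto
    then have "c0 = P y c"
      using c0(1) P_ext[of y c] unfolding g_def by (intro extensionalityI[of _ "{..<d}"]) auto
    then show ?thesis using c0(2) by (simp add: \<psi>_def c_def)
  qed
  have cont\<psi>: "continuous_map (prod_topology XU (cspace {..<d})) TU \<psi>"
  proof -
    have c1: "continuous_map (prod_topology XU (cspace {..<d})) euclidean (\<lambda>z. snd z k)" if "k < d" for k
      using continuous_map_compose[OF continuous_map_snd continuous_map_cspace_component, of k "{..<d}"] that
      by (simp add: o_def)
    have c2: "continuous_map (prod_topology XU (cspace {..<d})) euclidean (\<lambda>z. p k (fst z) i)" if "k < d" for k i
      using continuous_map_compose[OF continuous_map_fst, of XU euclidean "\<lambda>y. p k y i"] pc that
      by (simp add: o_def)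
    have "continuous_map (prod_topology XU (cspace {..<d})) (prod_topology XU (cspace {..<d}))
        (\<lambda>z. (fst z, P (fst z) (snd z)))"
    proof (intro continuous_map_pairedI continuous_map_fst continuous_map_into_cspace P_ext)
      fix i assume i: "i \<in> {..<d}"
      have "continuous_map (prod_topology XU (cspace {..<d})) euclidean (\<lambda>z. \<Sum>k<d. snd z k * p k (fst z) i)"
        by (intro continuous_map_arith c1 c2) auto
      then show "continuous_map (prod_topology XU (cspace {..<d})) euclidean (\<lambda>z. P (fst z) (snd z) i)"
        using i by (simp add: P_def)
    qed
    from continuous_map_compose[OF this cont\<phi>] show ?thesis
      by (simp add: \<psi>_def o_def case_prod_unfold)
  qed
  have cont\<psi>E: "continuous_map (prod_topology XU (cspace {..<d})) (btotal E) \<psi>"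
    using cont\<psi> unfolding TU_def by (rule continuous_map_into_fulltopology)
  have b_cont: "continuous_map XU (btotal E) (b k)" for k
    using continuous_map_compose[OF continuous_map_pairedI[OF continuous_map_id[unfolded id_def, of XU]] cont\<psi>E,
      of "\<lambda>_. e k"] by (simp add: o_def b_def[abs_def] topspace_cspace e_ext)
  have proj_cont: "continuous_map TU XU (bproj E)"
    unfolding XU_def TU_def using E unfolding hermitian_bundle_def
    by (intro continuous_map_into_subtopology continuous_map_from_subtopology) auto
  have cont_coord: "continuous_map TU (prod_topology XU (cspace {..<d})) (coord E {..<d} b)"
    unfolding coord_def
  proof (intro continuous_map_pairedI proj_cont continuous_map_into_cspace)
    fix k assume k: "k \<in> {..<d}"
    have "continuous_map TU (btotal E) (\<lambda>v. b k (bproj E v))"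
      using continuous_map_compose[OF proj_cont b_cont] by (simp add: o_def)
    moreover have "continuous_map TU (btotal E) (\<lambda>v. v)" by (simp add: TU_def)
    moreover have "bproj E (b k (bproj E v)) = bproj E v" if "v \<in> topspace TU" for v
      using b_fib[of "bproj E v" k] that by (simp add: tTU fibre_def)
    ultimately have "continuous_map TU euclidean (\<lambda>v. bherm E (b k (bproj E v)) v)"
      by (rule hermc)
    then show "continuous_map TU euclidean (\<lambda>v. (\<lambda>i\<in>{..<d}. bherm E (b i (bproj E v)) v) k)"
      using k by simp
  qed simp
  have homs: "homeomorphic_maps (prod_topology XU (cspace {..<d})) TU \<psi> (coord E {..<d} b)"
    unfolding homeomorphic_maps_def
  proof (intro conjI cont\<psi> cont_coord ballI)
    fix z assume "z \<in> topspace (prod_topology XU (cspace {..<d}))"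
    then obtain y c where z: "z = (y, c)" "y \<in> U" "c \<in> extensional {..<d}" unfolding tprod by auto
    have "bproj E (\<psi> (y, c)) = y" using \<psi>_fib[OF z(2)] by (simp add: fibre_def)
    moreover have "(\<lambda>i\<in>{..<d}. bherm E (b i y) (\<psi> (y, c))) = c"
      using z(2,3) coord_\<psi> by (intro extensionalityI[of _ "{..<d}"]) auto
    ultimately show "coord E {..<d} b (\<psi> z) = z" by (simp add: coord_def z(1))
  next
    fix v assume "v \<in> topspace TU"
    then have "v \<in> fibre E (bproj E v)" "bproj E v \<in> U" by (auto simp: tTU fibre_def)
    then show "\<psi> (coord E {..<d} b v) = v" unfolding coord_def using \<psi>_coord by simp
  qed
  have parseval: "bherm E v w = (\<Sum>k<d. cnj (bherm E (b k y) v) * bherm E (b k y) w)"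
    if y: "y \<in> U" and v: "v \<in> fibre E y" and w: "w \<in> fibre E y" for y v w
  proof -
    obtain c0 where c0: "c0 \<in> extensional {..<d}" "v = \<phi> (y, c0)" using \<phi>_surj[OF v y] by blast
    define c where "c = (\<lambda>k\<in>{..<d}. bherm E (b k y) w)"
    have w_eq: "w = \<phi> (y, P y c)" using \<psi>_coord[OF y w] by (simp add: c_def \<psi>_def)
    have "bherm E v w = gram_form d (h y) c0 (P y c)"
      unfolding c0(2) w_eq by (rule gram[OF y c0(1) P_ext])
    also have "\<dots> = (\<Sum>l<d. c l * gram_form d (h y) c0 (p l y))" by (rule gram_P)
    also have "\<dots> = (\<Sum>l<d. cnj (bherm E (b l y) v) * bherm E (b l y) w)"
    proof (intro sum.cong refl)
      fix l assume l: "l \<in> {..<d}"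
      have "gram_form d (h y) c0 (p l y) = bherm E v (b l y)"
        using gram[OF y c0(1), of "\<lambda>i\<in>{..<d}. p l y i"] l
        by (simp add: b_eq c0(2)) (auto intro!: gram_form_cong)
      also have "\<dots> = cnj (bherm E (b l y) v)" by (rule H(3)[OF y b_fib[OF y] v])
      finally show "c l * gram_form d (h y) c0 (p l y) = cnj (bherm E (b l y) v) * bherm E (b l y) w"
        using l by (simp add: c_def)
    qed
    finally show ?thesis .
  qed
  have "local_triv E U \<psi>"
    unfolding local_triv_def
  proof (intro conjI opU ballI allI)
    show "homeomorphic_map (prod_topology (subtopology (bbase E) U) (cspace {..<brank E}))
       (subtopology (btotal E) {v \<in> topspace (btotal E). bproj E v \<in> U}) \<psi>"
      using homs homeomorphic_maps_map unfolding XU_def TU_def d_def by blast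
    fix y c assume y: "y \<in> U" and "c \<in> topspace (cspace {..<brank E})"
    then show "bproj E (\<psi> (y, c)) = y" using \<psi>_fib[OF y, of c] by (simp add: fibre_def)
    fix a
    have "P y (\<lambda>i\<in>{..<d}. a * c i) = (\<lambda>i\<in>{..<d}. a * P y c i)"
      by (auto simp: P_def fun_eq_iff sum_distrib_left mult_ac)
    then show "\<psi> (y, \<lambda>i\<in>{..<brank E}. a * c i) = bscale E a (\<psi> (y, c))"
      using tr(2)[OF y P_ext] by (simp add: \<psi>_def d_def)
    fix c'
    have "P y (\<lambda>i\<in>{..<d}. c i + c' i) = (\<lambda>i\<in>{..<d}. P y c i + P y c' i)"
      by (auto simp: P_def fun_eq_iff sum.distrib algebra_simps)
    then show "\<psi> (y, \<lambda>i\<in>{..<brank E}. c i + c' i) = badd E (\<psi> (y, c)) (\<psi> (y, c'))"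
      using tr(3)[OF y P_ext P_ext] by (simp add: \<psi>_def d_def)
  qed
  moreover have "frame E {..<brank E} U b"
    unfolding frame_def
  proof (intro conjI opU ballI)
    show "homeomorphic_map (subtopology (btotal E) {v \<in> topspace (btotal E). bproj E v \<in> U})
       (prod_topology (subtopology (bbase E) U) (cspace {..<brank E})) (coord E {..<brank E} b)"
      using homs homeomorphic_maps_map unfolding XU_def TU_def d_def by blast
  qed (auto intro: b_fib simp: b_orth parseval d_def[symmetric])
  moreover have "b = (\<lambda>i y. \<psi> (y, unit_vec (brank E) i))"
    by (auto simp: b_def e_def d_def fun_eq_iff)
  ultimately show ?thesis using xU by blast
qed

lemma continuous_map_locally:
  assumes "\<And>x. x \<in> topspace Y \<Longrightarrow> \<exists>V. openin Y V \<and> x \<in> V \<and> continuous_map (subtopology Y V) Z f"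
  shows "continuous_map Y Z f"
proof -
  define J where "J = {V. openin Y V \<and> continuous_map (subtopology Y V) Z f}"
  show ?thesis
    by (rule pasting_lemma[where I = J and T = "\<lambda>V. V" and f = "\<lambda>_. f"])
      (use assms in \<open>auto simp: J_def\<close>)
qed

text \<open>Fibres are plain sets with operations, not types of a vector space class. Parseval,
  separation by coordinates and free choice of coordinates are therefore part of the notion instead
  of consequences of a dimension count.\<close>

definition onb :: "('x, 'f) hbundle \<Rightarrow> 'i set \<Rightarrow> 'x \<Rightarrow> ('i \<Rightarrow> 'f) \<Rightarrow> bool" where
  "onb F I x b \<longleftrightarrow> (\<forall>i\<in>I. b i \<in> fibre F x \<and> (\<forall>j\<in>I. bherm F (b i) (b j) = (if i = j then 1 else 0))) \<and>
    (\<forall>v\<in>fibre F x. \<forall>w\<in>fibre F x. bherm F v w = (\<Sum>i\<in>I. cnj (bherm F (b i) v) * bherm F (b i) w)) \<and>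
    (\<forall>v\<in>fibre F x. \<forall>w\<in>fibre F x. (\<forall>i\<in>I. bherm F (b i) v = bherm F (b i) w) \<longrightarrow> v = w) \<and>
    (\<forall>c. \<exists>v\<in>fibre F x. \<forall>i\<in>I. bherm F (b i) v = c i)"

lemma onbD:
  assumes "onb F I x b"
  shows "i \<in> I \<Longrightarrow> b i \<in> fibre F x"
    "i \<in> I \<Longrightarrow> j \<in> I \<Longrightarrow> bherm F (b i) (b j) = (if i = j then 1 else 0)"
    "v \<in> fibre F x \<Longrightarrow> w \<in> fibre F x \<Longrightarrow> bherm F v w = (\<Sum>i\<in>I. cnj (bherm F (b i) v) * bherm F (b i) w)"
    "v \<in> fibre F x \<Longrightarrow> w \<in> fibre F x \<Longrightarrow> (\<And>i. i \<in> I \<Longrightarrow> bherm F (b i) v = bherm F (b i) w) \<Longrightarrow> v = w"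
    "\<exists>v\<in>fibre F x. \<forall>i\<in>I. bherm F (b i) v = c i"
  using assms unfolding onb_def by blast+

lemma frame_open: "frame F I U b \<Longrightarrow> openin (bbase F) U"
  by (simp add: frame_def)

lemma frame_section_fibre: "frame F I U b \<Longrightarrow> y \<in> U \<Longrightarrow> i \<in> I \<Longrightarrow> b i y \<in> fibre F y"
  by (simp add: frame_def)

lemma frame_inverse:
  assumes "frame F I U b"
  obtains s where "homeomorphic_maps (subtopology (btotal F) {v \<in> topspace (btotal F). bproj F v \<in> U})
       (prod_topology (subtopology (bbase F) U) (cspace I)) (coord F I b) s"
  using assms homeomorphic_map_maps unfolding frame_def by blast

lemma topspace_frame_domain:
  assumes "frame F I U b"
  shows "topspace (prod_topology (subtopology (bbase F) U) (cspace I)) = U \<times> extensional I"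
  using openin_subset[OF frame_open[OF assms]] by (auto simp: topspace_cspace)

text \<open>Separation by coordinates and their free choice are injectivity and surjectivity of the
  coordinate homeomorphism, restricted to one fibre.\<close>

lemma frame_onb:
  assumes b: "frame F I U b" and y: "y \<in> U"
  shows "onb F I y (\<lambda>i. b i y)"
proof -
  obtain s where s: "homeomorphic_maps (subtopology (btotal F) {v \<in> topspace (btotal F). bproj F v \<in> U})
       (prod_topology (subtopology (bbase F) U) (cspace I)) (coord F I b) s"
    using frame_inverse[OF b] .
  have inj: "v = w" if "v \<in> fibre F y" "w \<in> fibre F y" "\<forall>i\<in>I. bherm F (b i y) v = bherm F (b i y) w" for v w
  proof -
    have "coord F I b v = coord F I b w" using that by (auto simp: coord_def fibre_def)
    moreover have "s (coord F I b v) = v" "s (coord F I b w) = w"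
      using s that y by (auto simp: homeomorphic_maps_def fibre_def)
    ultimately show ?thesis by metis
  qed
  have surj: "\<exists>v\<in>fibre F y. \<forall>i\<in>I. bherm F (b i y) v = c i" for c
  proof -
    have mem: "(y, restrict c I) \<in> topspace (prod_topology (subtopology (bbase F) U) (cspace I))"
      using y by (simp only: topspace_frame_domain[OF b]) auto
    have "coord F I b (s (y, restrict c I)) = (y, restrict c I)"
      using s mem unfolding homeomorphic_maps_def by blast
    moreover have "s (y, restrict c I) \<in> topspace (btotal F)"
      using s mem unfolding homeomorphic_maps_def continuous_map_def by auto
    ultimately show ?thesis
      by (intro bexI[of _ "s (y, restrict c I)"]) (auto simp: coord_def fibre_def fun_eq_iff restrict_def, metis+)
  qed
  show ?thesis unfolding onb_def using b y inj surj unfolding frame_def by blast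
qed

lemma frame_restrict:
  assumes b: "frame F I U b" and V: "openin (bbase F) V" "V \<subseteq> U"
  shows "frame F I V b"
proof -
  have hom: "homeomorphic_map (subtopology (btotal F) {v \<in> topspace (btotal F). bproj F v \<in> U})
       (prod_topology (subtopology (bbase F) U) (cspace I)) (coord F I b)"
    using b by (simp add: frame_def)
  have "homeomorphic_map
      (subtopology (subtopology (btotal F) {v \<in> topspace (btotal F). bproj F v \<in> U})
        {v \<in> topspace (btotal F). bproj F v \<in> V})
      (subtopology (prod_topology (subtopology (bbase F) U) (cspace I)) (V \<times> UNIV)) (coord F I b)"
    by (rule homeomorphic_map_subtopologies_alt[OF hom]) (auto simp: coord_def)
  moreover have "{v \<in> topspace (btotal F). bproj F v \<in> U} \<inter> {v \<in> topspace (btotal F). bproj F v \<in> V} =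
      {v \<in> topspace (btotal F). bproj F v \<in> V}"
    using V by auto
  moreover have "subtopology (prod_topology (subtopology (bbase F) U) (cspace I)) (V \<times> UNIV) =
      prod_topology (subtopology (bbase F) V) (cspace I)"
    using V(2) by (metis inf.absorb_iff2 prod_topology_subtopology(1) subtopology_Times subtopology_UNIV subtopology_subtopology)
  ultimately show ?thesis
    using b V unfolding frame_def by (simp add: subtopology_subtopology subset_eq)
qed

section \<open>Linear algebra in the fibres of a framed bundle\<close>

locale framed =
  fixes F :: "('x, 'f) hbundle" and I :: "'i set"
  assumes finite_index: "finite I"
    and proj_cont: "continuous_map (btotal F) (bbase F) (bproj F)"
    and add_fibre: "v \<in> fibre F x \<Longrightarrow> w \<in> fibre F x \<Longrightarrow> badd F v w \<in> fibre F x"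
    and scale_fibre: "v \<in> fibre F x \<Longrightarrow> bscale F a v \<in> fibre F x"
    and herm_add: "v \<in> fibre F x \<Longrightarrow> w \<in> fibre F x \<Longrightarrow> w' \<in> fibre F x \<Longrightarrow>
      bherm F v (badd F w w') = bherm F v w + bherm F v w'"
    and herm_scale: "v \<in> fibre F x \<Longrightarrow> w \<in> fibre F x \<Longrightarrow> bherm F v (bscale F a w) = a * bherm F v w"
    and ex_frame: "x \<in> topspace (bbase F) \<Longrightarrow> \<exists>U b. x \<in> U \<and> frame F I U b"
begin

lemma proj_base: "v \<in> topspace (btotal F) \<Longrightarrow> bproj F v \<in> topspace (bbase F)"
  using continuous_map_image_subset_topspace[OF proj_cont] by blast

lemma fibre_base': "v \<in> fibre F x \<Longrightarrow> x \<in> topspace (bbase F)"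
  using proj_base by (auto simp: fibre_def)

lemma fibre_topspace: "v \<in> fibre F x \<Longrightarrow> v \<in> topspace (btotal F)"
  by (simp add: fibre_def)

lemma topspace_fibre: "v \<in> topspace (btotal F) \<Longrightarrow> v \<in> fibre F (bproj F v)"
  by (simp add: fibre_def)

lemma ex_onb: "x \<in> topspace (bbase F) \<Longrightarrow> \<exists>b. onb F I x b"
  using ex_frame frame_onb by metis

lemma herm_cnj:
  assumes "v \<in> fibre F x" "w \<in> fibre F x"
  shows "bherm F w v = cnj (bherm F v w)"
proof -
  obtain b where "onb F I x b" using ex_onb fibre_base'[OF assms(1)] by blast
  then show ?thesis using assms by (simp add: onbD(3)[of F I x b] mult.commute)
qed

lemma herm_add_left:
  "v \<in> fibre F x \<Longrightarrow> w \<in> fibre F x \<Longrightarrow> u \<in> fibre F x \<Longrightarrow>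
    bherm F (badd F v w) u = bherm F v u + bherm F w u"
  by (simp only: herm_cnj[of u x "badd F v w"] herm_cnj[of u x v] herm_cnj[of u x w] add_fibre herm_add complex_cnj_add)

lemma herm_scale_left:
  "v \<in> fibre F x \<Longrightarrow> u \<in> fibre F x \<Longrightarrow> bherm F (bscale F a v) u = cnj a * bherm F v u"
  by (simp only: herm_cnj[of u x "bscale F a v"] herm_cnj[of u x v] scale_fibre herm_scale complex_cnj_mult)

text \<open>The way to prove vector identities: vector space axioms are not assumed for the fibres,
  and whatever is needed of them follows by pairing both sides with all vectors.\<close>

lemma herm_eqI:
  assumes "v \<in> fibre F x" "w \<in> fibre F x" "\<And>u. u \<in> fibre F x \<Longrightarrow> bherm F u v = bherm F u w"
  shows "v = w"
proof -
  obtain b where "onb F I x b" using ex_onb fibre_base'[OF assms(1)] by blast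
  then show ?thesis using assms onbD(1,4)[of F I x b] by metis
qed

text \<open>Removing the component along one basis vector kills that coordinate and changes no
  other. Induction on the support of the coordinates thus ends with a vector whose coordinates all
  vanish; it equals \<open>0\<close> times itself, so the functional is zero on it.\<close>

lemma linear_functional_expand:
  assumes b: "onb F I x b" and v: "v \<in> fibre F x"
    and add: "\<And>v w. v \<in> fibre F x \<Longrightarrow> w \<in> fibre F x \<Longrightarrow> f (badd F v w) = f v + f w"
    and scale: "\<And>a v. v \<in> fibre F x \<Longrightarrow> f (bscale F a v) = a * f v"
  shows "f v = (\<Sum>i\<in>I. bherm F (b i) v * (f (b i) :: complex))"
proof -
  have "finite A \<Longrightarrow> A \<subseteq> I \<Longrightarrow> v \<in> fibre F x \<Longrightarrow> (\<And>i. i \<in> I - A \<Longrightarrow> bherm F (b i) v = 0) \<Longrightarrow>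
      f v = (\<Sum>i\<in>A. bherm F (b i) v * f (b i))" for A v
  proof (induction A arbitrary: v rule: finite_induct)
    case empty
    have "v = bscale F 0 v"
      by (rule onbD(4)[OF b]) (use empty in \<open>auto intro: scale_fibre simp: herm_scale[OF onbD(1)[OF b]]\<close>)
    then show ?case using scale[OF empty(2), of 0] by simp
  next
    case (insert a A)
    have a: "b a \<in> fibre F x" "a \<in> I" using onbD(1)[OF b] insert by auto
    define v' where "v' = badd F v (bscale F (- bherm F (b a) v) (b a))"
    have sa: "bscale F c (b a) \<in> fibre F x" for c by (rule scale_fibre[OF a(1)])
    have v': "v' \<in> fibre F x" unfolding v'_def by (rule add_fibre[OF insert.prems(2) sa])
    have co: "bherm F (b i) v' = (if i = a then 0 else bherm F (b i) v)" if "i \<in> I" for i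
      unfolding v'_def herm_add[OF onbD(1)[OF b that] insert.prems(2) sa]
        herm_scale[OF onbD(1)[OF b that] a(1)] using onbD(2)[OF b that a(2)] by simp
    have "f v' = (\<Sum>i\<in>A. bherm F (b i) v' * f (b i))"
      using insert v' by (intro insert.IH) (auto simp: co)
    also have "\<dots> = (\<Sum>i\<in>A. bherm F (b i) v * f (b i))"
    proof (rule sum.cong[OF refl])
      fix i assume "i \<in> A"
      then have "i \<in> I" "i \<noteq> a" using insert by auto
      then show "bherm F (b i) v' * f (b i) = bherm F (b i) v * f (b i)" by (simp add: co)
    qed
    finally have "f v + - bherm F (b a) v * f (b a) = (\<Sum>i\<in>A. bherm F (b i) v * f (b i))"
      unfolding v'_def add[OF insert.prems(2) sa] scale[OF a(1)] .
    then show ?case using insert by (simp add: algebra_simps)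
  qed
  from this[OF finite_index order_refl v] show ?thesis by simp
qed

lemma riesz:
  assumes x: "x \<in> topspace (bbase F)"
    and add: "\<And>v w. v \<in> fibre F x \<Longrightarrow> w \<in> fibre F x \<Longrightarrow> f (badd F v w) = f v + f w"
    and scale: "\<And>a v. v \<in> fibre F x \<Longrightarrow> f (bscale F a v) = a * f v"
  shows "\<exists>v\<in>fibre F x. \<forall>w\<in>fibre F x. bherm F v w = (f w :: complex)"
proof -
  obtain b where b: "onb F I x b" using ex_onb[OF x] by blast
  obtain v where v: "v \<in> fibre F x" "\<forall>i\<in>I. bherm F (b i) v = cnj (f (b i))"
    using onbD(5)[OF b, of "\<lambda>i. cnj (f (b i))"] by blast
  have "bherm F v w = f w" if w: "w \<in> fibre F x" for w
  proof -
    have "bherm F v w = (\<Sum>i\<in>I. cnj (bherm F (b i) v) * bherm F (b i) w)" by (rule onbD(3)[OF b v(1) w])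
    also have "\<dots> = (\<Sum>i\<in>I. bherm F (b i) w * f (b i))" using v(2) by (intro sum.cong) auto
    also have "\<dots> = f w" by (rule linear_functional_expand[OF b w add scale, symmetric])
    finally show ?thesis .
  qed
  then show ?thesis using v(1) by blast
qed

lemma bnorm_L2:
  assumes "onb F I x b" "v \<in> fibre F x"
  shows "bnorm F v = L2_set (\<lambda>i. cmod (bherm F (b i) v)) I"
proof -
  have "bherm F v v = of_real (\<Sum>i\<in>I. (cmod (bherm F (b i) v))\<^sup>2)"
    unfolding onbD(3)[OF assms(1,2,2)] by (simp add: complex_norm_square mult.commute del: of_real_power)
  then show ?thesis by (simp add: bnorm_def L2_set_def)
qed

lemma bnorm_nonneg: "v \<in> fibre F x \<Longrightarrow> 0 \<le> bnorm F v"
  using ex_onb[OF fibre_base'] bnorm_L2 L2_set_nonneg by metis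

lemma herm_self:
  assumes v: "v \<in> fibre F x"
  shows "bherm F v v = complex_of_real ((bnorm F v)\<^sup>2)"
proof -
  obtain b where b: "onb F I x b" using ex_onb fibre_base'[OF v] by blast
  have "bherm F v v = of_real (\<Sum>i\<in>I. (cmod (bherm F (b i) v))\<^sup>2)"
    unfolding onbD(3)[OF b v v] by (simp add: complex_norm_square mult.commute del: of_real_power)
  then show ?thesis by (simp add: bnorm_L2[OF b v] L2_set_def sum_nonneg)
qed

lemma cauchy_schwarz:
  assumes v: "v \<in> fibre F x" and w: "w \<in> fibre F x"
  shows "cmod (bherm F v w) \<le> bnorm F v * bnorm F w"
proof -
  obtain b where b: "onb F I x b" using ex_onb fibre_base'[OF v] by blast
  have "cmod (bherm F v w) \<le> (\<Sum>i\<in>I. \<bar>cmod (bherm F (b i) v)\<bar> * \<bar>cmod (bherm F (b i) w)\<bar>)"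
    unfolding onbD(3)[OF b v w] by (rule order_trans[OF norm_sum]) (simp add: norm_mult)
  also have "\<dots> \<le> bnorm F v * bnorm F w"
    unfolding bnorm_L2[OF b v] bnorm_L2[OF b w] by (rule L2_set_mult_ineq)
  finally show ?thesis .
qed

lemma bnorm_scale:
  assumes v: "v \<in> fibre F x"
  shows "bnorm F (bscale F a v) = cmod a * bnorm F v"
proof -
  have "bherm F (bscale F a v) (bscale F a v) = (a * cnj a) * of_real ((bnorm F v)\<^sup>2)"
    unfolding herm_scale[OF scale_fibre[OF v] v] herm_scale_left[OF v v] herm_self[OF v] by simp
  also have "\<dots> = of_real ((cmod a * bnorm F v)\<^sup>2)"
    unfolding complex_norm_square[symmetric] power_mult_distrib by simp
  finally have "bherm F (bscale F a v) (bscale F a v) = of_real ((cmod a * bnorm F v)\<^sup>2)" .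
  then show ?thesis using bnorm_nonneg[OF v] by (simp add: bnorm_def)
qed

text \<open>Test against \<open>v\<close> itself and cancel one factor of its norm.\<close>

lemma bnorm_le_dual:
  assumes v: "v \<in> fibre F x" and C: "\<And>w. w \<in> fibre F x \<Longrightarrow> cmod (bherm F w v) \<le> C * bnorm F w" "0 \<le> C"
  shows "bnorm F v \<le> C"
proof (cases "bnorm F v = 0")
  case False
  then have pos: "0 < bnorm F v" using bnorm_nonneg[OF v] by simp
  have "(bnorm F v)\<^sup>2 \<le> C * bnorm F v"
    using C(1)[OF v] herm_self[OF v] by (simp add: norm_power)
  then show ?thesis using pos by (simp add: power2_eq_square)
qed (use C in simp)

lemma continuous_map_coordinate:
  assumes b: "frame F I U b" and i: "i \<in> I"
  shows "continuous_map (subtopology (btotal F) {v \<in> topspace (btotal F). bproj F v \<in> U}) euclidean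
    (\<lambda>v. bherm F (b i (bproj F v)) v)"
proof -
  have "continuous_map (subtopology (btotal F) {v \<in> topspace (btotal F). bproj F v \<in> U}) (cspace I)
      (snd \<circ> coord F I b)"
  proof -
    have "continuous_map (subtopology (btotal F) {v \<in> topspace (btotal F). bproj F v \<in> U})
       (prod_topology (subtopology (bbase F) U) (cspace I)) (coord F I b)"
      using b unfolding frame_def by (blast intro: homeomorphic_imp_continuous_map)
    then show ?thesis unfolding continuous_map_pairwise by (rule conjunct2)
  qed
  from continuous_map_compose[OF this continuous_map_cspace_component[OF i]] i
  show ?thesis by (simp add: o_def coord_def)
qed

text \<open>Over the frame domain \<open>f\<close> is the inverse coordinate homeomorphism applied
  to the coordinates of \<open>f\<close>, so continuity into the total space reduces to that of the
  base point and of scalar functions.\<close>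

lemma continuous_map_into_total:
  assumes b: "frame F I U b"
    and f: "\<And>z. z \<in> topspace Y \<Longrightarrow> f z \<in> topspace (btotal F) \<and> bproj F (f z) \<in> U"
    and proj: "continuous_map Y (bbase F) (\<lambda>z. bproj F (f z))"
    and co: "\<And>i. i \<in> I \<Longrightarrow> continuous_map Y euclidean (\<lambda>z. bherm F (b i (bproj F (f z))) (f z))"
  shows "continuous_map Y (btotal F) f"
proof -
  let ?T = "subtopology (btotal F) {v \<in> topspace (btotal F). bproj F v \<in> U}"
  let ?P = "prod_topology (subtopology (bbase F) U) (cspace I)"
  obtain s where s: "homeomorphic_maps ?T ?P (coord F I b) s" using frame_inverse[OF b] .
  have "continuous_map Y ?P (\<lambda>z. coord F I b (f z))"
    unfolding coord_def
    by (intro continuous_map_pairedI continuous_map_into_subtopology proj continuous_map_into_cspace)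
      (use f co in auto)
  moreover have "continuous_map ?P ?T s" using s by (simp add: homeomorphic_maps_def)
  ultimately have "continuous_map Y ?T (\<lambda>z. s (coord F I b (f z)))"
    using continuous_map_compose by (fastforce simp: o_def)
  then have "continuous_map Y ?T f"
    by (rule continuous_map_eq) (use s f in \<open>auto simp: homeomorphic_maps_def\<close>)
  then show ?thesis by (rule continuous_map_into_fulltopology)
qed

text \<open>The sections of a frame have constant coordinates in that frame.\<close>

lemma frame_section_cont:
  assumes b: "frame F I U b" and i: "i \<in> I"
  shows "continuous_map (subtopology (bbase F) U) (btotal F) (b i)"
proof (rule continuous_map_into_total[OF b])
  have UX: "U \<subseteq> topspace (bbase F)" by (rule openin_subset[OF frame_open[OF b]])
  have fib: "b i y \<in> fibre F y" if "y \<in> U" for y by (rule frame_section_fibre[OF b that i])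
  show "b i z \<in> topspace (btotal F) \<and> bproj F (b i z) \<in> U" if "z \<in> topspace (subtopology (bbase F) U)" for z
    using fib[of z] that by (simp add: fibre_def)
  show "continuous_map (subtopology (bbase F) U) (bbase F) (\<lambda>z. bproj F (b i z))"
    by (rule continuous_map_eq[OF continuous_map_id_subt[unfolded id_def]]) (use fib in \<open>auto simp: fibre_def\<close>)
  show "continuous_map (subtopology (bbase F) U) euclidean (\<lambda>z. bherm F (b j (bproj F (b i z))) (b i z))"
    if j: "j \<in> I" for j
    by (rule continuous_map_eq[of _ _ "\<lambda>_. if j = i then 1 else 0"])
      (use fib onbD(2)[OF frame_onb[OF b] j i] in \<open>auto simp: fibre_def\<close>)
qed

lemma mid_bmor: "mid F \<in> bmor F F"
  unfolding bmor_def mid_def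
  by (auto intro: scale_fibre add_fibre fibre_topspace
      simp: restrict_continuous_map[OF order_refl] fibre_topspace[OF scale_fibre] fibre_topspace[OF add_fibre] fibre_topspace)

end

lemma bmorD:
  assumes "t \<in> bmor F F'"
  shows "t \<in> extensional (topspace (btotal F))" "continuous_map (btotal F) (btotal F') t"
    "x \<in> topspace (bbase F) \<Longrightarrow> v \<in> fibre F x \<Longrightarrow> t v \<in> fibre F' x"
    "x \<in> topspace (bbase F) \<Longrightarrow> v \<in> fibre F x \<Longrightarrow> t (bscale F a v) = bscale F' a (t v)"
    "x \<in> topspace (bbase F) \<Longrightarrow> v \<in> fibre F x \<Longrightarrow> w \<in> fibre F x \<Longrightarrow> t (badd F v w) = badd F' (t v) (t w)"
  using assms unfolding bmor_def by blast+

lemma bmor_eqI: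
  assumes "t \<in> bmor F F'" "t' \<in> bmor F F''" "\<And>v. v \<in> topspace (btotal F) \<Longrightarrow> t v = t' v"
  shows "t = t'"
  using assms by (intro extensionalityI[of t "topspace (btotal F)"]) (auto simp: bmor_def)

section \<open>Morphisms between framed bundles\<close>

locale framed_pair = F: framed F I + F': framed F' I'
  for F :: "('x, 'f) hbundle" and I :: "'i set" and F' :: "('x, 'g) hbundle" and I' :: "'j set" +
  assumes same_base: "bbase F' = bbase F"
begin

lemma ex_frames:
  assumes "x \<in> topspace (bbase F)"
  shows "\<exists>U b b'. x \<in> U \<and> frame F I U b \<and> frame F' I' U b'"
proof -
  obtain U b where b: "x \<in> U" "frame F I U b" using F.ex_frame assms by blast
  obtain U' b' where b': "x \<in> U'" "frame F' I' U' b'" using F'.ex_frame assms same_base by metis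
  have "openin (bbase F) (U \<inter> U')"
    using frame_open[OF b(2)] frame_open[OF b'(2)] by (simp add: same_base openin_Int)
  then have "frame F I (U \<inter> U') b" "frame F' I' (U \<inter> U') b'"
    using frame_restrict[OF b(2)] frame_restrict[OF b'(2)] same_base by simp_all
  then show ?thesis using b(1) b'(1) by blast
qed

lemma bmor_fibre: "t \<in> bmor F F' \<Longrightarrow> v \<in> fibre F x \<Longrightarrow> t v \<in> fibre F' x"
  using bmorD(3) F.fibre_base' by metis

lemma bmor_scale: "t \<in> bmor F F' \<Longrightarrow> v \<in> fibre F x \<Longrightarrow> t (bscale F a v) = bscale F' a (t v)"
  using bmorD(4) F.fibre_base' by metis

lemma bmor_add: "t \<in> bmor F F' \<Longrightarrow> v \<in> fibre F x \<Longrightarrow> w \<in> fibre F x \<Longrightarrow> t (badd F v w) = badd F' (t v) (t w)"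
  using bmorD(5) F.fibre_base' by metis

text \<open>Stated for fibrewise linear maps without continuity, because it is used to prove that
  such a map is continuous.\<close>

lemma herm_map_expand:
  assumes fib: "\<And>v. v \<in> fibre F x \<Longrightarrow> t v \<in> fibre F' x"
    and scale: "\<And>a v. v \<in> fibre F x \<Longrightarrow> t (bscale F a v) = bscale F' a (t v)"
    and add: "\<And>v w. v \<in> fibre F x \<Longrightarrow> w \<in> fibre F x \<Longrightarrow> t (badd F v w) = badd F' (t v) (t w)"
    and b: "onb F I x b" and v: "v \<in> fibre F x" and w: "w \<in> fibre F' x"
  shows "bherm F' w (t v) = (\<Sum>i\<in>I. bherm F (b i) v * bherm F' w (t (b i)))"
  by (rule F.linear_functional_expand[OF b v])
    (simp_all add: fib scale add F'.herm_add[OF w] F'.herm_scale[OF w])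

text \<open>The coordinates of an image are sums of coordinates of the argument times matrix entries
  of \<open>t\<close>; on the preimage of a frame domain all of these are continuous.\<close>

lemma bmorI_frames:
  assumes ext: "t \<in> extensional (topspace (btotal F))"
    and fib: "\<And>x v. v \<in> fibre F x \<Longrightarrow> t v \<in> fibre F' x"
    and scale: "\<And>x a v. v \<in> fibre F x \<Longrightarrow> t (bscale F a v) = bscale F' a (t v)"
    and add: "\<And>x v w. v \<in> fibre F x \<Longrightarrow> w \<in> fibre F x \<Longrightarrow> t (badd F v w) = badd F' (t v) (t w)"
    and co: "\<And>x. x \<in> topspace (bbase F) \<Longrightarrow> \<exists>U b b'. x \<in> U \<and> frame F I U b \<and> frame F' I' U b' \<and>
      (\<forall>i\<in>I. \<forall>j\<in>I'. continuous_map (subtopology (bbase F) U) euclidean (\<lambda>y. bherm F' (b' j y) (t (b i y))))"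
  shows "t \<in> bmor F F'"
proof -
  have "continuous_map (btotal F) (btotal F') t"
  proof (rule continuous_map_locally)
    fix v0 assume v0: "v0 \<in> topspace (btotal F)"
    obtain U b b' where x: "bproj F v0 \<in> U" and b: "frame F I U b" and b': "frame F' I' U b'"
      and c: "\<And>i j. i \<in> I \<Longrightarrow> j \<in> I' \<Longrightarrow>
        continuous_map (subtopology (bbase F) U) euclidean (\<lambda>y. bherm F' (b' j y) (t (b i y)))"
      using co[OF F.proj_base[OF v0]] by blast
    define V where "V = {v \<in> topspace (btotal F). bproj F v \<in> U}"
    have tV: "topspace (subtopology (btotal F) V) = V" by (auto simp: V_def)
    have opV: "openin (btotal F) V"
      unfolding V_def by (rule openin_continuous_map_preimage[OF F.proj_cont frame_open[OF b]])
    have Vf: "v \<in> fibre F (bproj F v)" "bproj F v \<in> U" if "v \<in> V" for v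
      using that by (auto simp: V_def fibre_def)
    have pr: "bproj F' (t v) = bproj F v" "t v \<in> topspace (btotal F')" if "v \<in> V" for v
      using fib[OF Vf(1)[OF that]] by (auto simp: fibre_def)
    have projV: "continuous_map (subtopology (btotal F) V) (subtopology (bbase F) U) (bproj F)"
      by (intro continuous_map_into_subtopology continuous_map_from_subtopology F.proj_cont) (auto simp: V_def)
    have "continuous_map (subtopology (btotal F) V) (btotal F') t"
    proof (rule F'.continuous_map_into_total[OF b'])
      show "t z \<in> topspace (btotal F') \<and> bproj F' (t z) \<in> U" if "z \<in> topspace (subtopology (btotal F) V)" for z
        using that pr Vf unfolding tV by simp
      show "continuous_map (subtopology (btotal F) V) (bbase F') (\<lambda>z. bproj F' (t z))"
        unfolding same_base
        by (rule continuous_map_eq[OF continuous_map_from_subtopology[OF F.proj_cont]]) (use pr tV in auto)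
      fix j assume j: "j \<in> I'"
      have "continuous_map (subtopology (btotal F) V) euclidean
          (\<lambda>v. \<Sum>i\<in>I. bherm F (b i (bproj F v)) v * bherm F' (b' j (bproj F v)) (t (b i (bproj F v))))"
      proof (intro continuous_map_arith)
        fix i assume i: "i \<in> I"
        show "continuous_map (subtopology (btotal F) V) euclidean (\<lambda>v. bherm F (b i (bproj F v)) v)"
          unfolding V_def by (rule F.continuous_map_coordinate[OF b i])
        show "continuous_map (subtopology (btotal F) V) euclidean
            (\<lambda>v. bherm F' (b' j (bproj F v)) (t (b i (bproj F v))))"
          using continuous_map_compose[OF projV c[OF i j]] by (simp add: o_def)
      qed
      then show "continuous_map (subtopology (btotal F) V) euclidean (\<lambda>z. bherm F' (b' j (bproj F' (t z))) (t z))"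
      proof (rule continuous_map_eq)
        fix v assume "v \<in> topspace (subtopology (btotal F) V)"
        then have v: "v \<in> V" by (simp add: tV)
        show "(\<Sum>i\<in>I. bherm F (b i (bproj F v)) v * bherm F' (b' j (bproj F v)) (t (b i (bproj F v)))) =
            bherm F' (b' j (bproj F' (t v))) (t v)"
          unfolding pr(1)[OF v]
          by (rule herm_map_expand[symmetric, OF fib scale add frame_onb[OF b Vf(2)[OF v]] Vf(1)[OF v]
                frame_section_fibre[OF b' Vf(2)[OF v] j]])
      qed
    qed
    then show "\<exists>V. openin (btotal F) V \<and> v0 \<in> V \<and> continuous_map (subtopology (btotal F) V) (btotal F') t"
      using opV v0 x by (auto simp: V_def)
  qed
  then show ?thesis using ext fib scale add unfolding bmor_def by blast
qed

lemma bmor_coefficient_cont: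
  assumes t: "t \<in> bmor F F'" and b: "frame F I U b" and b': "frame F' I' U b'" and i: "i \<in> I" and j: "j \<in> I'"
  shows "continuous_map (subtopology (bbase F) U) euclidean (\<lambda>y. bherm F' (b' j y) (t (b i y)))"
proof -
  have UX: "U \<subseteq> topspace (bbase F)" by (rule openin_subset[OF frame_open[OF b]])
  have pr: "bproj F' (t (b i y)) = y" "t (b i y) \<in> topspace (btotal F')" if "y \<in> U" for y
    using bmor_fibre[OF t frame_section_fibre[OF b that i]] by (auto simp: fibre_def)
  have "continuous_map (subtopology (bbase F) U) (btotal F') (\<lambda>y. t (b i y))"
    using continuous_map_compose[OF F.frame_section_cont[OF b i] bmorD(2)[OF t]] by (simp add: o_def)
  then have "continuous_map (subtopology (bbase F) U)
      (subtopology (btotal F') {v \<in> topspace (btotal F'). bproj F' v \<in> U}) (\<lambda>y. t (b i y))"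
    by (rule continuous_map_into_subtopology) (use pr in auto)
  from continuous_map_compose[OF this F'.continuous_map_coordinate[OF b' j]]
  have "continuous_map (subtopology (bbase F) U) euclidean
      (\<lambda>y. bherm F' (b' j (bproj F' (t (b i y)))) (t (b i y)))"
    by (simp add: o_def)
  then show ?thesis by (rule continuous_map_eq) (use pr in auto)
qed

lemma madd_bmor:
  assumes t: "t \<in> bmor F F'" and t': "t' \<in> bmor F F'"
  shows "madd F F' t t' \<in> bmor F F'"
proof -
  have eq: "madd F F' t t' v = badd F' (t v) (t' v)" if "v \<in> fibre F x" for v x
    using that by (simp add: madd_def fibre_def)
  have four: "badd F' (badd F' a b) (badd F' c d) = badd F' (badd F' a c) (badd F' b d)"
    if "a \<in> fibre F' x" "b \<in> fibre F' x" "c \<in> fibre F' x" "d \<in> fibre F' x" for a b c d x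
    by (rule F'.herm_eqI[of _ x]) (use that in \<open>auto simp: F'.herm_add F'.add_fibre\<close>)
  have sc: "bscale F' z (badd F' a b) = badd F' (bscale F' z a) (bscale F' z b)"
    if "a \<in> fibre F' x" "b \<in> fibre F' x" for a b x z
    by (rule F'.herm_eqI[of _ x])
      (use that in \<open>auto simp: F'.herm_add F'.herm_scale F'.add_fibre F'.scale_fibre algebra_simps\<close>)
  show ?thesis
  proof (rule bmorI_frames)
    show "madd F F' t t' \<in> extensional (topspace (btotal F))" by (simp add: madd_def)
  next
    fix x v assume v: "v \<in> fibre F x"
    show "madd F F' t t' v \<in> fibre F' x"
      using v t t' by (simp add: eq[OF v] F'.add_fibre bmor_fibre)
    show "madd F F' t t' (bscale F a v) = bscale F' a (madd F F' t t' v)" for a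
      using sc[OF bmor_fibre[OF t v] bmor_fibre[OF t' v]]
      by (simp add: eq[OF v] eq[OF F.scale_fibre[OF v]] bmor_scale[OF t v] bmor_scale[OF t' v])
    show "madd F F' t t' (badd F v w) = badd F' (madd F F' t t' v) (madd F F' t t' w)" if w: "w \<in> fibre F x" for w
      using four[OF bmor_fibre[OF t v] bmor_fibre[OF t w] bmor_fibre[OF t' v] bmor_fibre[OF t' w]]
      by (simp add: eq[OF v] eq[OF w] eq[OF F.add_fibre[OF v w]] bmor_add[OF t v w] bmor_add[OF t' v w])
  next
    fix x assume "x \<in> topspace (bbase F)"
    then obtain U b b' where x: "x \<in> U" and b: "frame F I U b" and b': "frame F' I' U b'"
      using ex_frames by blast
    have "continuous_map (subtopology (bbase F) U) euclidean (\<lambda>y. bherm F' (b' j y) (madd F F' t t' (b i y)))"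
      if i: "i \<in> I" and j: "j \<in> I'" for i j
    proof (rule continuous_map_eq[OF continuous_map_add])
      show "continuous_map (subtopology (bbase F) U) euclidean (\<lambda>y. bherm F' (b' j y) (t (b i y)))"
        "continuous_map (subtopology (bbase F) U) euclidean (\<lambda>y. bherm F' (b' j y) (t' (b i y)))"
        by (rule bmor_coefficient_cont[OF t b b' i j], rule bmor_coefficient_cont[OF t' b b' i j])
      fix y assume "y \<in> topspace (subtopology (bbase F) U)"
      then have y: "y \<in> U" by simp
      show "bherm F' (b' j y) (t (b i y)) + bherm F' (b' j y) (t' (b i y)) =
          bherm F' (b' j y) (madd F F' t t' (b i y))"
        using frame_section_fibre[OF b y i] frame_section_fibre[OF b' y j] t t'
        by (simp add: eq F'.herm_add bmor_fibre)
    qed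
    then show "\<exists>U b b'. x \<in> U \<and> frame F I U b \<and> frame F' I' U b' \<and>
      (\<forall>i\<in>I. \<forall>j\<in>I'. continuous_map (subtopology (bbase F) U) euclidean
        (\<lambda>y. bherm F' (b' j y) (madd F F' t t' (b i y))))"
      using x b b' by blast
  qed
qed

lemma mscale_bmor:
  assumes t: "t \<in> bmor F F'"
  shows "mscale F F' c t \<in> bmor F F'"
proof -
  have eq: "mscale F F' c t v = bscale F' c (t v)" if "v \<in> fibre F x" for v x
    using that by (simp add: mscale_def fibre_def)
  have sc: "bscale F' z (badd F' a b) = badd F' (bscale F' z a) (bscale F' z b)"
    if "a \<in> fibre F' x" "b \<in> fibre F' x" for a b x z
    by (rule F'.herm_eqI[of _ x])
      (use that in \<open>auto simp: F'.herm_add F'.herm_scale F'.add_fibre F'.scale_fibre algebra_simps\<close>)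
  have com: "bscale F' z (bscale F' z' a) = bscale F' z' (bscale F' z a)"
    if "a \<in> fibre F' x" for a x z z'
    by (rule F'.herm_eqI[of _ x]) (use that in \<open>auto simp: F'.herm_scale F'.scale_fibre\<close>)
  show ?thesis
  proof (rule bmorI_frames)
    show "mscale F F' c t \<in> extensional (topspace (btotal F))" by (simp add: mscale_def)
  next
    fix x v assume v: "v \<in> fibre F x"
    show "mscale F F' c t v \<in> fibre F' x"
      using v t by (simp add: eq[OF v] F'.scale_fibre bmor_fibre)
    show "mscale F F' c t (bscale F a v) = bscale F' a (mscale F F' c t v)" for a
      using com[OF bmor_fibre[OF t v]]
      by (simp add: eq[OF v] eq[OF F.scale_fibre[OF v]] bmor_scale[OF t v])
    show "mscale F F' c t (badd F v w) = badd F' (mscale F F' c t v) (mscale F F' c t w)" if w: "w \<in> fibre F x" for w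
      using sc[OF bmor_fibre[OF t v] bmor_fibre[OF t w]]
      by (simp add: eq[OF v] eq[OF w] eq[OF F.add_fibre[OF v w]] bmor_add[OF t v w])
  next
    fix x assume "x \<in> topspace (bbase F)"
    then obtain U b b' where x: "x \<in> U" and b: "frame F I U b" and b': "frame F' I' U b'"
      using ex_frames by blast
    have "continuous_map (subtopology (bbase F) U) euclidean (\<lambda>y. bherm F' (b' j y) (mscale F F' c t (b i y)))"
      if i: "i \<in> I" and j: "j \<in> I'" for i j
    proof (rule continuous_map_eq[OF continuous_map_mult'])
      show "continuous_map (subtopology (bbase F) U) euclidean (\<lambda>y. c)" by simp
      show "continuous_map (subtopology (bbase F) U) euclidean (\<lambda>y. bherm F' (b' j y) (t (b i y)))"
        by (rule bmor_coefficient_cont[OF t b b' i j])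
      fix y assume "y \<in> topspace (subtopology (bbase F) U)"
      then have y: "y \<in> U" by simp
      show "c * bherm F' (b' j y) (t (b i y)) = bherm F' (b' j y) (mscale F F' c t (b i y))"
        using frame_section_fibre[OF b y i] frame_section_fibre[OF b' y j] t
        by (simp add: eq F'.herm_scale bmor_fibre)
    qed
    then show "\<exists>U b b'. x \<in> U \<and> frame F I U b \<and> frame F' I' U b' \<and>
      (\<forall>i\<in>I. \<forall>j\<in>I'. continuous_map (subtopology (bbase F) U) euclidean
        (\<lambda>y. bherm F' (b' j y) (mscale F F' c t (b i y))))"
      using x b b' by blast
  qed
qed

lemma mcomp_bmor:
  assumes t: "t \<in> bmor F F'" and t': "t' \<in> bmor F' F''"
  shows "mcomp F t' t \<in> bmor F F''"
  unfolding bmor_def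
proof (intro CollectI conjI ballI allI)
  show "mcomp F t' t \<in> extensional (topspace (btotal F))" by (simp add: mcomp_def)
  show "continuous_map (btotal F) (btotal F'') (mcomp F t' t)"
    using continuous_map_compose[OF bmorD(2)[OF t] bmorD(2)[OF t']] by (simp add: mcomp_def o_def)
  fix x v assume x: "x \<in> topspace (bbase F)" and v: "v \<in> fibre F x"
  have x': "x \<in> topspace (bbase F')" using x same_base by simp
  note top = F.fibre_topspace[OF v] and tv = bmor_fibre[OF t v]
  show "mcomp F t' t v \<in> fibre F'' x"
    using bmorD(3)[OF t' x' tv] top by (simp add: mcomp_def)
  show "mcomp F t' t (bscale F a v) = bscale F'' a (mcomp F t' t v)" for a
    using bmorD(4)[OF t' x' tv] top F.fibre_topspace[OF F.scale_fibre[OF v]] bmor_scale[OF t v]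
    by (simp add: mcomp_def)
  fix w assume w: "w \<in> fibre F x"
  show "mcomp F t' t (badd F v w) = badd F'' (mcomp F t' t v) (mcomp F t' t w)"
    using bmorD(5)[OF t' x' tv bmor_fibre[OF t w]] top F.fibre_topspace[OF w]
      F.fibre_topspace[OF F.add_fibre[OF v w]] bmor_add[OF t v w]
    by (simp add: mcomp_def)
qed

text \<open>Riesz supplies the values point by point. Testing against all vectors forces linearity,
  and the matrix in orthonormal frames is the conjugate transpose, hence continuous.\<close>

lemma madj_exists:
  assumes t: "t \<in> bmor F F'"
  shows "\<exists>u. u \<in> bmor F' F \<and>
     (\<forall>x\<in>topspace (bbase F). \<forall>v\<in>fibre F x. \<forall>w\<in>fibre F' x. bherm F (u w) v = bherm F' w (t v))"
proof -
  interpret opp: framed_pair F' I' F I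
    by unfold_locales (rule same_base[symmetric])
  have "\<exists>v\<in>fibre F (bproj F' w). \<forall>v'\<in>fibre F (bproj F' w). bherm F v v' = bherm F' w (t v')"
    if w: "w \<in> topspace (btotal F')" for w
  proof (rule F.riesz)
    show "bproj F' w \<in> topspace (bbase F)" using F'.proj_base[OF w] same_base by simp
    note wf = F'.topspace_fibre[OF w]
    show "bherm F' w (t (badd F v v')) = bherm F' w (t v) + bherm F' w (t v')"
      if "v \<in> fibre F (bproj F' w)" "v' \<in> fibre F (bproj F' w)" for v v'
      using F'.herm_add[OF wf bmor_fibre[OF t that(1)] bmor_fibre[OF t that(2)]] bmor_add[OF t that] by simp
    show "bherm F' w (t (bscale F a v)) = a * bherm F' w (t v)"
      if "v \<in> fibre F (bproj F' w)" for a v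
      using F'.herm_scale[OF wf bmor_fibre[OF t that]] bmor_scale[OF t that] by simp
  qed
  then obtain u0 where u0: "\<And>w. w \<in> topspace (btotal F') \<Longrightarrow> u0 w \<in> fibre F (bproj F' w) \<and>
      (\<forall>v'\<in>fibre F (bproj F' w). bherm F (u0 w) v' = bherm F' w (t v'))"
    by metis
  define u where "u = restrict u0 (topspace (btotal F'))"
  have uf: "u w \<in> fibre F x" and uh: "v \<in> fibre F x \<Longrightarrow> bherm F (u w) v = bherm F' w (t v)"
    if "w \<in> fibre F' x" for w v x
    using u0[of w] that by (auto simp: u_def fibre_def)
  have uh': "bherm F v (u w) = cnj (bherm F' w (t v))" if "w \<in> fibre F' x" "v \<in> fibre F x" for w v x
    using F.herm_cnj[OF uf[OF that(1)] that(2)] uh[OF that] by simp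
  have "u \<in> bmor F' F"
  proof (rule opp.bmorI_frames)
    show "u \<in> extensional (topspace (btotal F'))" by (simp add: u_def)
  next
    fix x w assume w: "w \<in> fibre F' x"
    show "u w \<in> fibre F x" by (rule uf[OF w])
    show "u (bscale F' a w) = bscale F a (u w)" for a
    proof (rule F.herm_eqI[OF uf[OF F'.scale_fibre[OF w]] F.scale_fibre[OF uf[OF w]]])
      fix v assume v: "v \<in> fibre F x"
      show "bherm F v (u (bscale F' a w)) = bherm F v (bscale F a (u w))"
        by (simp add: uh'[OF F'.scale_fibre[OF w] v] F.herm_scale[OF v uf[OF w]] uh'[OF w v]
            F'.herm_scale_left[OF w bmor_fibre[OF t v]])
    qed
    fix w' assume w': "w' \<in> fibre F' x"
    show "u (badd F' w w') = badd F (u w) (u w')"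
    proof (rule F.herm_eqI[OF uf[OF F'.add_fibre[OF w w']] F.add_fibre[OF uf[OF w] uf[OF w']]])
      fix v assume v: "v \<in> fibre F x"
      show "bherm F v (u (badd F' w w')) = bherm F v (badd F (u w) (u w'))"
        by (simp add: uh'[OF F'.add_fibre[OF w w'] v] F.herm_add[OF v uf[OF w] uf[OF w']] uh'[OF w v]
            uh'[OF w' v] F'.herm_add_left[OF w w' bmor_fibre[OF t v]])
    qed
  next
    fix x assume "x \<in> topspace (bbase F')"
    then obtain U b b' where x: "x \<in> U" and b: "frame F I U b" and b': "frame F' I' U b'"
      using ex_frames same_base by metis
    have "continuous_map (subtopology (bbase F') U) euclidean (\<lambda>y. bherm F (b i y) (u (b' j y)))"
      if i: "i \<in> I" and j: "j \<in> I'" for i j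
      unfolding same_base
      by (rule continuous_map_eq[OF continuous_map_cnj[OF bmor_coefficient_cont[OF t b b' i j]]])
        (simp add: uh'[OF frame_section_fibre[OF b' _ j] frame_section_fibre[OF b _ i]])
    then show "\<exists>U b' b. x \<in> U \<and> frame F' I' U b' \<and> frame F I U b \<and>
      (\<forall>j\<in>I'. \<forall>i\<in>I. continuous_map (subtopology (bbase F') U) euclidean (\<lambda>y. bherm F (b i y) (u (b' j y))))"
      using x b b' by blast
  qed
  then show ?thesis using uh by blast
qed

lemma madj:
  assumes t: "t \<in> bmor F F'"
  shows "madj F F' t \<in> bmor F' F"
    "v \<in> fibre F x \<Longrightarrow> w \<in> fibre F' x \<Longrightarrow> bherm F (madj F F' t w) v = bherm F' w (t v)"
proof -
  interpret opp: framed_pair F' I' F I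
    by unfold_locales (rule same_base[symmetric])
  let ?P = "\<lambda>u. u \<in> bmor F' F \<and>
     (\<forall>x\<in>topspace (bbase F). \<forall>v\<in>fibre F x. \<forall>w\<in>fibre F' x. bherm F (u w) v = bherm F' w (t v))"
  have "\<exists>!u. ?P u"
  proof (rule ex_ex1I[OF madj_exists[OF t]])
    fix u u' assume u: "?P u" and u': "?P u'"
    show "u = u'"
    proof (rule bmor_eqI[of u F' F u' F])
      fix w assume "w \<in> topspace (btotal F')"
      then have w: "w \<in> fibre F' (bproj F' w)" by (rule F'.topspace_fibre)
      have x: "bproj F' w \<in> topspace (bbase F)" using F'.fibre_base'[OF w] same_base by simp
      have uw: "u w \<in> fibre F (bproj F' w)" "u' w \<in> fibre F (bproj F' w)"
        using u u' opp.bmor_fibre[OF _ w] by blast+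
      show "u w = u' w"
      proof (rule F.herm_eqI[OF uw])
        fix v assume v: "v \<in> fibre F (bproj F' w)"
        have "bherm F (u w) v = bherm F (u' w) v" using u u' x v w by simp
        then show "bherm F v (u w) = bherm F v (u' w)"
          using F.herm_cnj[OF uw(1) v] F.herm_cnj[OF uw(2) v] by simp
      qed
    qed (use u u' in auto)
  qed
  from theI'[OF this] have P: "?P (madj F F' t)" unfolding madj_def .
  then show "madj F F' t \<in> bmor F' F" by blast
  show "bherm F (madj F F' t w) v = bherm F' w (t v)" if "v \<in> fibre F x" "w \<in> fibre F' x"
    using P F.fibre_base'[OF that(1)] that by blast
qed

section \<open>Operator norm and uniform limits of morphisms\<close>

lemma bmor_bounded:
  assumes comp: "compact_space (bbase F)" and t: "t \<in> bmor F F'"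
  shows "\<exists>C\<ge>0. \<forall>v\<in>topspace (btotal F). bnorm F' (t v) \<le> C * bnorm F v"
proof -
  define bd where "bd W C \<longleftrightarrow> 0 \<le> C \<and> (\<forall>v\<in>topspace (btotal F). bproj F v \<in> W \<longrightarrow> bnorm F' (t v) \<le> C * bnorm F v)"
    for W and C :: real
  define \<U> where "\<U> = {W. openin (bbase F) W \<and> (\<exists>C. bd W C)}"
  have "\<exists>W\<in>\<U>. x \<in> W" if x: "x \<in> topspace (bbase F)" for x
  proof -
    obtain U b b' where xU: "x \<in> U" and b: "frame F I U b" and b': "frame F' I' U b'"
      using ex_frames[OF x] by blast
    \<comment> \<open>The sum of the moduli of all matrix entries dominates the norm of
      \<open>t\<close> on the fibre and depends continuously on the point, so it stays below
      \<open>g x + 1\<close> near \<open>x\<close>.\<close>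
    define g where "g y = (\<Sum>j\<in>I'. \<Sum>i\<in>I. cmod (bherm F' (b' j y) (t (b i y))))" for y
    have "continuous_map (subtopology (bbase F) U) euclideanreal g"
      unfolding g_def by (intro continuous_map_arith continuous_map_norm bmor_coefficient_cont[OF t b b'])
    then have op: "openin (subtopology (bbase F) U) {y \<in> topspace (subtopology (bbase F) U). g y \<in> {..<g x + 1}}"
      by (rule openin_continuous_map_preimage) simp
    define W where "W = {y \<in> topspace (subtopology (bbase F) U). g y \<in> {..<g x + 1}}"
    have opW: "openin (bbase F) W"
      using op frame_open[OF b] unfolding W_def by (rule openin_trans_full)
    have g0: "0 \<le> g y" for y by (simp add: g_def sum_nonneg)
    have "bnorm F' (t v) \<le> (g x + 1) * bnorm F v" if v: "v \<in> topspace (btotal F)" "bproj F v \<in> W" for v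
    proof -
      define y where "y = bproj F v"
      have y: "y \<in> U" "g y < g x + 1" using v(2) by (auto simp: W_def y_def)
      have vf: "v \<in> fibre F y" using F.topspace_fibre[OF v(1)] by (simp add: y_def)
      note ob = frame_onb[OF b y(1)] and ob' = frame_onb[OF b' y(1)]
      have n0: "0 \<le> bnorm F v" by (rule F.bnorm_nonneg[OF vf])
      have bi: "cmod (bherm F (b i y) v) \<le> bnorm F v" if "i \<in> I" for i
        unfolding F.bnorm_L2[OF ob vf] by (rule member_le_L2_set[OF F.finite_index that])
      have "bnorm F' (t v) \<le> (\<Sum>j\<in>I'. \<bar>cmod (bherm F' (b' j y) (t v))\<bar>)"
        unfolding F'.bnorm_L2[OF ob' bmor_fibre[OF t vf]] by (rule L2_set_le_sum_abs)
      also have "\<dots> \<le> (\<Sum>j\<in>I'. \<Sum>i\<in>I. bnorm F v * cmod (bherm F' (b' j y) (t (b i y))))"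
      proof (rule sum_mono)
        fix j assume j: "j \<in> I'"
        have "bherm F' (b' j y) (t v) = (\<Sum>i\<in>I. bherm F (b i y) v * bherm F' (b' j y) (t (b i y)))"
          by (rule herm_map_expand[OF bmor_fibre[OF t] bmor_scale[OF t] bmor_add[OF t] ob vf onbD(1)[OF ob' j]])
        also have "cmod \<dots> \<le> (\<Sum>i\<in>I. bnorm F v * cmod (bherm F' (b' j y) (t (b i y))))"
          by (intro order_trans[OF norm_sum] sum_mono) (auto simp: norm_mult intro!: mult_right_mono bi)
        finally show "\<bar>cmod (bherm F' (b' j y) (t v))\<bar> \<le> (\<Sum>i\<in>I. bnorm F v * cmod (bherm F' (b' j y) (t (b i y))))"
          by simp
      qed
      also have "\<dots> = g y * bnorm F v"
        unfolding g_def by (simp add: sum_distrib_left sum_distrib_right mult.commute)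
      also have "\<dots> \<le> (g x + 1) * bnorm F v"
        using y(2) n0 by (intro mult_right_mono) auto
      finally show ?thesis .
    qed
    then have "bd W (g x + 1)" using g0[of x] by (simp add: bd_def)
    moreover have "x \<in> W" using xU x by (simp add: W_def)
    ultimately show ?thesis using opW by (auto simp: \<U>_def)
  qed
  then obtain \<F> where \<F>: "finite \<F>" "\<F> \<subseteq> \<U>" "topspace (bbase F) \<subseteq> \<Union>\<F>"
    using comp unfolding compact_space_alt by (metis (no_types, lifting) UnionI \<U>_def mem_Collect_eq subsetI)
  then have "\<forall>W\<in>\<F>. \<exists>C. bd W C" by (auto simp: \<U>_def)
  then obtain C where C: "\<And>W. W \<in> \<F> \<Longrightarrow> bd W (C W)" by metis
  \<comment> \<open>The sum of the finitely many local constants is a global bound that, unlike a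
    maximum, also makes sense for an empty cover.\<close>
  have "bnorm F' (t v) \<le> sum C \<F> * bnorm F v" if v: "v \<in> topspace (btotal F)" for v
  proof -
    obtain W where W: "W \<in> \<F>" "bproj F v \<in> W" using \<F>(3) F.proj_base[OF v] by blast
    have "C W \<le> sum C \<F>" by (rule member_le_sum[OF W(1) _ \<F>(1)]) (use C in \<open>auto simp: bd_def\<close>)
    then have "C W * bnorm F v \<le> sum C \<F> * bnorm F v"
      by (rule mult_right_mono[OF _ F.bnorm_nonneg[OF F.topspace_fibre[OF v]]])
    moreover have "bnorm F' (t v) \<le> C W * bnorm F v" using C[OF W(1)] v W(2) by (simp add: bd_def)
    ultimately show ?thesis by linarith
  qed
  moreover have "0 \<le> sum C \<F>" using C by (intro sum_nonneg) (simp add: bd_def)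
  ultimately show ?thesis by blast
qed

lemma mnorm_upper:
  assumes comp: "compact_space (bbase F)" and t: "t \<in> bmor F F'"
  shows "bdd_above (insert 0 {bnorm F' (t v) | v. v \<in> topspace (btotal F) \<and> bnorm F v \<le> 1})"
proof -
  obtain C where C: "C \<ge> 0" "\<And>v. v \<in> topspace (btotal F) \<Longrightarrow> bnorm F' (t v) \<le> C * bnorm F v"
    using bmor_bounded[OF assms] by blast
  show ?thesis
  proof (rule bdd_aboveI[of _ C])
    fix r assume "r \<in> insert 0 {bnorm F' (t v) | v. v \<in> topspace (btotal F) \<and> bnorm F v \<le> 1}"
    then show "r \<le> C"
    proof safe
      fix v assume v: "v \<in> topspace (btotal F)" "bnorm F v \<le> 1"
      have "C * bnorm F v \<le> C" using v(2) C(1) by (simp add: mult_left_le)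
      then show "bnorm F' (t v) \<le> C" using C(2)[OF v(1)] by linarith
    qed (use C in simp)
  qed
qed

lemma mnorm_nonneg: "compact_space (bbase F) \<Longrightarrow> t \<in> bmor F F' \<Longrightarrow> 0 \<le> mnorm F F' t"
  unfolding mnorm_def by (rule cSup_upper[OF _ mnorm_upper]) simp_all

lemma mnorm_bound:
  assumes comp: "compact_space (bbase F)" and t: "t \<in> bmor F F'" and v: "v \<in> fibre F x"
  shows "bnorm F' (t v) \<le> mnorm F F' t * bnorm F v"
proof (cases "bnorm F v = 0")
  \<comment> \<open>A vector of norm zero cannot be normalized; the crude bound from compactness
    shows that its image has norm zero as well.\<close>
  case True
  obtain C where "\<And>v. v \<in> topspace (btotal F) \<Longrightarrow> bnorm F' (t v) \<le> C * bnorm F v"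
    using bmor_bounded[OF comp t] by blast
  from this[OF F.fibre_topspace[OF v]] show ?thesis using True by simp
next
  case False
  then have pos: "0 < bnorm F v" using F.bnorm_nonneg[OF v] by simp
  define a where "a = complex_of_real (inverse (bnorm F v))"
  have a: "cmod a = inverse (bnorm F v)" using pos by (simp add: a_def norm_inverse)
  have "bnorm F' (t (bscale F a v)) \<le> mnorm F F' t"
    unfolding mnorm_def
  proof (rule cSup_upper[OF _ mnorm_upper[OF comp t]])
    have "bnorm F (bscale F a v) \<le> 1" using pos by (simp add: F.bnorm_scale[OF v] a)
    then show "bnorm F' (t (bscale F a v)) \<in> insert 0 {bnorm F' (t v) | v. v \<in> topspace (btotal F) \<and> bnorm F v \<le> 1}"
      using F.fibre_topspace[OF F.scale_fibre[OF v]] by blast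
  qed
  then have "inverse (bnorm F v) * bnorm F' (t v) \<le> mnorm F F' t"
    by (simp add: bmor_scale[OF t v] F'.bnorm_scale[OF bmor_fibre[OF t v]] a)
  then show ?thesis using pos by (simp add: field_simps)
qed

lemma mnorm_least:
  assumes "0 \<le> C" and "\<And>x v. v \<in> fibre F x \<Longrightarrow> bnorm F' (t v) \<le> C * bnorm F v"
  shows "mnorm F F' t \<le> C"
  unfolding mnorm_def
proof (rule cSup_least)
  fix r assume "r \<in> insert 0 {bnorm F' (t v) | v. v \<in> topspace (btotal F) \<and> bnorm F v \<le> 1}"
  then show "r \<le> C"
  proof safe
    fix v assume v: "v \<in> topspace (btotal F)" "bnorm F v \<le> 1"
    have "C * bnorm F v \<le> C" using v(2) assms(1) by (simp add: mult_left_le)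
    then show "bnorm F' (t v) \<le> C" using assms(2)[OF F.topspace_fibre[OF v(1)]] by linarith
  qed (use assms in simp)
qed simp

lemma mnorm_herm_bound:
  assumes comp: "compact_space (bbase F)" and t: "t \<in> bmor F F'" and v: "v \<in> fibre F x" and w: "w \<in> fibre F' x"
  shows "cmod (bherm F' w (t v)) \<le> mnorm F F' t * bnorm F v * bnorm F' w"
proof -
  have "cmod (bherm F' w (t v)) \<le> bnorm F' w * bnorm F' (t v)"
    by (rule F'.cauchy_schwarz[OF w bmor_fibre[OF t v]])
  also have "\<dots> \<le> bnorm F' w * (mnorm F F' t * bnorm F v)"
    by (rule mult_left_mono[OF mnorm_bound[OF comp t v] F'.bnorm_nonneg[OF w]])
  finally show ?thesis by (simp add: mult_ac)
qed

lemma mnorm_le_dual: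
  assumes C: "0 \<le> C" and fib: "\<And>x v. v \<in> fibre F x \<Longrightarrow> t v \<in> fibre F' x"
    and h: "\<And>x v w. v \<in> fibre F x \<Longrightarrow> w \<in> fibre F' x \<Longrightarrow> cmod (bherm F' w (t v)) \<le> C * bnorm F v * bnorm F' w"
  shows "mnorm F F' t \<le> C"
proof (rule mnorm_least[OF C])
  fix x v assume v: "v \<in> fibre F x"
  show "bnorm F' (t v) \<le> C * bnorm F v"
    by (rule F'.bnorm_le_dual[OF fib[OF v]]) (use h[OF v] C F.bnorm_nonneg[OF v] in auto)
qed

text \<open>The limit is built weakly: matrix coefficients converge, and Riesz turns the limit form
  into vectors. The estimate is uniform over the base, so coefficients in frames are uniform limits
  of continuous functions.\<close>

lemma bmor_uniform_limit:
  assumes f: "\<And>n::nat. f n \<in> bmor F F'"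
    and cauchy: "\<And>e. 0 < e \<Longrightarrow> \<exists>N. \<forall>m\<ge>N. \<forall>n\<ge>N. \<forall>x. \<forall>v\<in>fibre F x. \<forall>w\<in>fibre F' x.
      cmod (bherm F' w (f m v) - bherm F' w (f n v)) \<le> e * bnorm F v * bnorm F' w"
  shows "\<exists>t\<in>bmor F F'. \<forall>e>0. \<exists>N. \<forall>n\<ge>N. \<forall>x. \<forall>v\<in>fibre F x. \<forall>w\<in>fibre F' x.
      cmod (bherm F' w (f n v) - bherm F' w (t v)) \<le> e * bnorm F v * bnorm F' w"
proof -
  have conv: "convergent (\<lambda>n. bherm F' w (f n v))" if v: "v \<in> fibre F x" and w: "w \<in> fibre F' x" for v w x
  proof (rule Cauchy_convergent, rule metric_CauchyI)
    fix e :: real assume e: "0 < e"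
    define K where "K = bnorm F v * bnorm F' w"
    have K: "0 \<le> K" using F.bnorm_nonneg[OF v] F'.bnorm_nonneg[OF w] by (simp add: K_def)
    \<comment> \<open>The \<open>+ 1\<close> in the tolerance guards against
      \<open>K = 0\<close>.\<close>
    obtain N where N: "\<And>m n. m \<ge> N \<Longrightarrow> n \<ge> N \<Longrightarrow>
        cmod (bherm F' w (f m v) - bherm F' w (f n v)) \<le> (e / (K + 1)) * bnorm F v * bnorm F' w"
      using cauchy[of "e / (K + 1)"] e K v w by (smt (verit, best) divide_pos_pos)
    have "(e / (K + 1)) * bnorm F v * bnorm F' w < e"
    proof -
      have "e * K < e * (K + 1)" using e by simp
      then have "(e / (K + 1)) * K < e" using K by (simp add: field_simps)
      then show ?thesis by (simp add: K_def mult.assoc)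
    qed
    then show "\<exists>M. \<forall>m\<ge>M. \<forall>n\<ge>M. dist (bherm F' w (f m v)) (bherm F' w (f n v)) < e"
      using N by (intro exI[of _ N]) (auto simp: dist_norm intro: le_less_trans)
  qed
  define h where "h v w = lim (\<lambda>n. bherm F' w (f n v))" for v w
  have h: "(\<lambda>n. bherm F' w (f n v)) \<longlonglongrightarrow> h v w" if "v \<in> fibre F x" "w \<in> fibre F' x" for v w x
    unfolding h_def using conv[OF that] by (simp add: convergent_LIMSEQ_iff)
  \<comment> \<open>The limit form \<open>h v w\<close> is conjugate linear in \<open>w\<close>, so
    its conjugate is the functional that Riesz represents.\<close>
  have "\<exists>u\<in>fibre F' (bproj F v). \<forall>w\<in>fibre F' (bproj F v). bherm F' u w = cnj (h v w)"
    if v: "v \<in> topspace (btotal F)" for v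
  proof (rule F'.riesz)
    note vf = F.topspace_fibre[OF v]
    show "bproj F v \<in> topspace (bbase F')" using F.proj_base[OF v] same_base by simp
    show "cnj (h v (badd F' w w')) = cnj (h v w) + cnj (h v w')"
      if w: "w \<in> fibre F' (bproj F v)" "w' \<in> fibre F' (bproj F v)" for w w'
    proof -
      have "(\<lambda>n. bherm F' (badd F' w w') (f n v)) \<longlonglongrightarrow> h v w + h v w'"
        using tendsto_add[OF h[OF vf w(1)] h[OF vf w(2)]] bmor_fibre[OF f vf] w
        by (simp add: F'.herm_add_left)
      from LIMSEQ_unique[OF h[OF vf F'.add_fibre[OF w]] this] show ?thesis by simp
    qed
    show "cnj (h v (bscale F' a w)) = a * cnj (h v w)" if w: "w \<in> fibre F' (bproj F v)" for a w
    proof -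
      have "(\<lambda>n. bherm F' (bscale F' a w) (f n v)) \<longlonglongrightarrow> cnj a * h v w"
        using tendsto_mult_left[OF h[OF vf w], of "cnj a"] bmor_fibre[OF f vf] w
        by (simp add: F'.herm_scale_left)
      from LIMSEQ_unique[OF h[OF vf F'.scale_fibre[OF w]] this] show ?thesis by simp
    qed
  qed
  then obtain t0 where t0: "\<And>v. v \<in> topspace (btotal F) \<Longrightarrow> t0 v \<in> fibre F' (bproj F v) \<and>
      (\<forall>w\<in>fibre F' (bproj F v). bherm F' (t0 v) w = cnj (h v w))"
    by metis
  define t where "t = restrict t0 (topspace (btotal F))"
  have tf: "t v \<in> fibre F' x" if "v \<in> fibre F x" for v x
    using t0[of v] that by (auto simp: t_def fibre_def)
  have th: "bherm F' w (t v) = h v w" if "v \<in> fibre F x" "w \<in> fibre F' x" for v w x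
  proof -
    have "bherm F' (t v) w = cnj (h v w)" using t0[of v] that by (auto simp: t_def fibre_def)
    then show ?thesis using F'.herm_cnj[OF tf[OF that(1)] that(2)] by simp
  qed
  have lim: "(\<lambda>n. bherm F' w (f n v)) \<longlonglongrightarrow> bherm F' w (t v)" if "v \<in> fibre F x" "w \<in> fibre F' x" for v w x
    using h[OF that] th[OF that] by simp
  have unif: "\<exists>N. \<forall>n\<ge>N. \<forall>x. \<forall>v\<in>fibre F x. \<forall>w\<in>fibre F' x.
      cmod (bherm F' w (f n v) - bherm F' w (t v)) \<le> e * bnorm F v * bnorm F' w" if e: "e > 0" for e
  proof -
    obtain N where N: "\<forall>m\<ge>N. \<forall>n\<ge>N. \<forall>x. \<forall>v\<in>fibre F x. \<forall>w\<in>fibre F' x.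
        cmod (bherm F' w (f m v) - bherm F' w (f n v)) \<le> e * bnorm F v * bnorm F' w"
      using cauchy[OF e] by blast
    have "cmod (bherm F' w (f n v) - bherm F' w (t v)) \<le> e * bnorm F v * bnorm F' w"
      if "n \<ge> N" "v \<in> fibre F x" "w \<in> fibre F' x" for n v w x
    proof (rule LIMSEQ_le_const2)
      show "(\<lambda>m. cmod (bherm F' w (f n v) - bherm F' w (f m v))) \<longlonglongrightarrow>
          cmod (bherm F' w (f n v) - bherm F' w (t v))"
        by (intro tendsto_intros lim[OF that(2,3)])
      show "\<exists>M. \<forall>m\<ge>M. cmod (bherm F' w (f n v) - bherm F' w (f m v)) \<le> e * bnorm F v * bnorm F' w"
        using N that by blast
    qed
    then show ?thesis by blast
  qed
  have "t \<in> bmor F F'"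
  proof (rule bmorI_frames)
    show "t \<in> extensional (topspace (btotal F))" by (simp add: t_def)
  next
    fix x v assume v: "v \<in> fibre F x"
    show "t v \<in> fibre F' x" by (rule tf[OF v])
    show "t (bscale F a v) = bscale F' a (t v)" for a
    proof (rule F'.herm_eqI[OF tf[OF F.scale_fibre[OF v]] F'.scale_fibre[OF tf[OF v]]])
      fix w assume w: "w \<in> fibre F' x"
      have "(\<lambda>n. bherm F' w (f n (bscale F a v))) \<longlonglongrightarrow> a * bherm F' w (t v)"
        using tendsto_mult_left[OF lim[OF v w], of a]
        by (simp add: bmor_scale[OF f v] F'.herm_scale[OF w bmor_fibre[OF f v]])
      from LIMSEQ_unique[OF lim[OF F.scale_fibre[OF v] w] this]
      show "bherm F' w (t (bscale F a v)) = bherm F' w (bscale F' a (t v))"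
        by (simp add: F'.herm_scale[OF w tf[OF v]])
    qed
    fix v' assume v': "v' \<in> fibre F x"
    show "t (badd F v v') = badd F' (t v) (t v')"
    proof (rule F'.herm_eqI[OF tf[OF F.add_fibre[OF v v']] F'.add_fibre[OF tf[OF v] tf[OF v']]])
      fix w assume w: "w \<in> fibre F' x"
      have "(\<lambda>n. bherm F' w (f n (badd F v v'))) \<longlonglongrightarrow> bherm F' w (t v) + bherm F' w (t v')"
        using tendsto_add[OF lim[OF v w] lim[OF v' w]]
        by (simp add: bmor_add[OF f v v'] F'.herm_add[OF w bmor_fibre[OF f v] bmor_fibre[OF f v']])
      from LIMSEQ_unique[OF lim[OF F.add_fibre[OF v v'] w] this]
      show "bherm F' w (t (badd F v v')) = bherm F' w (badd F' (t v) (t v'))"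
        by (simp add: F'.herm_add[OF w tf[OF v] tf[OF v']])
    qed
  next
    fix x assume "x \<in> topspace (bbase F)"
    then obtain U b b' where x: "x \<in> U" and b: "frame F I U b" and b': "frame F' I' U b'"
      using ex_frames by blast
    have "continuous_map (subtopology (bbase F) U) euclidean (\<lambda>y. bherm F' (b' j y) (t (b i y)))"
      if i: "i \<in> I" and j: "j \<in> I'" for i j
    proof -
      have bn: "bnorm F (b i y) = 1" "bnorm F' (b' j y) = 1" if "y \<in> U" for y
        using onbD(2)[OF frame_onb[OF b that] i i] onbD(2)[OF frame_onb[OF b' that] j j]
        by (simp_all add: bnorm_def)
      have "continuous_map (subtopology (bbase F) U) Met_TC.mtopology (\<lambda>y. bherm F' (b' j y) (t (b i y)))"
      proof (rule Met_TC.continuous_map_uniform_limit[where F = sequentially and f = "\<lambda>n y. bherm F' (b' j y) (f n (b i y))"])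
        show "\<forall>\<^sub>F n in sequentially.
            continuous_map (subtopology (bbase F) U) Met_TC.mtopology (\<lambda>y. bherm F' (b' j y) (f n (b i y)))"
          using bmor_coefficient_cont[OF f b b' i j] by simp
        fix e :: real assume e: "0 < e"
        obtain N where N: "\<And>n x v w. n \<ge> N \<Longrightarrow> v \<in> fibre F x \<Longrightarrow> w \<in> fibre F' x \<Longrightarrow>
            cmod (bherm F' w (f n v) - bherm F' w (t v)) \<le> e / 2 * bnorm F v * bnorm F' w"
          using unif[of "e / 2"] e by (meson half_gt_zero)
        have "cmod (bherm F' (b' j y) (f n (b i y)) - bherm F' (b' j y) (t (b i y))) < e"
          if "n \<ge> N" "y \<in> U" for n y
          using N[OF that(1) frame_section_fibre[OF b that(2) i] frame_section_fibre[OF b' that(2) j]] bn[OF that(2)] e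
          by simp
        then show "\<forall>\<^sub>F n in sequentially. \<forall>y\<in>topspace (subtopology (bbase F) U).
            bherm F' (b' j y) (t (b i y)) \<in> UNIV \<and>
            dist (bherm F' (b' j y) (f n (b i y))) (bherm F' (b' j y) (t (b i y))) < e"
          by (auto simp: eventually_sequentially dist_norm)
      qed simp
      then show ?thesis by simp
    qed
    then show "\<exists>U b b'. x \<in> U \<and> frame F I U b \<and> frame F' I' U b' \<and>
      (\<forall>i\<in>I. \<forall>j\<in>I'. continuous_map (subtopology (bbase F) U) euclidean (\<lambda>y. bherm F' (b' j y) (t (b i y))))"
      using x b b' by blast
  qed
  then show ?thesis using unif by blast
qed

end

section \<open>Frames of the tensor powers\<close>

definition tuples :: "'a set \<Rightarrow> nat \<Rightarrow> 'a list set" where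
  "tuples A r = {xs. length xs = r \<and> set xs \<subseteq> A}"

lemma multi_index_tuples: "multi_index d r = tuples {..<d} r"
  by (simp add: multi_index_def tuples_def)

lemma tuples_0 [simp]: "tuples A 0 = {[]}"
  by (auto simp: tuples_def)

lemma finite_tuples: "finite A \<Longrightarrow> finite (tuples A r)"
  using finite_lists_length_eq[of A r] by (simp add: tuples_def conj_commute)

lemma card_tuples: "finite A \<Longrightarrow> card (tuples A r) = card A ^ r"
  using card_lists_length_eq[of A r] by (simp add: tuples_def conj_commute)

lemma tuples_length: "xs \<in> tuples A r \<Longrightarrow> length xs = r"
  by (simp add: tuples_def)

lemma tuples_append: "xs \<in> tuples A r \<Longrightarrow> ys \<in> tuples A s \<Longrightarrow> xs @ ys \<in> tuples A (r + s)"
  by (auto simp: tuples_def)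

lemma tuples_mono: "A \<subseteq> B \<Longrightarrow> xs \<in> tuples A r \<Longrightarrow> xs \<in> tuples B r"
  by (auto simp: tuples_def)

lemma tuples_map: "(\<And>a. a \<in> A \<Longrightarrow> f a \<in> B) \<Longrightarrow> xs \<in> tuples A r \<Longrightarrow> map f xs \<in> tuples B r"
  by (auto simp: tuples_def)

lemma tuples_Cons_iff: "x # xs \<in> tuples A (Suc r) \<longleftrightarrow> x \<in> A \<and> xs \<in> tuples A r"
  by (auto simp: tuples_def)

lemma tuples_addE:
  assumes "xs \<in> tuples A (r + s)"
  obtains us vs where "xs = us @ vs" "us \<in> tuples A r" "vs \<in> tuples A s"
proof
  show "xs = take r xs @ drop r xs" by simp
  show "take r xs \<in> tuples A r" "drop r xs \<in> tuples A s"
    using assms by (auto simp: tuples_def dest: in_set_takeD in_set_dropD)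
qed

lemma tuples_take_drop:
  assumes "xs \<in> tuples A (r + s)"
  shows "take r xs \<in> tuples A r" "drop r xs \<in> tuples A s"
  using assms by (auto simp: tuples_def dest: in_set_takeD in_set_dropD)

lemma sum_tuples_append:
  "(\<Sum>xs\<in>tuples A (r + s). f xs) = (\<Sum>us\<in>tuples A r. \<Sum>vs\<in>tuples A s. f (us @ vs))"
proof -
  have "bij_betw (\<lambda>(us, vs). us @ vs) (tuples A r \<times> tuples A s) (tuples A (r + s))"
    unfolding bij_betw_def
  proof
    show "inj_on (\<lambda>(us, vs). us @ vs) (tuples A r \<times> tuples A s)"
      by (auto simp: inj_on_def tuples_def)
    show "(\<lambda>(us, vs). us @ vs) ` (tuples A r \<times> tuples A s) = tuples A (r + s)"
      by (auto intro: tuples_append elim!: tuples_addE)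
  qed
  from sum.reindex_bij_betw[OF this, of f] show ?thesis
    by (simp add: sum.cartesian_product case_prod_unfold)
qed

lemma tuples_1: "tuples A (Suc 0) = (\<lambda>a. [a]) ` A"
  by (auto simp: tuples_def length_Suc_conv)

lemma sum_tuples_Suc:
  "(\<Sum>xs\<in>tuples A (Suc r). f xs) = (\<Sum>a\<in>A. \<Sum>xs\<in>tuples A r. f (a # xs))"
  using sum_tuples_append[of f A "Suc 0" r] by (simp add: tuples_1 sum.reindex inj_on_def)

text \<open>Both cardinalities equal the double sum of the squared moduli of the inner products
  between the two bases, evaluated by Parseval in either of them.\<close>

lemma onb_card:
  assumes "onb F I x b" "onb F J x c" "finite I" "finite J"
  shows "card I = card J"
proof -
  have "(\<Sum>i\<in>I. bherm F (b i) (b i)) = (\<Sum>i\<in>I. \<Sum>j\<in>J. cnj (bherm F (c j) (b i)) * bherm F (c j) (b i))"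
    by (intro sum.cong refl onbD(3)[OF assms(2)] onbD(1)[OF assms(1)])
  also have "\<dots> = (\<Sum>j\<in>J. \<Sum>i\<in>I. cnj (bherm F (b i) (c j)) * bherm F (b i) (c j))"
  proof (subst sum.swap, intro sum.cong refl)
    fix i j assume i: "i \<in> I" and j: "j \<in> J"
    have "bherm F (c j) (b i) = cnj (bherm F (b i) (c j))"
      using onbD(3)[OF assms(1) onbD(1)[OF assms(1) i] onbD(1)[OF assms(2) j]]
        onbD(3)[OF assms(1) onbD(1)[OF assms(2) j] onbD(1)[OF assms(1) i]]
      by (simp add: mult.commute)
    then show "cnj (bherm F (c j) (b i)) * bherm F (c j) (b i) = cnj (bherm F (b i) (c j)) * bherm F (b i) (c j)"
      by (simp add: mult.commute)
  qed
  also have "\<dots> = (\<Sum>j\<in>J. bherm F (c j) (c j))"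
    by (intro sum.cong refl onbD(3)[OF assms(1), symmetric] onbD(1)[OF assms(2)])
  finally have "(\<Sum>i\<in>I. 1) = (\<Sum>j\<in>J. 1 :: complex)"
    by (simp add: onbD(2)[OF assms(1)] onbD(2)[OF assms(2)])
  then show ?thesis by simp
qed

section \<open>Bases of the fibres, simple tensors and tensor fibres\<close>

locale herm_bundle =
  fixes E :: "('x, 'e) hbundle"
  assumes hermitian: "hermitian_bundle E"
begin

abbreviation "X \<equiv> topspace (bbase E)"
abbreviation "d \<equiv> brank E"
abbreviation "st \<equiv> simple_tensor E"
abbreviation "TF \<equiv> tensor_fibre E"

definition fl :: "nat \<Rightarrow> 'x \<Rightarrow> 'e list set" where "fl r x = tuples (fibre E x) r"

lemma ex_triv_frame:
  "x \<in> X \<Longrightarrow> \<exists>U \<phi>. x \<in> U \<and> local_triv E U \<phi> \<and> frame E {..<d} U (\<lambda>i y. \<phi> (y, unit_vec d i))"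
  by (rule orthonormal_local_triv[OF hermitian])

lemma triv_add_scale:
  assumes v: "v \<in> fibre E x"
  shows "bscale E a v \<in> fibre E x" "w \<in> fibre E x \<Longrightarrow> badd E v w \<in> fibre E x"
proof -
  obtain U \<phi> where x: "x \<in> U" and triv: "local_triv E U \<phi>"
    using hermitian fibre_base[OF hermitian v] unfolding hermitian_bundle_def by blast
  have UX: "U \<subseteq> X" using triv openin_subset unfolding local_triv_def by blast
  have surj: "\<phi> ` (topspace (prod_topology (subtopology (bbase E) U) (cspace {..<d}))) =
      topspace (subtopology (btotal E) {v \<in> topspace (btotal E). bproj E v \<in> U})"
    using triv homeomorphic_imp_surjective_map unfolding local_triv_def by blast
  have top: "topspace (prod_topology (subtopology (bbase E) U) (cspace {..<d})) = U \<times> extensional {..<d}"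
    using UX by (auto simp: topspace_cspace)
  have tr: "bproj E (\<phi> (y, c)) = y"
    "\<phi> (y, \<lambda>i\<in>{..<d}. a * c i) = bscale E a (\<phi> (y, c))"
    "c' \<in> extensional {..<d} \<Longrightarrow> \<phi> (y, \<lambda>i\<in>{..<d}. c i + c' i) = badd E (\<phi> (y, c)) (\<phi> (y, c'))"
    if "y \<in> U" "c \<in> extensional {..<d}" for y c c' a
    using triv that unfolding local_triv_def topspace_cspace by blast+
  have \<phi>: "\<phi> (x, c) \<in> fibre E x" if "c \<in> extensional {..<d}" for c
    using surj tr(1)[OF x that] x that unfolding top fibre_def by auto
  have ex: "\<exists>c\<in>extensional {..<d}. v = \<phi> (x, c)" if v: "v \<in> fibre E x" for v
  proof -
    have "v \<in> \<phi> ` (U \<times> extensional {..<d})" using surj v x unfolding top fibre_def by auto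
    then obtain y c where c: "y \<in> U" "c \<in> extensional {..<d}" "v = \<phi> (y, c)" by auto
    with tr(1)[OF c(1,2)] v show ?thesis by (auto simp: fibre_def)
  qed
  obtain c where c: "c \<in> extensional {..<d}" "v = \<phi> (x, c)" using ex[OF v] by blast
  show "bscale E a v \<in> fibre E x"
    unfolding c(2) tr(2)[OF x c(1), symmetric] by (rule \<phi>) simp
  assume "w \<in> fibre E x"
  then obtain c' where c': "c' \<in> extensional {..<d}" "w = \<phi> (x, c')" using ex by blast
  show "badd E v w \<in> fibre E x"
    unfolding c(2) c'(2) tr(3)[OF x c(1) c'(1), symmetric] by (rule \<phi>) simp
qed

lemma framed_E: "framed E {..<d}"
proof
  show "continuous_map (btotal E) (bbase E) (bproj E)"
    using hermitian by (simp add: hermitian_bundle_def)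
  show "bherm E v (badd E w w') = bherm E v w + bherm E v w'"
    if "v \<in> fibre E x" "w \<in> fibre E x" "w' \<in> fibre E x" for v w w' x
    using hermitian_bundleD(5)[OF hermitian fibre_base[OF hermitian] that(1,2,3)] that by blast
  show "bherm E v (bscale E a w) = a * bherm E v w"
    if "v \<in> fibre E x" "w \<in> fibre E x" for v w x a
    using hermitian_bundleD(4)[OF hermitian fibre_base[OF hermitian] that(1,2)] that by blast
  show "\<exists>U b. x \<in> U \<and> frame E {..<d} U b" if "x \<in> X" for x
    using ex_triv_frame[OF that] by blast
qed (auto intro: triv_add_scale)

sublocale E: framed E "{..<d}"
  by (rule framed_E)

sublocale EE: framed_pair E "{..<d}" E "{..<d}"
  by unfold_locales (rule refl)

text \<open>Riesz provides the vector that pairs as the basis expansion of \<open>w\<close>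
  prescribes. Its difference from \<open>w\<close> is orthogonal to the basis, so it has norm zero
  and, by Cauchy-Schwarz, pairs to zero with every vector; this is Parseval.\<close>

lemma orthonormal_basis_onb:
  assumes x: "x \<in> X" and B: "orthonormal_basis E x B"
  shows "onb E B x (\<lambda>b. b)"
proof -
  have fin: "finite B" and Bf: "\<And>b. b \<in> B \<Longrightarrow> b \<in> fibre E x"
    and orth: "\<And>b b'. b \<in> B \<Longrightarrow> b' \<in> B \<Longrightarrow> bherm E b b' = (if b = b' then 1 else 0)"
    and compl: "\<And>v. v \<in> fibre E x \<Longrightarrow> (\<And>b. b \<in> B \<Longrightarrow> bherm E b v = 0) \<Longrightarrow> bherm E v v = 0"
    using B unfolding orthonormal_basis_def by blast+
  have riesz: "\<exists>v\<in>fibre E x. \<forall>u\<in>fibre E x. bherm E v u = (\<Sum>b\<in>B. c b * bherm E b u)" for c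
    by (rule E.riesz[OF x])
      (simp_all add: E.herm_add[OF Bf] E.herm_scale[OF Bf] sum.distrib sum_distrib_left algebra_simps)
  have sum1: "(\<Sum>b\<in>B. c b * bherm E b b') = c b'" if "b' \<in> B" for c b'
  proof -
    have "(\<Sum>b\<in>B. c b * bherm E b b') = (\<Sum>b\<in>B. if b = b' then c b' else 0)"
      by (intro sum.cong refl) (simp add: orth that)
    then show ?thesis using that fin by simp
  qed
  have pars: "bherm E w u = (\<Sum>b\<in>B. bherm E w b * bherm E b u)"
    if w: "w \<in> fibre E x" and u: "u \<in> fibre E x" for w u
  proof -
    obtain w' where w': "w' \<in> fibre E x" "\<forall>u\<in>fibre E x. bherm E w' u = (\<Sum>b\<in>B. bherm E w b * bherm E b u)"
      using riesz by blast
    define z where "z = badd E w (bscale E (-1) w')"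
    have s: "bscale E (-1) w' \<in> fibre E x" by (rule E.scale_fibre[OF w'(1)])
    have z: "z \<in> fibre E x" unfolding z_def by (rule E.add_fibre[OF w s])
    have zu: "bherm E z u = bherm E w u - bherm E w' u" if "u \<in> fibre E x" for u
      unfolding z_def E.herm_add_left[OF w s that] E.herm_scale_left[OF w'(1) that] by simp
    have "bherm E b z = 0" if b: "b \<in> B" for b
      using E.herm_cnj[OF z Bf[OF b]] zu[OF Bf[OF b]] w'(2) Bf[OF b] sum1[OF b] by simp
    then have "bherm E z z = 0" by (rule compl[OF z])
    then have "bnorm E z = 0" by (simp add: bnorm_def)
    then have "bherm E z u = 0" using E.cauchy_schwarz[OF z u] by simp
    then show ?thesis using zu[OF u] w'(2) u by simp
  qed
  show ?thesis
    unfolding onb_def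
  proof (intro conjI ballI allI impI)
    fix v w assume v: "v \<in> fibre E x" and w: "w \<in> fibre E x"
    show "bherm E v w = (\<Sum>b\<in>B. cnj (bherm E b v) * bherm E b w)"
      unfolding pars[OF v w] by (intro sum.cong refl) (simp add: E.herm_cnj[OF Bf v])
    assume eq: "\<forall>b\<in>B. bherm E b v = bherm E b w"
    show "v = w"
      by (rule E.herm_eqI[OF v w]) (simp add: pars v w eq)
  next
    fix c :: "'e \<Rightarrow> complex"
    obtain v where v: "v \<in> fibre E x" "\<forall>u\<in>fibre E x. bherm E v u = (\<Sum>b\<in>B. cnj (c b) * bherm E b u)"
      using riesz[of "\<lambda>b. cnj (c b)"] by blast
    have "bherm E b v = c b" if b: "b \<in> B" for b
      using E.herm_cnj[OF v(1) Bf[OF b]] v(2) Bf[OF b] sum1[OF b] by simp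
    then show "\<exists>v\<in>fibre E x. \<forall>b\<in>B. bherm E b v = c b" using v(1) by blast
  qed (simp_all add: Bf orth)
qed

text \<open>The very choice made inside \<open>tensor_herm\<close>, so that the inner product of
  tensors unfolds to a sum over \<open>L r x\<close>. It is made separately at each point, with no
  continuity in \<open>x\<close>.\<close>

definition B :: "'x \<Rightarrow> 'e set" where "B x = (SOME B. orthonormal_basis E x B)"

abbreviation L :: "nat \<Rightarrow> 'x \<Rightarrow> 'e list set" where "L r x \<equiv> tuples (B x) r"

lemma orthonormal_basis_B:
  assumes x: "x \<in> X"
  shows "orthonormal_basis E x (B x)"
proof -
  obtain b where b: "onb E {..<d} x b" using E.ex_onb[OF x] by blast
  have "orthonormal_basis E x (b ` {..<d})"
    unfolding orthonormal_basis_def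
  proof (intro conjI ballI impI)
    fix u v assume u: "u \<in> b ` {..<d}" and v: "v \<in> b ` {..<d}"
    then obtain i j where ij: "i < d" "j < d" "u = b i" "v = b j" by auto
    then show "bherm E u v = (if u = v then 1 else 0)"
      using onbD(2)[OF b, of i j] onbD(2)[OF b, of i i] by auto
  next
    fix v assume v: "v \<in> fibre E x" "\<forall>c\<in>b ` {..<d}. bherm E c v = 0"
    then show "bherm E v v = 0" using onbD(3)[OF b v(1) v(1)] by simp
  qed (use onbD(1)[OF b] in auto)
  then show ?thesis unfolding B_def by (rule someI)
qed

lemma onb_B: "x \<in> X \<Longrightarrow> onb E (B x) x (\<lambda>b. b)"
  using orthonormal_basis_onb orthonormal_basis_B by blast

lemma finite_B: "x \<in> X \<Longrightarrow> finite (B x)"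
  using orthonormal_basis_B by (simp add: orthonormal_basis_def)

lemma B_fibre: "x \<in> X \<Longrightarrow> B x \<subseteq> fibre E x"
  using orthonormal_basis_B by (simp add: orthonormal_basis_def)

lemma card_B:
  assumes x: "x \<in> X"
  shows "card (B x) = d"
proof -
  obtain b where b: "onb E {..<d} x b" using E.ex_onb[OF x] by blast
  show ?thesis using onb_card[OF onb_B[OF x] b finite_B[OF x]] by simp
qed

lemma L_fl: "x \<in> X \<Longrightarrow> vs \<in> L r x \<Longrightarrow> vs \<in> fl r x"
  unfolding fl_def by (rule tuples_mono[OF B_fibre])

lemma finite_L: "x \<in> X \<Longrightarrow> finite (L r x)"
  by (rule finite_tuples[OF finite_B])

lemma fl_length: "ws \<in> fl r x \<Longrightarrow> length ws = r"
  by (simp add: fl_def tuples_def)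

lemma st_Cons: "ws \<in> fl r x \<Longrightarrow> vs \<in> fl r x \<Longrightarrow> w \<in> fibre E x \<Longrightarrow>
    st x (v # vs) (w # ws) = bherm E w v * st x vs ws"
  by (simp add: simple_tensor_def fl_def tuples_def prod.lessThan_Suc_shift del: prod.lessThan_Suc)

lemma st_Nil: "st x [] [] = 1"
  by (simp add: simple_tensor_def)

lemma st_outside: "ws \<notin> fl (length vs) x \<Longrightarrow> st x vs ws = 0"
  by (auto simp: simple_tensor_def fl_def tuples_def)

lemma st_append:
  assumes "ws \<in> fl r x" "vs \<in> fl r x" "ws' \<in> fl s x" "vs' \<in> fl s x"
  shows "st x (vs @ vs') (ws @ ws') = st x vs ws * st x vs' ws'"
proof -
  have "length ws = length vs" using assms(1,2) by (simp add: fl_length)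
  then show ?thesis using assms
  proof (induction ws vs arbitrary: r rule: list_induct2)
    case Nil
    then show ?case by (simp add: st_Nil)
  next
    case (Cons w ws v vs)
    have m: "ws \<in> fl (length vs) x" "vs \<in> fl (length vs) x" "w \<in> fibre E x" "ws @ ws' \<in> fl (length vs + s) x"
      "vs @ vs' \<in> fl (length vs + s) x"
      using Cons by (auto simp: fl_def tuples_def)
    show ?case using Cons.IH[OF m(1,2) Cons.prems(3,4)] by (simp add: st_Cons[OF m(4,5,3)] st_Cons[OF m(1,2,3)])
  qed
qed

lemma st_cnj: "ws \<in> fl r x \<Longrightarrow> vs \<in> fl r x \<Longrightarrow> cnj (st x vs ws) = st x ws vs"
proof -
  assume a: "ws \<in> fl r x" "vs \<in> fl r x"
  have "cnj (bherm E (ws ! i) (vs ! i)) = bherm E (vs ! i) (ws ! i)" if "i < r" for i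
  proof -
    have "ws ! i \<in> fibre E x" "vs ! i \<in> fibre E x"
      using a that nth_mem[of i ws] nth_mem[of i vs] unfolding fl_def tuples_def by auto
    then show ?thesis by (rule E.herm_cnj[symmetric])
  qed
  then show ?thesis using a by (simp add: simple_tensor_def fl_def tuples_def)
qed

text \<open>Parseval in each slot, multiplied along the list.\<close>

lemma st_expand:
  assumes b: "onb E I x b" and I: "finite I"
  shows "ws \<in> fl r x \<Longrightarrow> vs \<in> fl r x \<Longrightarrow>
    st x vs ws = (\<Sum>J\<in>tuples I r. st x vs (map b J) * st x (map b J) ws)"
proof (induction r arbitrary: ws vs)
  case 0
  then show ?case by (simp add: fl_def st_Nil)
next
  case (Suc r)
  obtain w ws' v vs' where eq: "ws = w # ws'" "vs = v # vs'"
    using Suc.prems by (metis fl_length length_Suc_conv)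
  have m: "ws' \<in> fl r x" "vs' \<in> fl r x" "w \<in> fibre E x" "v \<in> fibre E x"
    using Suc.prems by (auto simp: eq fl_def tuples_Cons_iff)
  have bm: "map b J \<in> fl r x" if "J \<in> tuples I r" for J
    unfolding fl_def by (rule tuples_map[OF onbD(1)[OF b] that])
  have "st x vs ws = bherm E w v * st x vs' ws'" by (simp add: eq st_Cons[OF m(1,2,3)])
  also have "\<dots> = (\<Sum>i\<in>I. cnj (bherm E (b i) w) * bherm E (b i) v) *
      (\<Sum>J\<in>tuples I r. st x vs' (map b J) * st x (map b J) ws')"
    using onbD(3)[OF b m(3,4)] Suc.IH[OF m(1,2)] by simp
  also have "\<dots> = (\<Sum>i\<in>I. \<Sum>J\<in>tuples I r. st x vs (map b (i # J)) * st x (map b (i # J)) ws)"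
    unfolding sum_product
  proof (intro sum.cong refl)
    fix i J assume i: "i \<in> I" and J: "J \<in> tuples I r"
    have "cnj (bherm E (b i) w) = bherm E w (b i)"
      by (rule E.herm_cnj[OF onbD(1)[OF b i] m(3), symmetric])
    then show "cnj (bherm E (b i) w) * bherm E (b i) v * (st x vs' (map b J) * st x (map b J) ws') =
        st x vs (map b (i # J)) * st x (map b (i # J)) ws"
      by (simp add: eq st_Cons[OF bm[OF J] m(2) onbD(1)[OF b i]] st_Cons[OF m(1) bm[OF J] m(3)])
  qed
  finally show ?case by (simp add: sum_tuples_Suc)
qed

lemma st_onb:
  assumes b: "onb E I x b"
  shows "J \<in> tuples I r \<Longrightarrow> K \<in> tuples I r \<Longrightarrow> st x (map b K) (map b J) = (if J = K then 1 else 0)"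
proof (induction r arbitrary: J K)
  case 0
  then show ?case by (simp add: st_Nil)
next
  case (Suc r)
  obtain j J' k K' where eq: "J = j # J'" "K = k # K'"
    using Suc.prems by (metis tuples_length length_Suc_conv)
  have m: "J' \<in> tuples I r" "K' \<in> tuples I r" "j \<in> I" "k \<in> I"
    using Suc.prems by (auto simp: eq tuples_Cons_iff)
  have bm: "map b J \<in> fl r x" if "J \<in> tuples I r" for J
    unfolding fl_def by (rule tuples_map[OF onbD(1)[OF b] that])
  show ?case
    using Suc.IH[OF m(1,2)] onbD(2)[OF b m(3,4)]
    by (simp add: eq st_Cons[OF bm[OF m(1)] bm[OF m(2)] onbD(1)[OF b m(3)]])
qed

text \<open>A tensor is a form, and its coefficients in the product basis are its own values at
  lists of basis vectors.\<close>

lemma TF_expand: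
  assumes T: "T \<in> TF r x" and b: "onb E I x b" and I: "finite I"
  shows "T ws = (\<Sum>J\<in>tuples I r. T (map b J) * st x (map b J) ws)"
proof -
  obtain n :: nat and c vs where T: "T = (\<lambda>ws. \<Sum>i<n. c i * st x (vs i) ws)"
    and vs: "\<forall>i<n. length (vs i) = r \<and> set (vs i) \<subseteq> fibre E x"
    using T unfolding tensor_fibre_def by blast
  have vs': "vs i \<in> fl r x" if "i < n" for i using vs that by (simp add: fl_def tuples_def)
  have bm: "map b J \<in> fl r x" if "J \<in> tuples I r" for J
    unfolding fl_def by (rule tuples_map[OF onbD(1)[OF b] that])
  show ?thesis
  proof (cases "ws \<in> fl r x")
    case True
    have "T ws = (\<Sum>i<n. c i * (\<Sum>J\<in>tuples I r. st x (vs i) (map b J) * st x (map b J) ws))"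
      unfolding T by (intro sum.cong refl) (simp add: st_expand[OF b I True vs'])
    also have "\<dots> = (\<Sum>J\<in>tuples I r. T (map b J) * st x (map b J) ws)"
      unfolding T by (simp add: sum_distrib_left sum_distrib_right mult.assoc) (rule sum.swap)
    finally show ?thesis .
  next
    case False
    have "st x us ws = 0" if "us \<in> fl r x" for us
      by (rule st_outside) (use False fl_length[OF that] in simp)
    then show ?thesis using vs' bm by (simp add: T)
  qed
qed

lemma TF_I:
  assumes "onb E I x b" "finite I"
  shows "(\<lambda>ws. \<Sum>J\<in>tuples I r. c J * st x (map b J) ws) \<in> TF r x"
proof -
  obtain g where g: "bij_betw g {0..<card (tuples I r)} (tuples I r)"
    using ex_bij_betw_nat_finite[OF finite_tuples[OF assms(2)]] by blast
  have g': "bij_betw g {..<card (tuples I r)} (tuples I r)"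
    using g by (simp add: lessThan_atLeast0)
  have "(\<Sum>J\<in>tuples I r. c J * st x (map b J) ws) =
      (\<Sum>i<card (tuples I r). c (g i) * st x (map b (g i)) ws)" for ws
    by (rule sum.reindex_bij_betw[OF g', symmetric])
  moreover have "length (map b (g i)) = r \<and> set (map b (g i)) \<subseteq> fibre E x" if "i < card (tuples I r)" for i
  proof -
    have "g i \<in> tuples I r" using g' that by (auto simp: bij_betw_def)
    then show ?thesis using onbD(1)[OF assms(1)] by (auto simp: tuples_def)
  qed
  ultimately show ?thesis unfolding tensor_fibre_def by fastforce
qed

lemma TF_L: "x \<in> X \<Longrightarrow> T \<in> TF r x \<Longrightarrow> T ws = (\<Sum>bs\<in>L r x. T bs * st x bs ws)"
  using TF_expand[OF _ onb_B finite_B, of T r] by simp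

text \<open>Membership as a reproducing formula linear in \<open>T\<close>. It replaces spans with a
  varying number of summands and makes closure under linear operations a computation.\<close>

lemma TF_iff:
  assumes "x \<in> X"
  shows "T \<in> TF r x \<longleftrightarrow> (\<forall>ws. T ws = (\<Sum>bs\<in>L r x. T bs * st x bs ws))"
proof
  assume "T \<in> TF r x"
  then show "\<forall>ws. T ws = (\<Sum>bs\<in>L r x. T bs * st x bs ws)" using TF_L[OF assms] by blast
next
  assume *: "\<forall>ws. T ws = (\<Sum>bs\<in>L r x. T bs * st x bs ws)"
  have "(\<lambda>ws. \<Sum>bs\<in>L r x. T bs * st x bs ws) \<in> TF r x"
    using TF_I[OF onb_B[OF assms] finite_B[OF assms], where r = r and c = T] by simp
  moreover have "(\<lambda>ws. \<Sum>bs\<in>L r x. T bs * st x bs ws) = T"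
    by (rule ext) (rule *[rule_format, symmetric])
  ultimately show "T \<in> TF r x" by simp
qed

lemma TF_outside:
  assumes "x \<in> X" "T \<in> TF r x" "ws \<notin> fl r x"
  shows "T ws = 0"
proof -
  have "st x bs ws = 0" if "bs \<in> L r x" for bs
    by (rule st_outside) (use assms(3) that in \<open>simp add: tuples_length\<close>)
  then show ?thesis using TF_L[OF assms(1,2), of ws] by simp
qed

lemma st_TF: "vs \<in> fl r x \<Longrightarrow> st x vs \<in> TF r x"
  unfolding tensor_fibre_def fl_def tuples_def
  by (intro CollectI exI[of _ "1::nat"] exI[of _ "\<lambda>_. 1"] exI[of _ "\<lambda>_. vs"]) auto

lemma TF_add:
  assumes x: "x \<in> X" and S: "S \<in> TF r x" and T: "T \<in> TF r x"
  shows "(\<lambda>ws. S ws + T ws) \<in> TF r x"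
  unfolding TF_iff[OF x]
proof
  fix ws show "S ws + T ws = (\<Sum>bs\<in>L r x. (S bs + T bs) * st x bs ws)"
    unfolding TF_L[OF x S, of ws] TF_L[OF x T, of ws] by (simp add: distrib_right sum.distrib)
qed

lemma TF_scale:
  assumes x: "x \<in> X" and T: "T \<in> TF r x"
  shows "(\<lambda>ws. a * T ws) \<in> TF r x"
  unfolding TF_iff[OF x]
proof
  fix ws show "a * T ws = (\<Sum>bs\<in>L r x. (a * T bs) * st x bs ws)"
    unfolding TF_L[OF x T, of ws] by (simp add: sum_distrib_left mult.assoc)
qed

lemma TF_zero: "x \<in> X \<Longrightarrow> (\<lambda>ws. 0) \<in> TF r x"
  by (simp add: TF_iff)

lemma TF_sum:
  assumes x: "x \<in> X" and T: "\<And>a. a \<in> A \<Longrightarrow> T a \<in> TF r x"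
  shows "(\<lambda>ws. \<Sum>a\<in>A. T a ws) \<in> TF r x"
proof (cases "finite A")
  case True
  then show ?thesis using T
    by (induction A rule: finite_induct) (simp_all add: TF_zero[OF x] TF_add[OF x])
qed (simp add: TF_zero[OF x])

lemma TF_eqI:
  assumes "x \<in> X" "S \<in> TF r x" "T \<in> TF r x" "\<And>ws. ws \<in> L r x \<Longrightarrow> S ws = T ws"
  shows "S = T"
proof
  fix ws show "S ws = T ws"
    unfolding TF_L[OF assms(1,2), of ws] TF_L[OF assms(1,3), of ws] by (intro sum.cong refl) (simp add: assms(4))
qed

lemma tensor_herm_L: "tensor_herm E r x S T = (\<Sum>bs\<in>L r x. cnj (S bs) * T bs)"
  by (simp add: tensor_herm_def Let_def B_def tuples_def)

text \<open>The reproducing property: pairing with a simple tensor is evaluation, so matrix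
  coefficients are plain function values.\<close>

lemma tensor_herm_st:
  assumes x: "x \<in> X" and T: "T \<in> TF r x" and vs: "vs \<in> fl r x"
  shows "tensor_herm E r x (st x vs) T = T vs"
  unfolding tensor_herm_L TF_L[OF x T, of vs]
  by (intro sum.cong refl) (simp add: st_cnj[OF L_fl[OF x] vs])

text \<open>Independence of the basis chosen in the definition, which is what allows the inner
  product to be computed in a continuous frame.\<close>

lemma tensor_herm_onb:
  assumes x: "x \<in> X" and S: "S \<in> TF r x" and T: "T \<in> TF r x" and b: "onb E I x b" and I: "finite I"
  shows "tensor_herm E r x S T = (\<Sum>J\<in>tuples I r. cnj (S (map b J)) * T (map b J))"
proof -
  have bm: "map b J \<in> fl r x" if "J \<in> tuples I r" for J
    unfolding fl_def by (rule tuples_map[OF onbD(1)[OF b] that])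
  have "tensor_herm E r x S T = (\<Sum>bs\<in>L r x. \<Sum>J\<in>tuples I r. cnj (S (map b J)) * (cnj (st x (map b J) bs) * T bs))"
    unfolding tensor_herm_L
    by (intro sum.cong refl, subst TF_expand[OF S b I]) (simp add: sum_distrib_right mult.assoc)
  also have "\<dots> = (\<Sum>J\<in>tuples I r. cnj (S (map b J)) * tensor_herm E r x (st x (map b J)) T)"
    unfolding tensor_herm_L by (subst sum.swap) (simp add: sum_distrib_left)
  also have "\<dots> = (\<Sum>J\<in>tuples I r. cnj (S (map b J)) * T (map b J))"
    by (intro sum.cong refl) (simp add: tensor_herm_st[OF x T bm])
  finally show ?thesis .
qed

section \<open>Topology and frames of the tensor powers\<close>

lemma istopology_tensor: "istopology (\<lambda>W.
     W \<subseteq> (SIGMA x:topspace (bbase E). tensor_fibre E r x) \<and>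
     (\<forall>U \<phi>. local_triv E U \<phi> \<longrightarrow>
        openin (prod_topology (subtopology (bbase E) U) (cspace (multi_index (brank E) r)))
          {p \<in> U \<times> topspace (cspace (multi_index (brank E) r)). tensor_chart E r \<phi> p \<in> W}))"
  (is "istopology (\<lambda>W. W \<subseteq> ?S \<and> (\<forall>U \<phi>. local_triv E U \<phi> \<longrightarrow> openin (?P U) {p \<in> ?D U. ?c \<phi> p \<in> W}))")
  unfolding istopology_def
proof (intro conjI allI impI)
  fix W W' assume W: "W \<subseteq> ?S \<and> (\<forall>U \<phi>. local_triv E U \<phi> \<longrightarrow> openin (?P U) {p \<in> ?D U. ?c \<phi> p \<in> W})"
    and W': "W' \<subseteq> ?S \<and> (\<forall>U \<phi>. local_triv E U \<phi> \<longrightarrow> openin (?P U) {p \<in> ?D U. ?c \<phi> p \<in> W'})"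
  show "W \<inter> W' \<subseteq> ?S" using W by blast
  fix U \<phi> assume t: "local_triv E U \<phi>"
  have "openin (?P U) ({p \<in> ?D U. ?c \<phi> p \<in> W} \<inter> {p \<in> ?D U. ?c \<phi> p \<in> W'})"
    using W W' t by (intro openin_Int) blast+
  moreover have "{p \<in> ?D U. ?c \<phi> p \<in> W} \<inter> {p \<in> ?D U. ?c \<phi> p \<in> W'} = {p \<in> ?D U. ?c \<phi> p \<in> W \<inter> W'}"
    by blast
  ultimately show "openin (?P U) {p \<in> ?D U. ?c \<phi> p \<in> W \<inter> W'}" by simp
next
  fix \<W> assume W: "\<forall>W\<in>\<W>. W \<subseteq> ?S \<and> (\<forall>U \<phi>. local_triv E U \<phi> \<longrightarrow> openin (?P U) {p \<in> ?D U. ?c \<phi> p \<in> W})"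
  show "\<Union>\<W> \<subseteq> ?S" using W by blast
  fix U \<phi> assume t: "local_triv E U \<phi>"
  have "openin (?P U) (\<Union>W\<in>\<W>. {p \<in> ?D U. ?c \<phi> p \<in> W})"
    using W t by (intro openin_Union) blast
  moreover have "(\<Union>W\<in>\<W>. {p \<in> ?D U. ?c \<phi> p \<in> W}) = {p \<in> ?D U. ?c \<phi> p \<in> \<Union>\<W>}" by blast
  ultimately show "openin (?P U) {p \<in> ?D U. ?c \<phi> p \<in> \<Union>\<W>}" by simp
qed

lemma openin_tensor_topology: "openin (tensor_topology E r) W \<longleftrightarrow>
     W \<subseteq> (SIGMA x:X. TF r x) \<and>
     (\<forall>U \<phi>. local_triv E U \<phi> \<longrightarrow>
        openin (prod_topology (subtopology (bbase E) U) (cspace (multi_index d r)))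
          {p \<in> U \<times> topspace (cspace (multi_index d r)). tensor_chart E r \<phi> p \<in> W})"
  unfolding tensor_topology_def topology_inverse'[OF istopology_tensor] ..

lemma local_triv_section:
  assumes "local_triv E U \<phi>" "y \<in> U"
  shows "\<phi> (y, unit_vec d i) \<in> fibre E y"
proof -
  have UX: "U \<subseteq> X" using assms openin_subset unfolding local_triv_def by blast
  have u: "unit_vec d i \<in> extensional {..<d}" by (simp add: unit_vec_def)
  have "continuous_map (prod_topology (subtopology (bbase E) U) (cspace {..<d}))
       (subtopology (btotal E) {v \<in> topspace (btotal E). bproj E v \<in> U}) \<phi>"
    using assms homeomorphic_imp_continuous_map unfolding local_triv_def by blast
  then have "\<phi> \<in> topspace (prod_topology (subtopology (bbase E) U) (cspace {..<d})) \<rightarrow>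
       topspace (subtopology (btotal E) {v \<in> topspace (btotal E). bproj E v \<in> U})"
    unfolding continuous_map_def by (rule conjunct1)
  moreover have "(y, unit_vec d i) \<in> topspace (prod_topology (subtopology (bbase E) U) (cspace {..<d}))"
    using assms(2) UX u by (auto simp: topspace_cspace)
  ultimately have "\<phi> (y, unit_vec d i) \<in> topspace (subtopology (btotal E) {v \<in> topspace (btotal E). bproj E v \<in> U})"
    by (rule funcset_mem)
  then have "\<phi> (y, unit_vec d i) \<in> topspace (btotal E)" by simp
  moreover have "bproj E (\<phi> (y, unit_vec d i)) = y"
    using assms u unfolding local_triv_def topspace_cspace by blast
  ultimately show ?thesis by (simp add: fibre_def)
qed

lemma local_triv_section_cont:
  assumes "local_triv E U \<phi>"
  shows "continuous_map (subtopology (bbase E) U) (btotal E) (\<lambda>y. \<phi> (y, unit_vec d i))"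
proof -
  have "continuous_map (prod_topology (subtopology (bbase E) U) (cspace {..<d}))
       (subtopology (btotal E) {v \<in> topspace (btotal E). bproj E v \<in> U}) \<phi>"
    using assms homeomorphic_imp_continuous_map unfolding local_triv_def by blast
  then have 1: "continuous_map (prod_topology (subtopology (bbase E) U) (cspace {..<d})) (btotal E) \<phi>"
    by (rule continuous_map_into_fulltopology)
  have 2: "continuous_map (subtopology (bbase E) U)
      (prod_topology (subtopology (bbase E) U) (cspace {..<d})) (\<lambda>y. (y, unit_vec d i))"
    by (intro continuous_map_pairedI) (simp_all add: topspace_cspace unit_vec_def)
  show ?thesis
    using continuous_map_compose[OF 2 1] by (simp add: o_def)
qed

lemma tensor_chart_TF:
  assumes "local_triv E U \<phi>" "y \<in> U" "y \<in> X"
  shows "tensor_chart E r \<phi> (y, c) \<in> {y} \<times> TF r y"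
proof -
  have "map (\<lambda>i. \<phi> (y, unit_vec d i)) I \<in> fl r y" if "I \<in> multi_index d r" for I
    using local_triv_section[OF assms(1,2)] that by (auto simp: fl_def tuples_def multi_index_def)
  then show ?thesis
    unfolding tensor_chart_def
    by (auto intro!: TF_sum[OF assms(3)] TF_scale[OF assms(3)] st_TF)
qed

lemma tensor_chart_TF':
  assumes "local_triv E U \<phi>" "p \<in> U \<times> A"
  shows "tensor_chart E r \<phi> p \<in> (SIGMA x:X. TF r x)" "fst (tensor_chart E r \<phi> p) = fst p"
proof -
  have "U \<subseteq> X" using assms openin_subset unfolding local_triv_def by blast
  obtain y c where p: "p = (y, c)" "y \<in> U" using assms(2) by blast
  with \<open>U \<subseteq> X\<close> have y: "y \<in> X" by blast
  show "tensor_chart E r \<phi> p \<in> (SIGMA x:X. TF r x)" "fst (tensor_chart E r \<phi> p) = fst p"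
    using tensor_chart_TF[OF assms(1) p(2) y, of r c] y unfolding p(1) by auto
qed

lemma topspace_tensor: "topspace (tensor_topology E r) = (SIGMA x:X. TF r x)"
proof
  show "topspace (tensor_topology E r) \<subseteq> (SIGMA x:X. TF r x)"
    using openin_topspace[of "tensor_topology E r"] unfolding openin_tensor_topology by blast
  have "openin (tensor_topology E r) (SIGMA x:X. TF r x)"
    unfolding openin_tensor_topology
  proof (intro conjI allI impI order_refl)
    fix U \<phi> assume t: "local_triv E U \<phi>"
    have UX: "U \<subseteq> X" using t openin_subset unfolding local_triv_def by blast
    have "{p \<in> U \<times> topspace (cspace (multi_index d r)). tensor_chart E r \<phi> p \<in> (SIGMA x:X. TF r x)} =
        topspace (prod_topology (subtopology (bbase E) U) (cspace (multi_index d r)))"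
      using UX tensor_chart_TF'(1)[OF t] by auto
    then show "openin (prod_topology (subtopology (bbase E) U) (cspace (multi_index d r)))
       {p \<in> U \<times> topspace (cspace (multi_index d r)). tensor_chart E r \<phi> p \<in> (SIGMA x:X. TF r x)}"
      by (simp only: openin_topspace)
  qed
  then show "(SIGMA x:X. TF r x) \<subseteq> topspace (tensor_topology E r)" by (rule openin_subset)
qed

lemma tpow_simps [simp]:
  "bbase (tpow E r) = bbase E" "btotal (tpow E r) = tensor_topology E r" "bproj (tpow E r) = fst"
  "badd (tpow E r) (x, S) (y, T) = (x, \<lambda>ws. S ws + T ws)"
  "bscale (tpow E r) a (x, S) = (x, \<lambda>ws. a * S ws)"
  "bherm (tpow E r) (x, S) (y, T) = tensor_herm E r x S T"
  by (simp_all add: tpow_def)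

lemma fibre_tpow: "x \<in> X \<Longrightarrow> fibre (tpow E r) x = {x} \<times> TF r x"
  by (auto simp: fibre_def topspace_tensor)

lemma fibre_tpowE:
  assumes "v \<in> fibre (tpow E r) x"
  obtains T where "v = (x, T)" "T \<in> TF r x" "x \<in> X"
  using assms by (auto simp: fibre_def topspace_tensor)

text \<open>The coordinates of a tensor in the product frame are its values at lists of frame
  vectors. The chart is continuous by definition of the topology; the work lies in its inverse,
  because openness in the tensor topology is tested against every local trivialization, orthonormal
  or not.\<close>

lemma tpow_frame:
  assumes t: "local_triv E U \<phi>" and b: "frame E {..<d} U (\<lambda>i y. \<phi> (y, unit_vec d i))"
  shows "frame (tpow E r) (multi_index d r) U (\<lambda>I y. (y, st y (map (\<lambda>i. \<phi> (y, unit_vec d i)) I)))"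
proof -
  define f where "f = (\<lambda>i y. \<phi> (y, unit_vec d i))"
  define fm where "fm I y = map (\<lambda>i. f i y) I" for I y
  define M where "M = multi_index d r"
  have Mt: "M = tuples {..<d} r" by (simp add: M_def multi_index_tuples)
  have finM: "finite M" by (simp add: Mt finite_tuples)
  have opU: "openin (bbase E) U" using t by (simp add: local_triv_def)
  have UX: "U \<subseteq> X" by (rule openin_subset[OF opU])
  have b': "frame E {..<d} U f" using b by (simp add: f_def)
  have onb: "onb E {..<d} y (\<lambda>i. f i y)" if "y \<in> U" for y by (rule frame_onb[OF b' that])
  have ffl: "fm I y \<in> fl r y" if "y \<in> U" "I \<in> M" for I y
    unfolding fl_def fm_def by (rule tuples_map[OF onbD(1)[OF onb[OF that(1)]]]) (use that in \<open>auto simp: Mt\<close>)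
  let ?TU = "subtopology (tensor_topology E r) {v \<in> topspace (tensor_topology E r). fst v \<in> U}"
  let ?PU = "\<lambda>U. prod_topology (subtopology (bbase E) U) (cspace M)"
  have chart: "tensor_chart E r \<phi> = (\<lambda>(y, c). (y, \<lambda>ws. \<Sum>I\<in>M. c I * st y (fm I y) ws))"
    by (simp add: tensor_chart_def f_def fm_def M_def)
  have coord: "coord (tpow E r) M (\<lambda>I y. (y, st y (fm I y))) (y, T) = (y, \<lambda>I\<in>M. T (fm I y))"
    if "y \<in> U" "T \<in> TF r y" for y T
    using tensor_herm_st[OF subsetD[OF UX that(1)] that(2) ffl[OF that(1)]]
    by (auto simp: coord_def fun_eq_iff)
  have topPU: "topspace (?PU V) = V \<times> extensional M" if "V \<subseteq> X" for V
    using that by (auto simp: topspace_cspace)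
  have topTU: "topspace ?TU = (SIGMA y:U. TF r y)" using UX by (auto simp: topspace_tensor)
  have homs: "homeomorphic_maps (?PU U) ?TU (tensor_chart E r \<phi>) (coord (tpow E r) M (\<lambda>I y. (y, st y (fm I y))))"
    unfolding homeomorphic_maps_def
  proof (intro conjI ballI)
    show "continuous_map (?PU U) ?TU (tensor_chart E r \<phi>)"
    proof (rule continuous_map_into_subtopology)
      show "continuous_map (?PU U) (tensor_topology E r) (tensor_chart E r \<phi>)"
        unfolding continuous_map_def topPU[OF UX]
      proof (intro conjI allI impI)
        show "tensor_chart E r \<phi> \<in> U \<times> extensional M \<rightarrow> topspace (tensor_topology E r)"
          unfolding topspace_tensor using tensor_chart_TF'(1)[OF t] by (intro funcsetI)
        fix W assume "openin (tensor_topology E r) W"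
        then show "openin (?PU U) {p \<in> U \<times> extensional M. tensor_chart E r \<phi> p \<in> W}"
          using t unfolding openin_tensor_topology M_def topspace_cspace by blast
      qed
      show "tensor_chart E r \<phi> \<in> topspace (?PU U) \<rightarrow> {v \<in> topspace (tensor_topology E r). fst v \<in> U}"
      proof (rule funcsetI)
        fix p assume "p \<in> topspace (?PU U)"
        then have p: "p \<in> U \<times> extensional M" by (simp only: topPU[OF UX])
        show "tensor_chart E r \<phi> p \<in> {v \<in> topspace (tensor_topology E r). fst v \<in> U}"
          using tensor_chart_TF'[OF t p] p unfolding topspace_tensor by auto
      qed
    qed
    show "continuous_map ?TU (?PU U) (coord (tpow E r) M (\<lambda>I y. (y, st y (fm I y))))"
      unfolding continuous_map_def
    proof (intro conjI allI impI)
      show "coord (tpow E r) M (\<lambda>I y. (y, st y (fm I y))) \<in> topspace ?TU \<rightarrow> topspace (?PU U)"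
        unfolding topTU topPU[OF UX] using coord by auto
      fix V assume V: "openin (?PU U) V"
      define W where "W = {v \<in> topspace ?TU. coord (tpow E r) M (\<lambda>I y. (y, st y (fm I y))) v \<in> V}"
      have "openin (tensor_topology E r) W"
        unfolding openin_tensor_topology
      proof (intro conjI allI impI)
        show "W \<subseteq> (SIGMA x:X. TF r x)" unfolding W_def topTU using UX by auto
        fix U' \<phi>' assume t': "local_triv E U' \<phi>'"
        have opU': "openin (bbase E) U'" using t' by (simp add: local_triv_def)
        have UX': "U' \<subseteq> X" by (rule openin_subset[OF opU'])
        define f' where "f' = (\<lambda>i y. \<phi>' (y, unit_vec d i))"
        \<comment> \<open>The change of coordinates from the chart of \<open>\<phi>'\<close> to the
          orthonormal frame. Its matrix entries are products of inner products of frame vectors with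
          sections of \<open>\<phi>'\<close>, so no inverse matrix occurs.\<close>
        define g where "g = (\<lambda>(y, c). (y, \<lambda>I\<in>M. \<Sum>J\<in>M. c J * (\<Prod>i<r. bherm E (f (I ! i) y) (f' (J ! i) y))))"
        have opUU: "openin (bbase E) (U \<inter> U')" using opU opU' by (rule openin_Int)
        have UUX: "U \<inter> U' \<subseteq> X" using UX by blast
        have f'fib: "f' i y \<in> fibre E y" if "y \<in> U'" for i y
          unfolding f'_def by (rule local_triv_section[OF t' that])
        have hc: "continuous_map (subtopology (bbase E) (U \<inter> U')) euclidean (\<lambda>y. bherm E (f i y) (f' j y))"
          if i: "i < d" for i j
        proof -
          have "continuous_map (subtopology (bbase E) (U \<inter> U'))
              (subtopology (btotal E) {v \<in> topspace (btotal E). bproj E v \<in> U}) (f' j)"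
          proof (rule continuous_map_into_subtopology)
            show "continuous_map (subtopology (bbase E) (U \<inter> U')) (btotal E) (f' j)"
              unfolding f'_def by (rule continuous_map_from_subtopology_mono[OF local_triv_section_cont[OF t']]) simp
            show "f' j \<in> topspace (subtopology (bbase E) (U \<inter> U')) \<rightarrow> {v \<in> topspace (btotal E). bproj E v \<in> U}"
              using f'fib by (auto simp: fibre_def)
          qed
          from continuous_map_compose[OF this E.continuous_map_coordinate[OF b', of i]] i
          have "continuous_map (subtopology (bbase E) (U \<inter> U')) euclidean
              (\<lambda>y. bherm E (f i (bproj E (f' j y))) (f' j y))" by (simp add: o_def)
          then show ?thesis by (rule continuous_map_eq) (use f'fib in \<open>auto simp: fibre_def\<close>)
        qed
        have hc2: "continuous_map (?PU (U \<inter> U')) euclidean (\<lambda>z. bherm E (f i (fst z)) (f' j (fst z)))"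
          if i: "i < d" for i j
          using continuous_map_compose[OF continuous_map_fst hc[OF i]] by (simp add: o_def)
        have cc: "continuous_map (?PU (U \<inter> U')) euclidean (\<lambda>z. snd z J)" if "J \<in> M" for J
          using continuous_map_compose[OF continuous_map_snd continuous_map_cspace_component[OF that]]
          by (simp add: o_def)
        have "continuous_map (?PU (U \<inter> U')) (?PU U) g"
          unfolding g_def case_prod_unfold
        proof (intro continuous_map_pairedI continuous_map_into_cspace)
          show "continuous_map (?PU (U \<inter> U')) (subtopology (bbase E) U) fst"
            by (rule continuous_map_into_subtopology)
              (auto intro: continuous_map_into_fulltopology[OF continuous_map_fst])
          fix I assume I: "I \<in> M"
          have "continuous_map (?PU (U \<inter> U')) euclidean
              (\<lambda>z. \<Sum>J\<in>M. snd z J * (\<Prod>i<r. bherm E (f (I ! i) (fst z)) (f' (J ! i) (fst z))))"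
          proof (intro continuous_map_arith cc hc2)
            fix i assume "i \<in> {..<r}"
            then have "I ! i \<in> set I" using I by (intro nth_mem) (simp add: Mt tuples_def)
            then show "I ! i < d" using I unfolding Mt tuples_def by blast
          qed
          then show "continuous_map (?PU (U \<inter> U')) euclidean
              (\<lambda>z. (\<lambda>I\<in>M. \<Sum>J\<in>M. snd z J * (\<Prod>i<r. bherm E (f (I ! i) (fst z)) (f' (J ! i) (fst z)))) I)"
            using I by simp
        qed simp
        from openin_continuous_map_preimage[OF this V]
        have op: "openin (?PU (U \<inter> U')) {p \<in> (U \<inter> U') \<times> extensional M. g p \<in> V}"
          unfolding topPU[OF UUX] .
        have eq: "{p \<in> U' \<times> topspace (cspace (multi_index d r)). tensor_chart E r \<phi>' p \<in> W} =
            {p \<in> (U \<inter> U') \<times> extensional M. g p \<in> V}"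
        proof -
          have "tensor_chart E r \<phi>' (y, c) \<in> W \<longleftrightarrow> y \<in> U \<and> g (y, c) \<in> V" if y: "y \<in> U'" for y c
          proof (cases "y \<in> U")
            case True
            define T where "T = (\<lambda>ws. \<Sum>J\<in>M. c J * st y (map (\<lambda>i. f' i y) J) ws)"
            have ch: "tensor_chart E r \<phi>' (y, c) = (y, T)"
              by (simp add: tensor_chart_def T_def f'_def M_def)
            have T: "T \<in> TF r y" using tensor_chart_TF[OF t' y, of r c] UX' y by (auto simp: ch)
            have "T (fm I y) = (\<Sum>J\<in>M. c J * (\<Prod>i<r. bherm E (f (I ! i) y) (f' (J ! i) y)))" if I: "I \<in> M" for I
              unfolding T_def
            proof (intro sum.cong refl)
              fix J assume J: "J \<in> M"
              have "st y (map (\<lambda>i. f' i y) J) (fm I y) = (\<Prod>i<r. bherm E (f (I ! i) y) (f' (J ! i) y))"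
                using I J ffl[OF True I] by (simp add: simple_tensor_def fl_def tuples_def Mt fm_def)
              then show "c J * st y (map (\<lambda>i. f' i y) J) (fm I y) =
                  c J * (\<Prod>i<r. bherm E (f (I ! i) y) (f' (J ! i) y))" by simp
            qed
            then have "coord (tpow E r) M (\<lambda>I y. (y, st y (fm I y))) (y, T) = g (y, c)"
              unfolding coord[OF True T] g_def by (auto simp: fun_eq_iff)
            then show ?thesis unfolding ch W_def topTU using True T by simp
          next
            case False
            then show ?thesis unfolding W_def topTU by (auto simp: tensor_chart_def)
          qed
          then show ?thesis by (auto simp: topspace_cspace M_def)
        qed
        have "?PU (U \<inter> U') = subtopology (?PU U') ((U \<inter> U') \<times> extensional M)"
          unfolding subtopology_Times subtopology_subtopology
          by (simp add: topspace_cspace[symmetric] inf.absorb2 Int_left_commute Int_commute)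
        with op have "openin (subtopology (?PU U') ((U \<inter> U') \<times> extensional M)) {p \<in> (U \<inter> U') \<times> extensional M. g p \<in> V}"
          by simp
        moreover have "openin (?PU U') ((U \<inter> U') \<times> extensional M)"
          unfolding openin_prod_Times_iff using opUU
          by (auto simp: topspace_cspace[symmetric] openin_subtopology)
        ultimately have "openin (?PU U') {p \<in> (U \<inter> U') \<times> extensional M. g p \<in> V}"
          by (rule openin_trans_full)
        then show "openin (prod_topology (subtopology (bbase E) U') (cspace (multi_index d r)))
          {p \<in> U' \<times> topspace (cspace (multi_index d r)). tensor_chart E r \<phi>' p \<in> W}"
          unfolding eq by (simp add: M_def)
      qed
      moreover have "W = W \<inter> {v \<in> topspace (tensor_topology E r). fst v \<in> U}"
        by (auto simp: W_def)
      ultimately show "openin ?TU {v \<in> topspace ?TU. coord (tpow E r) M (\<lambda>I y. (y, st y (fm I y))) v \<in> V}"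
        unfolding W_def[symmetric] openin_subtopology by blast
    qed
  next
    fix z assume "z \<in> topspace (?PU U)"
    then obtain y c where z: "z = (y, c)" "y \<in> U" "c \<in> extensional M" unfolding topPU[OF UX] by auto
    define T where "T = (\<lambda>ws. \<Sum>I\<in>M. c I * st y (fm I y) ws)"
    have ch: "tensor_chart E r \<phi> z = (y, T)" by (simp add: chart z(1) T_def)
    have T: "T \<in> TF r y" using tensor_chart_TF[OF t z(2), of r c] UX z by (auto simp: ch[unfolded z(1)])
    have "T (fm I y) = c I" if I: "I \<in> M" for I
    proof -
      have "T (fm I y) = (\<Sum>J\<in>M. if J = I then c I else 0)"
        unfolding T_def
      proof (intro sum.cong refl)
        fix J assume J: "J \<in> M"
        show "c J * st y (fm J y) (fm I y) = (if J = I then c I else 0)"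
          using st_onb[OF onb[OF z(2)], of I r J] I J by (simp add: fm_def Mt)
      qed
      then show ?thesis using I finM by simp
    qed
    then have "(\<lambda>I\<in>M. T (fm I y)) = c" using z(3) by (intro extensionalityI[of _ M]) auto
    then show "coord (tpow E r) M (\<lambda>I y. (y, st y (fm I y))) (tensor_chart E r \<phi> z) = z"
      unfolding ch coord[OF z(2) T] by (simp add: z(1))
  next
    fix v assume "v \<in> topspace ?TU"
    then obtain y T where v: "v = (y, T)" "y \<in> U" "T \<in> TF r y" unfolding topTU by auto
    show "tensor_chart E r \<phi> (coord (tpow E r) M (\<lambda>I y. (y, st y (fm I y))) v) = v"
      unfolding v(1) coord[OF v(2,3)] chart
    proof -
      have "(\<lambda>ws. \<Sum>I\<in>M. (\<lambda>I\<in>M. T (fm I y)) I * st y (fm I y) ws) = T"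
      proof
        fix ws show "(\<Sum>I\<in>M. (\<lambda>I\<in>M. T (fm I y)) I * st y (fm I y) ws) = T ws"
          by (subst TF_expand[OF v(3) onb[OF v(2)] finite_lessThan, of ws])
            (auto intro!: sum.cong simp: fm_def Mt)
      qed
      then show "(case (y, \<lambda>I\<in>M. T (fm I y)) of (y, c) \<Rightarrow> (y, \<lambda>ws. \<Sum>I\<in>M. c I * st y (fm I y) ws)) = (y, T)"
        by simp
    qed
  qed
  have "frame (tpow E r) M U (\<lambda>I y. (y, st y (fm I y)))"
    unfolding frame_def
  proof (intro conjI ballI)
    show "openin (bbase (tpow E r)) U" using opU by simp
    fix y assume y: "y \<in> U"
    have yX: "y \<in> X" using y UX by blast
    {
      fix I J assume I: "I \<in> M" and J: "J \<in> M"
      show "(y, st y (fm I y)) \<in> fibre (tpow E r) y" using st_TF[OF ffl[OF y I]] by (simp add: fibre_tpow[OF yX])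
      show "bherm (tpow E r) (y, st y (fm I y)) (y, st y (fm J y)) = (if I = J then 1 else 0)"
        using tensor_herm_st[OF yX st_TF[OF ffl[OF y J]] ffl[OF y I]] st_onb[OF onb[OF y], of I r J] I J
        by (simp add: fm_def Mt)
    }
    fix v w assume v: "v \<in> fibre (tpow E r) y" and w: "w \<in> fibre (tpow E r) y"
    obtain S T where S: "v = (y, S)" "S \<in> TF r y" and T: "w = (y, T)" "T \<in> TF r y"
      using v w by (metis fibre_tpowE)
    show "bherm (tpow E r) v w = (\<Sum>I\<in>M. cnj (bherm (tpow E r) (y, st y (fm I y)) v) *
        bherm (tpow E r) (y, st y (fm I y)) w)"
      using tensor_herm_onb[OF yX S(2) T(2) onb[OF y]] tensor_herm_st[OF yX S(2) ffl[OF y]]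
        tensor_herm_st[OF yX T(2) ffl[OF y]]
      by (simp add: S(1) T(1) fm_def Mt)
  next
    show "homeomorphic_map (subtopology (btotal (tpow E r)) {v \<in> topspace (btotal (tpow E r)). bproj (tpow E r) v \<in> U})
       (prod_topology (subtopology (bbase (tpow E r)) U) (cspace M)) (coord (tpow E r) M (\<lambda>I y. (y, st y (fm I y))))"
      using homs homeomorphic_maps_map by (simp only: tpow_simps) blast
  qed
  then show ?thesis by (simp add: M_def fm_def f_def)
qed

text \<open>Tensor powers are thereby framed bundles in their own right, and the results on
  morphisms, adjoints and norms apply to \<open>thom E r s\<close>.\<close>

lemma framed_tpow: "framed (tpow E r) (multi_index d r)"
proof
  show "finite (multi_index d r)" by (simp add: multi_index_tuples finite_tuples)
  show "continuous_map (btotal (tpow E r)) (bbase (tpow E r)) (bproj (tpow E r))"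
    unfolding tpow_simps continuous_map_def
  proof (intro conjI allI impI)
    show "fst \<in> topspace (tensor_topology E r) \<rightarrow> X" by (auto simp: topspace_tensor)
    fix W assume W: "openin (bbase E) W"
    show "openin (tensor_topology E r) {v \<in> topspace (tensor_topology E r). fst v \<in> W}"
      unfolding openin_tensor_topology
    proof (intro conjI allI impI)
      show "{v \<in> topspace (tensor_topology E r). fst v \<in> W} \<subseteq> (SIGMA x:X. TF r x)"
        by (auto simp: topspace_tensor)
      fix U \<phi> assume t: "local_triv E U \<phi>"
      have UX: "U \<subseteq> X" using t openin_subset unfolding local_triv_def by blast
      have "{p \<in> U \<times> topspace (cspace (multi_index d r)). tensor_chart E r \<phi> p \<in>
          {v \<in> topspace (tensor_topology E r). fst v \<in> W}} = (U \<inter> W) \<times> topspace (cspace (multi_index d r))"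
      proof (rule set_eqI)
        fix p
        show "p \<in> {p \<in> U \<times> topspace (cspace (multi_index d r)). tensor_chart E r \<phi> p \<in>
          {v \<in> topspace (tensor_topology E r). fst v \<in> W}} \<longleftrightarrow> p \<in> (U \<inter> W) \<times> topspace (cspace (multi_index d r))"
          using tensor_chart_TF'[OF t, of p "topspace (cspace (multi_index d r))" r] unfolding topspace_tensor
          by (cases p) auto
      qed
      moreover have "openin (subtopology (bbase E) U) (U \<inter> W)"
        using W by (auto simp: openin_subtopology)
      ultimately show "openin (prod_topology (subtopology (bbase E) U) (cspace (multi_index d r)))
          {p \<in> U \<times> topspace (cspace (multi_index d r)). tensor_chart E r \<phi> p \<in>
            {v \<in> topspace (tensor_topology E r). fst v \<in> W}}"
        by (simp add: openin_prod_Times_iff)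
    qed
  qed
  show "badd (tpow E r) v w \<in> fibre (tpow E r) x" if "v \<in> fibre (tpow E r) x" "w \<in> fibre (tpow E r) x" for v w x
    using that by (auto elim!: fibre_tpowE simp: fibre_tpow TF_add)
  show "bscale (tpow E r) a v \<in> fibre (tpow E r) x" if "v \<in> fibre (tpow E r) x" for v a x
    using that by (auto elim!: fibre_tpowE simp: fibre_tpow TF_scale)
  show "bherm (tpow E r) v (badd (tpow E r) w w') = bherm (tpow E r) v w + bherm (tpow E r) v w'"
    if "v \<in> fibre (tpow E r) x" "w \<in> fibre (tpow E r) x" "w' \<in> fibre (tpow E r) x" for v w w' x
    using that by (auto elim!: fibre_tpowE simp: tensor_herm_L distrib_left sum.distrib)
  show "bherm (tpow E r) v (bscale (tpow E r) a w) = a * bherm (tpow E r) v w"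
    if "v \<in> fibre (tpow E r) x" "w \<in> fibre (tpow E r) x" for v w x a
    using that by (auto elim!: fibre_tpowE simp: tensor_herm_L sum_distrib_left mult_ac)
  show "\<exists>U b. x \<in> U \<and> frame (tpow E r) (multi_index d r) U b" if "x \<in> topspace (bbase (tpow E r))" for x
    using ex_triv_frame[of x] that tpow_frame by fastforce
qed

sublocale T: framed "tpow E r" "multi_index d r" for r
  by (rule framed_tpow)

sublocale TT: framed_pair "tpow E r" "multi_index d r" "tpow E s" "multi_index d s" for r s
  by unfold_locales simp

end

section \<open>Kernels of morphisms\<close>

context herm_bundle
begin

definition act :: "('x \<times> 'e tensor \<Rightarrow> 'x \<times> 'e tensor) \<Rightarrow> 'x \<Rightarrow> 'e tensor \<Rightarrow> 'e tensor" where
  "act t x T = snd (t (x, T))"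

text \<open>Linear in the vectors \<open>vs\<close> and conjugate linear in \<open>ws\<close>. The
  arguments are arbitrary lists of vectors, not basis lists, so identities between kernels involve
  no choice of basis.\<close>

definition K :: "('x \<times> 'e tensor \<Rightarrow> 'x \<times> 'e tensor) \<Rightarrow> 'x \<Rightarrow> 'e list \<Rightarrow> 'e list \<Rightarrow> complex" where
  "K t x ws vs = act t x (st x vs) ws"

lemma thom_act:
  assumes t: "t \<in> thom E r s" and x: "x \<in> X" and T: "T \<in> TF r x"
  shows "t (x, T) = (x, act t x T)" "act t x T \<in> TF s x"
proof -
  have "t (x, T) \<in> fibre (tpow E s) x"
    by (rule TT.bmor_fibre[OF t]) (simp add: fibre_tpow[OF x] T)
  then show "t (x, T) = (x, act t x T)" "act t x T \<in> TF s x"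
    by (auto simp: act_def fibre_tpow[OF x])
qed

lemma act_add:
  assumes t: "t \<in> thom E r s" and x: "x \<in> X" and S: "S \<in> TF r x" and T: "T \<in> TF r x"
  shows "act t x (\<lambda>ws. S ws + T ws) = (\<lambda>ws. act t x S ws + act t x T ws)"
proof -
  have "t (badd (tpow E r) (x, S) (x, T)) = badd (tpow E s) (t (x, S)) (t (x, T))"
    by (rule TT.bmor_add[OF t, where x = x]) (simp_all add: fibre_tpow[OF x] S T)
  then have "t (x, \<lambda>ws. S ws + T ws) = (x, \<lambda>ws. act t x S ws + act t x T ws)"
    using thom_act(1)[OF t x S] thom_act(1)[OF t x T] by simp
  then show ?thesis unfolding act_def[of t x "\<lambda>ws. S ws + T ws"] by simp
qed

lemma act_scale:
  assumes t: "t \<in> thom E r s" and x: "x \<in> X" and T: "T \<in> TF r x"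
  shows "act t x (\<lambda>ws. a * T ws) = (\<lambda>ws. a * act t x T ws)"
proof -
  have "t (bscale (tpow E r) a (x, T)) = bscale (tpow E s) a (t (x, T))"
    by (rule TT.bmor_scale[OF t, where x = x]) (simp_all add: fibre_tpow[OF x] T)
  then have "t (x, \<lambda>ws. a * T ws) = (x, \<lambda>ws. a * act t x T ws)"
    using thom_act(1)[OF t x T] by simp
  then show ?thesis unfolding act_def[of t x "\<lambda>ws. a * T ws"] by simp
qed

lemma act_sum:
  assumes t: "t \<in> thom E r s" and x: "x \<in> X" and A: "finite A" and T: "\<And>a. a \<in> A \<Longrightarrow> T a \<in> TF r x"
  shows "act t x (\<lambda>ws. \<Sum>a\<in>A. c a * T a ws) = (\<lambda>ws. \<Sum>a\<in>A. c a * act t x (T a) ws)"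
  using A T
proof (induction A rule: finite_induct)
  case empty
  show ?case using act_scale[OF t x TF_zero[OF x], of 0] by simp
next
  case (insert a A)
  have "act t x (\<lambda>ws. c a * T a ws + (\<Sum>a\<in>A. c a * T a ws)) =
      (\<lambda>ws. act t x (\<lambda>ws. c a * T a ws) ws + act t x (\<lambda>ws. \<Sum>a\<in>A. c a * T a ws) ws)"
    by (rule act_add[OF t x]) (use insert in \<open>auto intro!: TF_scale[OF x] TF_sum[OF x]\<close>)
  then show ?case using insert act_scale[OF t x, of "T a" "c a"] by simp
qed

lemma act_onb:
  assumes t: "t \<in> thom E r s" and x: "x \<in> X" and T: "T \<in> TF r x" and b: "onb E I x b" and I: "finite I"
  shows "act t x T ws = (\<Sum>J\<in>tuples I r. T (map b J) * K t x ws (map b J))"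
proof -
  have bm: "map b J \<in> fl r x" if "J \<in> tuples I r" for J
    unfolding fl_def by (rule tuples_map[OF onbD(1)[OF b] that])
  have "T = (\<lambda>ws. \<Sum>J\<in>tuples I r. T (map b J) * st x (map b J) ws)"
    by (rule ext) (rule TF_expand[OF T b I])
  then have "act t x T = act t x (\<lambda>ws. \<Sum>J\<in>tuples I r. T (map b J) * st x (map b J) ws)" by (rule arg_cong)
  also have "\<dots> = (\<lambda>ws. \<Sum>J\<in>tuples I r. T (map b J) * act t x (st x (map b J)) ws)"
    by (rule act_sum[OF t x finite_tuples[OF I]]) (rule st_TF[OF bm])
  finally show ?thesis by (simp add: K_def)
qed

lemma act_L:
  assumes "t \<in> thom E r s" "x \<in> X" "T \<in> TF r x"
  shows "act t x T ws = (\<Sum>bs\<in>L r x. T bs * K t x ws bs)"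
  using act_onb[OF assms onb_B[OF assms(2)] finite_B[OF assms(2)], of ws] by simp

lemma K_TF: "t \<in> thom E r s \<Longrightarrow> x \<in> X \<Longrightarrow> vs \<in> fl r x \<Longrightarrow> (\<lambda>ws. K t x ws vs) \<in> TF s x"
  unfolding K_def by (rule thom_act(2)) (auto intro: st_TF)

lemma thom_eqI:
  assumes t: "t \<in> thom E r s" and t': "t' \<in> thom E r s"
    and K: "\<And>x ws vs. x \<in> X \<Longrightarrow> ws \<in> fl s x \<Longrightarrow> vs \<in> fl r x \<Longrightarrow> K t x ws vs = K t' x ws vs"
  shows "t = t'"
proof (rule bmor_eqI[OF t t'])
  fix v assume "v \<in> topspace (btotal (tpow E r))"
  then obtain x T where v: "v = (x, T)" "x \<in> X" "T \<in> TF r x" by (auto simp: topspace_tensor)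
  have "act t x T = act t' x T"
  proof (rule TF_eqI[OF v(2) thom_act(2)[OF t v(2,3)] thom_act(2)[OF t' v(2,3)]])
    fix ws assume ws: "ws \<in> L s x"
    show "act t x T ws = act t' x T ws"
      unfolding act_L[OF t v(2,3)] act_L[OF t' v(2,3)]
    proof (rule sum.cong[OF refl])
      fix bs assume "bs \<in> L r x"
      from K[OF v(2) L_fl[OF v(2) ws] L_fl[OF v(2) this]]
      show "T bs * K t x ws bs = T bs * K t' x ws bs" by simp
    qed
  qed
  then show "t v = t' v" using thom_act(1)[OF t v(2,3)] thom_act(1)[OF t' v(2,3)] v(1) by simp
qed

definition otriv :: "'x set \<Rightarrow> ('x \<times> (nat \<Rightarrow> complex) \<Rightarrow> 'e) \<Rightarrow> bool" where
  "otriv U \<phi> \<longleftrightarrow> local_triv E U \<phi> \<and> frame E {..<d} U (\<lambda>i y. \<phi> (y, unit_vec d i))"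

definition sec :: "('x \<times> (nat \<Rightarrow> complex) \<Rightarrow> 'e) \<Rightarrow> 'x \<Rightarrow> nat list \<Rightarrow> 'e list" where
  "sec \<phi> y I = map (\<lambda>i. \<phi> (y, unit_vec d i)) I"

lemma sec_append: "sec \<phi> y (I @ J) = sec \<phi> y I @ sec \<phi> y J"
  by (simp add: sec_def)

lemma otriv_onb: "otriv U \<phi> \<Longrightarrow> y \<in> U \<Longrightarrow> onb E {..<d} y (\<lambda>i. \<phi> (y, unit_vec d i))"
  using frame_onb[of E "{..<d}" U "\<lambda>i y. \<phi> (y, unit_vec d i)" y] by (simp add: otriv_def)

lemma sec_fl: "otriv U \<phi> \<Longrightarrow> y \<in> U \<Longrightarrow> I \<in> multi_index d r \<Longrightarrow> sec \<phi> y I \<in> fl r y"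
  unfolding fl_def sec_def multi_index_tuples by (rule tuples_map[OF onbD(1)[OF otriv_onb]])

lemma otriv_frame:
  "otriv U \<phi> \<Longrightarrow> frame (tpow E r) (multi_index d r) U (\<lambda>I y. (y, st y (sec \<phi> y I)))"
  unfolding otriv_def sec_def using tpow_frame by blast

lemma K_cont:
  assumes t: "t \<in> thom E r s" and \<phi>: "otriv U \<phi>" and I: "I \<in> multi_index d s" and J: "J \<in> multi_index d r"
  shows "continuous_map (subtopology (bbase E) U) euclidean (\<lambda>y. K t y (sec \<phi> y I) (sec \<phi> y J))"
proof -
  have "continuous_map (subtopology (bbase (tpow E r)) U) euclidean
      (\<lambda>y. bherm (tpow E s) (y, st y (sec \<phi> y I)) (t (y, st y (sec \<phi> y J))))"
    by (rule TT.bmor_coefficient_cont[OF t otriv_frame[OF \<phi>] otriv_frame[OF \<phi>] J I])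
  then have "continuous_map (subtopology (bbase E) U) euclidean
      (\<lambda>y. bherm (tpow E s) (y, st y (sec \<phi> y I)) (t (y, st y (sec \<phi> y J))))" by simp
  then show ?thesis
  proof (rule continuous_map_eq)
    fix y assume "y \<in> topspace (subtopology (bbase E) U)"
    then have y: "y \<in> U" "y \<in> X" by auto
    have S: "st y (sec \<phi> y J) \<in> TF r y" by (rule st_TF[OF sec_fl[OF \<phi> y(1) J]])
    show "bherm (tpow E s) (y, st y (sec \<phi> y I)) (t (y, st y (sec \<phi> y J))) = K t y (sec \<phi> y I) (sec \<phi> y J)"
      by (simp add: thom_act(1)[OF t y(2) S] tensor_herm_st[OF y(2) thom_act(2)[OF t y(2) S] sec_fl[OF \<phi> y(1) I]] K_def)
  qed
qed

text \<open>A kernel that is a tensor in the first argument and a conjugate tensor in the second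
  comes from a morphism as soon as its matrix in orthonormal frames is continuous. All morphisms
  below are produced in this way.\<close>

lemma thom_of_kernel:
  assumes k1: "\<And>x vs. x \<in> X \<Longrightarrow> vs \<in> fl r x \<Longrightarrow> \<exists>T\<in>TF s x. \<forall>ws\<in>fl s x. T ws = k x ws vs"
    and k2: "\<And>x ws. x \<in> X \<Longrightarrow> ws \<in> fl s x \<Longrightarrow> \<exists>T\<in>TF r x. \<forall>vs\<in>fl r x. T vs = cnj (k x ws vs)"
    and k3: "\<And>U \<phi> I J. otriv U \<phi> \<Longrightarrow> I \<in> multi_index d s \<Longrightarrow> J \<in> multi_index d r \<Longrightarrow>
      continuous_map (subtopology (bbase E) U) euclidean (\<lambda>y. k y (sec \<phi> y I) (sec \<phi> y J))"
  shows "\<exists>t\<in>thom E r s. \<forall>x\<in>X. \<forall>ws\<in>fl s x. \<forall>vs\<in>fl r x. K t x ws vs = k x ws vs"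
proof -
  obtain R where R: "\<And>x vs. x \<in> X \<Longrightarrow> vs \<in> fl r x \<Longrightarrow> R x vs \<in> TF s x \<and> (\<forall>ws\<in>fl s x. R x vs ws = k x ws vs)"
    using k1 by metis
  \<comment> \<open>The linear extension of the columns \<open>R x bs\<close> from the basis chosen
    at \<open>x\<close>.\<close>
  define m where "m x T = (\<lambda>ws. \<Sum>bs\<in>L r x. T bs * R x bs ws)" for x and T :: "'e tensor"
  have mTF: "m x T \<in> TF s x" if "x \<in> X" for x T
    unfolding m_def using R[OF that L_fl[OF that]] by (intro TF_sum[OF that] TF_scale[OF that]) blast
  define t where "t = (\<lambda>v\<in>topspace (tensor_topology E r). (fst v, m (fst v) (snd v)))"
  have t_eq: "t (x, T) = (x, m x T)" if "x \<in> X" "T \<in> TF r x" for x T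
    using that by (simp add: t_def topspace_tensor)
  \<comment> \<open>At basis lists \<open>vs\<close> the kernel is right by construction. The second
    hypothesis makes the conjugated kernel a tensor in \<open>vs\<close>, whose expansion over the
    same basis extends the agreement to all lists.\<close>
  have Kt: "K t x ws vs = k x ws vs" if x: "x \<in> X" and ws: "ws \<in> fl s x" and vs: "vs \<in> fl r x" for x ws vs
  proof -
    obtain Q where Q: "Q \<in> TF r x" "\<And>vs. vs \<in> fl r x \<Longrightarrow> Q vs = cnj (k x ws vs)" using k2[OF x ws] by blast
    have "K t x ws vs = (\<Sum>bs\<in>L r x. st x vs bs * k x ws bs)"
      unfolding K_def act_def t_eq[OF x st_TF[OF vs]] snd_conv m_def
      by (intro sum.cong refl) (simp add: R[OF x L_fl[OF x]] ws)
    also have "\<dots> = cnj (\<Sum>bs\<in>L r x. Q bs * st x bs vs)"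
      unfolding cnj_sum by (intro sum.cong refl) (simp add: Q(2) L_fl[OF x] st_cnj[OF vs L_fl[OF x]] mult.commute)
    also have "\<dots> = cnj (Q vs)" using TF_L[OF x Q(1), of vs] by simp
    finally show ?thesis by (simp add: Q(2)[OF vs])
  qed
  have "t \<in> thom E r s"
  proof (rule TT.bmorI_frames)
    show "t \<in> extensional (topspace (btotal (tpow E r)))" by (simp add: t_def)
  next
    fix x v assume v: "v \<in> fibre (tpow E r) x"
    then obtain T where T: "v = (x, T)" "T \<in> TF r x" "x \<in> X" by (rule fibre_tpowE)
    show "t v \<in> fibre (tpow E s) x" by (simp add: T(1) t_eq[OF T(3,2)] fibre_tpow[OF T(3)] mTF[OF T(3)])
    show "t (bscale (tpow E r) a v) = bscale (tpow E s) a (t v)" for a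
      by (simp add: T(1) t_eq[OF T(3,2)] t_eq[OF T(3) TF_scale[OF T(3,2)]] m_def sum_distrib_left mult.assoc)
    fix w assume "w \<in> fibre (tpow E r) x"
    then obtain S where S: "w = (x, S)" "S \<in> TF r x" by (rule fibre_tpowE)
    show "t (badd (tpow E r) v w) = badd (tpow E s) (t v) (t w)"
      by (simp add: T(1) S(1) t_eq[OF T(3,2)] t_eq[OF T(3) S(2)] t_eq[OF T(3) TF_add[OF T(3,2) S(2)]] m_def
          distrib_right sum.distrib)
  next
    fix x assume "x \<in> topspace (bbase (tpow E r))"
    then obtain U \<phi> where x: "x \<in> U" and \<phi>: "otriv U \<phi>"
      using ex_triv_frame[of x] unfolding otriv_def by auto
    have "continuous_map (subtopology (bbase (tpow E r)) U) euclidean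
        (\<lambda>y. bherm (tpow E s) (y, st y (sec \<phi> y I)) (t (y, st y (sec \<phi> y J))))"
      if I: "I \<in> multi_index d s" and J: "J \<in> multi_index d r" for I J
    proof (rule continuous_map_eq)
      show "continuous_map (subtopology (bbase (tpow E r)) U) euclidean (\<lambda>y. k y (sec \<phi> y I) (sec \<phi> y J))"
        using k3[OF \<phi> I J] by simp
      fix y assume "y \<in> topspace (subtopology (bbase (tpow E r)) U)"
      then have y: "y \<in> U" "y \<in> X" by auto
      have S: "st y (sec \<phi> y J) \<in> TF r y" by (rule st_TF[OF sec_fl[OF \<phi> y(1) J]])
      show "k y (sec \<phi> y I) (sec \<phi> y J) = bherm (tpow E s) (y, st y (sec \<phi> y I)) (t (y, st y (sec \<phi> y J)))"
        using Kt[OF y(2) sec_fl[OF \<phi> y(1) I] sec_fl[OF \<phi> y(1) J]]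
        by (simp add: t_eq[OF y(2) S] tensor_herm_st[OF y(2) mTF[OF y(2)] sec_fl[OF \<phi> y(1) I]] K_def act_def)
    qed
    then show "\<exists>U b b'. x \<in> U \<and> frame (tpow E r) (multi_index d r) U b \<and> frame (tpow E s) (multi_index d s) U b' \<and>
      (\<forall>J\<in>multi_index d r. \<forall>I\<in>multi_index d s.
        continuous_map (subtopology (bbase (tpow E r)) U) euclidean (\<lambda>y. bherm (tpow E s) (b' I y) (t (b J y))))"
      using x otriv_frame[OF \<phi>] by blast
  qed
  then show ?thesis using Kt by blast
qed

lemma act_mid: "x \<in> X \<Longrightarrow> T \<in> TF r x \<Longrightarrow> act (mid (tpow E r)) x T = T"
  by (simp add: act_def mid_def topspace_tensor)

lemma K_mid: "x \<in> X \<Longrightarrow> vs \<in> fl r x \<Longrightarrow> K (mid (tpow E r)) x ws vs = st x vs ws"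
  by (simp add: K_def act_mid st_TF)

lemma act_mcomp:
  assumes "t \<in> thom E r s" "x \<in> X" "T \<in> TF r x"
  shows "act (mcomp (tpow E r) t' t) x T = act t' x (act t x T)"
proof -
  have "mcomp (tpow E r) t' t (x, T) = t' (x, act t x T)"
    using thom_act(1)[OF assms] assms by (simp add: mcomp_def topspace_tensor)
  then show ?thesis by (simp add: act_def[of "mcomp (tpow E r) t' t"] act_def[of t'])
qed

text \<open>Matrix multiplication over an arbitrary orthonormal basis; the freedom in the basis is
  used to show that products of invariant morphisms are invariant.\<close>

lemma K_mcomp_onb:
  assumes t: "t \<in> thom E r s" and t': "t' \<in> thom E s u" and x: "x \<in> X" and vs: "vs \<in> fl r x"
    and b: "onb E I x b" and I: "finite I"
  shows "K (mcomp (tpow E r) t' t) x ws vs = (\<Sum>J\<in>tuples I s. K t' x ws (map b J) * K t x (map b J) vs)"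
  unfolding K_def[of "mcomp (tpow E r) t' t"] act_mcomp[OF t x st_TF[OF vs]]
    act_onb[OF t' x thom_act(2)[OF t x st_TF[OF vs]] b I]
  by (simp add: K_def mult.commute)

lemma K_madd:
  assumes "t \<in> thom E r s" "t' \<in> thom E r s" "x \<in> X" "vs \<in> fl r x"
  shows "K (madd (tpow E r) (tpow E s) t t') x ws vs = K t x ws vs + K t' x ws vs"
proof -
  have "madd (tpow E r) (tpow E s) t t' (x, st x vs) = (x, \<lambda>ws. act t x (st x vs) ws + act t' x (st x vs) ws)"
    using thom_act(1)[OF assms(1,3) st_TF[OF assms(4)]] thom_act(1)[OF assms(2,3) st_TF[OF assms(4)]] assms
    by (simp add: madd_def topspace_tensor st_TF)
  then show ?thesis by (simp add: K_def act_def[of "madd (tpow E r) (tpow E s) t t'"])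
qed

lemma K_mscale:
  assumes "t \<in> thom E r s" "x \<in> X" "vs \<in> fl r x"
  shows "K (mscale (tpow E r) (tpow E s) a t) x ws vs = a * K t x ws vs"
proof -
  have "mscale (tpow E r) (tpow E s) a t (x, st x vs) = (x, \<lambda>ws. a * act t x (st x vs) ws)"
    using thom_act(1)[OF assms(1,2) st_TF[OF assms(3)]] assms
    by (simp add: mscale_def topspace_tensor st_TF)
  then show ?thesis by (simp add: K_def act_def[of "mscale (tpow E r) (tpow E s) a t"])
qed

lemma thom_closed:
  "t \<in> thom E r s \<Longrightarrow> t' \<in> thom E r s \<Longrightarrow> madd (tpow E r) (tpow E s) t t' \<in> thom E r s"
  "t \<in> thom E r s \<Longrightarrow> mscale (tpow E r) (tpow E s) a t \<in> thom E r s"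
  "t \<in> thom E r s \<Longrightarrow> u \<in> thom E s q \<Longrightarrow> mcomp (tpow E r) u t \<in> thom E r q"
  "t \<in> thom E r s \<Longrightarrow> madj (tpow E r) (tpow E s) t \<in> thom E s r"
  "mid (tpow E r) \<in> thom E r r"
  by (rule TT.madd_bmor TT.mscale_bmor TT.mcomp_bmor TT.madj T.mid_bmor, assumption+)+ (rule T.mid_bmor)

lemma K_madj:
  assumes t: "t \<in> thom E r s" and x: "x \<in> X" and ws: "ws \<in> fl s x" and vs: "vs \<in> fl r x"
  shows "K (madj (tpow E r) (tpow E s) t) x vs ws = cnj (K t x ws vs)"
proof -
  note u = TT.madj(1)[OF t]
  note S = st_TF[OF vs] and W = st_TF[OF ws]
  have "bherm (tpow E r) (madj (tpow E r) (tpow E s) t (x, st x ws)) (x, st x vs) =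
      bherm (tpow E s) (x, st x ws) (t (x, st x vs))"
    by (rule TT.madj(2)[OF t, where x = x]) (simp_all add: fibre_tpow[OF x] S W)
  also have "\<dots> = K t x ws vs"
    by (simp add: thom_act(1)[OF t x S] tensor_herm_st[OF x thom_act(2)[OF t x S] ws] K_def)
  also have "bherm (tpow E r) (madj (tpow E r) (tpow E s) t (x, st x ws)) (x, st x vs) =
      cnj (tensor_herm E r x (st x vs) (act (madj (tpow E r) (tpow E s) t) x (st x ws)))"
    by (simp add: thom_act(1)[OF u x W] tensor_herm_L mult.commute)
  also have "tensor_herm E r x (st x vs) (act (madj (tpow E r) (tpow E s) t) x (st x ws)) =
      K (madj (tpow E r) (tpow E s) t) x vs ws"
    by (simp add: tensor_herm_st[OF x thom_act(2)[OF u x W] vs] K_def)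
  finally show ?thesis by (metis complex_cnj_cnj)
qed

section \<open>Tensor products of vectors and of morphisms\<close>

lemma fl_appendE:
  assumes "ws \<in> fl (r + s) x"
  obtains us vs where "ws = us @ vs" "us \<in> fl r x" "vs \<in> fl s x"
  using assms unfolding fl_def by (rule tuples_addE)

lemma fl_append: "us \<in> fl r x \<Longrightarrow> vs \<in> fl s x \<Longrightarrow> us @ vs \<in> fl (r + s) x"
  unfolding fl_def by (rule tuples_append)

lemma fl_take_drop: "ws \<in> fl (r + s) x \<Longrightarrow> take r ws \<in> fl r x" "ws \<in> fl (r + s) x \<Longrightarrow> drop r ws \<in> fl s x"
  unfolding fl_def by (rule tuples_take_drop, assumption)+

lemma fl_of_take_drop: "take r ws \<in> fl r x \<Longrightarrow> drop r ws \<in> fl s x \<Longrightarrow> ws \<in> fl (r + s) x"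
  using fl_append[of "take r ws" r x "drop r ws" s] by simp

lemma tensor_vec_outside:
  assumes x: "x \<in> X" and S: "S \<in> TF r x" and T: "T \<in> TF s x" and ws: "ws \<notin> fl (r + s) x"
  shows "tensor_vec r S T ws = 0"
  using fl_of_take_drop[of r ws x s] TF_outside[OF x S, of "take r ws"] TF_outside[OF x T, of "drop r ws"] ws
  by (auto simp: tensor_vec_def)

lemma tensor_vec_append: "length us = r \<Longrightarrow> tensor_vec r S T (us @ vs) = S us * T vs"
  by (simp add: tensor_vec_def)

lemma tensor_vec_TF:
  assumes x: "x \<in> X" and S: "S \<in> TF r x" and T: "T \<in> TF s x"
  shows "tensor_vec r S T \<in> TF (r + s) x"
  unfolding TF_iff[OF x]
proof
  fix ws
  have eq: "(\<Sum>bs\<in>L (r + s) x. tensor_vec r S T bs * st x bs ws) =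
      (\<Sum>us\<in>L r x. \<Sum>vs\<in>L s x. S us * T vs * st x (us @ vs) ws)"
    unfolding sum_tuples_append by (intro sum.cong refl) (simp add: tensor_vec_append tuples_length)
  show "tensor_vec r S T ws = (\<Sum>bs\<in>L (r + s) x. tensor_vec r S T bs * st x bs ws)"
  proof (cases "ws \<in> fl (r + s) x")
    case True
    then obtain us vs where w: "ws = us @ vs" "us \<in> fl r x" "vs \<in> fl s x" by (rule fl_appendE)
    have "tensor_vec r S T ws = S us * T vs" by (simp add: w(1) tensor_vec_append fl_length[OF w(2)])
    also have "\<dots> = (\<Sum>us'\<in>L r x. S us' * st x us' us) * (\<Sum>vs'\<in>L s x. T vs' * st x vs' vs)"
      using TF_L[OF x S, of us] TF_L[OF x T, of vs] by simp
    also have "\<dots> = (\<Sum>us'\<in>L r x. \<Sum>vs'\<in>L s x. S us' * T vs' * st x (us' @ vs') ws)"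
      unfolding sum_product w(1)
      by (intro sum.cong refl) (simp add: st_append[OF w(2) L_fl[OF x] w(3) L_fl[OF x]] mult_ac)
    finally show ?thesis unfolding eq .
  next
    case False
    have "st x (us @ vs) ws = 0" if "us \<in> L r x" "vs \<in> L s x" for us vs
      by (rule st_outside) (use False that in \<open>simp add: tuples_length\<close>)
    then show ?thesis unfolding eq tensor_vec_outside[OF x S T False] by simp
  qed
qed

lemma tensor_vec_st:
  assumes x: "x \<in> X" and us: "us \<in> fl r x" and vs: "vs \<in> fl s x"
  shows "tensor_vec r (st x us) (st x vs) = st x (us @ vs)"
proof (rule TF_eqI[OF x tensor_vec_TF[OF x st_TF[OF us] st_TF[OF vs]] st_TF[OF fl_append[OF us vs]]])
  fix ws assume "ws \<in> L (r + s) x"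
  then have "ws \<in> fl (r + s) x" by (rule L_fl[OF x])
  then obtain us' vs' where w: "ws = us' @ vs'" "us' \<in> fl r x" "vs' \<in> fl s x" by (rule fl_appendE)
  show "tensor_vec r (st x us) (st x vs) ws = st x (us @ vs) ws"
    by (simp add: w(1) tensor_vec_append fl_length[OF w(2)] st_append[OF w(2) us w(3) vs])
qed

lemma multi_index_append:
  assumes "I \<in> multi_index d (r + s)"
  shows "take r I \<in> multi_index d r" "drop r I \<in> multi_index d s"
  using assms unfolding multi_index_tuples by (rule tuples_take_drop)+

lemma sec_take_drop: "take n (sec \<phi> y I) = sec \<phi> y (take n I)" "drop n (sec \<phi> y I) = sec \<phi> y (drop n I)"
  by (simp_all add: sec_def take_map drop_map)

text \<open>The conjugated product kernel is the product of the kernels of the two adjoints, which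
  settles the condition on the second argument.\<close>

lemma mtensor_exists:
  assumes t: "t \<in> thom E r s" and t': "t' \<in> thom E r' s'"
  shows "\<exists>u\<in>thom E (r + r') (s + s'). \<forall>x\<in>X. \<forall>ws\<in>fl (s + s') x. \<forall>vs\<in>fl (r + r') x.
    K u x ws vs = K t x (take s ws) (take r vs) * K t' x (drop s ws) (drop r vs)"
proof (rule thom_of_kernel)
  fix x vs assume x: "x \<in> X" and vs: "vs \<in> fl (r + r') x"
  have m: "(\<lambda>ws. K t x ws (take r vs)) \<in> TF s x" "(\<lambda>ws. K t' x ws (drop r vs)) \<in> TF s' x"
    by (rule K_TF[OF t x fl_take_drop(1)[OF vs]], rule K_TF[OF t' x fl_take_drop(2)[OF vs]])
  show "\<exists>T\<in>TF (s + s') x. \<forall>ws\<in>fl (s + s') x. T ws = K t x (take s ws) (take r vs) * K t' x (drop s ws) (drop r vs)"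
    by (rule bexI[OF _ tensor_vec_TF[OF x m]]) (simp add: tensor_vec_def)
next
  fix x ws assume x: "x \<in> X" and ws: "ws \<in> fl (s + s') x"
  note w = fl_take_drop[OF ws]
  have m: "(\<lambda>vs. K (madj (tpow E r) (tpow E s) t) x vs (take s ws)) \<in> TF r x"
    "(\<lambda>vs. K (madj (tpow E r') (tpow E s') t') x vs (drop s ws)) \<in> TF r' x"
    by (rule K_TF[OF thom_closed(4)[OF t] x w(1)], rule K_TF[OF thom_closed(4)[OF t'] x w(2)])
  show "\<exists>T\<in>TF (r + r') x. \<forall>vs\<in>fl (r + r') x.
      T vs = cnj (K t x (take s ws) (take r vs) * K t' x (drop s ws) (drop r vs))"
    by (rule bexI[OF _ tensor_vec_TF[OF x m]])
      (auto simp: tensor_vec_def K_madj[OF t x w(1) fl_take_drop(1)] K_madj[OF t' x w(2) fl_take_drop(2)])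
next
  fix U \<phi> I J assume \<phi>: "otriv U \<phi>" and I: "I \<in> multi_index d (s + s')" and J: "J \<in> multi_index d (r + r')"
  show "continuous_map (subtopology (bbase E) U) euclidean
     (\<lambda>y. K t y (take s (sec \<phi> y I)) (take r (sec \<phi> y J)) * K t' y (drop s (sec \<phi> y I)) (drop r (sec \<phi> y J)))"
    unfolding sec_take_drop
    by (intro continuous_map_mult' K_cont[OF t \<phi>] K_cont[OF t' \<phi>] multi_index_append[OF I] multi_index_append[OF J])
qed

lemma thom_eqI_st:
  assumes "u \<in> thom E r s" "u' \<in> thom E r s"
    "\<And>x vs. x \<in> X \<Longrightarrow> vs \<in> fl r x \<Longrightarrow> u (x, st x vs) = u' (x, st x vs)"
  shows "u = u'"
  by (rule thom_eqI[OF assms(1,2)]) (simp add: K_def act_def assms(3))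

text \<open>Existence comes from the product kernel. For uniqueness, a simple tensor splits into a
  product of two simple tensors, where the values are prescribed.\<close>

lemma mtensor:
  assumes t: "t \<in> thom E r s" and t': "t' \<in> thom E r' s'"
  shows "mtensor E r s r' s' t t' \<in> thom E (r + r') (s + s')"
    "x \<in> X \<Longrightarrow> S \<in> TF r x \<Longrightarrow> T \<in> TF r' x \<Longrightarrow>
      act (mtensor E r s r' s' t t') x (tensor_vec r S T) = tensor_vec s (act t x S) (act t' x T)"
proof -
  let ?P = "\<lambda>u. u \<in> thom E (r + r') (s + s') \<and>
     (\<forall>x\<in>X. \<forall>S\<in>TF r x. \<forall>T\<in>TF r' x.
        u (x, tensor_vec r S T) = (x, tensor_vec s (snd (t (x, S))) (snd (t' (x, T)))))"
  have "\<exists>!u. ?P u"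
  proof (rule ex_ex1I)
    obtain u where u: "u \<in> thom E (r + r') (s + s')"
      and Ku: "\<And>x ws vs. x \<in> X \<Longrightarrow> ws \<in> fl (s + s') x \<Longrightarrow> vs \<in> fl (r + r') x \<Longrightarrow>
        K u x ws vs = K t x (take s ws) (take r vs) * K t' x (drop s ws) (drop r vs)"
      using mtensor_exists[OF t t'] by blast
    have "u (x, tensor_vec r S T) = (x, tensor_vec s (snd (t (x, S))) (snd (t' (x, T))))"
      if x: "x \<in> X" and S: "S \<in> TF r x" and T: "T \<in> TF r' x" for x S T
    proof -
      note ST = tensor_vec_TF[OF x S T]
      note R = tensor_vec_TF[OF x thom_act(2)[OF t x S] thom_act(2)[OF t' x T]]
      have "act u x (tensor_vec r S T) = tensor_vec s (act t x S) (act t' x T)"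
      proof (rule TF_eqI[OF x thom_act(2)[OF u x ST] R])
        fix ws assume "ws \<in> L (s + s') x"
        then have ws: "ws \<in> fl (s + s') x" by (rule L_fl[OF x])
        have "act u x (tensor_vec r S T) ws =
            (\<Sum>us\<in>L r x. \<Sum>vs\<in>L r' x. (S us * K t x (take s ws) us) * (T vs * K t' x (drop s ws) vs))"
          unfolding act_L[OF u x ST] sum_tuples_append
        proof (intro sum.cong refl)
          fix us vs assume us: "us \<in> L r x" and vs: "vs \<in> L r' x"
          have "us @ vs \<in> fl (r + r') x" using us vs by (intro fl_append L_fl[OF x])
          then show "tensor_vec r S T (us @ vs) * K u x ws (us @ vs) =
              (S us * K t x (take s ws) us) * (T vs * K t' x (drop s ws) vs)"
            using us by (simp add: Ku[OF x ws] tensor_vec_append tuples_length mult_ac)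
        qed
        also have "\<dots> = act t x S (take s ws) * act t' x T (drop s ws)"
          unfolding act_L[OF t x S] act_L[OF t' x T] sum_product ..
        finally show "act u x (tensor_vec r S T) ws = tensor_vec s (act t x S) (act t' x T) ws"
          by (simp add: tensor_vec_def)
      qed
      then show ?thesis unfolding thom_act(1)[OF u x ST] by (simp add: act_def[of t] act_def[of t'])
    qed
    then show "\<exists>u. ?P u" using u by blast
  next
    fix u u' assume u: "?P u" and u': "?P u'"
    show "u = u'"
    proof (rule thom_eqI_st)
      fix x vs assume x: "x \<in> X" and "vs \<in> fl (r + r') x"
      then obtain v1 v2 where v: "vs = v1 @ v2" "v1 \<in> fl r x" "v2 \<in> fl r' x" by (blast elim: fl_appendE)
      have "u (x, tensor_vec r (st x v1) (st x v2)) = u' (x, tensor_vec r (st x v1) (st x v2))"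
        using u u' x st_TF[OF v(2)] st_TF[OF v(3)] by simp
      then show "u (x, st x vs) = u' (x, st x vs)"
        unfolding tensor_vec_st[OF x v(2,3)] v(1)[symmetric] .
    qed (use u u' in auto)
  qed
  from theI'[OF this] have P: "?P (mtensor E r s r' s' t t')" unfolding mtensor_def .
  then show "mtensor E r s r' s' t t' \<in> thom E (r + r') (s + s')" by blast
  show "act (mtensor E r s r' s' t t') x (tensor_vec r S T) = tensor_vec s (act t x S) (act t' x T)"
    if "x \<in> X" "S \<in> TF r x" "T \<in> TF r' x"
    using P that by (simp add: act_def)
qed

lemma K_mtensor:
  assumes t: "t \<in> thom E r s" and t': "t' \<in> thom E r' s'" and x: "x \<in> X"
    and w: "w1 \<in> fl s x" and v: "v1 \<in> fl r x" "v2 \<in> fl r' x"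
  shows "K (mtensor E r s r' s' t t') x (w1 @ w2) (v1 @ v2) = K t x w1 v1 * K t' x w2 v2"
  using mtensor(2)[OF t t' x st_TF[OF v(1)] st_TF[OF v(2)]] tensor_vec_st[OF x v]
  by (simp add: K_def tensor_vec_append fl_length[OF w])

section \<open>Unitaries, their tensor powers and invariance\<close>

lemma unitary_adj:
  assumes g: "g \<in> unitaries E"
  shows "g \<in> bmor E E" "madj E E g \<in> bmor E E"
    "v \<in> fibre E x \<Longrightarrow> madj E E g (g v) = v" "v \<in> fibre E x \<Longrightarrow> g (madj E E g v) = v"
    "v \<in> fibre E x \<Longrightarrow> w \<in> fibre E x \<Longrightarrow> bherm E (madj E E g w) v = bherm E w (g v)"
    "v \<in> fibre E x \<Longrightarrow> g v \<in> fibre E x" "v \<in> fibre E x \<Longrightarrow> madj E E g v \<in> fibre E x"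
proof -
  show g': "g \<in> bmor E E" using g by (simp add: unitaries_def)
  show a': "madj E E g \<in> bmor E E" by (rule EE.madj(1)[OF g'])
  show "bherm E (madj E E g w) v = bherm E w (g v)" if "v \<in> fibre E x" "w \<in> fibre E x"
    by (rule EE.madj(2)[OF g' that])
  show "g v \<in> fibre E x" "madj E E g v \<in> fibre E x" if "v \<in> fibre E x"
    by (rule EE.bmor_fibre[OF g' that], rule EE.bmor_fibre[OF a' that])
  have "mcomp E (madj E E g) g = mid E" "mcomp E g (madj E E g) = mid E"
    using g by (simp_all add: unitaries_def)
  then show "madj E E g (g v) = v" "g (madj E E g v) = v" if "v \<in> fibre E x"
    using E.fibre_topspace[OF that] by (auto simp: mcomp_def mid_def fun_eq_iff split: if_splits)
qed

lemma unitary_isometric: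
  assumes g: "g \<in> unitaries E" and v: "v \<in> fibre E x" and w: "w \<in> fibre E x"
  shows "bherm E (madj E E g v) (madj E E g w) = bherm E v w" "bherm E (g v) (g w) = bherm E v w"
proof -
  show "bherm E (madj E E g v) (madj E E g w) = bherm E v w"
    using unitary_adj(5)[OF g unitary_adj(7)[OF g w] v] unitary_adj(4)[OF g w] by simp
  show "bherm E (g v) (g w) = bherm E v w"
    using unitary_adj(5)[OF g w unitary_adj(6)[OF g v]] unitary_adj(3)[OF g v] by simp
qed

lemma madj_unitary:
  assumes g: "g \<in> unitaries E"
  shows "madj E E (madj E E g) = g"
proof (rule bmor_eqI[OF EE.madj(1)[OF unitary_adj(2)[OF g]] unitary_adj(1)[OF g]])
  fix v assume "v \<in> topspace (btotal E)"
  then have v: "v \<in> fibre E (bproj E v)" by (rule E.topspace_fibre)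
  show "madj E E (madj E E g) v = g v"
  proof (rule E.herm_eqI[OF EE.bmor_fibre[OF EE.madj(1)[OF unitary_adj(2)[OF g]] v] unitary_adj(6)[OF g v]])
    fix u assume u: "u \<in> fibre E (bproj E v)"
    have "bherm E (madj E E (madj E E g) v) u = bherm E v (madj E E g u)"
      by (rule EE.madj(2)[OF unitary_adj(2)[OF g] u v])
    also have "\<dots> = bherm E (g v) u"
      using unitary_isometric(2)[OF g v unitary_adj(7)[OF g u]] unitary_adj(4)[OF g u] by simp
    finally show "bherm E u (madj E E (madj E E g) v) = bherm E u (g v)"
      using E.herm_cnj[OF EE.bmor_fibre[OF EE.madj(1)[OF unitary_adj(2)[OF g]] v] u]
        E.herm_cnj[OF unitary_adj(6)[OF g v] u] by simp
  qed
qed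

lemma madj_in_unitaries: "g \<in> unitaries E \<Longrightarrow> madj E E g \<in> unitaries E"
  using madj_unitary[of g] unitary_adj(2)[of g] by (simp add: unitaries_def)

lemma fl_map: "(\<And>v. v \<in> fibre E x \<Longrightarrow> f v \<in> fibre E x) \<Longrightarrow> vs \<in> fl r x \<Longrightarrow> map f vs \<in> fl r x"
  unfolding fl_def by (rule tuples_map)

lemma st_map_adjoint:
  assumes g: "g \<in> unitaries E" and ws: "ws \<in> fl r x" and vs: "vs \<in> fl r x"
  shows "st x (map g vs) ws = st x vs (map (madj E E g) ws)"
proof -
  have "bherm E (ws ! i) (g (vs ! i)) = bherm E (madj E E g (ws ! i)) (vs ! i)" if "i < r" for i
  proof -
    have "ws ! i \<in> fibre E x" "vs ! i \<in> fibre E x"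
      using ws vs that nth_mem[of i ws] nth_mem[of i vs] unfolding fl_def tuples_def by auto
    then show ?thesis using unitary_adj(5)[OF g] by simp
  qed
  then have "(\<Prod>i<r. bherm E (ws ! i) (g (vs ! i))) = (\<Prod>i<r. bherm E (madj E E g (ws ! i)) (vs ! i))"
    by (intro prod.cong) auto
  moreover have "map g vs \<in> fl r x" "map (madj E E g) ws \<in> fl r x"
    by (rule fl_map[OF unitary_adj(6)[OF g] vs], assumption, rule fl_map[OF unitary_adj(7)[OF g] ws], assumption)
  ultimately show ?thesis using ws vs by (simp add: simple_tensor_def fl_def tuples_def)
qed

lemma st_map_isometric:
  assumes g: "g \<in> unitaries E" and ws: "ws \<in> fl r x" and vs: "vs \<in> fl r x"
  shows "st x (map (madj E E g) vs) (map (madj E E g) ws) = st x vs ws"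
proof -
  have m: "map (madj E E g) vs \<in> fl r x" by (rule fl_map[OF unitary_adj(7)[OF g] vs])
  have "map g (map (madj E E g) vs) = vs"
    using vs by (auto simp: fl_def tuples_def intro!: map_idI unitary_adj(4)[OF g])
  then show ?thesis using st_map_adjoint[OF g ws m] by simp
qed

lemma onb_unitary:
  assumes g: "g \<in> unitaries E" and b: "onb E I x b"
  shows "onb E I x (\<lambda>i. madj E E g (b i))"
  unfolding onb_def
proof (intro conjI ballI allI impI)
  note fib = onbD(1)[OF b]
  have eq: "bherm E (madj E E g (b i)) v = bherm E (b i) (g v)" if "i \<in> I" "v \<in> fibre E x" for i v
    by (rule unitary_adj(5)[OF g that(2) fib[OF that(1)]])
  note g6 = unitary_adj(6)[OF g]
  {
    fix i assume i: "i \<in> I"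
    show "madj E E g (b i) \<in> fibre E x" by (rule unitary_adj(7)[OF g fib[OF i]])
    fix j assume j: "j \<in> I"
    show "bherm E (madj E E g (b i)) (madj E E g (b j)) = (if i = j then 1 else 0)"
      using unitary_isometric(1)[OF g fib[OF i] fib[OF j]] onbD(2)[OF b i j] by simp
  next
    fix v w assume v: "v \<in> fibre E x" and w: "w \<in> fibre E x"
    show "bherm E v w = (\<Sum>i\<in>I. cnj (bherm E (madj E E g (b i)) v) * bherm E (madj E E g (b i)) w)"
      using onbD(3)[OF b g6[OF v] g6[OF w]] unitary_isometric(2)[OF g v w]
      by (simp add: eq[OF _ v] eq[OF _ w])
    assume h: "\<forall>i\<in>I. bherm E (madj E E g (b i)) v = bherm E (madj E E g (b i)) w"
    have "bherm E (b i) (g v) = bherm E (b i) (g w)" if "i \<in> I" for i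
      using bspec[OF h that] unfolding eq[OF that v] eq[OF that w] .
    then have "g v = g w" by (rule onbD(4)[OF b g6[OF v] g6[OF w]])
    then show "v = w" using unitary_adj(3)[OF g v] unitary_adj(3)[OF g w] by metis
  next
    fix c :: "_ \<Rightarrow> complex"
    obtain v where v: "v \<in> fibre E x" "\<forall>i\<in>I. bherm E (b i) v = c i" using onbD(5)[OF b] by blast
    then show "\<exists>v\<in>fibre E x. \<forall>i\<in>I. bherm E (madj E E g (b i)) v = c i"
      by (intro bexI[of _ "madj E E g v"] unitary_adj(7)[OF g])
        (simp_all add: unitary_isometric(1)[OF g fib])
  }
qed

text \<open>By \<open>st_map_adjoint\<close> the kernel is a conjugate tensor in its second
  argument, and its entries in a frame are products of matrix entries of \<open>g\<close>.\<close>

lemma mpow: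
  assumes g: "g \<in> unitaries E"
  shows "mpow E r g \<in> thom E r r"
    "x \<in> X \<Longrightarrow> vs \<in> fl r x \<Longrightarrow> act (mpow E r g) x (st x vs) = st x (map g vs)"
proof -
  let ?P = "\<lambda>u. u \<in> thom E r r \<and>
     (\<forall>x\<in>X. \<forall>vs. length vs = r \<and> set vs \<subseteq> fibre E x \<longrightarrow>
        u (x, st x vs) = (x, st x (map g vs)))"
  have gm: "map g vs \<in> fl r x" if "vs \<in> fl r x" for x vs by (rule fl_map[OF unitary_adj(6)[OF g] that])
  have am: "map (madj E E g) vs \<in> fl r x" if "vs \<in> fl r x" for x vs by (rule fl_map[OF unitary_adj(7)[OF g] that])
  have "\<exists>!u. ?P u"
  proof (rule ex_ex1I)
    have "\<exists>u\<in>thom E r r. \<forall>x\<in>X. \<forall>ws\<in>fl r x. \<forall>vs\<in>fl r x. K u x ws vs = st x (map g vs) ws"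
    proof (rule thom_of_kernel)
      fix x vs assume x: "x \<in> X" and vs: "vs \<in> fl r x"
      show "\<exists>T\<in>TF r x. \<forall>ws\<in>fl r x. T ws = st x (map g vs) ws"
        by (rule bexI[OF _ st_TF[OF gm[OF vs]]]) simp
    next
      fix x ws assume x: "x \<in> X" and ws: "ws \<in> fl r x"
      show "\<exists>T\<in>TF r x. \<forall>vs\<in>fl r x. T vs = cnj (st x (map g vs) ws)"
        by (rule bexI[OF _ st_TF[OF am[OF ws]]])
          (simp add: st_map_adjoint[OF g ws] st_cnj[OF am[OF ws]])
    next
      fix U \<phi> I J assume \<phi>: "otriv U \<phi>" and I: "I \<in> multi_index d r" and J: "J \<in> multi_index d r"
      have fr: "frame E {..<d} U (\<lambda>i y. \<phi> (y, unit_vec d i))" using \<phi> by (simp add: otriv_def)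
      have nth: "I ! i < d" "J ! i < d" if "i < r" for i
      proof -
        have "I ! i \<in> set I" "J ! i \<in> set J" using I J that by (auto intro!: nth_mem simp: multi_index_def)
        then show "I ! i < d" "J ! i < d" using I J by (auto simp: multi_index_def)
      qed
      have "continuous_map (subtopology (bbase E) U) euclidean
          (\<lambda>y. \<Prod>i<r. bherm E (\<phi> (y, unit_vec d (I ! i))) (g (\<phi> (y, unit_vec d (J ! i)))))"
        by (intro continuous_map_prod' EE.bmor_coefficient_cont[OF unitary_adj(1)[OF g] fr fr]) (simp_all add: nth)
      then show "continuous_map (subtopology (bbase E) U) euclidean (\<lambda>y. st y (map g (sec \<phi> y J)) (sec \<phi> y I))"
      proof (rule continuous_map_eq)
        fix y assume "y \<in> topspace (subtopology (bbase E) U)"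
        then have y: "y \<in> U" by simp
        have "length I = r" "length J = r" using I J by (auto simp: multi_index_def)
        then show "(\<Prod>i<r. bherm E (\<phi> (y, unit_vec d (I ! i))) (g (\<phi> (y, unit_vec d (J ! i))))) =
            st y (map g (sec \<phi> y J)) (sec \<phi> y I)"
          using sec_fl[OF \<phi> y I] by (simp add: simple_tensor_def fl_def tuples_def) (simp add: sec_def)
      qed
    qed
    then obtain u where u: "u \<in> thom E r r"
      and Ku: "\<And>x ws vs. x \<in> X \<Longrightarrow> ws \<in> fl r x \<Longrightarrow> vs \<in> fl r x \<Longrightarrow> K u x ws vs = st x (map g vs) ws"
      by blast
    have "u (x, st x vs) = (x, st x (map g vs))" if x: "x \<in> X" and vs: "vs \<in> fl r x" for x vs
    proof -
      have "act u x (st x vs) = st x (map g vs)"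
        by (rule TF_eqI[OF x thom_act(2)[OF u x st_TF[OF vs]] st_TF[OF gm[OF vs]]])
          (use Ku[OF x L_fl[OF x] vs] in \<open>simp add: K_def\<close>)
      then show ?thesis using thom_act(1)[OF u x st_TF[OF vs]] by simp
    qed
    then show "\<exists>u. ?P u" using u by (auto simp: fl_def tuples_def)
  next
    fix u u' assume u: "?P u" and u': "?P u'"
    show "u = u'"
      by (rule thom_eqI_st) (use u u' in \<open>auto simp: fl_def tuples_def\<close>)
  qed
  from theI'[OF this] have P: "?P (mpow E r g)" unfolding mpow_def .
  then show "mpow E r g \<in> thom E r r" by blast
  show "act (mpow E r g) x (st x vs) = st x (map g vs)" if "x \<in> X" "vs \<in> fl r x"
    using P that by (simp add: act_def fl_def tuples_def)
qed

lemma act_mpow: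
  assumes g: "g \<in> unitaries E" and x: "x \<in> X" and T: "T \<in> TF r x" and ws: "ws \<in> fl r x"
  shows "act (mpow E r g) x T ws = T (map (madj E E g) ws)"
proof -
  have "act (mpow E r g) x T ws = (\<Sum>bs\<in>L r x. T bs * st x bs (map (madj E E g) ws))"
    unfolding act_L[OF mpow(1)[OF g] x T]
    by (intro sum.cong refl) (simp add: K_def mpow(2)[OF g x L_fl[OF x]] st_map_adjoint[OF g ws L_fl[OF x]])
  then show ?thesis using TF_L[OF x T, of "map (madj E E g) ws"] by simp
qed

lemma hat:
  assumes g: "g \<in> unitaries E" and t: "t \<in> thom E r s"
  shows "hat E r s g t \<in> thom E r s"
    "x \<in> X \<Longrightarrow> ws \<in> fl s x \<Longrightarrow> vs \<in> fl r x \<Longrightarrow>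
      K (hat E r s g t) x ws vs = K t x (map (madj E E g) ws) (map (madj E E g) vs)"
proof -
  note ga = madj_in_unitaries[OF g]
  note m = mpow(1)[OF ga, of r] and m' = mpow(1)[OF g, of s]
  note c = thom_closed(3)[OF m t]
  show "hat E r s g t \<in> thom E r s" unfolding hat_def by (rule thom_closed(3)[OF c m'])
  assume x: "x \<in> X" and ws: "ws \<in> fl s x" and vs: "vs \<in> fl r x"
  note S = st_TF[OF vs]
  have gv: "map (madj E E g) vs \<in> fl r x" by (rule fl_map[OF unitary_adj(7)[OF g] vs])
  show "K (hat E r s g t) x ws vs = K t x (map (madj E E g) ws) (map (madj E E g) vs)"
    unfolding K_def hat_def act_mcomp[OF c x S] act_mcomp[OF m x S] mpow(2)[OF ga x vs]
    by (rule act_mpow[OF g x thom_act(2)[OF t x st_TF[OF gv]] ws])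
qed

text \<open>Invariance turns into a condition on the kernel alone, with the adjoints applied to all
  vectors at once; compositions and powers disappear.\<close>

lemma invariant_hom_iff:
  assumes G: "G \<subseteq> unitaries E"
  shows "t \<in> invariant_hom E G r s \<longleftrightarrow> t \<in> thom E r s \<and>
    (\<forall>g\<in>G. \<forall>x\<in>X. \<forall>ws\<in>fl s x. \<forall>vs\<in>fl r x. K t x (map (madj E E g) ws) (map (madj E E g) vs) = K t x ws vs)"
proof -
  have "hat E r s g t = t \<longleftrightarrow>
      (\<forall>x\<in>X. \<forall>ws\<in>fl s x. \<forall>vs\<in>fl r x. K t x (map (madj E E g) ws) (map (madj E E g) vs) = K t x ws vs)"
    if g: "g \<in> unitaries E" and t: "t \<in> thom E r s" for g
  proof
    assume "hat E r s g t = t"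
    then show "\<forall>x\<in>X. \<forall>ws\<in>fl s x. \<forall>vs\<in>fl r x. K t x (map (madj E E g) ws) (map (madj E E g) vs) = K t x ws vs"
      using hat(2)[OF g t] by simp
  next
    assume "\<forall>x\<in>X. \<forall>ws\<in>fl s x. \<forall>vs\<in>fl r x. K t x (map (madj E E g) ws) (map (madj E E g) vs) = K t x ws vs"
    then show "hat E r s g t = t"
      by (intro thom_eqI[OF hat(1)[OF g t] t]) (simp add: hat(2)[OF g t])
  qed
  then show ?thesis using G unfolding invariant_hom_def by blast
qed

end

section \<open>Flips, partial traces and norms\<close>

definition mdiff :: "('x, 'e) hbundle \<Rightarrow> ('x, 'f) hbundle \<Rightarrow> ('e \<Rightarrow> 'f) \<Rightarrow> ('e \<Rightarrow> 'f) \<Rightarrow> 'e \<Rightarrow> 'f" where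
  "mdiff E F t t' = madd E F t (mscale E F (-1) t')"

context framed_pair
begin

lemma mdiff_bmor: "t \<in> bmor F F' \<Longrightarrow> t' \<in> bmor F F' \<Longrightarrow> mdiff F F' t t' \<in> bmor F F'"
  unfolding mdiff_def by (intro madd_bmor mscale_bmor)

lemma madd_eq: "v \<in> fibre F x \<Longrightarrow> madd F F' t t' v = badd F' (t v) (t' v)"
  by (simp add: madd_def F.fibre_topspace)

lemma mscale_eq: "v \<in> fibre F x \<Longrightarrow> mscale F F' a t v = bscale F' a (t v)"
  by (simp add: mscale_def F.fibre_topspace)

lemma herm_mdiff:
  assumes t: "t \<in> bmor F F'" and t': "t' \<in> bmor F F'" and v: "v \<in> fibre F x" and w: "w \<in> fibre F' x"
  shows "bherm F' w (mdiff F F' t t' v) = bherm F' w (t v) - bherm F' w (t' v)"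
  unfolding mdiff_def madd_eq[OF v] mscale_eq[OF v]
    F'.herm_add[OF w bmor_fibre[OF t v] F'.scale_fibre[OF bmor_fibre[OF t' v]]]
    F'.herm_scale[OF w bmor_fibre[OF t' v]] by simp

lemma mdiff_zeroD:
  assumes comp: "compact_space (bbase F)" and t: "t \<in> bmor F F'" and t': "t' \<in> bmor F F'"
    and 0: "mnorm F F' (mdiff F F' t t') = 0"
  shows "t = t'"
proof (rule bmor_eqI[OF t t'])
  fix v assume "v \<in> topspace (btotal F)"
  then have v: "v \<in> fibre F (bproj F v)" by (rule F.topspace_fibre)
  show "t v = t' v"
  proof (rule F'.herm_eqI[OF bmor_fibre[OF t v] bmor_fibre[OF t' v]])
    fix w assume w: "w \<in> fibre F' (bproj F v)"
    show "bherm F' w (t v) = bherm F' w (t' v)"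
      using mnorm_herm_bound[OF comp mdiff_bmor[OF t t'] v w] herm_mdiff[OF t t' v w] 0 by simp
  qed
qed

lemma madj_bound:
  assumes comp: "compact_space (bbase F)" and t: "t \<in> bmor F F'" and w: "w \<in> fibre F' x"
  shows "bnorm F (madj F F' t w) \<le> mnorm F F' t * bnorm F' w"
proof -
  interpret opp: framed_pair F' I' F I
    by unfold_locales (rule same_base[symmetric])
  note aw = opp.bmor_fibre[OF madj(1)[OF t] w]
  show ?thesis
  proof (rule F.bnorm_le_dual[OF aw])
    show "0 \<le> mnorm F F' t * bnorm F' w"
      using mnorm_nonneg[OF comp t] F'.bnorm_nonneg[OF w] by simp
    fix v assume v: "v \<in> fibre F x"
    have "cmod (bherm F v (madj F F' t w)) = cmod (bherm F' w (t v))"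
      using F.herm_cnj[OF v aw] madj(2)[OF t v w] by (metis complex_mod_cnj)
    also have "\<dots> \<le> mnorm F F' t * bnorm F v * bnorm F' w"
      by (rule mnorm_herm_bound[OF comp t v w])
    finally show "cmod (bherm F v (madj F F' t w)) \<le> mnorm F F' t * bnorm F' w * bnorm F v"
      by (simp add: mult_ac)
  qed
qed

text \<open>For \<open>c\<close> outside the half line, the segment from \<open>-c\<close> to \<open>M - c\<close> lies in an open half plane, so
  that multiplication by a small \<open>\<kappa>\<close> moves it into the disc of radius \<open>1\<close> around \<open>1\<close>.\<close>

lemma half_line_contraction:
  fixes c :: complex
  assumes c: "\<not> (Im c = 0 \<and> Re c \<ge> 0)" and M: "0 \<le> M"
  shows "\<exists>\<kappa>. \<kappa> \<noteq> 0 \<and> cmod (1 + \<kappa> * c) < 1 \<and> cmod (1 + \<kappa> * c - \<kappa> * of_real M) < 1"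
proof -
  \<comment> \<open>A quarter turn, or none, that puts both end points into the left half plane:
    subtracting the real number \<open>M\<close> leaves the imaginary part of \<open>c\<close>
    unchanged and can only lower its real part.\<close>
  define \<omega> where "\<omega> = (if Re c < 0 then 1 else if Im c > 0 then \<i> else - \<i>)"
  have w: "cmod \<omega> = 1" by (simp add: \<omega>_def)
  have R: "Re (\<omega> * c) < 0" "Re (\<omega> * (c - of_real M)) < 0"
    using c M by (auto simp: \<omega>_def split: if_splits)
  have small: "\<exists>\<delta>>0. \<forall>\<tau>. 0 < \<tau> \<and> \<tau> < \<delta> \<longrightarrow> cmod (1 + of_real \<tau> * z) < 1" if z: "Re z < 0" for z
  proof -
    have z0: "cmod z > 0" using z by auto
    have "cmod (1 + of_real \<tau> * z) < 1" if \<tau>: "0 < \<tau>" "\<tau> < (- 2 * Re z) / (cmod z)\<^sup>2" for \<tau>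
    proof -
      have "(cmod (1 + of_real \<tau> * z))\<^sup>2 = 1 + 2 * \<tau> * Re z + \<tau>\<^sup>2 * (cmod z)\<^sup>2"
        unfolding cmod_power2 by (simp add: power2_eq_square algebra_simps)
      also have "\<dots> < 1"
      proof -
        have "\<tau> * (cmod z)\<^sup>2 < - 2 * Re z" using \<tau>(2) z0 by (simp add: field_simps)
        then have "\<tau> * (\<tau> * (cmod z)\<^sup>2) < \<tau> * (- 2 * Re z)" by (rule mult_strict_left_mono[OF _ \<tau>(1)])
        then show ?thesis by (simp add: power2_eq_square mult_ac)
      qed
      finally show ?thesis by (simp add: abs_square_less_1)
    qed
    moreover have "(- 2 * Re z) / (cmod z)\<^sup>2 > 0" using z z0 by (intro divide_pos_pos zero_less_power) simp_all
    ultimately show ?thesis by blast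
  qed
  obtain \<delta>1 \<delta>2 where d: "\<delta>1 > 0" "\<delta>2 > 0"
    "\<And>\<tau>. 0 < \<tau> \<Longrightarrow> \<tau> < \<delta>1 \<Longrightarrow> cmod (1 + of_real \<tau> * (\<omega> * c)) < 1"
    "\<And>\<tau>. 0 < \<tau> \<Longrightarrow> \<tau> < \<delta>2 \<Longrightarrow> cmod (1 + of_real \<tau> * (\<omega> * (c - of_real M))) < 1"
    using small[OF R(1)] small[OF R(2)] by blast
  define \<tau> where "\<tau> = min \<delta>1 \<delta>2 / 2"
  have \<tau>: "0 < \<tau>" "\<tau> < \<delta>1" "\<tau> < \<delta>2" using d(1,2) by (auto simp: \<tau>_def)
  have "of_real \<tau> * \<omega> \<noteq> 0" using \<tau>(1) w by auto
  moreover have "cmod (1 + of_real \<tau> * \<omega> * c) < 1" using d(3)[OF \<tau>(1,2)] by (simp add: mult.assoc)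
  moreover have "cmod (1 + of_real \<tau> * \<omega> * c - of_real \<tau> * \<omega> * of_real M) < 1"
    using d(4)[OF \<tau>(1,3)] by (simp add: algebra_simps)
  ultimately show ?thesis by blast
qed

text \<open>Prepares a Neumann series: the operator is
  \<open>1 - \<kappa> (t\<^sup>* t - c)\<close>, so a norm below 1 makes
  \<open>t\<^sup>* t - c\<close> invertible. Estimating quadratic forms on the fibres replaces
  spectral theory.\<close>

lemma positive_contraction:
  assumes comp: "compact_space (bbase F)" and t: "t \<in> bmor F F'" and c: "\<not> (Im c = 0 \<and> Re c \<ge> 0)"
  shows "\<exists>\<kappa>. \<kappa> \<noteq> 0 \<and> mnorm F F (madd F F (mscale F F (1 + \<kappa> * c) (mid F))
      (mscale F F (- \<kappa>) (mcomp F (madj F F' t) t))) < 1"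
proof -
  interpret opp: framed_pair F' I' F I
    by unfold_locales (rule same_base[symmetric])
  interpret self: framed_pair F I F I by unfold_locales (rule refl)
  define m where "m = mnorm F F' t"
  have m0: "0 \<le> m" unfolding m_def by (rule mnorm_nonneg[OF comp t])
  define M where "M = m\<^sup>2"
  obtain \<kappa> where \<kappa>: "\<kappa> \<noteq> 0" "cmod (1 + \<kappa> * c) < 1" "cmod (1 + \<kappa> * c - \<kappa> * of_real M) < 1"
    using half_line_contraction[OF c, of M] by (auto simp: M_def)
  define \<alpha> where "\<alpha> = 1 + \<kappa> * c"
  define \<beta> where "\<beta> = - \<kappa>"
  define N where "N = max (cmod \<alpha>) (cmod (\<alpha> + \<beta> * of_real M))"
  have N: "0 \<le> N" "N < 1" using \<kappa> by (auto simp: N_def \<alpha>_def \<beta>_def max_def)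
  let ?a = "mcomp F (madj F F' t) t"
  let ?u = "madd F F (mscale F F \<alpha> (mid F)) (mscale F F \<beta> ?a)"
  have a: "?a \<in> bmor F F" by (rule mcomp_bmor[OF t madj(1)[OF t]])
  have "bnorm F (?u v) \<le> N * bnorm F v" if v: "v \<in> fibre F x" for x v
  proof -
    define w where "w = ?a v"
    have w: "w \<in> fibre F x" unfolding w_def by (rule self.bmor_fibre[OF a v])
    have w_eq: "w = madj F F' t (t v)" using F.fibre_topspace[OF v] by (simp add: w_def mcomp_def)
    note tv = bmor_fibre[OF t v]
    define q where "q = (bnorm F' (t v))\<^sup>2"
    define p where "p = (bnorm F v)\<^sup>2"
    have wv: "bherm F w v = of_real q"
      unfolding w_eq madj(2)[OF t v tv] q_def by (rule F'.herm_self[OF tv])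
    have vw: "bherm F v w = of_real q" using F.herm_cnj[OF w v] wv by simp
    have q: "0 \<le> q" "q \<le> M * p"
      using power_mono[OF mnorm_bound[OF comp t v] F'.bnorm_nonneg[OF tv], of 2]
      by (simp_all add: q_def M_def p_def m_def power_mult_distrib)
    have ww: "(bnorm F w)\<^sup>2 \<le> M * q"
      using power_mono[OF madj_bound[OF comp t tv] F.bnorm_nonneg[OF w[unfolded w_eq]], of 2]
      by (simp add: q_def M_def m_def power_mult_distrib w_eq)
    have vt: "v \<in> topspace (btotal F)" by (rule F.fibre_topspace[OF v])
    have u: "?u v = badd F (bscale F \<alpha> v) (bscale F \<beta> w)"
      using vt by (simp add: self.madd_eq[OF v] self.mscale_eq[OF v] mid_def w_def)
    have s: "bscale F \<alpha> v \<in> fibre F x" "bscale F \<beta> w \<in> fibre F x"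
      by (rule F.scale_fibre[OF v], rule F.scale_fibre[OF w])
    have "bherm F (?u v) (?u v) = \<alpha> * cnj \<alpha> * of_real p + cnj \<alpha> * \<beta> * of_real q + cnj (cnj \<alpha> * \<beta>) * of_real q +
        \<beta> * cnj \<beta> * bherm F w w"
      unfolding u F.herm_add_left[OF s F.add_fibre[OF s]] F.herm_add[OF s(1) s] F.herm_add[OF s(2) s]
        F.herm_scale_left[OF v s(1)] F.herm_scale_left[OF v s(2)] F.herm_scale_left[OF w s(1)]
        F.herm_scale_left[OF w s(2)] F.herm_scale[OF v v] F.herm_scale[OF v w] F.herm_scale[OF w v]
        F.herm_scale[OF w w] wv vw F.herm_self[OF v] p_def
      by (simp add: algebra_simps)
    then have "(bnorm F (?u v))\<^sup>2 = (cmod \<alpha>)\<^sup>2 * p + 2 * Re (cnj \<alpha> * \<beta>) * q + (cmod \<beta>)\<^sup>2 * (bnorm F w)\<^sup>2"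
      unfolding F.herm_self[OF w] F.herm_self[OF self.bmor_fibre[OF self.madd_bmor[OF
          self.mscale_bmor[OF F.mid_bmor] self.mscale_bmor[OF a]] v]]
        complex_norm_square[symmetric]
      by (simp add: complex_eq_iff)
    also have "\<dots> \<le> (cmod \<alpha>)\<^sup>2 * p + 2 * Re (cnj \<alpha> * \<beta>) * q + (cmod \<beta>)\<^sup>2 * (M * q)"
      using ww by (simp add: mult_left_mono)
    also have "\<dots> = (cmod \<alpha>)\<^sup>2 * p + q * (2 * Re (cnj \<alpha> * \<beta>) + (cmod \<beta>)\<^sup>2 * M)"
      by (simp add: algebra_simps)
    also have "\<dots> \<le> N\<^sup>2 * p"
    proof -
      \<comment> \<open>The bound is affine in \<open>q\<close> with slope \<gamma>, and
        \<open>q\<close> ranges over an interval from \<open>0\<close> to \<open>M * p\<close>. It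
        is largest at an end point, and the two end points give \<open>cmod \<alpha>\<close> and
        \<open>cmod (\<alpha> + \<beta> * of_real M)\<close>.\<close>
      define \<gamma> where "\<gamma> = 2 * Re (cnj \<alpha> * \<beta>) + (cmod \<beta>)\<^sup>2 * M"
      have p0: "0 \<le> p" by (simp add: p_def)
      have Na: "(cmod \<alpha>)\<^sup>2 \<le> N\<^sup>2" "(cmod (\<alpha> + \<beta> * of_real M))\<^sup>2 \<le> N\<^sup>2"
        by (intro power_mono; simp add: N_def)+
      show ?thesis
      proof (cases "\<gamma> \<le> 0")
        case True
        then have "q * \<gamma> \<le> 0" using q(1) by (simp add: mult_nonneg_nonpos)
        moreover have "(cmod \<alpha>)\<^sup>2 * p \<le> N\<^sup>2 * p" by (rule mult_right_mono[OF Na(1) p0])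
        ultimately show ?thesis unfolding \<gamma>_def by linarith
      next
        case False
        then have "q * \<gamma> \<le> M * p * \<gamma>" using q(2) by (simp add: mult_right_mono)
        moreover have "(cmod (\<alpha> + \<beta> * of_real M))\<^sup>2 = (cmod \<alpha>)\<^sup>2 + M * \<gamma>"
          unfolding \<gamma>_def cmod_power2 by (simp add: power2_eq_square algebra_simps)
        moreover have "(cmod (\<alpha> + \<beta> * of_real M))\<^sup>2 * p \<le> N\<^sup>2 * p" by (rule mult_right_mono[OF Na(2) p0])
        ultimately show ?thesis unfolding \<gamma>_def[symmetric] by (simp add: algebra_simps)
      qed
    qed
    also have "\<dots> = (N * bnorm F v)\<^sup>2" by (simp add: p_def power_mult_distrib)
    finally show ?thesis
      by (rule power2_le_imp_le) (intro mult_nonneg_nonneg N(1) F.bnorm_nonneg[OF v])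
  qed
  then have "mnorm F F ?u \<le> N" by (rule self.mnorm_least[OF N(1)])
  then show ?thesis using N(2) \<kappa>(1) unfolding \<alpha>_def \<beta>_def by (intro exI[of _ \<kappa>]) simp
qed

end

context herm_bundle
begin

lemma act_mtensor_st:
  assumes "t \<in> thom E r s" "t' \<in> thom E r' s'" "x \<in> X" "v1 \<in> fl r x" "v2 \<in> fl r' x"
  shows "act (mtensor E r s r' s' t t') x (st x (v1 @ v2)) = tensor_vec s (act t x (st x v1)) (act t' x (st x v2))"
  using mtensor(2)[OF assms(1-3) st_TF[OF assms(4)] st_TF[OF assms(5)]] tensor_vec_st[OF assms(3-5)] by simp

lemma mcomp_mid:
  assumes t: "t \<in> thom E r s"
  shows "mcomp (tpow E r) (mid (tpow E s)) t = t" "mcomp (tpow E r) t (mid (tpow E r)) = t"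
proof -
  show "mcomp (tpow E r) (mid (tpow E s)) t = t"
  proof (rule thom_eqI[OF thom_closed(3)[OF t thom_closed(5)] t])
    fix x ws vs assume x: "x \<in> X" and vs: "vs \<in> fl r x"
    show "K (mcomp (tpow E r) (mid (tpow E s)) t) x ws vs = K t x ws vs"
      by (simp add: K_def act_mcomp[OF t x st_TF[OF vs]] act_mid[OF x thom_act(2)[OF t x st_TF[OF vs]]])
  qed
  show "mcomp (tpow E r) t (mid (tpow E r)) = t"
  proof (rule thom_eqI[OF thom_closed(3)[OF thom_closed(5) t] t])
    fix x ws vs assume x: "x \<in> X" and vs: "vs \<in> fl r x"
    show "K (mcomp (tpow E r) t (mid (tpow E r))) x ws vs = K t x ws vs"
      by (simp add: K_def act_mcomp[OF thom_closed(5) x st_TF[OF vs]] act_mid[OF x st_TF[OF vs]])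
  qed
qed

lemma mtensor_mcomp:
  assumes t: "t \<in> thom E r s" and u: "u \<in> thom E s q" and t': "t' \<in> thom E r' s'" and u': "u' \<in> thom E s' q'"
  shows "mcomp (tpow E (r + r')) (mtensor E s q s' q' u u') (mtensor E r s r' s' t t') =
    mtensor E r q r' q' (mcomp (tpow E r) u t) (mcomp (tpow E r') u' t')"
proof (rule thom_eqI)
  note c = thom_closed(3)[OF t u] and c' = thom_closed(3)[OF t' u'] and m = mtensor(1)[OF t t'] and n = mtensor(1)[OF u u']
  show "mcomp (tpow E (r + r')) (mtensor E s q s' q' u u') (mtensor E r s r' s' t t') \<in> thom E (r + r') (q + q')"
    by (rule thom_closed(3)[OF m n])
  show "mtensor E r q r' q' (mcomp (tpow E r) u t) (mcomp (tpow E r') u' t') \<in> thom E (r + r') (q + q')"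
    by (rule mtensor(1)[OF c c'])
  fix x ws vs assume x: "x \<in> X" and "vs \<in> fl (r + r') x"
  then obtain v1 v2 where v: "vs = v1 @ v2" "v1 \<in> fl r x" "v2 \<in> fl r' x" by (blast elim: fl_appendE)
  note S = st_TF[OF v(2)] and T = st_TF[OF v(3)]
  have "act (mcomp (tpow E (r + r')) (mtensor E s q s' q' u u') (mtensor E r s r' s' t t')) x (st x vs) =
      tensor_vec q (act u x (act t x (st x v1))) (act u' x (act t' x (st x v2)))"
    unfolding v(1) act_mcomp[OF m x st_TF[OF fl_append[OF v(2,3)]]] act_mtensor_st[OF t t' x v(2,3)]
    by (rule mtensor(2)[OF u u' x thom_act(2)[OF t x S] thom_act(2)[OF t' x T]])
  also have "\<dots> = act (mtensor E r q r' q' (mcomp (tpow E r) u t) (mcomp (tpow E r') u' t')) x (st x vs)"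
    unfolding v(1) act_mtensor_st[OF c c' x v(2,3)] act_mcomp[OF t x S] act_mcomp[OF t' x T] ..
  finally show "K (mcomp (tpow E (r + r')) (mtensor E s q s' q' u u') (mtensor E r s r' s' t t')) x ws vs =
      K (mtensor E r q r' q' (mcomp (tpow E r) u t) (mcomp (tpow E r') u' t')) x ws vs"
    by (simp add: K_def)
qed

lemma fl_append3E:
  assumes "ws \<in> fl (a + (b + c)) x"
  obtains w1 w2 w3 where "ws = w1 @ w2 @ w3" "w1 \<in> fl a x" "w2 \<in> fl b x" "w3 \<in> fl c x"
proof -
  obtain w1 w where 1: "ws = w1 @ w" "w1 \<in> fl a x" "w \<in> fl (b + c) x" using assms by (rule fl_appendE)
  obtain w2 w3 where 2: "w = w2 @ w3" "w2 \<in> fl b x" "w3 \<in> fl c x" using 1(3) by (rule fl_appendE)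
  show thesis by (rule that[OF _ 1(2) 2(2,3)]) (simp add: 1(1) 2(1))
qed

lemma mtensor_assoc:
  assumes t: "t \<in> thom E r s" and t': "t' \<in> thom E r' s'" and t'': "t'' \<in> thom E r'' s''"
  shows "mtensor E (r + r') (s + s') r'' s'' (mtensor E r s r' s' t t') t'' =
    mtensor E r s (r' + r'') (s' + s'') t (mtensor E r' s' r'' s'' t' t'')"
proof (rule thom_eqI)
  show "mtensor E (r + r') (s + s') r'' s'' (mtensor E r s r' s' t t') t'' \<in> thom E (r + (r' + r'')) (s + (s' + s''))"
    using mtensor(1)[OF mtensor(1)[OF t t'] t''] by (simp add: add.assoc)
  show "mtensor E r s (r' + r'') (s' + s'') t (mtensor E r' s' r'' s'' t' t'') \<in> thom E (r + (r' + r'')) (s + (s' + s''))"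
    by (rule mtensor(1)[OF t mtensor(1)[OF t' t'']])
  fix x ws vs assume x: "x \<in> X" and ws: "ws \<in> fl (s + (s' + s'')) x" and vs: "vs \<in> fl (r + (r' + r'')) x"
  obtain w1 w2 w3 where w: "ws = w1 @ w2 @ w3" "w1 \<in> fl s x" "w2 \<in> fl s' x" "w3 \<in> fl s'' x"
    using ws by (rule fl_append3E)
  obtain v1 v2 v3 where v: "vs = v1 @ v2 @ v3" "v1 \<in> fl r x" "v2 \<in> fl r' x" "v3 \<in> fl r'' x"
    using vs by (rule fl_append3E)
  have "K (mtensor E (r + r') (s + s') r'' s'' (mtensor E r s r' s' t t') t'') x ((w1 @ w2) @ w3) ((v1 @ v2) @ v3) =
      K t x w1 v1 * K t' x w2 v2 * K t'' x w3 v3"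
    by (simp only: K_mtensor[OF mtensor(1)[OF t t'] t'' x fl_append[OF w(2,3)] fl_append[OF v(2,3)] v(4)]
        K_mtensor[OF t t' x w(2) v(2,3)])
  moreover have "K (mtensor E r s (r' + r'') (s' + s'') t (mtensor E r' s' r'' s'' t' t'')) x (w1 @ w2 @ w3) (v1 @ v2 @ v3) =
      K t x w1 v1 * (K t' x w2 v2 * K t'' x w3 v3)"
    by (simp only: K_mtensor[OF t mtensor(1)[OF t' t''] x w(2) v(2) fl_append[OF v(3,4)]]
        K_mtensor[OF t' t'' x w(3) v(3,4)])
  ultimately show "K (mtensor E (r + r') (s + s') r'' s'' (mtensor E r s r' s' t t') t'') x ws vs =
      K (mtensor E r s (r' + r'') (s' + s'') t (mtensor E r' s' r'' s'' t' t'')) x ws vs"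
    by (simp add: w(1) v(1))
qed

lemma mtensor_mid: "mtensor E r r s s (mid (tpow E r)) (mid (tpow E s)) = mid (tpow E (r + s))"
proof (rule thom_eqI[OF mtensor(1)[OF thom_closed(5) thom_closed(5)] thom_closed(5)])
  fix x ws vs assume x: "x \<in> X" and ws: "ws \<in> fl (r + s) x" and vs: "vs \<in> fl (r + s) x"
  obtain w1 w2 where w: "ws = w1 @ w2" "w1 \<in> fl r x" "w2 \<in> fl s x" using ws by (rule fl_appendE)
  obtain v1 v2 where v: "vs = v1 @ v2" "v1 \<in> fl r x" "v2 \<in> fl s x" using vs by (rule fl_appendE)
  show "K (mtensor E r r s s (mid (tpow E r)) (mid (tpow E s))) x ws vs = K (mid (tpow E (r + s))) x ws vs"
    using K_mtensor[OF thom_closed(5) thom_closed(5) x w(2) v(2,3)] vs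
    by (simp add: K_mid x v w st_append[OF w(2) v(2) w(3) v(3)])
qed

lemma mtensor_mid0:
  assumes t: "t \<in> thom E r s"
  shows "mtensor E r s 0 0 t (mid (tpow E 0)) = t" "mtensor E 0 0 r s (mid (tpow E 0)) t = t"
proof -
  have n: "[] \<in> fl 0 x" for x by (simp add: fl_def)
  have m: "mtensor E r s 0 0 t (mid (tpow E 0)) \<in> thom E r s" "mtensor E 0 0 r s (mid (tpow E 0)) t \<in> thom E r s"
    using mtensor(1)[OF t thom_closed(5)[of 0]] mtensor(1)[OF thom_closed(5)[of 0] t] by simp_all
  show "mtensor E r s 0 0 t (mid (tpow E 0)) = t"
  proof (rule thom_eqI[OF m(1) t])
    fix x ws vs assume x: "x \<in> X" and ws: "ws \<in> fl s x" and vs: "vs \<in> fl r x"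
    show "K (mtensor E r s 0 0 t (mid (tpow E 0))) x ws vs = K t x ws vs"
      using K_mtensor[OF t thom_closed(5)[of 0] x ws vs n, of "[]"] K_mid[OF x n, of "[]"] by (simp add: st_Nil)
  qed
  show "mtensor E 0 0 r s (mid (tpow E 0)) t = t"
  proof (rule thom_eqI[OF m(2) t])
    fix x ws vs assume x: "x \<in> X" and ws: "ws \<in> fl s x" and vs: "vs \<in> fl r x"
    show "K (mtensor E 0 0 r s (mid (tpow E 0)) t) x ws vs = K t x ws vs"
      using K_mtensor[OF thom_closed(5)[of 0] t x n n vs, of ws] K_mid[OF x n, of "[]"] by (simp add: st_Nil)
  qed
qed

text \<open>Acting on disjoint slots in either order gives the same result; this is the source of
  the commutation relations in the algebra.\<close>

lemma mtensor_interchange: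
  assumes t: "t \<in> thom E r s" and t': "t' \<in> thom E r' s'"
  shows "mcomp (tpow E (r + r')) (mtensor E r s s' s' t (mid (tpow E s'))) (mtensor E r r r' s' (mid (tpow E r)) t') =
      mtensor E r s r' s' t t'"
    "mcomp (tpow E (r + r')) (mtensor E s s r' s' (mid (tpow E s)) t') (mtensor E r s r' r' t (mid (tpow E r'))) =
      mtensor E r s r' s' t t'"
  using mtensor_mcomp[OF thom_closed(5) t t' thom_closed(5)] mtensor_mcomp[OF t thom_closed(5) thom_closed(5) t']
  by (simp_all add: mcomp_mid[OF t] mcomp_mid[OF t'])

lemma K_mdiff:
  assumes "t \<in> thom E r s" "t' \<in> thom E r s" "x \<in> X" "vs \<in> fl r x"
  shows "K (mdiff (tpow E r) (tpow E s) t t') x ws vs = K t x ws vs - K t' x ws vs"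
  unfolding mdiff_def using assms by (simp add: K_madd thom_closed K_mscale)

definition tn :: "nat \<Rightarrow> 'x \<Rightarrow> 'e tensor \<Rightarrow> real" where
  "tn r x T = bnorm (tpow E r) (x, T)"

lemma tn_sq: "(tn r x T)\<^sup>2 = (\<Sum>bs\<in>L r x. (cmod (T bs))\<^sup>2)"
proof -
  have "tensor_herm E r x T T = of_real (\<Sum>bs\<in>L r x. (cmod (T bs))\<^sup>2)"
    by (simp add: tensor_herm_L complex_norm_square mult.commute del: of_real_power)
  then show ?thesis by (simp add: tn_def bnorm_def sum_nonneg)
qed

lemma tn_nonneg: "0 \<le> tn r x T"
proof -
  have "0 \<le> Re (tensor_herm E r x T T)"
    by (simp add: tensor_herm_L) (intro sum_nonneg, simp)
  then show ?thesis by (simp add: tn_def bnorm_def)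
qed

lemma tn_ge: "x \<in> X \<Longrightarrow> bs \<in> L r x \<Longrightarrow> cmod (T bs) \<le> tn r x T"
  by (rule power2_le_imp_le[OF _ tn_nonneg])
    (simp add: tn_sq, rule member_le_sum, auto intro: finite_L)

lemma st_L: "x \<in> X \<Longrightarrow> J \<in> L r x \<Longrightarrow> I \<in> L r x \<Longrightarrow> st x I J = (if J = I then 1 else 0)"
  using st_onb[OF onb_B, of x J r I] by simp

lemma tn_st_L:
  assumes x: "x \<in> X" and w: "w \<in> L r x"
  shows "tn r x (st x w) = 1"
proof -
  have "(tn r x (st x w))\<^sup>2 = (\<Sum>bs\<in>L r x. if bs = w then 1 else 0)"
    unfolding tn_sq by (intro sum.cong refl) (simp add: st_L[OF x _ w])
  also have "\<dots> = 1" using w finite_L[OF x] by simp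
  finally show ?thesis using tn_nonneg[of r x "st x w"] by (simp add: power2_eq_1_iff)
qed

lemma tn_tensor_vec: "tn (r + s) x (tensor_vec r S T) = tn r x S * tn s x T"
proof -
  have "(tn (r + s) x (tensor_vec r S T))\<^sup>2 = (\<Sum>us\<in>L r x. \<Sum>vs\<in>L s x. (cmod (S us))\<^sup>2 * (cmod (T vs))\<^sup>2)"
    unfolding tn_sq sum_tuples_append
    by (intro sum.cong refl) (simp add: tensor_vec_append tuples_length norm_mult power_mult_distrib)
  also have "\<dots> = (tn r x S * tn s x T)\<^sup>2"
    unfolding power_mult_distrib tn_sq sum_product ..
  finally show ?thesis using tn_nonneg by (simp add: power2_eq_iff_nonneg)
qed

end

section \<open>Norm estimates and limits over a compact base\<close>

locale compact_bundle = herm_bundle E for E :: "('x, 'e) hbundle" +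
  assumes compact: "compact_space (bbase E)"
begin

abbreviation mn :: "nat \<Rightarrow> nat \<Rightarrow> ('x \<times> 'e tensor \<Rightarrow> 'x \<times> 'e tensor) \<Rightarrow> real" where
  "mn r s \<equiv> mnorm (tpow E r) (tpow E s)"

lemma compact_tpow: "compact_space (bbase (tpow E r))"
  using compact by simp

lemma tn_act:
  assumes t: "t \<in> thom E r s" and x: "x \<in> X" and T: "T \<in> TF r x"
  shows "tn s x (act t x T) \<le> mn r s t * tn r x T"
  using TT.mnorm_bound[OF compact_tpow t, of "(x, T)" x] thom_act(1)[OF t x T]
  by (simp add: tn_def fibre_tpow[OF x] T)

lemma mn_nonneg: "t \<in> thom E r s \<Longrightarrow> 0 \<le> mn r s t"
  by (rule TT.mnorm_nonneg[OF compact_tpow])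

lemma mn_least:
  assumes "0 \<le> C" "t \<in> thom E r s" "\<And>x T. x \<in> X \<Longrightarrow> T \<in> TF r x \<Longrightarrow> tn s x (act t x T) \<le> C * tn r x T"
  shows "mn r s t \<le> C"
proof (rule TT.mnorm_least[OF assms(1)])
  fix x v assume "v \<in> fibre (tpow E r) x"
  then obtain T where T: "v = (x, T)" "T \<in> TF r x" "x \<in> X" by (rule fibre_tpowE)
  show "bnorm (tpow E s) (t v) \<le> C * bnorm (tpow E r) v"
    using assms(3)[OF T(3,2)] thom_act(1)[OF assms(2) T(3,2)] by (simp add: T(1) tn_def)
qed

lemma mn_dual:
  assumes C: "0 \<le> C" and t: "t \<in> thom E r s"
    and h: "\<And>x T S. x \<in> X \<Longrightarrow> T \<in> TF r x \<Longrightarrow> S \<in> TF s x \<Longrightarrow>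
      cmod (tensor_herm E s x S (act t x T)) \<le> C * tn r x T * tn s x S"
  shows "mn r s t \<le> C"
proof (rule TT.mnorm_le_dual[OF C TT.bmor_fibre[OF t]])
  fix x v w assume "v \<in> fibre (tpow E r) x" "w \<in> fibre (tpow E s) x"
  then obtain T S where T: "v = (x, T)" "T \<in> TF r x" "x \<in> X" and S: "w = (x, S)" "S \<in> TF s x"
    by (metis fibre_tpowE)
  show "cmod (bherm (tpow E s) w (t v)) \<le> C * bnorm (tpow E r) v * bnorm (tpow E s) w"
    using h[OF T(3,2) S(2)] thom_act(1)[OF t T(3,2)] by (simp add: T(1) S(1) tn_def)
qed

lemma herm_act:
  assumes t: "t \<in> thom E r s" and x: "x \<in> X" and T: "T \<in> TF r x" and S: "S \<in> TF s x"
  shows "cmod (tensor_herm E s x S (act t x T)) \<le> mn r s t * tn r x T * tn s x S"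
  using TT.mnorm_herm_bound[OF compact_tpow t, of "(x, T)" x "(x, S)"] thom_act(1)[OF t x T]
  by (simp add: tn_def fibre_tpow[OF x] T S)

lemma K_bound:
  assumes t: "t \<in> thom E r s" and x: "x \<in> X" and vs: "vs \<in> fl r x" and ws: "ws \<in> fl s x"
  shows "cmod (K t x ws vs) \<le> mn r s t * tn r x (st x vs) * tn s x (st x ws)"
  using herm_act[OF t x st_TF[OF vs] st_TF[OF ws]]
    tensor_herm_st[OF x thom_act(2)[OF t x st_TF[OF vs]] ws]
  by (simp add: K_def)

text \<open>Test on tensors \<open>T \<otimes> w\<close> with a basis tensor \<open>w\<close> that
  \<open>z\<close> maps to norm at least 1; norms of tensor products multiply. The entry may depend
  on the point, since the norm is a supremum over fibres.\<close>

lemma mn_mtensor_lower: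
  assumes y: "y \<in> thom E p u" and z: "z \<in> thom E q q'"
    and big: "\<And>x. x \<in> X \<Longrightarrow> \<exists>w\<in>L q x. \<exists>w'\<in>L q' x. 1 \<le> cmod (K z x w' w)"
  shows "mn p u y \<le> mn (p + q) (u + q') (mtensor E p u q q' y z)"
proof (rule mn_least[OF mn_nonneg[OF mtensor(1)[OF y z]] y])
  fix x T assume x: "x \<in> X" and T: "T \<in> TF p x"
  obtain w w' where w: "w \<in> L q x" "w' \<in> L q' x" "1 \<le> cmod (K z x w' w)" using big[OF x] by blast
  note W = st_TF[OF L_fl[OF x w(1)]]
  have "tn u x (act y x T) * 1 \<le> tn u x (act y x T) * tn q' x (act z x (st x w))"
    using w(3) tn_ge[OF x w(2), of "act z x (st x w)"]
    by (intro mult_left_mono[OF _ tn_nonneg]) (simp add: K_def)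
  also have "\<dots> = tn (u + q') x (act (mtensor E p u q q' y z) x (tensor_vec p T (st x w)))"
    unfolding mtensor(2)[OF y z x T W] tn_tensor_vec ..
  also have "\<dots> \<le> mn (p + q) (u + q') (mtensor E p u q q' y z) * tn (p + q) x (tensor_vec p T (st x w))"
    by (rule tn_act[OF mtensor(1)[OF y z] x tensor_vec_TF[OF x T W]])
  also have "tn (p + q) x (tensor_vec p T (st x w)) = tn p x T"
    by (simp add: tn_tensor_vec tn_st_L[OF x w(1)])
  finally show "tn u x (act y x T) \<le> mn (p + q) (u + q') (mtensor E p u q q' y z) * tn p x T" by simp
qed

lemma thom_uniform_limit:
  assumes f: "\<And>n::nat. f n \<in> thom E r s"
    and cauchy: "\<And>e. 0 < e \<Longrightarrow> \<exists>N. \<forall>m\<ge>N. \<forall>n\<ge>N. mn r s (mdiff (tpow E r) (tpow E s) (f m) (f n)) \<le> e"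
  shows "\<exists>t\<in>thom E r s. \<forall>e>0. \<exists>N. \<forall>n\<ge>N. mn r s (mdiff (tpow E r) (tpow E s) (f n) t) \<le> e"
proof -
  let ?d = "mdiff (tpow E r) (tpow E s)"
  have bound: "cmod (bherm (tpow E s) w (t v) - bherm (tpow E s) w (t' v)) \<le>
      e * bnorm (tpow E r) v * bnorm (tpow E s) w"
    if "t \<in> thom E r s" "t' \<in> thom E r s" "mn r s (?d t t') \<le> e" "v \<in> fibre (tpow E r) x" "w \<in> fibre (tpow E s) x"
    for t t' e v w x
  proof -
    have "cmod (bherm (tpow E s) w (?d t t' v)) \<le> mn r s (?d t t') * bnorm (tpow E r) v * bnorm (tpow E s) w"
      by (rule TT.mnorm_herm_bound[OF compact_tpow TT.mdiff_bmor[OF that(1,2)] that(4,5)])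
    also have "\<dots> \<le> e * bnorm (tpow E r) v * bnorm (tpow E s) w"
      by (intro mult_right_mono that(3) T.bnorm_nonneg[OF that(4)] T.bnorm_nonneg[OF that(5)])
    finally show ?thesis unfolding TT.herm_mdiff[OF that(1,2,4,5)] .
  qed
  have "\<exists>t\<in>thom E r s. \<forall>e>0. \<exists>N. \<forall>n\<ge>N. \<forall>x. \<forall>v\<in>fibre (tpow E r) x. \<forall>w\<in>fibre (tpow E s) x.
      cmod (bherm (tpow E s) w (f n v) - bherm (tpow E s) w (t v)) \<le> e * bnorm (tpow E r) v * bnorm (tpow E s) w"
    by (rule TT.bmor_uniform_limit[OF f]) (meson cauchy bound f)
  then obtain t where t: "t \<in> thom E r s"
    and lim: "\<And>e. e > 0 \<Longrightarrow> \<exists>N. \<forall>n\<ge>N. \<forall>x. \<forall>v\<in>fibre (tpow E r) x. \<forall>w\<in>fibre (tpow E s) x.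
      cmod (bherm (tpow E s) w (f n v) - bherm (tpow E s) w (t v)) \<le> e * bnorm (tpow E r) v * bnorm (tpow E s) w"
    by blast
  have "\<exists>N. \<forall>n\<ge>N. mn r s (?d (f n) t) \<le> e" if e: "e > 0" for e
  proof -
    obtain N where N: "\<And>n x v w. n \<ge> N \<Longrightarrow> v \<in> fibre (tpow E r) x \<Longrightarrow> w \<in> fibre (tpow E s) x \<Longrightarrow>
      cmod (bherm (tpow E s) w (f n v) - bherm (tpow E s) w (t v)) \<le> e * bnorm (tpow E r) v * bnorm (tpow E s) w"
      using lim[OF e] by blast
    have "mn r s (?d (f n) t) \<le> e" if n: "n \<ge> N" for n
    proof (rule TT.mnorm_le_dual)
      show "0 \<le> e" using e by simp
      show "?d (f n) t v \<in> fibre (tpow E s) x" if "v \<in> fibre (tpow E r) x" for x v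
        by (rule TT.bmor_fibre[OF TT.mdiff_bmor[OF f t] that])
      show "cmod (bherm (tpow E s) w (?d (f n) t v)) \<le> e * bnorm (tpow E r) v * bnorm (tpow E s) w"
        if "v \<in> fibre (tpow E r) x" "w \<in> fibre (tpow E s) x" for x v w
        unfolding TT.herm_mdiff[OF f t that] by (rule N[OF n that])
    qed
    then show ?thesis by blast
  qed
  then show ?thesis using t by blast
qed

section \<open>Flips of blocks and partial traces\<close>

lemma flip_exists: "\<exists>f\<in>thom E (n + n) (n + n). \<forall>x\<in>X. \<forall>ws\<in>fl (n + n) x. \<forall>vs\<in>fl (n + n) x.
    K f x ws vs = st x (drop n vs @ take n vs) ws"
proof (rule thom_of_kernel)
  fix x vs assume x: "x \<in> X" and vs: "vs \<in> fl (n + n) x"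
  show "\<exists>T\<in>TF (n + n) x. \<forall>ws\<in>fl (n + n) x. T ws = st x (drop n vs @ take n vs) ws"
    by (rule bexI[OF _ st_TF[OF fl_append[OF fl_take_drop(2)[OF vs] fl_take_drop(1)[OF vs]]]]) simp
next
  fix x ws assume x: "x \<in> X" and ws: "ws \<in> fl (n + n) x"
  obtain w1 w2 where w: "ws = w1 @ w2" "w1 \<in> fl n x" "w2 \<in> fl n x" using ws by (rule fl_appendE)
  have "st x (w2 @ w1) vs = cnj (st x (drop n vs @ take n vs) ws)" if vs: "vs \<in> fl (n + n) x" for vs
  proof -
    obtain v1 v2 where v: "vs = v1 @ v2" "v1 \<in> fl n x" "v2 \<in> fl n x" using vs by (rule fl_appendE)
    have "st x (w2 @ w1) vs = st x w2 v1 * st x w1 v2"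
      unfolding v(1) by (rule st_append[OF v(2) w(3) v(3) w(2)])
    also have "\<dots> = cnj (st x v1 w2) * cnj (st x v2 w1)"
      using st_cnj[OF w(3) v(2)] st_cnj[OF w(2) v(3)] by simp
    also have "\<dots> = cnj (st x (v2 @ v1) (w1 @ w2))"
      unfolding st_append[OF w(2) v(3) w(3) v(2)] by simp
    finally show ?thesis using fl_length[OF v(2)] by (simp add: v(1) w(1))
  qed
  then show "\<exists>T\<in>TF (n + n) x. \<forall>vs\<in>fl (n + n) x. T vs = cnj (st x (drop n vs @ take n vs) ws)"
    by (intro bexI[OF _ st_TF[OF fl_append[OF w(3,2)]]]) blast
next
  fix U \<phi> I J assume \<phi>: "otriv U \<phi>" and I: "I \<in> multi_index d (n + n)" and J: "J \<in> multi_index d (n + n)"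
  have J': "drop n J @ take n J \<in> tuples {..<d} (n + n)"
    using multi_index_append[OF J] unfolding multi_index_tuples by (intro tuples_append)
  \<comment> \<open>In an orthonormal frame the flip is a permutation matrix, the same at every
    point.\<close>
  have "continuous_map (subtopology (bbase E) U) euclidean
      (\<lambda>y. if I = drop n J @ take n J then 1 else 0 :: complex)" by simp
  then show "continuous_map (subtopology (bbase E) U) euclidean
      (\<lambda>y. st y (drop n (sec \<phi> y J) @ take n (sec \<phi> y J)) (sec \<phi> y I))"
  proof (rule continuous_map_eq)
    fix y assume "y \<in> topspace (subtopology (bbase E) U)"
    then have y: "y \<in> U" by simp
    show "(if I = drop n J @ take n J then 1 else 0) =
        st y (drop n (sec \<phi> y J) @ take n (sec \<phi> y J)) (sec \<phi> y I)"
      unfolding sec_take_drop sec_append[symmetric]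
      using st_onb[OF otriv_onb[OF \<phi> y] I[unfolded multi_index_tuples] J'] by (simp add: sec_def)
  qed
qed

text \<open>Two blocks of equal length \<open>n\<close> are exchanged: length 1 serves to separate
  degrees, general \<open>n\<close> to move surplus slots aside.\<close>

definition flip :: "nat \<Rightarrow> 'x \<times> 'e tensor \<Rightarrow> 'x \<times> 'e tensor" where
  "flip n = (SOME f. f \<in> thom E (n + n) (n + n) \<and> (\<forall>x\<in>X. \<forall>ws\<in>fl (n + n) x. \<forall>vs\<in>fl (n + n) x.
    K f x ws vs = st x (drop n vs @ take n vs) ws))"

lemma flip:
  "flip n \<in> thom E (n + n) (n + n)"
  "x \<in> X \<Longrightarrow> a \<in> fl n x \<Longrightarrow> b \<in> fl n x \<Longrightarrow> c \<in> fl n x \<Longrightarrow> e \<in> fl n x \<Longrightarrow>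
    K (flip n) x (a @ b) (c @ e) = st x e a * st x c b"
proof -
  have "\<exists>f. f \<in> thom E (n + n) (n + n) \<and> (\<forall>x\<in>X. \<forall>ws\<in>fl (n + n) x. \<forall>vs\<in>fl (n + n) x.
    K f x ws vs = st x (drop n vs @ take n vs) ws)"
    using flip_exists by blast
  from someI_ex[OF this] have P: "flip n \<in> thom E (n + n) (n + n) \<and> (\<forall>x\<in>X. \<forall>ws\<in>fl (n + n) x. \<forall>vs\<in>fl (n + n) x.
    K (flip n) x ws vs = st x (drop n vs @ take n vs) ws)"
    unfolding flip_def .
  then show "flip n \<in> thom E (n + n) (n + n)" by blast
  assume x: "x \<in> X" and m: "a \<in> fl n x" "b \<in> fl n x" "c \<in> fl n x" "e \<in> fl n x"
  have "K (flip n) x (a @ b) (c @ e) = st x (drop n (c @ e) @ take n (c @ e)) (a @ b)"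
    using P x fl_append[OF m(1,2)] fl_append[OF m(3,4)] by blast
  then show "K (flip n) x (a @ b) (c @ e) = st x e a * st x c b"
    using st_append[OF m(1,4,2,3)] fl_length[OF m(3)] by simp
qed

lemma act_flip:
  assumes x: "x \<in> X" and c: "c \<in> fl n x" and e: "e \<in> fl n x"
  shows "act (flip n) x (st x (c @ e)) = st x (e @ c)"
proof (rule TF_eqI[OF x thom_act(2)[OF flip(1) x st_TF[OF fl_append[OF c e]]] st_TF[OF fl_append[OF e c]]])
  fix ws assume "ws \<in> L (n + n) x"
  then have "ws \<in> fl (n + n) x" by (rule L_fl[OF x])
  then obtain a b where w: "ws = a @ b" "a \<in> fl n x" "b \<in> fl n x" by (rule fl_appendE)
  show "act (flip n) x (st x (c @ e)) ws = st x (e @ c) ws"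
    using flip(2)[OF x w(2,3) c e] st_append[OF w(2) e w(3) c] by (simp add: K_def w(1))
qed

lemma flip_self_adjoint: "madj (tpow E (n + n)) (tpow E (n + n)) (flip n) = flip n"
proof (rule thom_eqI[OF thom_closed(4)[OF flip(1)] flip(1)])
  fix x ws vs assume x: "x \<in> X" and ws: "ws \<in> fl (n + n) x" and vs: "vs \<in> fl (n + n) x"
  obtain a b where w: "ws = a @ b" "a \<in> fl n x" "b \<in> fl n x" using ws by (rule fl_appendE)
  obtain c e where v: "vs = c @ e" "c \<in> fl n x" "e \<in> fl n x" using vs by (rule fl_appendE)
  show "K (madj (tpow E (n + n)) (tpow E (n + n)) (flip n)) x ws vs = K (flip n) x ws vs"
    unfolding K_madj[OF flip(1) x vs ws]
    unfolding v(1) w(1) flip(2)[OF x v(2,3) w(2,3)] flip(2)[OF x w(2,3) v(2,3)]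
    by (simp add: st_cnj[OF v(2) w(3)] st_cnj[OF v(3) w(2)] mult.commute)
qed

lemma flip_involution: "mcomp (tpow E (n + n)) (flip n) (flip n) = mid (tpow E (n + n))"
proof (rule thom_eqI[OF thom_closed(3)[OF flip(1) flip(1)] thom_closed(5)])
  fix x ws vs assume x: "x \<in> X" and vs: "vs \<in> fl (n + n) x"
  obtain c e where v: "vs = c @ e" "c \<in> fl n x" "e \<in> fl n x" using vs by (rule fl_appendE)
  note S = st_TF[OF vs]
  show "K (mcomp (tpow E (n + n)) (flip n) (flip n)) x ws vs = K (mid (tpow E (n + n))) x ws vs"
    unfolding K_def act_mcomp[OF flip(1) x S] act_mid[OF x S]
    unfolding v(1) act_flip[OF x v(2,3)] act_flip[OF x v(3,2)] ..
qed

lemma act_mid_flip: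
  assumes x: "x \<in> X" and T: "T \<in> TF (s + (n + n)) x" and u: "u \<in> fl s x" and a: "a \<in> fl n x" and b: "b \<in> fl n x"
  shows "act (mtensor E s s (n + n) (n + n) (mid (tpow E s)) (flip n)) x T (u @ a @ b) = T (u @ b @ a)"
proof -
  note m = mtensor(1)[OF thom_closed(5) flip(1)]
  have "act (mtensor E s s (n + n) (n + n) (mid (tpow E s)) (flip n)) x T (u @ a @ b) =
      (\<Sum>bs\<in>L (s + (n + n)) x. T bs * st x bs (u @ b @ a))"
    unfolding act_L[OF m x T]
  proof (intro sum.cong refl)
    fix bs assume "bs \<in> L (s + (n + n)) x"
    then have "bs \<in> fl (s + (n + n)) x" by (rule L_fl[OF x])
    then obtain u' a' b' where w: "bs = u' @ a' @ b'" "u' \<in> fl s x" "a' \<in> fl n x" "b' \<in> fl n x"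
      by (rule fl_append3E)
    have "K (mtensor E s s (n + n) (n + n) (mid (tpow E s)) (flip n)) x (u @ a @ b) (u' @ a' @ b') =
        st x u' u * (st x b' a * st x a' b)"
      unfolding K_mtensor[OF thom_closed(5) flip(1) x u w(2) fl_append[OF w(3,4)]] K_mid[OF x w(2)]
        flip(2)[OF x a b w(3,4)] ..
    also have "\<dots> = st x (u' @ a' @ b') (u @ b @ a)"
      unfolding st_append[OF u w(2) fl_append[OF b a] fl_append[OF w(3,4)]] st_append[OF b w(3) a w(4)]
      by simp
    finally show "T bs * K (mtensor E s s (n + n) (n + n) (mid (tpow E s)) (flip n)) x (u @ a @ b) bs =
        T bs * st x bs (u @ b @ a)" by (simp add: w(1))
  qed
  also have "\<dots> = T (u @ b @ a)" by (rule TF_L[OF x T, symmetric])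
  finally show ?thesis .
qed

lemma st_slot:
  assumes x: "x \<in> X" and v: "v \<in> fl a x" and us: "us \<in> fl n x" and c: "onb E I x c" and I: "finite I"
  shows "st x (v @ us) ws = (\<Sum>J\<in>tuples I n. st x us (map c J) * st x (v @ map c J) ws)"
proof -
  have cm: "map c J \<in> fl n x" if "J \<in> tuples I n" for J
    unfolding fl_def by (rule tuples_map[OF onbD(1)[OF c] that])
  have "st x (v @ us) ws = tensor_vec a (st x v) (st x us) ws" by (simp add: tensor_vec_st[OF x v us])
  also have "\<dots> = st x v (take a ws) * (\<Sum>J\<in>tuples I n. st x us (map c J) * st x (map c J) (drop a ws))"
    unfolding tensor_vec_def by (subst TF_expand[OF st_TF[OF us] c I, of "drop a ws"]) (rule refl)
  also have "\<dots> = (\<Sum>J\<in>tuples I n. st x us (map c J) * tensor_vec a (st x v) (st x (map c J)) ws)"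
    unfolding sum_distrib_left tensor_vec_def by (intro sum.cong refl) simp
  also have "\<dots> = (\<Sum>J\<in>tuples I n. st x us (map c J) * st x (v @ map c J) ws)"
    by (intro sum.cong refl) (simp add: tensor_vec_st[OF x v cm])
  finally show ?thesis .
qed

lemma TF_slot:
  assumes x: "x \<in> X" and R: "R \<in> TF (b + n) x" and w: "w \<in> fl b x" and us: "us \<in> fl n x"
    and c: "onb E I x c" and I: "finite I"
  shows "R (w @ us) = (\<Sum>J\<in>tuples I n. st x (map c J) us * R (w @ map c J))"
proof -
  have cm: "map c J \<in> fl n x" if "J \<in> tuples I n" for J
    unfolding fl_def by (rule tuples_map[OF onbD(1)[OF c] that])
  have "R (w @ us) = (\<Sum>bs\<in>L (b + n) x. cnj (st x (w @ us) bs) * R bs)"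
    using tensor_herm_st[OF x R fl_append[OF w us]] unfolding tensor_herm_L by simp
  also have "\<dots> = (\<Sum>bs\<in>L (b + n) x. \<Sum>J\<in>tuples I n. cnj (st x us (map c J)) * (cnj (st x (w @ map c J) bs) * R bs))"
    by (intro sum.cong refl, subst st_slot[OF x w us c I]) (simp add: sum_distrib_right mult.assoc)
  also have "\<dots> = (\<Sum>J\<in>tuples I n. cnj (st x us (map c J)) * tensor_herm E (b + n) x (st x (w @ map c J)) R)"
    unfolding tensor_herm_L by (subst sum.swap) (simp add: sum_distrib_left)
  also have "\<dots> = (\<Sum>J\<in>tuples I n. st x (map c J) us * R (w @ map c J))"
    by (intro sum.cong refl) (simp add: tensor_herm_st[OF x R fl_append[OF w cm]] st_cnj[OF cm us])
  finally show ?thesis .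
qed

lemma K_slot:
  assumes t: "t \<in> thom E (a + n) q" and x: "x \<in> X" and v: "v \<in> fl a x" and us: "us \<in> fl n x"
    and c: "onb E I x c" and I: "finite I"
  shows "K t x ws (v @ us) = (\<Sum>J\<in>tuples I n. st x us (map c J) * K t x ws (v @ map c J))"
proof -
  have cm: "map c J \<in> fl n x" if "J \<in> tuples I n" for J
    unfolding fl_def by (rule tuples_map[OF onbD(1)[OF c] that])
  have "act t x (st x (v @ us)) = act t x (\<lambda>ws. \<Sum>J\<in>tuples I n. st x us (map c J) * st x (v @ map c J) ws)"
    by (rule arg_cong[where f = "act t x"]) (rule ext, rule st_slot[OF x v us c I])
  also have "\<dots> = (\<lambda>ws. \<Sum>J\<in>tuples I n. st x us (map c J) * act t x (st x (v @ map c J)) ws)"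
    by (rule act_sum[OF t x finite_tuples[OF I]]) (rule st_TF[OF fl_append[OF v cm]])
  finally show ?thesis by (simp add: K_def)
qed

text \<open>The basis behind \<open>L n x\<close> varies arbitrarily with the point, so continuity
  of the partial trace is visible only in a frame. The linear argument is expanded in the new basis,
  and the sum over the old one is then absorbed into the conjugate linear argument.\<close>

lemma partial_trace_onb:
  assumes t: "t \<in> thom E (a + n) (b + n)" and x: "x \<in> X" and w: "w \<in> fl b x" and v: "v \<in> fl a x"
    and c: "onb E I x c" and I: "finite I"
  shows "(\<Sum>bs\<in>L n x. K t x (w @ bs) (v @ bs)) = (\<Sum>J\<in>tuples I n. K t x (w @ map c J) (v @ map c J))"
proof -
  have cm: "map c J \<in> fl n x" if "J \<in> tuples I n" for J
    unfolding fl_def by (rule tuples_map[OF onbD(1)[OF c] that])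
  have "(\<Sum>bs\<in>L n x. K t x (w @ bs) (v @ bs)) =
      (\<Sum>bs\<in>L n x. \<Sum>J\<in>tuples I n. st x bs (map c J) * K t x (w @ bs) (v @ map c J))"
    by (intro sum.cong refl K_slot[OF t x v _ c I] L_fl[OF x])
  also have "\<dots> = (\<Sum>J\<in>tuples I n. \<Sum>bs\<in>L n x. st x bs (map c J) * K t x (w @ bs) (v @ map c J))"
    by (rule sum.swap)
  also have "\<dots> = (\<Sum>J\<in>tuples I n. K t x (w @ map c J) (v @ map c J))"
  proof (intro sum.cong refl)
    fix J assume J: "J \<in> tuples I n"
    note R = K_TF[OF t x fl_append[OF v cm[OF J]]]
    show "(\<Sum>bs\<in>L n x. st x bs (map c J) * K t x (w @ bs) (v @ map c J)) = K t x (w @ map c J) (v @ map c J)"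
      using TF_slot[OF x R w cm[OF J] onb_B[OF x] finite_B[OF x]] by simp
  qed
  finally show ?thesis .
qed

lemma TF_slice:
  assumes x: "x \<in> X" and R: "R \<in> TF (b + n) x" and us: "us \<in> fl n x"
  shows "\<exists>T\<in>TF b x. \<forall>w\<in>fl b x. T w = R (w @ us)"
proof
  let ?T = "\<lambda>w. \<Sum>cs\<in>L (b + n) x. (R cs * st x (drop b cs) us) * st x (take b cs) w"
  show "?T \<in> TF b x"
    by (intro TF_sum[OF x] TF_scale[OF x] st_TF fl_take_drop(1)[where s = n] L_fl[OF x])
  show "\<forall>w\<in>fl b x. ?T w = R (w @ us)"
  proof
    fix w assume w: "w \<in> fl b x"
    show "?T w = R (w @ us)"
      unfolding TF_L[OF x R, of "w @ us"]
    proof (intro sum.cong refl)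
      fix cs assume "cs \<in> L (b + n) x"
      then have "cs \<in> fl (b + n) x" by (rule L_fl[OF x])
      then obtain c1 c2 where c: "cs = c1 @ c2" "c1 \<in> fl b x" "c2 \<in> fl n x" by (rule fl_appendE)
      show "R cs * st x (drop b cs) us * st x (take b cs) w = R cs * st x cs (w @ us)"
        using st_append[OF w c(2) us c(3)] fl_length[OF c(2)] by (simp add: c(1))
    qed
  qed
qed

lemma partial_trace_exists:
  assumes t: "t \<in> thom E (a + n) (b + n)"
  shows "\<exists>u\<in>thom E a b. \<forall>x\<in>X. \<forall>w\<in>fl b x. \<forall>v\<in>fl a x.
    K u x w v = inverse (of_nat d ^ n) * (\<Sum>bs\<in>L n x. K t x (w @ bs) (v @ bs))"
proof (rule thom_of_kernel)
  fix x v assume x: "x \<in> X" and v: "v \<in> fl a x"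
  have "\<exists>T\<in>TF b x. \<forall>w\<in>fl b x. T w = K t x (w @ bs) (v @ bs)" if "bs \<in> L n x" for bs
    by (rule TF_slice[OF x K_TF[OF t x fl_append[OF v L_fl[OF x that]]] L_fl[OF x that]])
  then obtain T where T: "\<And>bs. bs \<in> L n x \<Longrightarrow> T bs \<in> TF b x \<and> (\<forall>w\<in>fl b x. T bs w = K t x (w @ bs) (v @ bs))"
    by metis
  show "\<exists>T\<in>TF b x. \<forall>w\<in>fl b x. T w = inverse (of_nat d ^ n) * (\<Sum>bs\<in>L n x. K t x (w @ bs) (v @ bs))"
  proof
    show "(\<lambda>w. inverse (of_nat d ^ n) * (\<Sum>bs\<in>L n x. T bs w)) \<in> TF b x"
      by (intro TF_scale[OF x] TF_sum[OF x]) (use T in blast)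
  qed (use T in \<open>simp cong: sum.cong\<close>)
next
  fix x w assume x: "x \<in> X" and w: "w \<in> fl b x"
  note a = thom_closed(4)[OF t]
  have "\<exists>T\<in>TF a x. \<forall>v\<in>fl a x. T v = cnj (K t x (w @ bs) (v @ bs))" if bs: "bs \<in> L n x" for bs
    using TF_slice[OF x K_TF[OF a x fl_append[OF w L_fl[OF x bs]]] L_fl[OF x bs]]
      K_madj[OF t x fl_append[OF w L_fl[OF x bs]] fl_append[OF _ L_fl[OF x bs]]] by metis
  then obtain T where T: "\<And>bs. bs \<in> L n x \<Longrightarrow> T bs \<in> TF a x \<and> (\<forall>v\<in>fl a x. T bs v = cnj (K t x (w @ bs) (v @ bs)))"
    by metis
  show "\<exists>T\<in>TF a x. \<forall>v\<in>fl a x. T v = cnj (inverse (of_nat d ^ n) * (\<Sum>bs\<in>L n x. K t x (w @ bs) (v @ bs)))"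
  proof
    show "(\<lambda>w. inverse (of_nat d ^ n) * (\<Sum>bs\<in>L n x. T bs w)) \<in> TF a x"
      by (intro TF_scale[OF x] TF_sum[OF x]) (use T in blast)
  qed (use T in \<open>simp cong: sum.cong\<close>)
next
  fix U \<phi> I J assume \<phi>: "otriv U \<phi>" and I: "I \<in> multi_index d b" and J: "J \<in> multi_index d a"
  have "continuous_map (subtopology (bbase E) U) euclidean
     (\<lambda>y. inverse (of_nat d ^ n) * (\<Sum>M\<in>multi_index d n. K t y (sec \<phi> y (I @ M)) (sec \<phi> y (J @ M))))"
    by (intro continuous_map_arith K_cont[OF t \<phi>])
      (use I J in \<open>auto simp: multi_index_tuples intro: tuples_append\<close>)
  then show "continuous_map (subtopology (bbase E) U) euclidean
     (\<lambda>y. inverse (of_nat d ^ n) * (\<Sum>bs\<in>L n y. K t y (sec \<phi> y I @ bs) (sec \<phi> y J @ bs)))"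
  proof (rule continuous_map_eq)
    fix y assume "y \<in> topspace (subtopology (bbase E) U)"
    then have y: "y \<in> U" "y \<in> X" by auto
    show "inverse (of_nat d ^ n) * (\<Sum>M\<in>multi_index d n. K t y (sec \<phi> y (I @ M)) (sec \<phi> y (J @ M))) =
        inverse (of_nat d ^ n) * (\<Sum>bs\<in>L n y. K t y (sec \<phi> y I @ bs) (sec \<phi> y J @ bs))"
      unfolding partial_trace_onb[OF t y(2) sec_fl[OF \<phi> y(1) I] sec_fl[OF \<phi> y(1) J] otriv_onb[OF \<phi> y(1)] finite_lessThan]
      by (simp add: multi_index_tuples sec_def)
  qed
qed

text \<open>Normalized by \<open>d ^ n\<close>, so that for positive rank it undoes tensoring with
  the identity of \<open>n\<close> slots, and never increases norms.\<close>

definition ptr :: "nat \<Rightarrow> nat \<Rightarrow> nat \<Rightarrow> ('x \<times> 'e tensor \<Rightarrow> 'x \<times> 'e tensor) \<Rightarrow> 'x \<times> 'e tensor \<Rightarrow> 'x \<times> 'e tensor" where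
  "ptr a b n t = (SOME u. u \<in> thom E a b \<and> (\<forall>x\<in>X. \<forall>w\<in>fl b x. \<forall>v\<in>fl a x.
    K u x w v = inverse (of_nat d ^ n) * (\<Sum>bs\<in>L n x. K t x (w @ bs) (v @ bs))))"

lemma ptr:
  assumes t: "t \<in> thom E (a + n) (b + n)"
  shows "ptr a b n t \<in> thom E a b"
    "x \<in> X \<Longrightarrow> w \<in> fl b x \<Longrightarrow> v \<in> fl a x \<Longrightarrow>
      K (ptr a b n t) x w v = inverse (of_nat d ^ n) * (\<Sum>bs\<in>L n x. K t x (w @ bs) (v @ bs))"
proof -
  have "\<exists>u. u \<in> thom E a b \<and> (\<forall>x\<in>X. \<forall>w\<in>fl b x. \<forall>v\<in>fl a x.
    K u x w v = inverse (of_nat d ^ n) * (\<Sum>bs\<in>L n x. K t x (w @ bs) (v @ bs)))"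
    using partial_trace_exists[OF t] by blast
  from someI_ex[OF this, folded ptr_def]
  show "ptr a b n t \<in> thom E a b"
    "x \<in> X \<Longrightarrow> w \<in> fl b x \<Longrightarrow> v \<in> fl a x \<Longrightarrow>
      K (ptr a b n t) x w v = inverse (of_nat d ^ n) * (\<Sum>bs\<in>L n x. K t x (w @ bs) (v @ bs))"
    by blast+
qed

lemma sum_st_L: "x \<in> X \<Longrightarrow> bs \<in> L n x \<Longrightarrow> (\<Sum>cs\<in>L n x. st x bs cs * f cs) = f bs"
proof -
  assume x: "x \<in> X" and bs: "bs \<in> L n x"
  have "(\<Sum>cs\<in>L n x. st x bs cs * f cs) = (\<Sum>cs\<in>L n x. if cs = bs then f bs else 0)"
    by (intro sum.cong refl) (simp add: st_L[OF x _ bs])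
  then show ?thesis using bs finite_L[OF x] by simp
qed

lemma card_L: "x \<in> X \<Longrightarrow> card (L n x) = d ^ n"
  by (simp add: card_tuples finite_B card_B)

text \<open>A matrix coefficient of the partial trace is an average of \<open>d ^ n\<close>
  coefficients of \<open>t\<close>, taken at \<open>T \<otimes> bs\<close> and
  \<open>S \<otimes> bs\<close>, and tensoring with a basis tensor preserves norms.\<close>

lemma mn_ptr:
  assumes t: "t \<in> thom E (a + n) (b + n)"
  shows "mn a b (ptr a b n t) \<le> mn (a + n) (b + n) t"
proof (rule mn_dual[OF mn_nonneg[OF t] ptr(1)[OF t]])
  fix x T S assume x: "x \<in> X" and T: "T \<in> TF a x" and S: "S \<in> TF b x"
  let ?h = "\<lambda>bs. tensor_herm E (b + n) x (tensor_vec b S (st x bs)) (act t x (tensor_vec a T (st x bs)))"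
  have TT: "tensor_vec a T (st x bs) \<in> TF (a + n) x" "tensor_vec b S (st x bs) \<in> TF (b + n) x"
    if "bs \<in> L n x" for bs
    using that by (auto intro!: tensor_vec_TF[OF x] T S st_TF L_fl[OF x])
  have h: "?h bs = (\<Sum>w\<in>L b x. \<Sum>v\<in>L a x. cnj (S w) * (T v * K t x (w @ bs) (v @ bs)))" if bs: "bs \<in> L n x" for bs
  proof -
    have a: "act t x (tensor_vec a T (st x bs)) ws = (\<Sum>v\<in>L a x. T v * K t x ws (v @ bs))" for ws
    proof -
      have "act t x (tensor_vec a T (st x bs)) ws = (\<Sum>v\<in>L a x. \<Sum>cs\<in>L n x. st x bs cs * (T v * K t x ws (v @ cs)))"
        unfolding act_L[OF t x TT(1)[OF bs]] sum_tuples_append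
        by (intro sum.cong refl) (simp add: tensor_vec_append tuples_length)
      then show ?thesis by (simp add: sum_st_L[OF x bs])
    qed
    have "?h bs = (\<Sum>w\<in>L b x. \<Sum>cs\<in>L n x. st x bs cs * (cnj (S w) * act t x (tensor_vec a T (st x bs)) (w @ cs)))"
      unfolding tensor_herm_L sum_tuples_append
      by (intro sum.cong refl) (simp add: tensor_vec_append tuples_length st_L[OF x _ bs])
    also have "\<dots> = (\<Sum>w\<in>L b x. cnj (S w) * act t x (tensor_vec a T (st x bs)) (w @ bs))"
      by (simp add: sum_st_L[OF x bs])
    finally show ?thesis unfolding a by (simp add: sum_distrib_left)
  qed
  have "tensor_herm E b x S (act (ptr a b n t) x T) =
      (\<Sum>w\<in>L b x. \<Sum>v\<in>L a x. \<Sum>bs\<in>L n x. inverse (of_nat d ^ n) * (cnj (S w) * (T v * K t x (w @ bs) (v @ bs))))"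
    unfolding tensor_herm_L act_L[OF ptr(1)[OF t] x T] sum_distrib_left
    by (intro sum.cong refl) (simp add: ptr(2)[OF t x L_fl[OF x] L_fl[OF x]] sum_distrib_left mult_ac)
  also have "\<dots> = inverse (of_nat d ^ n) * (\<Sum>bs\<in>L n x. ?h bs)"
    unfolding sum.swap[of _ "L n x" "L a x"] sum.swap[of _ "L n x" "L b x"]
    by (simp add: h sum_distrib_left)
  finally have "cmod (tensor_herm E b x S (act (ptr a b n t) x T)) =
      inverse (real d ^ n) * cmod (\<Sum>bs\<in>L n x. ?h bs)"
    by (simp add: norm_mult norm_inverse norm_power)
  also have "\<dots> \<le> inverse (real d ^ n) * (\<Sum>bs\<in>L n x. mn (a + n) (b + n) t * tn a x T * tn b x S)"
  proof (intro mult_left_mono order_trans[OF norm_sum] sum_mono)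
    fix bs assume bs: "bs \<in> L n x"
    show "cmod (?h bs) \<le> mn (a + n) (b + n) t * tn a x T * tn b x S"
      using herm_act[OF t x TT[OF bs]] by (simp add: tn_tensor_vec tn_st_L[OF x bs])
  qed simp
  also have "\<dots> = (inverse (real d ^ n) * real d ^ n) * (mn (a + n) (b + n) t * tn a x T * tn b x S)"
    by (simp add: card_L[OF x])
  also have "\<dots> \<le> 1 * (mn (a + n) (b + n) t * tn a x T * tn b x S)"
  proof (rule mult_right_mono)
    \<comment> \<open>Equality unless \<open>d ^ n\<close> is zero, where the inverse is zero by
      convention.\<close>
    show "inverse (real d ^ n) * real d ^ n \<le> 1" by (metis left_inverse mult_zero_right order_refl zero_le_one)
  qed (intro mult_nonneg_nonneg mn_nonneg[OF t] tn_nonneg)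
  finally show "cmod (tensor_herm E b x S (act (ptr a b n t) x T)) \<le> mn (a + n) (b + n) t * tn a x T * tn b x S"
    by simp
qed

text \<open>A morphism that hardly changes when its last \<open>n\<close> slots are moved \<open>n\<close> places to the right is close
  to a morphism not acting on them at all, namely to its partial trace: apply the partial trace over the
  last \<open>n\<close> slots to the difference of the two.\<close>

lemma shift_invariant_close:
  assumes d0: "d > 0" and y: "y \<in> thom E (r + n) (s + n)"
  defines "Y \<equiv> mtensor E (r + n) (s + n) n n y (mid (tpow E n))"
  defines "P \<equiv> \<lambda>q. mtensor E q q (n + n) (n + n) (mid (tpow E q)) (flip n)"
  defines "Z \<equiv> mcomp (tpow E (r + (n + n))) (P s) (mcomp (tpow E (r + (n + n))) Y (P r))"
  shows "Y \<in> thom E (r + (n + n)) (s + (n + n))" "P q \<in> thom E (q + (n + n)) (q + (n + n))"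
    "\<exists>F\<in>thom E r s. mn (r + n) (s + n) (mdiff (tpow E (r + n)) (tpow E (s + n))
        (mtensor E r s n n F (mid (tpow E n))) y) \<le>
      mn (r + (n + n)) (s + (n + n)) (mdiff (tpow E (r + (n + n))) (tpow E (s + (n + n))) Z Y)"
proof -
  have Y: "Y \<in> thom E (r + n + n) (s + n + n)" unfolding Y_def by (rule mtensor(1)[OF y thom_closed(5)])
  then show Y': "Y \<in> thom E (r + (n + n)) (s + (n + n))" by (simp add: add.assoc)
  have P: "P q \<in> thom E (q + (n + n)) (q + (n + n))" for q
    unfolding P_def by (rule mtensor(1)[OF thom_closed(5) flip(1)])
  then show "P q \<in> thom E (q + (n + n)) (q + (n + n))" .
  have YP: "mcomp (tpow E (r + (n + n))) Y (P r) \<in> thom E (r + (n + n)) (s + (n + n))"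
    by (rule thom_closed(3)[OF P Y'])
  have Z': "Z \<in> thom E (r + (n + n)) (s + (n + n))" unfolding Z_def by (rule thom_closed(3)[OF YP P])
  then have Z: "Z \<in> thom E (r + n + n) (s + n + n)" by (simp add: add.assoc)
  define F where "F = ptr r s n y"
  have F: "F \<in> thom E r s" unfolding F_def by (rule ptr(1)[OF y])
  have F1: "mtensor E r s n n F (mid (tpow E n)) \<in> thom E (r + n) (s + n)"
    by (rule mtensor(1)[OF F thom_closed(5)])
  \<comment> \<open>Conjugation by the flips makes \<open>y\<close> act past one untouched block:
    the middle vectors \<open>a\<close> and \<open>a'\<close> are paired by the identity, while
    \<open>b\<close> and \<open>b'\<close> enter \<open>y\<close>.\<close>
  have KZ: "K Z x (u @ a @ b) (v @ a' @ b') = K y x (u @ b) (v @ b') * st x a' a"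
    if x: "x \<in> X" and u: "u \<in> fl s x" and v: "v \<in> fl r x" and ab: "a \<in> fl n x" "b \<in> fl n x" "a' \<in> fl n x" "b' \<in> fl n x"
    for x u v a b a' b'
  proof -
    have V: "st x (v @ a' @ b') \<in> TF (r + (n + n)) x" by (intro st_TF fl_append v ab)
    have Pv: "act (P r) x (st x (v @ a' @ b')) = st x ((v @ b') @ a')"
      unfolding P_def act_mtensor_st[OF thom_closed(5) flip(1) x v fl_append[OF ab(3,4)]]
        act_mid[OF x st_TF[OF v]] act_flip[OF x ab(3,4)] tensor_vec_st[OF x v fl_append[OF ab(4,3)]] by simp
    have "K Z x (u @ a @ b) (v @ a' @ b') = act (P s) x (act Y x (act (P r) x (st x (v @ a' @ b')))) (u @ a @ b)"
      unfolding K_def Z_def act_mcomp[OF YP x V] act_mcomp[OF P x V] ..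
    also have "\<dots> = act Y x (act (P r) x (st x (v @ a' @ b'))) (u @ b @ a)"
      unfolding P_def by (rule act_mid_flip[OF x _ u ab(1,2)])
        (rule thom_act(2)[OF Y' x], rule thom_act(2)[OF P[unfolded P_def] x V])
    also have "\<dots> = K Y x ((u @ b) @ a) ((v @ b') @ a')"
      unfolding Pv K_def by simp
    also have "\<dots> = K y x (u @ b) (v @ b') * st x a' a"
      unfolding Y_def K_mtensor[OF y thom_closed(5) x fl_append[OF u ab(2)] fl_append[OF v ab(4)] ab(3)]
        K_mid[OF x ab(3)] ..
    finally show ?thesis .
  qed
  \<comment> \<open>In \<open>Z\<close> the block that is traced out is one on which
    \<open>y\<close> acts, so the trace reaches into \<open>y\<close> and the identity on the middle
    block survives.\<close>
  have pZ: "ptr (r + n) (s + n) n Z = mtensor E r s n n F (mid (tpow E n))"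
  proof (rule thom_eqI[OF ptr(1)[OF Z] F1])
    fix x ws vs assume x: "x \<in> X" and ws: "ws \<in> fl (s + n) x" and vs: "vs \<in> fl (r + n) x"
    obtain u a where w: "ws = u @ a" "u \<in> fl s x" "a \<in> fl n x" using ws by (rule fl_appendE)
    obtain v a' where v: "vs = v @ a'" "v \<in> fl r x" "a' \<in> fl n x" using vs by (rule fl_appendE)
    have "K (ptr (r + n) (s + n) n Z) x ws vs =
        inverse (of_nat d ^ n) * (\<Sum>bs\<in>L n x. K y x (u @ bs) (v @ bs) * st x a' a)"
      unfolding ptr(2)[OF Z x ws vs] using KZ[OF x w(2) v(2) w(3) L_fl[OF x] v(3) L_fl[OF x]]
      by (simp add: w(1) v(1) cong: sum.cong)
    also have "\<dots> = K F x u v * st x a' a"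
      unfolding F_def ptr(2)[OF y x w(2) v(2)] by (simp add: sum_distrib_right[symmetric])
    also have "\<dots> = K (mtensor E r s n n F (mid (tpow E n))) x ws vs"
      unfolding w(1) v(1) K_mtensor[OF F thom_closed(5) x w(2) v(2,3)] K_mid[OF x v(3)] ..
    finally show "K (ptr (r + n) (s + n) n Z) x ws vs = K (mtensor E r s n n F (mid (tpow E n))) x ws vs" .
  qed
  \<comment> \<open>In \<open>Y\<close> the traced block carries only the identity; its
    \<open>d ^ n\<close> equal summands cancel the normalization, by positivity of the rank.\<close>
  have pY: "ptr (r + n) (s + n) n Y = y"
  proof (rule thom_eqI[OF ptr(1)[OF Y] y])
    fix x ws vs assume x: "x \<in> X" and ws: "ws \<in> fl (s + n) x" and vs: "vs \<in> fl (r + n) x"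
    have "(\<Sum>bs\<in>L n x. K Y x (ws @ bs) (vs @ bs)) = (\<Sum>bs\<in>L n x. K y x ws vs)"
    proof (intro sum.cong refl)
      fix bs assume bs: "bs \<in> L n x"
      note f = L_fl[OF x bs]
      show "K Y x (ws @ bs) (vs @ bs) = K y x ws vs"
        unfolding Y_def K_mtensor[OF y thom_closed(5) x ws vs f] K_mid[OF x f] st_L[OF x bs bs] by simp
    qed
    then show "K (ptr (r + n) (s + n) n Y) x ws vs = K y x ws vs"
      unfolding ptr(2)[OF Y x ws vs] using d0 by (simp add: card_L[OF x])
  qed
  note D = TT.mdiff_bmor[OF Z Y]
  have "ptr (r + n) (s + n) n (mdiff (tpow E (r + n + n)) (tpow E (s + n + n)) Z Y) =
      mdiff (tpow E (r + n)) (tpow E (s + n)) (ptr (r + n) (s + n) n Z) (ptr (r + n) (s + n) n Y)"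
  proof (rule thom_eqI[OF ptr(1)[OF D] TT.mdiff_bmor[OF ptr(1)[OF Z] ptr(1)[OF Y]]])
    fix x ws vs assume x: "x \<in> X" and ws: "ws \<in> fl (s + n) x" and vs: "vs \<in> fl (r + n) x"
    have "K (mdiff (tpow E (r + n + n)) (tpow E (s + n + n)) Z Y) x (ws @ bs) (vs @ bs) =
        K Z x (ws @ bs) (vs @ bs) - K Y x (ws @ bs) (vs @ bs)" if "bs \<in> L n x" for bs
      by (rule K_mdiff[OF Z Y x fl_append[OF vs L_fl[OF x that]]])
    then have "(\<Sum>bs\<in>L n x. K (mdiff (tpow E (r + n + n)) (tpow E (s + n + n)) Z Y) x (ws @ bs) (vs @ bs)) =
        (\<Sum>bs\<in>L n x. K Z x (ws @ bs) (vs @ bs)) - (\<Sum>bs\<in>L n x. K Y x (ws @ bs) (vs @ bs))"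
      unfolding sum_subtractf[symmetric] by (intro sum.cong refl)
    then show "K (ptr (r + n) (s + n) n (mdiff (tpow E (r + n + n)) (tpow E (s + n + n)) Z Y)) x ws vs =
        K (mdiff (tpow E (r + n)) (tpow E (s + n)) (ptr (r + n) (s + n) n Z) (ptr (r + n) (s + n) n Y)) x ws vs"
      unfolding ptr(2)[OF D x ws vs] K_mdiff[OF ptr(1)[OF Z] ptr(1)[OF Y] x vs] ptr(2)[OF Z x ws vs] ptr(2)[OF Y x ws vs]
      by (simp only: right_diff_distrib)
  qed
  with mn_ptr[OF D] have "mn (r + n) (s + n) (mdiff (tpow E (r + n)) (tpow E (s + n))
        (mtensor E r s n n F (mid (tpow E n))) y) \<le>
      mn (r + n + n) (s + n + n) (mdiff (tpow E (r + n + n)) (tpow E (s + n + n)) Z Y)"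
    by (simp add: pZ pY)
  then show "\<exists>F\<in>thom E r s. mn (r + n) (s + n) (mdiff (tpow E (r + n)) (tpow E (s + n))
        (mtensor E r s n n F (mid (tpow E n))) y) \<le>
      mn (r + (n + n)) (s + (n + n)) (mdiff (tpow E (r + (n + n))) (tpow E (s + (n + n))) Z Y)"
    using F by (auto simp: add.assoc)
qed

section \<open>Operations on invariant morphisms and their limits\<close>

lemma invariant_closed:
  assumes G: "G \<subseteq> unitaries E"
  shows "t \<in> invariant_hom E G r s \<Longrightarrow> t \<in> thom E r s"
    "t \<in> invariant_hom E G r s \<Longrightarrow> t' \<in> invariant_hom E G r s \<Longrightarrow> madd (tpow E r) (tpow E s) t t' \<in> invariant_hom E G r s"
    "t \<in> invariant_hom E G r s \<Longrightarrow> mscale (tpow E r) (tpow E s) a t \<in> invariant_hom E G r s"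
    "t \<in> invariant_hom E G r s \<Longrightarrow> u \<in> invariant_hom E G s q \<Longrightarrow> mcomp (tpow E r) u t \<in> invariant_hom E G r q"
    "t \<in> invariant_hom E G r s \<Longrightarrow> madj (tpow E r) (tpow E s) t \<in> invariant_hom E G s r"
    "mid (tpow E r) \<in> invariant_hom E G r r"
    "t \<in> invariant_hom E G r s \<Longrightarrow> u \<in> invariant_hom E G r' s' \<Longrightarrow> mtensor E r s r' s' t u \<in> invariant_hom E G (r + r') (s + s')"
    "flip n \<in> invariant_hom E G (n + n) (n + n)"
proof -
  note iff = invariant_hom_iff[OF G]
  have g_fl: "map (madj E E g) vs \<in> fl r x" if "g \<in> G" "vs \<in> fl r x" for g vs r x
    by (rule fl_map[OF unitary_adj(7) that(2)]) (use that(1) G in auto)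
  show inv_thom: "t \<in> thom E r s" if "t \<in> invariant_hom E G r s" for t r s
    using that unfolding iff by blast
  have inv: "K t x (map (madj E E g) ws) (map (madj E E g) vs) = K t x ws vs"
    if "t \<in> invariant_hom E G r s" "g \<in> G" "x \<in> X" "ws \<in> fl s x" "vs \<in> fl r x" for t r s g x ws vs
    using that unfolding iff by blast
  show "madd (tpow E r) (tpow E s) t t' \<in> invariant_hom E G r s"
    if t: "t \<in> invariant_hom E G r s" and t': "t' \<in> invariant_hom E G r s"
    unfolding iff
  proof (intro conjI ballI)
    fix g x ws vs assume g: "g \<in> G" and x: "x \<in> X" and ws: "ws \<in> fl s x" and vs: "vs \<in> fl r x"
    show "K (madd (tpow E r) (tpow E s) t t') x (map (madj E E g) ws) (map (madj E E g) vs) =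
        K (madd (tpow E r) (tpow E s) t t') x ws vs"
      using K_madd[OF inv_thom[OF t] inv_thom[OF t'] x vs] K_madd[OF inv_thom[OF t] inv_thom[OF t'] x g_fl[OF g vs]]
        inv[OF t g x ws vs] inv[OF t' g x ws vs] by simp
  qed (intro thom_closed inv_thom t t')
  show "mscale (tpow E r) (tpow E s) a t \<in> invariant_hom E G r s" if t: "t \<in> invariant_hom E G r s"
    unfolding iff
  proof (intro conjI ballI)
    fix g x ws vs assume g: "g \<in> G" and x: "x \<in> X" and ws: "ws \<in> fl s x" and vs: "vs \<in> fl r x"
    show "K (mscale (tpow E r) (tpow E s) a t) x (map (madj E E g) ws) (map (madj E E g) vs) =
        K (mscale (tpow E r) (tpow E s) a t) x ws vs"
      using K_mscale[OF inv_thom[OF t] x vs] K_mscale[OF inv_thom[OF t] x g_fl[OF g vs]] inv[OF t g x ws vs] by simp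
  qed (intro thom_closed inv_thom t)
  show "mcomp (tpow E r) u t \<in> invariant_hom E G r q"
    if t: "t \<in> invariant_hom E G r s" and u: "u \<in> invariant_hom E G s q"
    unfolding iff
  proof (intro conjI ballI)
    fix g x ws vs assume g: "g \<in> G" and x: "x \<in> X" and ws: "ws \<in> fl q x" and vs: "vs \<in> fl r x"
    have gu: "g \<in> unitaries E" using g G by blast
    \<comment> \<open>The product is expanded over the intermediate basis moved by the adjoint of
      \<open>g\<close>, which is again orthonormal, so invariance of both factors applies term by
      term.\<close>
    have "K (mcomp (tpow E r) u t) x (map (madj E E g) ws) (map (madj E E g) vs) =
        (\<Sum>J\<in>L s x. K u x (map (madj E E g) ws) (map (madj E E g) J) * K t x (map (madj E E g) J) (map (madj E E g) vs))"
      by (rule K_mcomp_onb[OF inv_thom[OF t] inv_thom[OF u] x g_fl[OF g vs] onb_unitary[OF gu onb_B[OF x]] finite_B[OF x]])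
    also have "\<dots> = (\<Sum>J\<in>L s x. K u x ws J * K t x J vs)"
      by (intro sum.cong refl) (simp add: inv[OF u g x ws L_fl[OF x]] inv[OF t g x L_fl[OF x] vs])
    also have "\<dots> = K (mcomp (tpow E r) u t) x ws vs"
      using K_mcomp_onb[OF inv_thom[OF t] inv_thom[OF u] x vs onb_B[OF x] finite_B[OF x], of ws] by simp
    finally show "K (mcomp (tpow E r) u t) x (map (madj E E g) ws) (map (madj E E g) vs) =
        K (mcomp (tpow E r) u t) x ws vs" .
  qed (rule thom_closed(3)[OF inv_thom[OF t] inv_thom[OF u]])
  show "madj (tpow E r) (tpow E s) t \<in> invariant_hom E G s r" if t: "t \<in> invariant_hom E G r s"
    unfolding iff
  proof (intro conjI ballI)
    fix g x ws vs assume g: "g \<in> G" and x: "x \<in> X" and ws: "ws \<in> fl r x" and vs: "vs \<in> fl s x"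
    show "K (madj (tpow E r) (tpow E s) t) x (map (madj E E g) ws) (map (madj E E g) vs) =
        K (madj (tpow E r) (tpow E s) t) x ws vs"
      unfolding K_madj[OF inv_thom[OF t] x vs ws] K_madj[OF inv_thom[OF t] x g_fl[OF g vs] g_fl[OF g ws]]
        inv[OF t g x vs ws] ..
  qed (rule thom_closed(4)[OF inv_thom[OF t]])
  show "mid (tpow E r) \<in> invariant_hom E G r r"
    unfolding iff
  proof (intro conjI ballI thom_closed(5))
    fix g x ws vs assume g: "g \<in> G" and x: "x \<in> X" and ws: "ws \<in> fl r x" and vs: "vs \<in> fl r x"
    have gu: "g \<in> unitaries E" using g G by blast
    show "K (mid (tpow E r)) x (map (madj E E g) ws) (map (madj E E g) vs) = K (mid (tpow E r)) x ws vs"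
      unfolding K_mid[OF x vs] K_mid[OF x g_fl[OF g vs]] by (rule st_map_isometric[OF gu ws vs])
  qed
  show "mtensor E r s r' s' t u \<in> invariant_hom E G (r + r') (s + s')"
    if t: "t \<in> invariant_hom E G r s" and u: "u \<in> invariant_hom E G r' s'"
    unfolding iff
  proof (intro conjI ballI)
    fix g x ws vs assume g: "g \<in> G" and x: "x \<in> X" and ws: "ws \<in> fl (s + s') x" and vs: "vs \<in> fl (r + r') x"
    obtain w1 w2 where w: "ws = w1 @ w2" "w1 \<in> fl s x" "w2 \<in> fl s' x" using ws by (rule fl_appendE)
    obtain v1 v2 where v: "vs = v1 @ v2" "v1 \<in> fl r x" "v2 \<in> fl r' x" using vs by (rule fl_appendE)
    show "K (mtensor E r s r' s' t u) x (map (madj E E g) ws) (map (madj E E g) vs) = K (mtensor E r s r' s' t u) x ws vs"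
      unfolding w(1) v(1) map_append K_mtensor[OF inv_thom[OF t] inv_thom[OF u] x w(2) v(2,3)]
        K_mtensor[OF inv_thom[OF t] inv_thom[OF u] x g_fl[OF g w(2)] g_fl[OF g v(2)] g_fl[OF g v(3)]]
        inv[OF t g x w(2) v(2)] inv[OF u g x w(3) v(3)] ..
  qed (rule mtensor(1)[OF inv_thom[OF t] inv_thom[OF u]])
  show "flip n \<in> invariant_hom E G (n + n) (n + n)"
    unfolding iff
  proof (intro conjI ballI flip(1))
    fix g x ws vs assume g: "g \<in> G" and x: "x \<in> X" and ws: "ws \<in> fl (n + n) x" and vs: "vs \<in> fl (n + n) x"
    have gu: "g \<in> unitaries E" using g G by blast
    obtain a b where w: "ws = a @ b" "a \<in> fl n x" "b \<in> fl n x" using ws by (rule fl_appendE)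
    obtain c e where v: "vs = c @ e" "c \<in> fl n x" "e \<in> fl n x" using vs by (rule fl_appendE)
    show "K (flip n) x (map (madj E E g) ws) (map (madj E E g) vs) = K (flip n) x ws vs"
      unfolding w(1) v(1) map_append flip(2)[OF x w(2,3) v(2,3)]
        flip(2)[OF x g_fl[OF g w(2)] g_fl[OF g w(3)] g_fl[OF g v(2)] g_fl[OF g v(3)]]
        st_map_isometric[OF gu w(2) v(3)] st_map_isometric[OF gu w(3) v(2)] ..
  qed
qed

lemma L_nonempty:
  assumes "x \<in> X" "d > 0"
  shows "\<exists>bs. bs \<in> L n x"
proof -
  have "card (L n x) > 0" using assms by (simp add: card_L)
  then show ?thesis by (metis card_gt_0_iff equals0I)
qed

lemma tn_st: "x \<in> X \<Longrightarrow> vs \<in> fl r x \<Longrightarrow> tn r x (st x vs) = sqrt (Re (st x vs vs))"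
  by (simp add: tn_def bnorm_def tensor_herm_st st_TF)

text \<open>The number \<open>n\<close> of added slots may change with the error, so no limit is
  taken inside one space of invariant morphisms. Instead a coefficient of \<open>u\<close> is read
  off from \<open>u \<otimes> 1\<close> at lists prolonged by a basis list. The group moves this
  list to another one whose simple tensor has norm 1, which serves equally well.\<close>

lemma invariant_limit:
  assumes G: "G \<subseteq> unitaries E" and d0: "d > 0" and u: "u \<in> thom E r s"
    and lim: "\<And>e. e > 0 \<Longrightarrow> \<exists>n. \<exists>y\<in>invariant_hom E G (r + n) (s + n).
      mn (r + n) (s + n) (mdiff (tpow E (r + n)) (tpow E (s + n)) (mtensor E r s n n u (mid (tpow E n))) y) \<le> e"
  shows "u \<in> invariant_hom E G r s"
  unfolding invariant_hom_iff[OF G]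
proof (intro conjI ballI u)
  fix g x ws vs assume g: "g \<in> G" and x: "x \<in> X" and ws: "ws \<in> fl s x" and vs: "vs \<in> fl r x"
  have gu: "g \<in> unitaries E" using g G by blast
  define f where "f = map (madj E E g)"
  have f_fl: "f v \<in> fl q x" if "v \<in> fl q x" for v q
    unfolding f_def by (rule fl_map[OF unitary_adj(7)[OF gu] that])
  have f_iso: "st x (f v) (f w) = st x v w" if "v \<in> fl q x" "w \<in> fl q x" for v w q
    unfolding f_def by (rule st_map_isometric[OF gu that(2,1)])
  have f_tn: "tn q x (st x (f v)) = tn q x (st x v)" if "v \<in> fl q x" for v q
    by (simp add: tn_st[OF x that] tn_st[OF x f_fl[OF that]] f_iso[OF that that])
  define C where "C = tn r x (st x vs) * tn s x (st x ws)"
  have C: "0 \<le> C" by (simp add: C_def tn_nonneg)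
  have "cmod (K u x (f ws) (f vs) - K u x ws vs) \<le> 2 * e * C" if e: "e > 0" for e
  proof -
    obtain n y where y: "y \<in> invariant_hom E G (r + n) (s + n)"
      and close: "mn (r + n) (s + n) (mdiff (tpow E (r + n)) (tpow E (s + n)) (mtensor E r s n n u (mid (tpow E n))) y) \<le> e"
      using lim[OF e] by blast
    obtain bs where bs: "bs \<in> L n x" using L_nonempty[OF x d0] by blast
    note bf = L_fl[OF x bs]
    have yt: "y \<in> thom E (r + n) (s + n)" by (rule invariant_closed(1)[OF G y])
    note ut = mtensor(1)[OF u thom_closed(5)[of n]]
    have est: "cmod (K u x w v - K y x (w @ b) (v @ b)) \<le> e * (tn r x (st x v) * tn s x (st x w))"
      if w: "w \<in> fl s x" and v: "v \<in> fl r x" and b: "b \<in> fl n x" "st x b b = 1" for w v b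
    proof -
      have tb: "tn n x (st x b) = 1" using tn_st[OF x b(1)] b(2) by simp
      have t1: "tn (q + n) x (st x (z @ b)) = tn q x (st x z)" if "z \<in> fl q x" for z q
        using tn_tensor_vec[of q n x "st x z" "st x b"] tensor_vec_st[OF x that b(1)] tb by simp
      have "K u x w v - K y x (w @ b) (v @ b) =
          K (mdiff (tpow E (r + n)) (tpow E (s + n)) (mtensor E r s n n u (mid (tpow E n))) y) x (w @ b) (v @ b)"
        unfolding K_mdiff[OF ut yt x fl_append[OF v b(1)]] K_mtensor[OF u thom_closed(5) x w v b(1)] K_mid[OF x b(1)]
        by (simp add: b(2))
      also have "cmod \<dots> \<le> mn (r + n) (s + n) (mdiff (tpow E (r + n)) (tpow E (s + n)) (mtensor E r s n n u (mid (tpow E n))) y) *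
          tn (r + n) x (st x (v @ b)) * tn (s + n) x (st x (w @ b))"
        by (rule K_bound[OF TT.mdiff_bmor[OF ut yt] x fl_append[OF v b(1)] fl_append[OF w b(1)]])
      also have "\<dots> \<le> e * tn (r + n) x (st x (v @ b)) * tn (s + n) x (st x (w @ b))"
        by (intro mult_right_mono close tn_nonneg)
      finally show ?thesis by (simp add: t1[OF v] t1[OF w] mult.assoc)
    qed
    have bb: "st x bs bs = 1" using st_L[OF x bs bs] by simp
    have fb: "st x (f bs) (f bs) = 1" using f_iso[OF bf bf] bb by simp
    have yi: "K y x (f ws @ f bs) (f vs @ f bs) = K y x (ws @ bs) (vs @ bs)"
    proof -
      have "K y x (map (madj E E g) (ws @ bs)) (map (madj E E g) (vs @ bs)) = K y x (ws @ bs) (vs @ bs)"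
        using y[unfolded invariant_hom_iff[OF G]] g x fl_append[OF ws bf] fl_append[OF vs bf] by blast
      then show ?thesis by (simp add: f_def)
    qed
    have "K u x (f ws) (f vs) - K u x ws vs = (K u x (f ws) (f vs) - K y x (f ws @ f bs) (f vs @ f bs)) -
        (K u x ws vs - K y x (ws @ bs) (vs @ bs))"
      by (simp add: yi)
    also have "cmod \<dots> \<le> e * C + e * C"
    proof (rule order_trans[OF norm_triangle_ineq4 add_mono])
      show "cmod (K u x (f ws) (f vs) - K y x (f ws @ f bs) (f vs @ f bs)) \<le> e * C"
        using est[OF f_fl[OF ws] f_fl[OF vs] f_fl[OF bf] fb] by (simp add: C_def f_tn[OF ws] f_tn[OF vs])
      show "cmod (K u x ws vs - K y x (ws @ bs) (vs @ bs)) \<le> e * C"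
        using est[OF ws vs bf bb] by (simp add: C_def)
    qed
    finally show ?thesis by (simp add: algebra_simps)
  qed
  note bound = this
  have "cmod (K u x (f ws) (f vs) - K u x ws vs) \<le> 0 + e" if e: "e > 0" for e
  proof -
    have "cmod (K u x (f ws) (f vs) - K u x ws vs) \<le> 2 * (e / (2 * C + 1)) * C"
      using e C by (intro bound) simp
    also have "\<dots> = e * (2 * C / (2 * C + 1))" by simp
    also have "\<dots> \<le> e * 1" using e C by (intro mult_left_mono) (simp_all add: divide_simps)
    finally show ?thesis by simp
  qed
  then have "cmod (K u x (f ws) (f vs) - K u x ws vs) \<le> 0" by (rule field_le_epsilon)
  then show "K u x (map (madj E E g) ws) (map (madj E E g) vs) = K u x ws vs" by (simp add: f_def)
qed

text \<open>The flip of two neighbouring slots and its translate by \<open>m\<close> slots differ on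
  \<open>b\<^sub>1 \<otimes> b\<^sub>2 \<otimes> \<dots> \<otimes> b\<^sub>2\<close>, where \<open>b\<^sub>1\<close> and \<open>b\<^sub>2\<close> are distinct basis vectors: here the rank has to be at
  least \<open>2\<close>.\<close>

lemma flip_translate_entry:
  assumes d2: "d \<ge> 2" and m: "m \<ge> 1" and x: "x \<in> X"
  defines "z \<equiv> mdiff (tpow E (m + (1 + 1))) (tpow E (m + (1 + 1)))
    (mtensor E (1 + 1) (1 + 1) m m (flip 1) (mid (tpow E m))) (mtensor E m m (1 + 1) (1 + 1) (mid (tpow E m)) (flip 1))"
  shows "\<exists>w\<in>L (m + (1 + 1)) x. \<exists>w'\<in>L (m + (1 + 1)) x. 1 \<le> cmod (K z x w' w)"
proof -
  have "\<exists>b c. b \<in> B x \<and> c \<in> B x \<and> b \<noteq> c"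
  proof (rule ccontr)
    assume "\<nexists>b c. b \<in> B x \<and> c \<in> B x \<and> b \<noteq> c"
    then have "card (B x) \<le> 1" unfolding One_nat_def card_le_Suc0_iff_eq[OF finite_B[OF x]] by blast
    then show False using d2 card_B[OF x] by simp
  qed
  then obtain b c where bc: "b \<in> B x" "c \<in> B x" "b \<noteq> c" by blast
  have s: "[b] \<in> L 1 x" "[c] \<in> L 1 x" using bc by (auto simp: tuples_def)
  note f = L_fl[OF x s(1)] L_fl[OF x s(2)]
  define rc where "rc k = replicate k c" for k
  have rc: "rc k \<in> L k x" for k using bc by (auto simp: tuples_def rc_def)
  have rf: "rc k \<in> fl k x" for k by (rule L_fl[OF x rc])
  define w where "w = ([b] @ [c]) @ rc m"
  define w' where "w' = ([c] @ [b]) @ rc m"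
  have wL: "w \<in> L (m + (1 + 1)) x" "w' \<in> L (m + (1 + 1)) x"
    using tuples_append[OF tuples_append[OF s(1,2)] rc[of m]] tuples_append[OF tuples_append[OF s(2,1)] rc[of m]]
    by (simp_all add: w_def w'_def add.commute)
  have t1: "mtensor E (1 + 1) (1 + 1) m m (flip 1) (mid (tpow E m)) \<in> thom E (m + (1 + 1)) (m + (1 + 1))"
    using mtensor(1)[OF flip(1)[of 1] thom_closed(5)[of m]] by (simp add: add.commute)
  have t2: "mtensor E m m (1 + 1) (1 + 1) (mid (tpow E m)) (flip 1) \<in> thom E (m + (1 + 1)) (m + (1 + 1))"
    by (rule mtensor(1)[OF thom_closed(5) flip(1)])
  have "K (mtensor E (1 + 1) (1 + 1) m m (flip 1) (mid (tpow E m))) x w' w = 1"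
    unfolding w_def w'_def
      K_mtensor[OF flip(1) thom_closed(5) x fl_append[OF f(2,1)] fl_append[OF f(1,2)] rf]
      flip(2)[OF x f(2,1) f(1,2)] K_mid[OF x rf] st_L[OF x rc rc] st_L[OF x s(1,1)] st_L[OF x s(2,2)] by simp
  moreover have "K (mtensor E m m (1 + 1) (1 + 1) (mid (tpow E m)) (flip 1)) x w' w = 0"
  proof -
    have "take m w \<in> L m x" "drop m w \<in> L (1 + 1) x" "take m w' \<in> L m x" "drop m w' \<in> L (1 + 1) x"
      using tuples_take_drop[OF wL(1)] tuples_take_drop[OF wL(2)] by simp_all
    note h = this
    \<comment> \<open>As \<open>m \<ge> 1\<close>, the first slot belongs to the part on which the
      translated flip acts as the identity, and the two lists differ there.\<close>
    have ne: "take m w' \<noteq> take m w"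
      using m bc(3) by (cases m) (auto simp: w_def w'_def)
    have "K (mtensor E m m (1 + 1) (1 + 1) (mid (tpow E m)) (flip 1)) x (take m w' @ drop m w') (take m w @ drop m w) = 0"
      unfolding K_mtensor[OF thom_closed(5) flip(1) x L_fl[OF x h(3)] L_fl[OF x h(1)] L_fl[OF x h(2)]]
        K_mid[OF x L_fl[OF x h(1)]] st_L[OF x h(3,1)] using ne by simp
    then show ?thesis by simp
  qed
  ultimately have "K z x w' w = 1"
    unfolding z_def K_mdiff[OF t1 t2 x L_fl[OF x wL(1)]] by simp
  then show ?thesis using wL by force
qed

end

section \<open>Fejer means and the Cuntz--Pimsner algebra\<close>

lemma scaleC_zero [simp]: "scaleC 0 (x::'a::cstar_algebra) = 0"
  using scaleC_of_real[of 0 x] by simp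

lemma scaleC_one [simp]: "scaleC 1 (x::'a::cstar_algebra) = x"
  using scaleC_of_real[of 1 x] by simp

lemma scaleC_minus_one [simp]: "scaleC (-1) (x::'a::cstar_algebra) = - x"
  using scaleC_of_real[of "-1" x] by simp

lemma scaleC_zero_right [simp]: "scaleC c (0::'a::cstar_algebra) = 0"
  using scaleC_add_right[of c 0 0] by simp

lemma scaleC_sum_right: "scaleC c (\<Sum>a\<in>A. f a) = (\<Sum>a\<in>A. scaleC c (f a :: 'a::cstar_algebra))"
  by (induction A rule: infinite_finite_induct) (simp_all add: scaleC_add_right)

lemma scaleC_sum_left: "scaleC (\<Sum>a\<in>A. f a) (x::'a::cstar_algebra) = (\<Sum>a\<in>A. scaleC (f a) x)"
  by (induction A rule: infinite_finite_induct) (simp_all add: scaleC_add_left)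

lemma scaleC_diff_right: "scaleC c (x - y) = scaleC c x - scaleC c (y::'a::cstar_algebra)"
  using scaleC_add_right[of c "x - y" y] by simp

lemma star_zero [simp]: "star (0::'a::cstar_algebra) = 0"
  using star_add[of 0 "0::'a"] by simp

lemma star_minus: "star (- x) = - star (x::'a::cstar_algebra)"
proof -
  have "star x + star (- x) = 0" using star_add[of x "-x"] by simp
  then show ?thesis by (rule minus_unique[symmetric])
qed

lemma star_diff: "star (x - y) = star x - star (y::'a::cstar_algebra)"
  using star_add[of x "-y"] by (simp add: star_minus)

lemma star_sum: "star (\<Sum>a\<in>A. f a) = (\<Sum>a\<in>A. star (f a :: 'a::cstar_algebra))"
  by (induction A rule: infinite_finite_induct) (simp_all add: star_add)

lemma norm_star: "norm (star x) = norm (x::'a::cstar_algebra)"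
proof -
  have le: "norm y \<le> norm (star y)" for y :: 'a
  proof (cases "y = 0")
    case False
    have "norm y * norm y \<le> norm (star y) * norm y"
      using norm_mult_ineq[of "star y" y] by (simp add: norm_star_mult power2_eq_square)
    then show ?thesis using False by simp
  qed simp
  show ?thesis using le[of x] le[of "star x"] by (simp add: star_star)
qed

lemma tendsto_star: "(f \<longlongrightarrow> l) F \<Longrightarrow> ((\<lambda>n. star (f n :: 'a::cstar_algebra)) \<longlongrightarrow> star l) F"
  unfolding tendsto_iff dist_norm by (simp add: star_diff[symmetric] norm_star)

lemma tendsto_scaleC:
  assumes "(f \<longlongrightarrow> l) F"
  shows "((\<lambda>n. scaleC c (f n :: 'a::cstar_algebra)) \<longlongrightarrow> scaleC c l) F"
proof -
  have "((\<lambda>n. cmod c * norm (f n - l)) \<longlongrightarrow> cmod c * 0) F"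
    using assms by (intro tendsto_mult tendsto_const) (simp add: tendsto_norm_zero_iff LIM_zero_iff)
  then have "((\<lambda>n. norm (scaleC c (f n) - scaleC c l)) \<longlongrightarrow> 0) F"
    by (simp add: scaleC_diff_right[symmetric] norm_scaleC)
  then show ?thesis by (simp add: tendsto_norm_zero_iff LIM_zero_iff)
qed

lemma cstar_subalgebraD:
  assumes "cstar_subalgebra B"
  shows "closed B" "0 \<in> B" "x \<in> B \<Longrightarrow> y \<in> B \<Longrightarrow> x + y \<in> B" "x \<in> B \<Longrightarrow> y \<in> B \<Longrightarrow> x * y \<in> B"
    "x \<in> B \<Longrightarrow> star x \<in> B" "x \<in> B \<Longrightarrow> scaleC c x \<in> B" "x \<in> B \<Longrightarrow> y \<in> B \<Longrightarrow> x - y \<in> B"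
proof -
  note * = assms[unfolded cstar_subalgebra_def]
  show "closed B" "0 \<in> B" using * by blast+
  show p: "x + y \<in> B" "x * y \<in> B" if "x \<in> B" "y \<in> B" for x y using * that by blast+
  show c: "star x \<in> B" "scaleC c x \<in> B" if "x \<in> B" for x c using * that by blast+
  show "x - y \<in> B" if "x \<in> B" "y \<in> B"
    using p(1)[OF that(1) c(2)[OF that(2), of "-1"]] by simp
qed

lemma cstar_generated:
  shows "cstar_subalgebra (cstar_generated S)" "S \<subseteq> cstar_generated S"
    "cstar_subalgebra B \<Longrightarrow> S \<subseteq> B \<Longrightarrow> cstar_generated S \<subseteq> B"
proof -
  show "S \<subseteq> cstar_generated S" by (auto simp: cstar_generated_def)
  show "cstar_subalgebra B \<Longrightarrow> S \<subseteq> B \<Longrightarrow> cstar_generated S \<subseteq> B" by (auto simp: cstar_generated_def)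
  show "cstar_subalgebra (cstar_generated S)"
    unfolding cstar_subalgebra_def[of "cstar_generated S"]
  proof (intro conjI ballI allI)
    show "closed (cstar_generated S)"
      unfolding cstar_generated_def by (intro closed_Inter) (auto dest: cstar_subalgebraD(1))
  qed (auto simp: cstar_generated_def intro: cstar_subalgebraD)
qed

lemma cstar_subalgebra_closure:
  fixes S :: "'a::cstar_algebra set"
  assumes S: "0 \<in> S" "\<And>x y. x \<in> S \<Longrightarrow> y \<in> S \<Longrightarrow> x + y \<in> S" "\<And>x y. x \<in> S \<Longrightarrow> y \<in> S \<Longrightarrow> x * y \<in> S"
    "\<And>x. x \<in> S \<Longrightarrow> star x \<in> S" "\<And>c x. x \<in> S \<Longrightarrow> scaleC c x \<in> S"
  shows "cstar_subalgebra (closure S)"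
  unfolding cstar_subalgebra_def
proof (intro conjI ballI allI)
  show "0 \<in> closure S" using S(1) closure_subset by blast
next
  fix x y assume "x \<in> closure S" "y \<in> closure S"
  then obtain f g where f: "\<And>n. f n \<in> S" "f \<longlonglongrightarrow> x" and g: "\<And>n. g n \<in> S" "g \<longlonglongrightarrow> y"
    unfolding closure_sequential by blast
  show "x + y \<in> closure S"
    unfolding closure_sequential
    by (intro exI[of _ "\<lambda>n. f n + g n"] conjI allI S(2) f(1) g(1) tendsto_add f(2) g(2))
  show "x * y \<in> closure S"
    unfolding closure_sequential
    by (intro exI[of _ "\<lambda>n. f n * g n"] conjI allI S(3) f(1) g(1) tendsto_mult f(2) g(2))
next
  fix x c assume "x \<in> closure S"
  then obtain f where f: "\<And>n. f n \<in> S" "f \<longlonglongrightarrow> x"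
    unfolding closure_sequential by blast
  show "star x \<in> closure S"
    unfolding closure_sequential
    by (intro exI[of _ "\<lambda>n. star (f n)"] conjI allI S(4) f(1) tendsto_star f(2))
  show "scaleC c x \<in> closure S"
    unfolding closure_sequential
    by (intro exI[of _ "\<lambda>n. scaleC c (f n)"] conjI allI S(5) f(1) tendsto_scaleC f(2))
qed simp

text \<open>The bound on \<open>l\<close> rules out aliasing: the only multiple of \<open>M\<close>
  in this range is \<open>0\<close>.\<close>

lemma sum_roots_of_unity:
  assumes l: "\<bar>l\<bar> < int M"
  shows "(\<Sum>m<M. cis (2 * pi * real m * of_int l / real M)) = (if l = 0 then of_nat M else 0)"
proof (cases "l = 0")
  case False
  define w where "w = cis (2 * pi * of_int l / real M)"
  have M: "M > 0" using l by auto
  have pw: "cis (2 * pi * real m * of_int l / real M) = w ^ m" for m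
    unfolding w_def Complex.DeMoivre by (simp add: mult_ac)
  have "w ^ M = cis (2 * pi * of_int l)" unfolding w_def Complex.DeMoivre using M by simp
  also have "\<dots> = 1" by (rule cis_multiple_2pi) simp
  finally have wM: "w ^ M = 1" .
  have "w \<noteq> 1"
  proof
    assume "w = 1"
    then have "cos (2 * pi * of_int l / real M) = 1" by (simp add: w_def complex_eq_iff)
    then obtain k :: int where "2 * pi * of_int l / real M = of_int k * 2 * pi"
      unfolding cos_one_2pi_int by blast
    then have "real_of_int l = of_int (k * int M)" using M by (simp add: field_simps)
    then have "l = k * int M" by (simp only: of_int_eq_iff)
    then have "int M dvd l" by simp
    then have "int M \<le> \<bar>l\<bar>" using False by (intro zdvd_imp_le) simp_all
    then show False using l by simp
  qed
  then show ?thesis using wM False by (simp add: pw geometric_sum)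
qed simp

text \<open>For positive \<open>n\<close> this is the triangular weight
  \<open>max 0 (1 - \<bar>l\<bar> / n)\<close>, written as a count of pairs because that is how it
  arises when the square in the Fejer kernel is expanded.\<close>

definition fejer_weight :: "nat \<Rightarrow> int \<Rightarrow> real" where
  "fejer_weight n l = real (card {(p, q). p < n \<and> q < n \<and> int p - int q + l = 0}) / real n"

lemma fejer_card: "card {(p, q). p < n \<and> q < n \<and> int p - int q + l = 0} = n - nat \<bar>l\<bar>"
proof (cases "l \<ge> 0")
  case True
  have "{(p, q). p < n \<and> q < n \<and> int p - int q + l = 0} = (\<lambda>p. (p, p + nat l)) ` {..<n - nat l}"
    using True by (auto simp: image_iff)
  then show ?thesis using True by (simp add: card_image inj_on_def)
next
  case False
  have "{(p, q). p < n \<and> q < n \<and> int p - int q + l = 0} = (\<lambda>q. (q + nat (-l), q)) ` {..<n - nat (-l)}"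
    using False by (auto simp: image_iff)
  then show ?thesis using False by (simp add: card_image inj_on_def)
qed

lemma fejer_weight:
  assumes n: "n \<ge> 1"
  shows "0 \<le> fejer_weight n l" "fejer_weight n l \<le> 1" "1 - fejer_weight n l \<le> \<bar>of_int l\<bar> / real n"
    "\<bar>l\<bar> \<ge> int n \<Longrightarrow> fejer_weight n l = 0" "fejer_weight n 0 = 1"
proof -
  have eq: "fejer_weight n l = real (n - nat \<bar>l\<bar>) / real n" for l by (simp add: fejer_weight_def fejer_card)
  show "0 \<le> fejer_weight n l" "fejer_weight n l \<le> 1" using n by (simp_all add: eq)
  show "fejer_weight n 0 = 1" using n by (simp add: eq)
  show "fejer_weight n l = 0" if "\<bar>l\<bar> \<ge> int n" using that by (simp add: eq)
  have "real n - real (n - nat \<bar>l\<bar>) \<le> \<bar>of_int l\<bar>" by linarith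
  then have "(real n - real (n - nat \<bar>l\<bar>)) / real n \<le> \<bar>of_int l\<bar> / real n" by (rule divide_right_mono) simp
  then show "1 - fejer_weight n l \<le> \<bar>of_int l\<bar> / real n" using n by (simp add: eq diff_divide_distrib)
qed

text \<open>The weights are the Fourier coefficients of the Fejer kernel \<open>\<bar>1 + z + \<dots> + z\<^sup>n\<^sup>-\<^sup>1\<bar>\<^sup>2 / n\<close>. Its
  positivity makes the Cesaro means of the Fourier series contractive; the integral over the circle is
  replaced by an average over roots of unity of large order.\<close>

lemma fejer_contraction:
  fixes a :: "int \<Rightarrow> 'a::cstar_algebra"
  assumes K: "finite K" and n: "n \<ge> 1"
    and iso: "\<And>z. cmod z = 1 \<Longrightarrow> norm (\<Sum>k\<in>K. scaleC (z powi k) (a k)) = norm (\<Sum>k\<in>K. a k)"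
  shows "norm (\<Sum>k\<in>K. scaleC (of_real (fejer_weight n (k - k0))) (a k)) \<le> norm (\<Sum>k\<in>K. a k)"
proof -
  \<comment> \<open>Large enough that \<open>int p - int q + l\<close> stays below \<open>M\<close>
    in modulus for \<open>p\<close> and \<open>q\<close> below \<open>n\<close> and every
    \<open>l = k - k0\<close>. Inserting \<open>0\<close> covers an empty \<open>K\<close>.\<close>
  define M where "M = n + nat (Max (insert 0 ((\<lambda>k. \<bar>k - k0\<bar>) ` K))) + 1"
  have M: "int n + \<bar>k - k0\<bar> < int M" if "k \<in> K" for k
  proof -
    have "\<bar>k - k0\<bar> \<le> Max (insert 0 ((\<lambda>k. \<bar>k - k0\<bar>) ` K))" using K that by (intro Max_ge) auto
    moreover have "0 \<le> Max (insert 0 ((\<lambda>k. \<bar>k - k0\<bar>) ` K))" using K by (intro Max_ge) auto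
    ultimately show ?thesis by (simp add: M_def)
  qed
  have M0: "int n < int M" by (simp add: M_def)
  define e where "e m l = cis (2 * pi * real m * of_int l / real M)" for m :: nat and l :: int
  have e_add: "e m (l + l') = e m l * e m l'" for m l l'
    by (simp add: e_def cis_mult distrib_left add_divide_distrib)
  have e_cnj: "cnj (e m l) = e m (- l)" for m l by (simp add: e_def cis_cnj)
  have e_norm: "cmod (e m l) = 1" for m l by (simp add: e_def)
  have e_powi: "e m 1 powi l = e m l" for m l by (simp add: e_def cis_power_int mult_ac)
  have e_sum: "(\<Sum>m<M. e m l) = (if l = 0 then of_nat M else 0)" if "\<bar>l\<bar> < int M" for l
    unfolding e_def by (rule sum_roots_of_unity[OF that])
  define F where "F m = (cmod (\<Sum>p<n. e m (int p)))\<^sup>2 / real n" for m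
  have F0: "0 \<le> F m" for m by (simp add: F_def)
  have F: "complex_of_real (F m) = (\<Sum>p<n. \<Sum>q<n. e m (int p - int q)) / of_nat n" for m
  proof -
    have "complex_of_real ((cmod (\<Sum>p<n. e m (int p)))\<^sup>2) = (\<Sum>p<n. e m (int p)) * cnj (\<Sum>p<n. e m (int p))"
      by (rule complex_norm_square)
    also have "\<dots> = (\<Sum>p<n. \<Sum>q<n. e m (int p - int q))"
      unfolding cnj_sum sum_product e_cnj e_add[symmetric] by simp
    finally show ?thesis by (simp add: F_def)
  qed
  have coeff: "(\<Sum>m<M. of_real (F m) * e m l) / of_nat M = complex_of_real (fejer_weight n l)"
    if l: "int n + \<bar>l\<bar> < int M" for l
  proof -
    have "(\<Sum>m<M. of_real (F m) * e m l) = (\<Sum>m<M. \<Sum>p<n. \<Sum>q<n. e m (int p - int q + l)) / of_nat n"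
      by (simp add: F sum_distrib_right sum_divide_distrib e_add)
    also have "(\<Sum>m<M. \<Sum>p<n. \<Sum>q<n. e m (int p - int q + l)) = (\<Sum>p<n. \<Sum>q<n. \<Sum>m<M. e m (int p - int q + l))"
      by (subst sum.swap) (intro sum.cong refl sum.swap)
    also have "\<dots> = (\<Sum>p<n. \<Sum>q<n. if int p - int q + l = 0 then of_nat M else 0)"
      by (intro sum.cong refl e_sum) (use l in auto)
    also have "\<dots> = (\<Sum>z\<in>{..<n} \<times> {..<n}. if int (fst z) - int (snd z) + l = 0 then of_nat M else 0)"
      by (simp add: sum.cartesian_product case_prod_unfold)
    also have "\<dots> = (\<Sum>z\<in>{z \<in> {..<n} \<times> {..<n}. int (fst z) - int (snd z) + l = 0}. of_nat M)"
      by (rule sum.inter_filter[symmetric]) simp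
    also have "{z \<in> {..<n} \<times> {..<n}. int (fst z) - int (snd z) + l = 0} =
        {(p, q). p < n \<and> q < n \<and> int p - int q + l = 0}" by auto
    finally show ?thesis using n M0 by (simp add: fejer_weight_def)
  qed
  \<comment> \<open>The coefficient of index \<open>0\<close> says that the weights
    \<open>F m\<close> have mean 1; being nonnegative, they define a convex combination.\<close>
  have F1: "(\<Sum>m<M. F m) = real M"
  proof -
    have "(\<Sum>m<M. of_real (F m) * e m 0) / of_nat M = complex_of_real (fejer_weight n 0)"
      using M0 by (intro coeff) simp
    then have "complex_of_real (\<Sum>m<M. F m) = complex_of_real (real M)"
      using M0 fejer_weight(5)[OF n] by (simp add: e_def)
    then show ?thesis by (simp only: of_real_eq_iff)
  qed
  have M1: "real M > 0" using M0 by simp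
  let ?s = "\<Sum>k\<in>K. a k"
  have "(\<Sum>k\<in>K. scaleC (of_real (fejer_weight n (k - k0))) (a k)) =
      (\<Sum>k\<in>K. \<Sum>m<M. scaleC (of_real (F m) / of_nat M * e m (- k0)) (scaleC (e m 1 powi k) (a k)))"
  proof (intro sum.cong refl)
    fix k assume k: "k \<in> K"
    have "complex_of_real (fejer_weight n (k - k0)) = (\<Sum>m<M. of_real (F m) / of_nat M * e m (- k0) * e m k)"
      using coeff[OF M[OF k]] e_add[of _ "- k0" k] by (simp add: sum_divide_distrib mult.assoc add.commute)
    then show "scaleC (of_real (fejer_weight n (k - k0))) (a k) =
        (\<Sum>m<M. scaleC (of_real (F m) / of_nat M * e m (- k0)) (scaleC (e m 1 powi k) (a k)))"
      by (simp add: scaleC_sum_left scaleC_scaleC e_powi)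
  qed
  also have "\<dots> = (\<Sum>m<M. scaleC (of_real (F m) / of_nat M * e m (- k0)) (\<Sum>k\<in>K. scaleC (e m 1 powi k) (a k)))"
    by (subst sum.swap) (simp add: scaleC_sum_right)
  also have "norm \<dots> \<le> (\<Sum>m<M. F m / real M * norm ?s)"
  proof (intro order_trans[OF norm_sum] sum_mono)
    fix m
    show "norm (scaleC (of_real (F m) / of_nat M * e m (- k0)) (\<Sum>k\<in>K. scaleC (e m 1 powi k) (a k))) \<le> F m / real M * norm ?s"
      using F0[of m] by (simp add: norm_scaleC norm_mult norm_divide e_norm iso[OF e_norm])
  qed
  also have "\<dots> = norm ?s"
    using F1 M1 by (simp flip: sum_distrib_right sum_divide_distrib)
  finally show ?thesis .
qed

section \<open>Embedded morphisms and the canonical endomorphism\<close>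

locale cuntz_pimsner_setup = compact_bundle E for E :: "('x, 'e) hbundle" +
  fixes G :: "('e \<Rightarrow> 'e) set"
    and j :: "nat \<Rightarrow> nat \<Rightarrow> ('x \<times> 'e tensor \<Rightarrow> 'x \<times> 'e tensor) \<Rightarrow> 'a::cstar_algebra"
    and \<sigma> :: "'a \<Rightarrow> 'a"
  assumes rank: "brank E \<ge> 2"
    and group: "closed_unitary_group E G"
    and cp: "cuntz_pimsner E j"
    and endo: "canonical_endomorphism E j \<sigma>"
begin

lemma G: "G \<subseteq> unitaries E"
  using group by (simp add: closed_unitary_group_def)

lemma j_simps:
  assumes t: "t \<in> thom E r s"
  shows "j (Suc r) (Suc s) (mtensor E r s 1 1 t (mid (tpow E 1))) = j r s t"
    "norm (j r s t) = mn r s t"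
    "j s r (madj (tpow E r) (tpow E s) t) = star (j r s t)"
    "j r s (mscale (tpow E r) (tpow E s) a t) = scaleC a (j r s t)"
    "t' \<in> thom E r s \<Longrightarrow> j r s (madd (tpow E r) (tpow E s) t t') = j r s t + j r s t'"
    "u \<in> thom E s q \<Longrightarrow> j r q (mcomp (tpow E r) u t) = j s q u * j r s t"
proof -
  have "\<forall>r s. \<forall>t\<in>thom E r s.
        j (Suc r) (Suc s) (mtensor E r s 1 1 t (mid (tpow E 1))) = j r s t \<and>
        norm (j r s t) = mnorm (tpow E r) (tpow E s) t \<and>
        j s r (madj (tpow E r) (tpow E s) t) = star (j r s t) \<and>
        (\<forall>a. j r s (mscale (tpow E r) (tpow E s) a t) = scaleC a (j r s t)) \<and>
        (\<forall>t'\<in>thom E r s. j r s (madd (tpow E r) (tpow E s) t t') = j r s t + j r s t') \<and>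
        (\<forall>u. \<forall>t'\<in>thom E s u. j r u (mcomp (tpow E r) t' t) = j s u t' * j r s t)"
    using cp unfolding cuntz_pimsner_def by (rule conjunct1)
  note * = bspec[OF spec[OF spec[OF this, of r], of s] t]
  show "j (Suc r) (Suc s) (mtensor E r s 1 1 t (mid (tpow E 1))) = j r s t"
    "norm (j r s t) = mn r s t"
    "j s r (madj (tpow E r) (tpow E s) t) = star (j r s t)"
    "j r s (mscale (tpow E r) (tpow E s) a t) = scaleC a (j r s t)"
    "t' \<in> thom E r s \<Longrightarrow> j r s (madd (tpow E r) (tpow E s) t t') = j r s t + j r s t'"
    "u \<in> thom E s q \<Longrightarrow> j r q (mcomp (tpow E r) u t) = j s q u * j r s t"
    using * by blast+
qed

lemma j_mdiff:
  "t \<in> thom E r s \<Longrightarrow> t' \<in> thom E r s \<Longrightarrow> j r s (mdiff (tpow E r) (tpow E s) t t') = j r s t - j r s t'"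
  unfolding mdiff_def by (simp add: j_simps thom_closed)

lemma norm_j_diff:
  "t \<in> thom E r s \<Longrightarrow> t' \<in> thom E r s \<Longrightarrow> norm (j r s t - j r s t') = mn r s (mdiff (tpow E r) (tpow E s) t t')"
  by (metis j_mdiff j_simps(2) TT.mdiff_bmor)

lemma j_inj:
  assumes "t \<in> thom E r s" "t' \<in> thom E r s" "j r s t = j r s t'"
  shows "t = t'"
  by (rule TT.mdiff_zeroD[OF compact_tpow assms(1,2)]) (use norm_j_diff[OF assms(1,2)] assms(3) in simp)

lemma j_raise:
  assumes t: "t \<in> thom E r s"
  shows "j (r + n) (s + n) (mtensor E r s n n t (mid (tpow E n))) = j r s t"
proof (induction n)
  case 0
  show ?case by (simp add: mtensor_mid0[OF t])
next
  case (Suc n)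
  have m: "mtensor E r s n n t (mid (tpow E n)) \<in> thom E (r + n) (s + n)" by (rule mtensor(1)[OF t thom_closed(5)])
  have "mtensor E (r + n) (s + n) 1 1 (mtensor E r s n n t (mid (tpow E n))) (mid (tpow E 1)) =
      mtensor E r s (n + 1) (n + 1) t (mid (tpow E (n + 1)))"
    unfolding mtensor_assoc[OF t thom_closed(5) thom_closed(5)] mtensor_mid ..
  then show ?case using j_simps(1)[OF m] Suc.IH by simp
qed

lemma sigma:
  "continuous_on UNIV \<sigma>" "\<sigma> (a + b) = \<sigma> a + \<sigma> b" "\<sigma> (a * b) = \<sigma> a * \<sigma> b" "\<sigma> (star a) = star (\<sigma> a)"
  "\<sigma> (scaleC c a) = scaleC c (\<sigma> a)"
  "t \<in> thom E r s \<Longrightarrow> \<sigma> (j r s t) = j (Suc r) (Suc s) (mtensor E 1 1 r s (mid (tpow E 1)) t)"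
  using endo unfolding canonical_endomorphism_def by blast+

lemma sigma_pow:
  "continuous_on UNIV (\<sigma> ^^ n)" "(\<sigma> ^^ n) (a + b) = (\<sigma> ^^ n) a + (\<sigma> ^^ n) b"
  "(\<sigma> ^^ n) (a * b) = (\<sigma> ^^ n) a * (\<sigma> ^^ n) b" "(\<sigma> ^^ n) (star a) = star ((\<sigma> ^^ n) a)"
  "(\<sigma> ^^ n) (scaleC c a) = scaleC c ((\<sigma> ^^ n) a)"
proof -
  show "continuous_on UNIV (\<sigma> ^^ n)"
  proof (induction n)
    case (Suc n)
    have "continuous_on UNIV (\<sigma> \<circ> (\<sigma> ^^ n))"
      by (rule continuous_on_compose[OF Suc continuous_on_subset[OF sigma(1)]]) simp
    then show ?case by simp
  qed (simp add: continuous_on_id id_def)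
  show "(\<sigma> ^^ n) (a + b) = (\<sigma> ^^ n) a + (\<sigma> ^^ n) b" "(\<sigma> ^^ n) (a * b) = (\<sigma> ^^ n) a * (\<sigma> ^^ n) b"
    "(\<sigma> ^^ n) (star a) = star ((\<sigma> ^^ n) a)" "(\<sigma> ^^ n) (scaleC c a) = scaleC c ((\<sigma> ^^ n) a)"
    by (induction n) (simp_all add: sigma)
qed

lemma sigma_pow_diff: "(\<sigma> ^^ n) (a - b) = (\<sigma> ^^ n) a - (\<sigma> ^^ n) b"
  using sigma_pow(2)[of n "a - b" b] by simp

lemma sigma_pow_j:
  assumes t: "t \<in> thom E r s"
  shows "(\<sigma> ^^ n) (j r s t) = j (n + r) (n + s) (mtensor E n n r s (mid (tpow E n)) t)"
proof (induction n)
  case 0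
  show ?case by (simp add: mtensor_mid0[OF t])
next
  case (Suc n)
  have m: "mtensor E n n r s (mid (tpow E n)) t \<in> thom E (n + r) (n + s)" by (rule mtensor(1)[OF thom_closed(5) t])
  have "mtensor E 1 1 (n + r) (n + s) (mid (tpow E 1)) (mtensor E n n r s (mid (tpow E n)) t) =
      mtensor E (1 + n) (1 + n) r s (mid (tpow E (1 + n))) t"
    unfolding mtensor_assoc[OF thom_closed(5) thom_closed(5) t, symmetric] mtensor_mid ..
  then show ?case using sigma(6)[OF m] Suc.IH by simp
qed

text \<open>A morphism times a translate beyond its slots is a tensor product, in either order. This
  gives the intertwining relation for morphisms and allows products with translates to be estimated
  through tensor products.\<close>

lemma j_sigma_mult:
  assumes t: "t \<in> thom E r s" and w: "w \<in> thom E p q"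
  shows "j r s t * (\<sigma> ^^ r) (j p q w) = j (r + p) (s + q) (mtensor E r s p q t w)"
    "(\<sigma> ^^ s) (j p q w) * j r s t = j (r + p) (s + q) (mtensor E r s p q t w)"
proof -
  have m1: "mtensor E r s q q t (mid (tpow E q)) \<in> thom E (r + q) (s + q)"
    and m2: "mtensor E r r p q (mid (tpow E r)) w \<in> thom E (r + p) (r + q)"
    and m3: "mtensor E s s p q (mid (tpow E s)) w \<in> thom E (s + p) (s + q)"
    and m4: "mtensor E r s p p t (mid (tpow E p)) \<in> thom E (r + p) (s + p)"
    by (intro mtensor(1) t w thom_closed(5))+
  show "j r s t * (\<sigma> ^^ r) (j p q w) = j (r + p) (s + q) (mtensor E r s p q t w)"
    unfolding sigma_pow_j[OF w] j_raise[OF t, of q, symmetric] j_simps(6)[OF m2 m1, symmetric]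
      mtensor_interchange(1)[OF t w] ..
  show "(\<sigma> ^^ s) (j p q w) * j r s t = j (r + p) (s + q) (mtensor E r s p q t w)"
    unfolding sigma_pow_j[OF w] j_raise[OF t, of p, symmetric] j_simps(6)[OF m4 m3, symmetric]
      mtensor_interchange(2)[OF t w] ..
qed

abbreviation inv_hom :: "nat \<Rightarrow> nat \<Rightarrow> ('x \<times> 'e tensor \<Rightarrow> 'x \<times> 'e tensor) set" where
  "inv_hom \<equiv> invariant_hom E G"

lemmas inv_closed = invariant_closed[OF G]

lemma inv_raise: "t \<in> inv_hom r s \<Longrightarrow> mtensor E r s n n t (mid (tpow E n)) \<in> inv_hom (r + n) (s + n)"
  by (intro inv_closed(7) inv_closed(6))

section \<open>Homogeneous invariant elements\<close>

definition grade :: "int \<Rightarrow> 'a set" where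
  "grade k = {j r s t | r s t. int s - int r = k \<and> t \<in> inv_hom r s}"

lemma gradeE:
  assumes "a \<in> grade k"
  obtains r s t where "a = j r s t" "int s - int r = k" "t \<in> inv_hom r s" "t \<in> thom E r s"
  using assms inv_closed(1) unfolding grade_def by blast

lemma gradeI: "t \<in> inv_hom r s \<Longrightarrow> int s - int r = k \<Longrightarrow> j r s t \<in> grade k"
  unfolding grade_def by blast

lemma grade_cp: "grade k \<subseteq> cp_grade E j k"
  using inv_closed(1) unfolding grade_def cp_grade_def by blast

lemma grade_scale: "a \<in> grade k \<Longrightarrow> scaleC c a \<in> grade k"
  by (elim gradeE) (metis gradeI inv_closed(3) j_simps(4))

text \<open>Scaling by \<open>0\<close> only helps once the degree is known to contain something;
  for each \<open>k\<close> the zero morphism between suitable powers is produced from its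
  kernel.\<close>

lemma grade_zero: "0 \<in> grade k"
proof -
  define r s where "r = nat (- k)" and "s = nat k"
  have rs: "int s - int r = k" by (simp add: r_def s_def)
  have "\<exists>t\<in>thom E r s. \<forall>x\<in>X. \<forall>ws\<in>fl s x. \<forall>vs\<in>fl r x. K t x ws vs = 0"
    by (rule thom_of_kernel) (auto intro: TF_zero)
  then obtain t where t: "t \<in> thom E r s" "\<And>x ws vs. x \<in> X \<Longrightarrow> ws \<in> fl s x \<Longrightarrow> vs \<in> fl r x \<Longrightarrow> K t x ws vs = 0"
    by blast
  have "t \<in> inv_hom r s"
    unfolding invariant_hom_iff[OF G]
  proof (intro conjI ballI t(1))
    fix g x ws vs assume g: "g \<in> G" and x: "x \<in> X" and m: "ws \<in> fl s x" "vs \<in> fl r x"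
    have gu: "g \<in> unitaries E" using g G by blast
    show "K t x (map (madj E E g) ws) (map (madj E E g) vs) = K t x ws vs"
      using t(2)[OF x m] t(2)[OF x fl_map[OF unitary_adj(7)[OF gu] m(1)] fl_map[OF unitary_adj(7)[OF gu] m(2)]] by simp
  qed
  then have "scaleC 0 (j r s t) \<in> grade k" by (intro grade_scale gradeI rs)
  then show ?thesis by simp
qed

text \<open>Elements of one degree may come from different powers. Tensoring with identities brings
  both sources to \<open>r + r'\<close>, and equality of the degrees makes the targets
  agree.\<close>

lemma grade_add:
  assumes "a \<in> grade k" "b \<in> grade k"
  shows "a + b \<in> grade k"
proof -
  obtain r s t where a: "a = j r s t" "int s - int r = k" "t \<in> inv_hom r s" "t \<in> thom E r s"
    using assms(1) by (rule gradeE)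
  obtain r' s' t' where b: "b = j r' s' t'" "int s' - int r' = k" "t' \<in> inv_hom r' s'" "t' \<in> thom E r' s'"
    using assms(2) by (rule gradeE)
  have eq: "r' + r = r + r'" "s' + r = s + r'" using a(2) b(2) by auto
  let ?u = "mtensor E r s r' r' t (mid (tpow E r'))" and ?u' = "mtensor E r' s' r r t' (mid (tpow E r))"
  have u: "?u \<in> inv_hom (r + r') (s + r')" by (rule inv_raise[OF a(3)])
  have u': "?u' \<in> inv_hom (r + r') (s + r')" using inv_raise[OF b(3), of r] by (simp only: eq)
  have "a + b = j (r + r') (s + r') ?u + j (r + r') (s + r') ?u'"
    using j_raise[OF a(4), of r'] j_raise[OF b(4), of r] by (simp add: a(1) b(1) eq)
  also have "\<dots> = j (r + r') (s + r') (madd (tpow E (r + r')) (tpow E (s + r')) ?u ?u')"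
    using j_simps(5)[OF inv_closed(1)[OF u] inv_closed(1)[OF u']] by simp
  finally show ?thesis
    using gradeI[OF inv_closed(2)[OF u u'], of k] a(2) by simp
qed

lemma grade_diff: "a \<in> grade k \<Longrightarrow> b \<in> grade k \<Longrightarrow> a - b \<in> grade k"
  using grade_add[of a k "scaleC (-1) b"] grade_scale[of b k "-1"] by simp

lemma grade_star: "a \<in> grade k \<Longrightarrow> star a \<in> grade (- k)"
  by (elim gradeE) (metis gradeI inv_closed(5) j_simps(3) minus_diff_eq)

lemma grade_mult:
  assumes "a \<in> grade k" "b \<in> grade l"
  shows "a * b \<in> grade (k + l)"
proof -
  obtain r s t where a: "a = j r s t" "int s - int r = k" "t \<in> inv_hom r s" "t \<in> thom E r s"
    using assms(1) by (rule gradeE)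
  obtain r' s' t' where b: "b = j r' s' t'" "int s' - int r' = l" "t' \<in> inv_hom r' s'" "t' \<in> thom E r' s'"
    using assms(2) by (rule gradeE)
  let ?u = "mtensor E r s s' s' t (mid (tpow E s'))" and ?u' = "mtensor E r' s' r r t' (mid (tpow E r))"
  have u: "?u \<in> inv_hom (r + s') (s + s')" by (rule inv_raise[OF a(3)])
  have u': "?u' \<in> inv_hom (r' + r) (r + s')" using inv_raise[OF b(3), of r] by (simp only: add.commute[of s' r])
  have "a * b = j (r + s') (s + s') ?u * j (r' + r) (r + s') ?u'"
    using j_raise[OF a(4), of s'] j_raise[OF b(4), of r] by (simp add: a(1) b(1) add.commute[of s' r])
  also have "\<dots> = j (r' + r) (s + s') (mcomp (tpow E (r' + r)) ?u ?u')"
    by (rule j_simps(6)[OF inv_closed(1)[OF u'] inv_closed(1)[OF u], symmetric])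
  finally show ?thesis
    using gradeI[OF inv_closed(4)[OF u' u], of "k + l"] a(2) b(2) by simp
qed

lemma grade_sigma: "a \<in> grade k \<Longrightarrow> (\<sigma> ^^ n) a \<in> grade k"
proof (elim gradeE)
  fix r s t assume a: "a = j r s t" "int s - int r = k" "t \<in> inv_hom r s" "t \<in> thom E r s"
  show "(\<sigma> ^^ n) a \<in> grade k"
    unfolding a(1) sigma_pow_j[OF a(4)] using a(2) by (intro gradeI inv_closed(7) inv_closed(6) a(3)) simp
qed

text \<open>The family \<open>a\<close> is homogeneous at all integers and not only on
  \<open>A\<close>, so families over different finite sets can be extended by zero and
  compared.\<close>

definition span :: "'a set" where
  "span = {\<Sum>k\<in>A. a k | A a. finite A \<and> (\<forall>k. a k \<in> grade k)}"

lemma grade_span: "a \<in> grade k \<Longrightarrow> a \<in> span"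
  unfolding span_def
  by (intro CollectI exI[of _ "{k}"] exI[of _ "(\<lambda>_. 0)(k := a)"]) (auto simp: grade_zero)

lemma sum_restrict_grade:
  assumes "finite C" "A \<subseteq> C"
  shows "(\<Sum>k\<in>A. a k) = (\<Sum>k\<in>C. if k \<in> A then a k else (0::'a))"
proof -
  have "(\<Sum>k\<in>C. if k \<in> A then a k else 0) = (\<Sum>k\<in>C \<inter> A. a k)" using assms by (simp add: sum.inter_restrict)
  then show ?thesis using assms by (simp add: Int_absorb1)
qed

lemma span_add:
  assumes "x \<in> span" "y \<in> span"
  shows "x + y \<in> span"
proof -
  obtain A a where a: "x = (\<Sum>k\<in>A. a k)" "finite A" "\<And>k. a k \<in> grade k" using assms(1) unfolding span_def by blast
  obtain B b where b: "y = (\<Sum>k\<in>B. b k)" "finite B" "\<And>k. b k \<in> grade k" using assms(2) unfolding span_def by blast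
  define c where "c k = (if k \<in> A then a k else 0) + (if k \<in> B then b k else 0)" for k
  have "x + y = (\<Sum>k\<in>A \<union> B. c k)"
    unfolding a(1) b(1) c_def sum.distrib using a(2) b(2)
    by (simp add: sum_restrict_grade[of "A \<union> B" A a] sum_restrict_grade[of "A \<union> B" B b])
  moreover have "c k \<in> grade k" for k unfolding c_def by (intro grade_add) (auto simp: a(3) b(3) grade_zero)
  ultimately show ?thesis using a(2) b(2) unfolding span_def by blast
qed

lemma span_sum: "(\<And>i. i \<in> I \<Longrightarrow> f i \<in> span) \<Longrightarrow> (\<Sum>i\<in>I. f i) \<in> span"
  by (induction I rule: infinite_finite_induct) (auto intro: span_add grade_span[OF grade_zero[of 0]])

lemma span_scale: "x \<in> span \<Longrightarrow> scaleC c x \<in> span"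
  unfolding span_def using grade_scale by (fastforce simp: scaleC_sum_right)

lemma span_mult:
  assumes "x \<in> span" "y \<in> span"
  shows "x * y \<in> span"
proof -
  obtain A a where a: "x = (\<Sum>k\<in>A. a k)" "finite A" "\<And>k. a k \<in> grade k" using assms(1) unfolding span_def by blast
  obtain B b where b: "y = (\<Sum>k\<in>B. b k)" "finite B" "\<And>k. b k \<in> grade k" using assms(2) unfolding span_def by blast
  show ?thesis
    unfolding a(1) b(1) sum_product by (rule span_sum, rule span_sum, rule grade_span, rule grade_mult, rule a(3), rule b(3))
qed

lemma span_star: 
  assumes "x \<in> span"
  shows "star x \<in> span"
proof -
  obtain A a where a: "x = (\<Sum>k\<in>A. a k)" "finite A" "\<And>k. a k \<in> grade k" using assms(1) unfolding span_def by blast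
  show ?thesis unfolding a(1) star_sum by (rule span_sum, rule grade_span, rule grade_star, rule a(3))
qed

section \<open>The invariant algebra and its unit\<close>

abbreviation OG :: "'a set" where "OG \<equiv> invariant_algebra E j G"

lemma OG_subalgebra: "cstar_subalgebra OG"
  unfolding invariant_algebra_def by (rule cstar_generated(1))

lemmas OG_closed = cstar_subalgebraD[OF OG_subalgebra]

lemma j_OG: "t \<in> inv_hom r s \<Longrightarrow> j r s t \<in> OG"
  unfolding invariant_algebra_def
  by (rule subsetD[OF cstar_generated(2)]) blast

lemma OG_span: "OG \<subseteq> closure span"
  unfolding invariant_algebra_def
proof (rule cstar_generated(3))
  show "cstar_subalgebra (closure span)"
    by (rule cstar_subalgebra_closure)
      (auto intro: span_add span_mult span_star span_scale grade_span[OF grade_zero[of 0]])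
  show "(\<Union>r s. j r s ` inv_hom r s) \<subseteq> closure span"
    using gradeI grade_span closure_subset by blast
qed

lemma OG_approx:
  assumes "t \<in> OG" "e > 0"
  obtains A a where "finite A" "\<And>k. a k \<in> grade k" "norm (t - (\<Sum>k\<in>A. a k)) < e"
proof -
  have "t \<in> closure span" using assms(1) OG_span by blast
  then obtain y where "y \<in> span" "dist y t < e" using assms(2) unfolding closure_approachable by blast
  then show ?thesis using that unfolding span_def by (auto simp: dist_norm norm_minus_commute)
qed

text \<open>Induction over sums alone: homogeneous elements are stable under products and adjoints,
  so their sums are already dense.\<close>

lemma OG_induct:
  assumes j: "\<And>r s t. t \<in> inv_hom r s \<Longrightarrow> P (j r s t)"
    and add: "\<And>a b. P a \<Longrightarrow> P b \<Longrightarrow> P (a + b)"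
    and closed: "closed {a. P a}" and a: "a \<in> OG"
  shows "P a"
proof -
  have g: "P a" if "a \<in> grade k" for a k using that by (elim gradeE) (simp add: j)
  have "P (\<Sum>k\<in>A. a k)" if "finite A" "\<forall>k. a k \<in> grade k" for A and a :: "int \<Rightarrow> 'a"
    using that(1) by (induction A rule: finite_induct) (use g that(2) grade_zero in \<open>auto intro: add\<close>)
  then have "span \<subseteq> {a. P a}" unfolding span_def by blast
  then show ?thesis using closure_minimal[OF _ closed] OG_span a by blast
qed

lemma sigma_OG: "a \<in> OG \<Longrightarrow> (\<sigma> ^^ n) a \<in> OG"
proof (rule OG_induct[of "\<lambda>a. (\<sigma> ^^ n) a \<in> OG"])
  show "(\<sigma> ^^ n) (j r s t) \<in> OG" if t: "t \<in> inv_hom r s" for r s t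
    unfolding sigma_pow_j[OF inv_closed(1)[OF t]] by (intro j_OG inv_closed(7) inv_closed(6) t)
  show "closed {a. (\<sigma> ^^ n) a \<in> OG}"
    using closed_vimage[OF OG_closed(1) sigma_pow(1)[of n]] by (simp add: vimage_def)
qed (simp_all add: sigma_pow(2) OG_closed(3))

lemma intertwine:
  assumes t: "t \<in> thom E r s" and a: "a \<in> OG"
  shows "j r s t * (\<sigma> ^^ r) a = (\<sigma> ^^ s) a * j r s t"
proof (rule OG_induct[of "\<lambda>a. j r s t * (\<sigma> ^^ r) a = (\<sigma> ^^ s) a * j r s t", OF _ _ _ a])
  show "j r s t * (\<sigma> ^^ r) (j p q w) = (\<sigma> ^^ s) (j p q w) * j r s t" if "w \<in> inv_hom p q" for p q w
    using j_sigma_mult[OF t inv_closed(1)[OF that]] by simp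
  show "closed {a. j r s t * (\<sigma> ^^ r) a = (\<sigma> ^^ s) a * j r s t}"
    by (intro closed_Collect_eq continuous_on_mult continuous_on_const sigma_pow(1))
qed (simp add: sigma_pow(2) distrib_left distrib_right)

text \<open>The class of C*-algebras provides no unit. This element is the unit of O_G; it is
  \<open>0\<close> over an empty base, and for this reason its norm is only bounded by 1
  below.\<close>

definition e :: 'a where "e = j 0 0 (mid (tpow E 0))"

lemma e_eq: "j n n (mid (tpow E n)) = e"
  using j_raise[OF thom_closed(5), of 0 n] by (simp add: e_def mtensor_mid)

lemma e_j:
  assumes t: "t \<in> thom E r s"
  shows "e * j r s t = j r s t" "j r s t * e = j r s t"
proof -
  show "e * j r s t = j r s t"
    using j_simps(6)[OF t thom_closed(5)] unfolding mcomp_mid[OF t] e_eq by simp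
  show "j r s t * e = j r s t"
    using j_simps(6)[OF thom_closed(5) t] unfolding mcomp_mid[OF t] e_eq by simp
qed

lemma e_OG: "e \<in> OG"
  unfolding e_def by (rule j_OG[OF inv_closed(6)])

lemma e_unit:
  assumes "a \<in> OG"
  shows "e * a = a" "a * e = a"
proof -
  have "e * a = a \<and> a * e = a"
    by (rule OG_induct[of "\<lambda>a. e * a = a \<and> a * e = a", OF _ _ _ assms])
      (auto simp: e_j inv_closed(1) distrib_left distrib_right Collect_conj_eq
        intro!: closed_Int closed_Collect_eq continuous_intros)
  then show "e * a = a" "a * e = a" by blast+
qed

lemma algebra_unit: "algebra_unit OG = e"
  unfolding algebra_unit_def
proof (rule the_equality)
  show "e \<in> OG \<and> (\<forall>a\<in>OG. e * a = a \<and> a * e = a)" using e_OG e_unit by blast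
  show "u = e" if "u \<in> OG \<and> (\<forall>a\<in>OG. u * a = a \<and> a * u = a)" for u
    using that e_OG e_unit(2)[of u] by metis
qed

lemma sigma_e: "(\<sigma> ^^ n) e = e"
proof -
  have "(\<sigma> ^^ n) (j 0 0 (mid (tpow E 0))) = j (n + 0) (n + 0) (mid (tpow E (n + 0)))"
    unfolding sigma_pow_j[OF thom_closed(5)] mtensor_mid ..
  then show ?thesis unfolding e_eq .
qed

lemma star_e: "star e = e"
proof -
  have "star e * e = star e" by (rule e_unit(2)[OF OG_closed(5)[OF e_OG]])
  moreover have "star (star e * e) = star e * e" by (simp add: star_mult star_star)
  ultimately show ?thesis by (simp add: star_star)
qed

lemma norm_e: "norm e \<le> 1"
proof -
  have "(norm e)\<^sup>2 = norm e" using norm_star_mult[of e] by (simp add: star_e e_unit[OF e_OG])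
  then have "norm e * (norm e - 1) = 0" by (simp add: power2_eq_square algebra_simps)
  then show ?thesis by auto
qed

lemma norm_sum_grade:
  assumes A: "finite A" and n: "n \<ge> 1" and a: "\<And>k. a k \<in> grade k"
  shows "norm (\<Sum>k\<in>A. scaleC (of_real (fejer_weight n (k - k0))) (a k)) \<le> norm (\<Sum>k\<in>A. a k)"
proof (rule fejer_contraction[OF A n])
  have "\<forall>A a z. finite A \<and> (\<forall>k\<in>A. a k \<in> cp_grade E j k) \<and> cmod z = 1 \<longrightarrow>
        norm (\<Sum>k\<in>A. scaleC (z powi k) (a k)) = norm (\<Sum>k\<in>A. a k)"
    using cp unfolding cuntz_pimsner_def by blast
  then show "norm (\<Sum>k\<in>A. scaleC (z powi k) (a k)) = norm (\<Sum>k\<in>A. a k)" if "cmod z = 1" for z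
    using A a grade_cp that by blast
qed

text \<open>The Fejer weight of order 1 centred at \<open>k\<close> is 1 at \<open>k\<close> and 0
  at all other integers, so the mean is the component itself.\<close>

lemma norm_grade_component:
  assumes A: "finite A" and a: "\<And>k. a k \<in> grade k" and k: "k \<in> A"
  shows "norm (a k) \<le> norm (\<Sum>k\<in>A. a k)"
proof -
  have w: "fejer_weight 1 (l - k) = (if l = k then 1 else 0)" for l
    using fejer_weight(4)[of 1 "l - k"] fejer_weight(5)[of 1] by auto
  have "(\<Sum>l\<in>A. scaleC (of_real (fejer_weight 1 (l - k))) (a l)) = (\<Sum>l\<in>A. if l = k then a k else 0)"
    by (intro sum.cong refl) (simp only: w, simp)
  also have "\<dots> = a k" using A k by simp
  finally show ?thesis using norm_sum_grade[OF A order_refl a, of k] by simp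
qed

end

section \<open>Intertwiners\<close>

context cuntz_pimsner_setup
begin

definition jf :: 'a where "jf = j (1 + 1) (1 + 1) (flip 1)"

lemma jf_OG: "jf \<in> OG"
  unfolding jf_def by (rule j_OG[OF inv_closed(8)])

lemma symmetry_norm:
  assumes w: "w \<in> thom E n n" "madj (tpow E n) (tpow E n) w = w" "mcomp (tpow E n) w w = mid (tpow E n)"
  shows "j n n w * j n n w = e" "norm ((\<sigma> ^^ N) (j n n w)) \<le> 1"
proof -
  show ww: "j n n w * j n n w = e"
    using j_simps(6)[OF w(1,1)] by (simp add: w(3) e_eq)
  have "star (j n n w) = j n n w" using j_simps(3)[OF w(1)] by (simp add: w(2))
  then have "star ((\<sigma> ^^ N) (j n n w)) * (\<sigma> ^^ N) (j n n w) = e"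
    by (simp add: sigma_pow(4)[symmetric] sigma_pow(3)[symmetric] ww sigma_e)
  then have "(norm ((\<sigma> ^^ N) (j n n w)))\<^sup>2 \<le> 1"
    using norm_star_mult[of "(\<sigma> ^^ N) (j n n w)"] norm_e by simp
  then show "norm ((\<sigma> ^^ N) (j n n w)) \<le> 1" by (simp add: abs_square_le_1)
qed

lemma flip_norm: "j (n + n) (n + n) (flip n) * j (n + n) (n + n) (flip n) = e"
  "norm ((\<sigma> ^^ N) (j (n + n) (n + n) (flip n))) \<le> 1"
  by (rule symmetry_norm[OF flip(1) flip_self_adjoint flip_involution])+

text \<open>Both flips act beyond the slots of \<open>y\<close>, so the product is a tensor product of \<open>y\<close> with a
  morphism that has a matrix coefficient \<open>1\<close>.\<close>

lemma translate_lower: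
  assumes y: "y \<in> thom E p q" and m: "m \<ge> 1"
  shows "norm (j p q y) \<le> norm (j p q y * ((\<sigma> ^^ (p + i)) jf - (\<sigma> ^^ (p + i + m)) jf))"
proof -
  define z where "z = mdiff (tpow E (m + (1 + 1))) (tpow E (m + (1 + 1)))
    (mtensor E (1 + 1) (1 + 1) m m (flip 1) (mid (tpow E m))) (mtensor E m m (1 + 1) (1 + 1) (mid (tpow E m)) (flip 1))"
  have c: "(1 + 1) + m = m + (1 + 1)" by (rule add.commute)
  have t1: "mtensor E (1 + 1) (1 + 1) m m (flip 1) (mid (tpow E m)) \<in> thom E (m + (1 + 1)) (m + (1 + 1))"
    using mtensor(1)[OF flip(1)[of 1] thom_closed(5)[of m]] unfolding c .
  have t2: "mtensor E m m (1 + 1) (1 + 1) (mid (tpow E m)) (flip 1) \<in> thom E (m + (1 + 1)) (m + (1 + 1))"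
    by (rule mtensor(1)[OF thom_closed(5) flip(1)])
  have z: "z \<in> thom E (m + (1 + 1)) (m + (1 + 1))" unfolding z_def by (rule TT.mdiff_bmor[OF t1 t2])
  have jz: "j (m + (1 + 1)) (m + (1 + 1)) z = jf - (\<sigma> ^^ m) jf"
    unfolding z_def j_mdiff[OF t1 t2] jf_def sigma_pow_j[OF flip(1)] using j_raise[OF flip(1), of 1 m] unfolding c by simp
  \<comment> \<open>Padding with \<open>i\<close> identities turns the gap between \<open>y\<close>
    and the nearer flip into slots of \<open>y'\<close>, which represents the same element.\<close>
  define y' where "y' = mtensor E p q i i y (mid (tpow E i))"
  have y': "y' \<in> thom E (p + i) (q + i)" unfolding y'_def by (rule mtensor(1)[OF y thom_closed(5)])
  have jy': "j (p + i) (q + i) y' = j p q y" unfolding y'_def by (rule j_raise[OF y])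
  have "norm (j p q y) = mn (p + i) (q + i) y'" using j_simps(2)[OF y'] by (simp add: jy')
  also have "\<dots> \<le> mn (p + i + (m + (1 + 1))) (q + i + (m + (1 + 1)))
      (mtensor E (p + i) (q + i) (m + (1 + 1)) (m + (1 + 1)) y' z)"
    by (rule mn_mtensor_lower[OF y' z]) (unfold z_def, rule flip_translate_entry[OF rank m])
  also have "\<dots> = norm (j p q y * (\<sigma> ^^ (p + i)) (j (m + (1 + 1)) (m + (1 + 1)) z))"
    unfolding jy'[symmetric] j_sigma_mult(1)[OF y' z] j_simps(2)[OF mtensor(1)[OF y' z]] ..
  also have "(\<sigma> ^^ (p + i)) (j (m + (1 + 1)) (m + (1 + 1)) z) = (\<sigma> ^^ (p + i)) jf - (\<sigma> ^^ (p + i + m)) jf"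
    unfolding jz by (simp add: sigma_pow_diff funpow_add)
  finally show ?thesis .
qed

lemma off_grade:
  assumes a: "a \<in> grade k" and k: "k \<noteq> int s - int r"
  shows "\<exists>M. norm a \<le> norm (a * (\<sigma> ^^ r) ((\<sigma> ^^ M) jf) - (\<sigma> ^^ s) ((\<sigma> ^^ M) jf) * a)"
proof -
  obtain p q y where y: "a = j p q y" "int q - int p = k" "y \<in> thom E p q" using a by (blast elim: gradeE)
  have move: "a * (\<sigma> ^^ (p + i)) jf = (\<sigma> ^^ (q + i)) jf * a" for i
    using intertwine[OF y(3) sigma_OG[OF jf_OG, of i]] by (simp add: y(1) funpow_add)
  \<comment> \<open>The shift \<open>M\<close> puts both translates beyond the slots of
    \<open>y\<close>: \<open>r + M = p + l\<close> and \<open>s + M = q + i\<close>. Moving the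
    second one through \<open>a\<close> replaces \<open>q + i\<close> by \<open>p + i\<close>, and
    \<open>l = i\<close> would mean that the degree is \<open>s - r\<close>.\<close>
  define l where "l = r + q + s"
  define M where "M = p + q + s"
  define i where "i = s + s + p"
  have eq: "r + M = p + l" "s + M = q + i" by (simp_all add: l_def M_def i_def)
  define D where "D = a * (\<sigma> ^^ r) ((\<sigma> ^^ M) jf) - (\<sigma> ^^ s) ((\<sigma> ^^ M) jf) * a"
  have D: "D = a * (\<sigma> ^^ (p + l)) jf - (\<sigma> ^^ (q + i)) jf * a"
    unfolding D_def eq[symmetric] by (simp add: funpow_add)
  then have D': "D = a * ((\<sigma> ^^ (p + l)) jf - (\<sigma> ^^ (p + i)) jf)"
    by (simp add: move right_diff_distrib)
  have "l \<noteq> i" using k y(2) by (auto simp: l_def i_def)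
  then consider "l < i" | "i < l" by linarith
  then have "norm a \<le> norm D"
  proof cases
    case 1
    have "norm a \<le> norm (a * ((\<sigma> ^^ (p + l)) jf - (\<sigma> ^^ (p + l + (i - l))) jf))"
      unfolding y(1) by (rule translate_lower[OF y(3)]) (use 1 in simp)
    then show ?thesis using 1 by (simp add: D')
  next
    case 2
    have "norm a \<le> norm (a * ((\<sigma> ^^ (p + i)) jf - (\<sigma> ^^ (p + i + (l - i))) jf))"
      unfolding y(1) by (rule translate_lower[OF y(3)]) (use 2 in simp)
    then have "norm a \<le> norm (a * ((\<sigma> ^^ (p + i)) jf - (\<sigma> ^^ (p + l)) jf))" using 2 by simp
    also have "a * ((\<sigma> ^^ (p + i)) jf - (\<sigma> ^^ (p + l)) jf) = - D" by (simp add: D' algebra_simps)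
    finally show ?thesis by simp
  qed
  then show ?thesis unfolding D_def by blast
qed

section \<open>Approximation of intertwiners by morphisms\<close>

definition intertwiner :: "nat \<Rightarrow> nat \<Rightarrow> 'a \<Rightarrow> bool" where
  "intertwiner r s t \<longleftrightarrow> t \<in> OG \<and> (\<forall>a\<in>OG. t * (\<sigma> ^^ r) a = (\<sigma> ^^ s) a * t)"

text \<open>The corresponding expression for \<open>t\<close> vanishes, so only the error
  \<open>t - a\<close> contributes, once on each side.\<close>

lemma commutator_small:
  assumes t: "intertwiner r s t" and W: "W \<in> OG" "norm ((\<sigma> ^^ r) W) \<le> 1" "norm ((\<sigma> ^^ s) W) \<le> 1"
    and a: "norm (t - a) \<le> \<epsilon>"
  shows "norm (a * (\<sigma> ^^ r) W - (\<sigma> ^^ s) W * a) \<le> 2 * \<epsilon>"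
proof -
  have "a * (\<sigma> ^^ r) W - (\<sigma> ^^ s) W * a = (\<sigma> ^^ s) W * (t - a) - (t - a) * (\<sigma> ^^ r) W"
    using t W(1) by (simp add: intertwiner_def algebra_simps)
  also have "norm \<dots> \<le> norm ((\<sigma> ^^ s) W) * norm (t - a) + norm (t - a) * norm ((\<sigma> ^^ r) W)"
    by (intro order_trans[OF norm_triangle_ineq4] add_mono norm_mult_ineq)
  also have "\<dots> \<le> 1 * \<epsilon> + \<epsilon> * 1"
    by (intro add_mono mult_mono W a norm_ge_zero order_trans[OF norm_ge_zero a]) simp_all
  finally show ?thesis by simp
qed

text \<open>Translates of the flip have degree 0, so the commutator with the sum splits into
  commutators with the components, each in its own degree. A component is bounded by the whole, and
  the translate may be chosen for the one \<open>k\<close> under consideration.\<close>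

lemma off_grade_small:
  assumes t: "intertwiner r s t" and A: "finite A" and a: "\<And>k. a k \<in> grade k"
    and close: "norm (t - (\<Sum>k\<in>A. a k)) \<le> \<epsilon>" and k: "k \<in> A" "k \<noteq> int s - int r"
  shows "norm (a k) \<le> 2 * \<epsilon>"
proof -
  obtain M where M: "norm (a k) \<le> norm (a k * (\<sigma> ^^ r) ((\<sigma> ^^ M) jf) - (\<sigma> ^^ s) ((\<sigma> ^^ M) jf) * a k)"
    using off_grade[OF a k(2)] by blast
  define W where "W = (\<sigma> ^^ M) jf"
  have W: "W \<in> OG" unfolding W_def by (rule sigma_OG[OF jf_OG])
  have Wn: "norm ((\<sigma> ^^ N) W) \<le> 1" for N
    using flip_norm(2)[of "N + M" 1] by (simp only: W_def jf_def funpow_add o_apply)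
  have Wg: "(\<sigma> ^^ N) W \<in> grade 0" for N
    unfolding W_def jf_def by (intro grade_sigma gradeI inv_closed(8)) simp
  define D where "D k = a k * (\<sigma> ^^ r) W - (\<sigma> ^^ s) W * a k" for k
  have D: "D k \<in> grade k" for k
    using grade_mult[OF a Wg] grade_mult[OF Wg a] unfolding D_def by (intro grade_diff) simp_all
  have "norm (D k) \<le> norm (\<Sum>k\<in>A. D k)" by (rule norm_grade_component[OF A D k(1)])
  also have "(\<Sum>k\<in>A. D k) = (\<Sum>k\<in>A. a k) * (\<sigma> ^^ r) W - (\<sigma> ^^ s) W * (\<Sum>k\<in>A. a k)"
    by (simp add: D_def sum_subtractf sum_distrib_left sum_distrib_right)
  also have "norm \<dots> \<le> 2 * \<epsilon>" by (rule commutator_small[OF t W Wn Wn close])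
  finally show ?thesis using M unfolding D_def W_def by linarith
qed

text \<open>One approximation does not suffice: each component of wrong degree is small, but their
  number depends on the accuracy. A first approximation fixes the order \<open>n\<close> of the
  Fejer means, a second one has an accuracy adapted to \<open>n\<close>, and contractivity compares
  their means. The four errors are 1, 1, 2 and 1 times \<epsilon>.\<close>

lemma graded_approx:
  assumes t: "intertwiner r s t" and \<epsilon>: "\<epsilon> > 0"
  shows "\<exists>c\<in>grade (int s - int r). norm (t - c) \<le> 5 * \<epsilon>"
proof -
  define k0 where "k0 = int s - int r"
  have tOG: "t \<in> OG" using t by (simp add: intertwiner_def)
  obtain A a where A: "finite A" and a: "\<And>k. a k \<in> grade k" and ta: "norm (t - (\<Sum>k\<in>A. a k)) < \<epsilon>"
    using OG_approx[OF tOG \<epsilon>] by blast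
  define R where "R = (\<Sum>k\<in>A. \<bar>of_int (k - k0)\<bar> * norm (a k))"
  have R0: "0 \<le> R" by (simp add: R_def sum_nonneg)
  \<comment> \<open>With this order the mean moves the first approximation by at most \<epsilon>: a
    component at distance \<open>l\<close> from \<open>k0\<close> loses at most the fraction
    \<open>l / n\<close>.\<close>
  define n where "n = nat \<lceil>R / \<epsilon>\<rceil> + 1"
  have n: "n \<ge> 1" by (simp add: n_def)
  have "R / \<epsilon> \<le> real n" by (simp add: n_def) linarith
  then have Rn: "R / real n \<le> \<epsilon>" using \<epsilon> n by (simp add: field_simps)
  \<comment> \<open>The weights vanish outside a window of \<open>2 * n\<close> degrees around
    \<open>k0\<close>. Inside it the components of wrong degree have norm at most
    \<open>2 * \<delta>\<close>, in total \<open>4 * n * \<delta> = \<epsilon>\<close>.\<close>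
  define \<delta> where "\<delta> = \<epsilon> / (4 * real n)"
  have \<delta>: "\<delta> > 0" "\<delta> \<le> \<epsilon>" using \<epsilon> n by (simp_all add: \<delta>_def field_simps)
  obtain A' a' where A': "finite A'" and a': "\<And>k. a' k \<in> grade k" and ta': "norm (t - (\<Sum>k\<in>A'. a' k)) < \<delta>"
    using OG_approx[OF tOG \<delta>(1)] by blast
  define C where "C = insert k0 (A \<union> A')"
  have C: "finite C" "A \<subseteq> C" "A' \<subseteq> C" "k0 \<in> C" using A A' by (auto simp: C_def)
  define b where "b k = (if k \<in> A then a k else 0)" for k
  define b' where "b' k = (if k \<in> A' then a' k else 0)" for k
  have bg: "b k \<in> grade k" "b' k \<in> grade k" for k by (simp_all add: b_def b'_def a a' grade_zero)
  have sums: "(\<Sum>k\<in>A. a k) = (\<Sum>k\<in>C. b k)" "(\<Sum>k\<in>A'. a' k) = (\<Sum>k\<in>C. b' k)"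
    unfolding b_def b'_def by (rule sum_restrict_grade[OF C(1,2)], rule sum_restrict_grade[OF C(1,3)])
  define w where "w k = fejer_weight n (k - k0)" for k
  define \<Phi> where "\<Phi> f = (\<Sum>k\<in>C. scaleC (of_real (w k)) (f k))" for f :: "int \<Rightarrow> 'a"
  have off: "norm (b' k) \<le> 2 * \<delta>" if "k \<noteq> k0" for k
    using off_grade_small[OF t A' a' less_imp_le[OF ta'], of k] that \<delta>(1) by (auto simp: b'_def k0_def)
  have w01: "0 \<le> w k" "w k \<le> 1" for k unfolding w_def by (rule fejer_weight[OF n])+
  have 1: "norm ((\<Sum>k\<in>C. b k) - \<Phi> b) \<le> \<epsilon>"
  proof -
    have "(\<Sum>k\<in>C. b k) - \<Phi> b = (\<Sum>k\<in>C. scaleC (of_real (1 - w k)) (b k))"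
      unfolding \<Phi>_def sum_subtractf[symmetric]
    proof (intro sum.cong refl)
      fix k
      have "scaleC (of_real (1 - w k) + of_real (w k)) (b k) = b k" by simp
      then show "b k - scaleC (of_real (w k)) (b k) = scaleC (of_real (1 - w k)) (b k)"
        unfolding scaleC_add_left by (simp add: algebra_simps)
    qed
    also have "norm \<dots> \<le> (\<Sum>k\<in>C. if k \<in> A then \<bar>of_int (k - k0)\<bar> * norm (a k) / real n else 0)"
    proof (intro order_trans[OF norm_sum] sum_mono)
      fix k
      have "norm (scaleC (of_real (1 - w k)) (b k)) = (1 - w k) * norm (b k)"
        using w01(2)[of k] by (simp add: norm_scaleC norm_of_real del: of_real_diff)
      also have "\<dots> \<le> (\<bar>of_int (k - k0)\<bar> / real n) * norm (b k)"
        using fejer_weight(3)[OF n, of "k - k0"] unfolding w_def by (rule mult_right_mono) simp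
      finally show "norm (scaleC (of_real (1 - w k)) (b k)) \<le> (if k \<in> A then \<bar>of_int (k - k0)\<bar> * norm (a k) / real n else 0)"
        by (auto simp: b_def)
    qed
    also have "\<dots> = R / real n"
      using C(1,2) by (simp add: R_def sum.inter_restrict[symmetric] Int_absorb1 sum_divide_distrib)
    finally show ?thesis using Rn by linarith
  qed
  have 2: "norm (\<Phi> b - \<Phi> b') \<le> 2 * \<epsilon>"
  proof -
    have "\<Phi> b - \<Phi> b' = (\<Sum>k\<in>C. scaleC (of_real (fejer_weight n (k - k0))) (b k - b' k))"
      by (simp add: \<Phi>_def w_def scaleC_diff_right sum_subtractf)
    also have "norm \<dots> \<le> norm (\<Sum>k\<in>C. b k - b' k)"
      by (rule norm_sum_grade[OF C(1) n]) (intro grade_diff bg)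
    also have "(\<Sum>k\<in>C. b k - b' k) = (t - (\<Sum>k\<in>C. b' k)) - (t - (\<Sum>k\<in>C. b k))"
      by (simp add: sum_subtractf)
    also have "norm \<dots> \<le> \<delta> + \<epsilon>"
      using ta ta' norm_triangle_ineq4[of "t - (\<Sum>k\<in>C. b' k)" "t - (\<Sum>k\<in>C. b k)"]
      unfolding sums by linarith
    finally show ?thesis using \<delta>(2) by linarith
  qed
  have 3: "norm (\<Phi> b' - b' k0) \<le> \<epsilon>"
  proof -
    have "\<Phi> b' = b' k0 + (\<Sum>k\<in>C - {k0}. scaleC (of_real (w k)) (b' k))"
      unfolding \<Phi>_def using sum.remove[OF C(1,4), of "\<lambda>k. scaleC (of_real (w k)) (b' k)"]
      by (simp add: w_def fejer_weight(5)[OF n])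
    then have "norm (\<Phi> b' - b' k0) = norm (\<Sum>k\<in>C - {k0}. scaleC (of_real (w k)) (b' k))" by simp
    also have "\<dots> \<le> (\<Sum>k\<in>C - {k0}. if k \<in> {k0 - int n..<k0 + int n} then 2 * \<delta> else 0)"
    proof (intro order_trans[OF norm_sum] sum_mono)
      fix k assume k: "k \<in> C - {k0}"
      show "norm (scaleC (of_real (w k)) (b' k)) \<le> (if k \<in> {k0 - int n..<k0 + int n} then 2 * \<delta> else 0)"
      proof (cases "k \<in> {k0 - int n..<k0 + int n}")
        case True
        have "norm (scaleC (of_real (w k)) (b' k)) = w k * norm (b' k)"
          using w01(1)[of k] by (simp add: norm_scaleC)
        also have "\<dots> \<le> 1 * (2 * \<delta>)" using k by (intro mult_mono w01 off) auto
        finally show ?thesis using True by simp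
      next
        case False
        then have "w k = 0" unfolding w_def by (intro fejer_weight(4)[OF n]) auto
        then have "norm (scaleC (of_real (w k)) (b' k)) = 0" by simp
        then show ?thesis using \<delta>(1) by simp
      qed
    qed
    also have "\<dots> = (\<Sum>k\<in>(C - {k0}) \<inter> {k0 - int n..<k0 + int n}. 2 * \<delta>)"
      by (rule sum.inter_restrict[symmetric]) (use C(1) in simp)
    also have "\<dots> \<le> (\<Sum>k\<in>{k0 - int n..<k0 + int n}. 2 * \<delta>)"
      using \<delta>(1) by (intro sum_mono2) auto
    also have "\<dots> = \<epsilon>" using n by (simp add: \<delta>_def)
    finally show ?thesis .
  qed
  have "t - b' k0 = (t - (\<Sum>k\<in>C. b k)) + ((\<Sum>k\<in>C. b k) - \<Phi> b) + (\<Phi> b - \<Phi> b') + (\<Phi> b' - b' k0)" by simp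
  also have "norm \<dots> \<le> \<epsilon> + \<epsilon> + 2 * \<epsilon> + \<epsilon>"
    by (intro order_trans[OF norm_triangle_ineq] add_mono 1 2 3) (use ta in \<open>simp add: sums\<close>)
  finally have "norm (t - b' k0) \<le> 5 * \<epsilon>" by simp
  then show ?thesis using bg(2) unfolding k0_def by blast
qed

text \<open>Conjugation by the flip of the surplus slots fixes \<open>t\<close>, so it moves the
  approximant by at most \<open>2 * \<delta>\<close>; the partial trace turns this into a bound on
  the distance from the approximant to \<open>F\<close>, and one more \<delta> leads back to
  \<open>t\<close>.\<close>

lemma on_grade_close:
  assumes t: "intertwiner r s t" and y: "y \<in> thom E (r + n) (s + n)" and close: "norm (t - j (r + n) (s + n) y) \<le> \<delta>"
  shows "\<exists>F\<in>thom E r s. norm (t - j r s F) \<le> 3 * \<delta>"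
proof -
  define W where "W = j (n + n) (n + n) (flip n)"
  have W: "W \<in> OG" unfolding W_def by (rule j_OG[OF inv_closed(8)])
  have Wn: "norm ((\<sigma> ^^ N) W) \<le> 1" for N unfolding W_def by (rule flip_norm(2))
  have WW: "(\<sigma> ^^ N) W * (\<sigma> ^^ N) W = e" for N
    unfolding sigma_pow(3)[symmetric] W_def flip_norm(1) by (rule sigma_e)
  have tOG: "t \<in> OG" using t by (simp add: intertwiner_def)
  define a where "a = j (r + n) (s + n) y"
  have tW: "(\<sigma> ^^ s) W * (t * (\<sigma> ^^ r) W) = t"
  proof -
    have "t * (\<sigma> ^^ r) W = (\<sigma> ^^ s) W * t" using t W by (simp add: intertwiner_def)
    then show ?thesis using WW[of s] e_unit(1)[OF tOG] by (simp add: mult.assoc[symmetric])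
  qed
  let ?Y = "mtensor E (r + n) (s + n) n n y (mid (tpow E n))"
  let ?P = "\<lambda>q. mtensor E q q (n + n) (n + n) (mid (tpow E q)) (flip n)"
  let ?Z = "mcomp (tpow E (r + (n + n))) (?P s) (mcomp (tpow E (r + (n + n))) ?Y (?P r))"
  have d0: "d > 0" using rank by simp
  note sh = shift_invariant_close[OF d0 y]
  have Y: "?Y \<in> thom E (r + (n + n)) (s + (n + n))" by (rule sh(1))
  have P: "?P q \<in> thom E (q + (n + n)) (q + (n + n))" for q by (rule sh(2))
  have YP: "mcomp (tpow E (r + (n + n))) ?Y (?P r) \<in> thom E (r + (n + n)) (s + (n + n))" by (rule thom_closed(3)[OF P Y])
  have Z: "?Z \<in> thom E (r + (n + n)) (s + (n + n))" by (rule thom_closed(3)[OF YP P])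
  have jY: "j (r + (n + n)) (s + (n + n)) ?Y = a"
    using j_raise[OF y, of n] by (simp add: a_def add.assoc)
  have jP: "j (q + (n + n)) (q + (n + n)) (?P q) = (\<sigma> ^^ q) W" for q
    unfolding W_def sigma_pow_j[OF flip(1)] ..
  have jZ: "j (r + (n + n)) (s + (n + n)) ?Z = (\<sigma> ^^ s) W * (a * (\<sigma> ^^ r) W)"
    unfolding j_simps(6)[OF YP P] j_simps(6)[OF P Y] jY jP ..
  obtain F where F: "F \<in> thom E r s"
    and Fle: "mn (r + n) (s + n) (mdiff (tpow E (r + n)) (tpow E (s + n)) (mtensor E r s n n F (mid (tpow E n))) y)
      \<le> mn (r + (n + n)) (s + (n + n)) (mdiff (tpow E (r + (n + n))) (tpow E (s + (n + n))) ?Z ?Y)"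
    using sh(3) by blast
  have "norm (j r s F - a) = mn (r + n) (s + n) (mdiff (tpow E (r + n)) (tpow E (s + n)) (mtensor E r s n n F (mid (tpow E n))) y)"
    unfolding a_def j_raise[OF F, of n, symmetric] by (rule norm_j_diff[OF mtensor(1)[OF F thom_closed(5)] y])
  also have "\<dots> \<le> norm ((\<sigma> ^^ s) W * (a * (\<sigma> ^^ r) W) - a)"
    using Fle norm_j_diff[OF Z Y] by (simp only: jZ jY)
  also have "(\<sigma> ^^ s) W * (a * (\<sigma> ^^ r) W) - a = (t - a) - (\<sigma> ^^ s) W * ((t - a) * (\<sigma> ^^ r) W)"
    using tW by (simp add: algebra_simps)
  also have "norm \<dots> \<le> norm (t - a) + norm ((\<sigma> ^^ s) W) * (norm (t - a) * norm ((\<sigma> ^^ r) W))"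
    by (intro order_trans[OF norm_triangle_ineq4] add_mono order_refl order_trans[OF norm_mult_ineq]
        mult_left_mono norm_mult_ineq norm_ge_zero)
  also have "\<dots> \<le> \<delta> + 1 * (\<delta> * 1)"
    using close unfolding a_def[symmetric]
    by (intro add_mono mult_mono Wn norm_ge_zero mult_nonneg_nonneg) (auto intro: order_trans[OF norm_ge_zero])
  finally have "norm (j r s F - a) \<le> 2 * \<delta>" by simp
  moreover have "norm (t - j r s F) \<le> norm (t - a) + norm (j r s F - a)"
    using norm_triangle_ineq4[of "t - a" "j r s F - a"] by simp
  ultimately show ?thesis using F close unfolding a_def[symmetric] by (intro bexI[of _ F]) linarith+
qed

lemma intertwiner_approx:
  assumes t: "intertwiner r s t" and \<epsilon>: "\<epsilon> > 0"
  shows "\<exists>n. \<exists>y\<in>inv_hom (r + n) (s + n). norm (t - j (r + n) (s + n) y) \<le> \<epsilon>"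
proof -
  obtain c where c: "c \<in> grade (int s - int r)" "norm (t - c) \<le> 5 * (\<epsilon> / 5)"
    using graded_approx[OF t, of "\<epsilon> / 5"] \<epsilon> by auto
  obtain p q y where y: "c = j p q y" "int q - int p = int s - int r" "y \<in> inv_hom p q" "y \<in> thom E p q"
    using c(1) by (rule gradeE)
  \<comment> \<open>Only the degree of the approximant is known. With \<open>r\<close> added
    identities its source is \<open>r + p\<close>, and the degree then forces the target
    \<open>s + p\<close>; so the number of surplus slots is \<open>p\<close>.\<close>
  have eq: "p + r = r + p" "q + r = s + p" using y(2) by auto
  have "mtensor E p q r r y (mid (tpow E r)) \<in> inv_hom (r + p) (s + p)"
    using inv_raise[OF y(3), of r] unfolding eq .
  moreover have "j (r + p) (s + p) (mtensor E p q r r y (mid (tpow E r))) = c"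
    using j_raise[OF y(4), of r] unfolding eq y(1) .
  ultimately show ?thesis using c(2) by (intro exI[of _ p] bexI) auto
qed

text \<open>The embedding is isometric and the space of morphisms is complete.\<close>

lemma closed_j_image:
  assumes F: "\<And>i::nat. F i \<in> thom E r s" and lim: "(\<lambda>i. j r s (F i)) \<longlonglongrightarrow> t"
  shows "\<exists>u\<in>thom E r s. t = j r s u"
proof -
  have "\<exists>u\<in>thom E r s. \<forall>\<epsilon>>0. \<exists>N. \<forall>n\<ge>N. mn r s (mdiff (tpow E r) (tpow E s) (F n) u) \<le> \<epsilon>"
  proof (rule thom_uniform_limit[OF F])
    fix \<epsilon> :: real assume "\<epsilon> > 0"
    then obtain N where "\<forall>m\<ge>N. \<forall>n\<ge>N. norm (j r s (F m) - j r s (F n)) < \<epsilon>"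
      using LIMSEQ_imp_Cauchy[OF lim] unfolding Cauchy_iff by blast
    then show "\<exists>N. \<forall>m\<ge>N. \<forall>n\<ge>N. mn r s (mdiff (tpow E r) (tpow E s) (F m) (F n)) \<le> \<epsilon>"
      unfolding norm_j_diff[OF F F] by (meson less_imp_le)
  qed
  then obtain u where u: "u \<in> thom E r s"
    and ul: "\<And>\<epsilon>. \<epsilon> > 0 \<Longrightarrow> \<exists>N. \<forall>n\<ge>N. norm (j r s (F n) - j r s u) \<le> \<epsilon>"
    unfolding norm_j_diff[OF F, symmetric] using norm_j_diff[OF F] by (metis (no_types, lifting))
  have "(\<lambda>i. j r s (F i)) \<longlonglongrightarrow> j r s u"
    unfolding LIMSEQ_iff
  proof (intro allI impI)
    fix \<epsilon> :: real assume "\<epsilon> > 0"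
    then obtain N where "\<forall>n\<ge>N. norm (j r s (F n) - j r s u) \<le> \<epsilon> / 2" using ul[of "\<epsilon> / 2"] by auto
    then show "\<exists>N. \<forall>n\<ge>N. norm (j r s (F n) - j r s u) < \<epsilon>" using \<open>\<epsilon> > 0\<close> by (intro exI[of _ N]) fastforce
  qed
  then show ?thesis using LIMSEQ_unique[OF lim] u by blast
qed

theorem intertwiner_iff: "intertwiner r s t \<longleftrightarrow> t \<in> j r s ` inv_hom r s"
proof
  assume "t \<in> j r s ` inv_hom r s"
  then show "intertwiner r s t"
    unfolding intertwiner_def using j_OG intertwine inv_closed(1) by auto
next
  assume t: "intertwiner r s t"
  have "\<exists>F\<in>thom E r s. norm (t - j r s F) \<le> 3 * inverse (real (Suc i))" for i
  proof -
    obtain n y where y: "y \<in> inv_hom (r + n) (s + n)" "norm (t - j (r + n) (s + n) y) \<le> inverse (real (Suc i))"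
      using intertwiner_approx[OF t, of "inverse (real (Suc i))"] by auto
    show ?thesis by (rule on_grade_close[OF t inv_closed(1)[OF y(1)] y(2)])
  qed
  then obtain F where F: "\<And>i. F i \<in> thom E r s" "\<And>i. norm (t - j r s (F i)) \<le> 3 * inverse (real (Suc i))"
    by metis
  have "(\<lambda>i. j r s (F i) - t) \<longlonglongrightarrow> 0"
  proof (rule Lim_null_comparison)
    show "\<forall>\<^sub>F i in sequentially. norm (j r s (F i) - t) \<le> 3 * inverse (real (Suc i))"
      using F(2) by (simp add: norm_minus_commute)
    show "(\<lambda>i. 3 * inverse (real (Suc i))) \<longlonglongrightarrow> 0"
      using tendsto_mult_right_zero[OF LIMSEQ_inverse_real_of_nat] by blast
  qed
  then have "(\<lambda>i. j r s (F i)) \<longlonglongrightarrow> t" by (rule LIM_zero_cancel)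
  then obtain u where u: "u \<in> thom E r s" "t = j r s u" using closed_j_image[of F, OF F(1)] by blast
  \<comment> \<open>The partial traces \<open>F i\<close> are used as mere morphisms; invariance of
    the limit is recovered from invariant approximants of \<open>t\<close> on more slots.\<close>
  have "u \<in> inv_hom r s"
  proof (rule invariant_limit[OF G _ u(1)])
    show "d > 0" using rank by simp
    fix \<epsilon> :: real assume "\<epsilon> > 0"
    then obtain n y where y: "y \<in> inv_hom (r + n) (s + n)" "norm (t - j (r + n) (s + n) y) \<le> \<epsilon>"
      using intertwiner_approx[OF t] by blast
    have "norm (t - j (r + n) (s + n) y) = mn (r + n) (s + n)
        (mdiff (tpow E (r + n)) (tpow E (s + n)) (mtensor E r s n n u (mid (tpow E n))) y)"
      unfolding u(2) j_raise[OF u(1), of n, symmetric]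
      by (rule norm_j_diff[OF mtensor(1)[OF u(1) thom_closed(5)] inv_closed(1)[OF y(1)]])
    then show "\<exists>n. \<exists>y\<in>inv_hom (r + n) (s + n). mn (r + n) (s + n)
        (mdiff (tpow E (r + n)) (tpow E (s + n)) (mtensor E r s n n u (mid (tpow E n))) y) \<le> \<epsilon>"
      using y by (intro exI[of _ n] bexI[of _ y]) simp_all
  qed
  then show "t \<in> j r s ` inv_hom r s" using u(2) by blast
qed

end

section \<open>Transfer of the category axioms\<close>

text \<open>The arrows of \<open>D\<close> correspond bijectively to those of \<open>C\<close> over
  the same objects, compatibly with all operations. Equations and estimates can then be checked
  after applying \<open>J\<close>, and witnesses are pulled back along its surjectivity.\<close>

locale category_transfer = C: tensor_cstar_category C
  for C :: "('o, 'm) tensor_cat" +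
  fixes D :: "('o, 'n) tensor_cat" and J :: "'o \<Rightarrow> 'o \<Rightarrow> 'n \<Rightarrow> 'm"
  assumes obj: "Obj D = Obj C" "TUn D = TUn C" "TOb D = TOb C"
    and bij: "\<lbrakk>r \<in> Obj C; s \<in> Obj C\<rbrakk> \<Longrightarrow> bij_betw (J r s) (Arr D r s) (Arr C r s)"
    and add: "\<lbrakk>r \<in> Obj C; s \<in> Obj C; t \<in> Arr D r s; t' \<in> Arr D r s\<rbrakk> \<Longrightarrow>
      Add D r s t t' \<in> Arr D r s \<and> J r s (Add D r s t t') = Add C r s (J r s t) (J r s t')"
    and scl: "\<lbrakk>r \<in> Obj C; s \<in> Obj C; t \<in> Arr D r s\<rbrakk> \<Longrightarrow>
      Scl D r s c t \<in> Arr D r s \<and> J r s (Scl D r s c t) = Scl C r s c (J r s t)"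
    and cmp: "\<lbrakk>r \<in> Obj C; s \<in> Obj C; u \<in> Obj C; t \<in> Arr D r s; t' \<in> Arr D s u\<rbrakk> \<Longrightarrow>
      Cmp D r s u t' t \<in> Arr D r u \<and> J r u (Cmp D r s u t' t) = Cmp C r s u (J s u t') (J r s t)"
    and idt: "r \<in> Obj C \<Longrightarrow> Idt D r \<in> Arr D r r \<and> J r r (Idt D r) = Idt C r"
    and adj: "\<lbrakk>r \<in> Obj C; s \<in> Obj C; t \<in> Arr D r s\<rbrakk> \<Longrightarrow>
      Adj D r s t \<in> Arr D s r \<and> J s r (Adj D r s t) = Adj C r s (J r s t)"
    and nrm: "\<lbrakk>r \<in> Obj C; s \<in> Obj C; t \<in> Arr D r s\<rbrakk> \<Longrightarrow> Nrm D r s t = Nrm C r s (J r s t)"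
    and tar: "\<lbrakk>r \<in> Obj C; s \<in> Obj C; r' \<in> Obj C; s' \<in> Obj C; t \<in> Arr D r s; t' \<in> Arr D r' s'\<rbrakk> \<Longrightarrow>
      TAr D r s r' s' t t' \<in> Arr D (TOb C r r') (TOb C s s') \<and>
      J (TOb C r r') (TOb C s s') (TAr D r s r' s' t t') = TAr C r s r' s' (J r s t) (J r' s' t')"
begin

lemma JC: "\<lbrakk>r \<in> Obj C; s \<in> Obj C; t \<in> Arr D r s\<rbrakk> \<Longrightarrow> J r s t \<in> Arr C r s"
  using bij by (auto simp: bij_betw_def)

lemma J_eqI: "\<lbrakk>r \<in> Obj C; s \<in> Obj C; t \<in> Arr D r s; t' \<in> Arr D r s; J r s t = J r s t'\<rbrakk> \<Longrightarrow> t = t'"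
  using bij[of r s] by (auto simp: bij_betw_def inj_on_def)

lemma J_surj:
  assumes "r \<in> Obj C" "s \<in> Obj C" "t \<in> Arr C r s"
  obtains t' where "t' \<in> Arr D r s" "t = J r s t'"
  using bij[OF assms(1,2)] assms(3) by (auto simp: bij_betw_def)

lemma sub: "\<lbrakk>r \<in> Obj C; s \<in> Obj C; t \<in> Arr D r s; t' \<in> Arr D r s\<rbrakk> \<Longrightarrow>
    Sub D r s t t' \<in> Arr D r s \<and> J r s (Sub D r s t t') = Sub C r s (J r s t) (J r s t')"
  by (simp add: Sub_def add scl)

lemmas homs = obj JC add scl cmp idt adj nrm tar sub C.tunit_closed C.tobj_closed

lemma transfer_category: "tensor_cstar_category D"
  apply unfold_locales
  subgoal by (simp add: homs)
  subgoal by (simp add: homs)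
  subgoal for r s by (rule J_eqI[of r s]) (simp_all add: homs C.add_assoc)
  subgoal for r s by (rule J_eqI[of r s]) (simp_all add: homs C.add_commute)
  subgoal for r s
  proof -
    assume o: "r \<in> Obj D" "s \<in> Obj D"
    then obtain z where z: "z \<in> Arr C r s" "\<forall>t\<in>Arr C r s. Add C r s t z = t \<and> Sub C r s t t = z"
      using C.zero_exists[of r s] by (auto simp: obj)
    obtain z' where z': "z' \<in> Arr D r s" "z = J r s z'" using J_surj[OF _ _ z(1)] o by (auto simp: obj)
    show "\<exists>z\<in>Arr D r s. \<forall>t\<in>Arr D r s. Add D r s t z = t \<and> Sub D r s t t = z"
    proof (intro bexI[OF _ z'(1)] ballI conjI)
      fix t assume t: "t \<in> Arr D r s"
      show "Add D r s t z' = t"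
        by (rule J_eqI[of r s]) (use o t z' z in \<open>simp_all add: homs\<close>)
      show "Sub D r s t t = z'"
        by (rule J_eqI[of r s]) (use o t z' z in \<open>simp_all add: homs\<close>)
    qed
  qed
  subgoal for r s by (rule J_eqI[of r s]) (simp_all add: homs C.scale_one)
  subgoal for r s by (rule J_eqI[of r s]) (simp_all add: homs C.scale_scale)
  subgoal for r s by (rule J_eqI[of r s]) (simp_all add: homs C.scale_add_left)
  subgoal for r s by (rule J_eqI[of r s]) (simp_all add: homs C.scale_add_right)
  subgoal for r s t using C.norm_definite[of r s "J r s t"] J_eqI[of r s t "Scl D r s 0 t"] by (simp add: homs)
  subgoal by (simp add: homs C.norm_scale)
  subgoal by (simp add: homs C.norm_triangle)
  subgoal for r s f
  proof -
    assume o: "r \<in> Obj D" "s \<in> Obj D" and f: "\<And>n. f n \<in> Arr D r s"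
      and cau: "\<And>e. 0 < e \<Longrightarrow> \<exists>N. \<forall>m\<ge>N. \<forall>n\<ge>N. Nrm D r s (Sub D r s (f m) (f n)) < e"
    have oC: "r \<in> Obj C" "s \<in> Obj C" using o by (simp_all add: obj)
    have eq: "Nrm D r s (Sub D r s t t') = Nrm C r s (Sub C r s (J r s t) (J r s t'))"
      if "t \<in> Arr D r s" "t' \<in> Arr D r s" for t t' using that oC by (simp add: homs)
    have "\<exists>t\<in>Arr C r s. (\<lambda>n. Nrm C r s (Sub C r s (J r s (f n)) t)) \<longlonglongrightarrow> 0"
      by (rule C.norm_complete[OF oC]) (use JC[OF oC f] cau in \<open>simp_all add: eq[OF f f]\<close>)
    then obtain t where t: "t \<in> Arr C r s" "(\<lambda>n. Nrm C r s (Sub C r s (J r s (f n)) t)) \<longlonglongrightarrow> 0" by blast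
    obtain t' where t': "t' \<in> Arr D r s" "t = J r s t'" using J_surj[OF oC t(1)] by blast
    show "\<exists>t\<in>Arr D r s. (\<lambda>n. Nrm D r s (Sub D r s (f n) t)) \<longlonglongrightarrow> 0"
      by (rule bexI[OF _ t'(1)]) (use t(2) in \<open>simp add: eq[OF f t'(1)] t'(2)\<close>)
  qed
  subgoal by (simp add: homs)
  subgoal for r s u w by (rule J_eqI[of r w]) (simp_all add: homs C.comp_assoc)
  subgoal by (simp add: homs)
  subgoal for r s t
    using J_eqI[of r s "Cmp D r s s (Idt D s) t" t] J_eqI[of r s "Cmp D r r s t (Idt D r)" t]
    by (simp add: homs C.comp_id)
  subgoal for r s u by (rule J_eqI[of r u]) (simp_all add: homs C.comp_add_right)
  subgoal for r s u by (rule J_eqI[of r u]) (simp_all add: homs C.comp_add_left)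
  subgoal for r s u t t' c
    using J_eqI[of r u "Cmp D r s u t' (Scl D r s c t)" "Scl D r u c (Cmp D r s u t' t)"]
      J_eqI[of r u "Cmp D r s u (Scl D s u c t') t" "Scl D r u c (Cmp D r s u t' t)"]
    by (simp add: homs C.comp_scale)
  subgoal by (simp add: homs C.norm_comp)
  subgoal by (simp add: homs)
  subgoal for r s by (rule J_eqI[of r s]) (simp_all add: homs C.adj_adj)
  subgoal for r s by (rule J_eqI[of s r]) (simp_all add: homs C.adj_add)
  subgoal for r s by (rule J_eqI[of s r]) (simp_all add: homs C.adj_scale)
  subgoal for r s u by (rule J_eqI[of u r]) (simp_all add: homs C.adj_comp)
  subgoal by (simp add: homs C.cstar_identity)
  subgoal for r s t c p
  proof -
    assume o: "r \<in> Obj D" "s \<in> Obj D" and t: "t \<in> Arr D r s" and c: "\<not> (Im c = 0 \<and> 0 \<le> Re c)"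
      and p: "p = Sub D r r (Cmp D r s r (Adj D r s t) t) (Scl D r r c (Idt D r))"
    have oC: "r \<in> Obj C" "s \<in> Obj C" using o by (simp_all add: obj)
    have pD: "p \<in> Arr D r r" using oC t by (simp add: p homs)
    have Jp: "J r r p = Sub C r r (Cmp C r s r (Adj C r s (J r s t)) (J r s t)) (Scl C r r c (Idt C r))"
      using oC t by (simp add: p homs)
    obtain q where q: "q \<in> Arr C r r" "Cmp C r r r q (J r r p) = Idt C r" "Cmp C r r r (J r r p) q = Idt C r"
      using C.adj_comp_positive[OF oC JC[OF oC t] c Jp] by blast
    obtain q' where q': "q' \<in> Arr D r r" "q = J r r q'" using J_surj[OF oC(1,1) q(1)] by blast
    show "\<exists>q\<in>Arr D r r. Cmp D r r r q p = Idt D r \<and> Cmp D r r r p q = Idt D r"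
    proof (intro bexI[OF _ q'(1)] conjI)
      show "Cmp D r r r q' p = Idt D r"
        by (rule J_eqI[of r r]) (use oC q' q pD in \<open>simp_all add: homs\<close>)
      show "Cmp D r r r p q' = Idt D r"
        by (rule J_eqI[of r r]) (use oC q' q pD in \<open>simp_all add: homs\<close>)
    qed
  qed
  subgoal by (simp add: homs)
  subgoal by (simp add: homs)
  subgoal by (simp add: homs C.tobj_assoc)
  subgoal by (simp add: homs C.tobj_unit)
  subgoal by (simp add: homs)
  subgoal for r s r' s' r'' s''
    by (rule J_eqI[of "TOb C r (TOb C r' r'')" "TOb C s (TOb C s' s'')"])
      (use tar[of "TOb C r r'" "TOb C s s'" r'' s''] in \<open>simp_all add: homs C.tobj_assoc C.tens_assoc[symmetric]\<close>)
  subgoal for r s t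
    using J_eqI[of r s "TAr D (TUn D) (TUn D) r s (Idt D (TUn D)) t" t]
      J_eqI[of r s "TAr D r s (TUn D) (TUn D) t (Idt D (TUn D))" t]
      tar[of "TUn C" "TUn C" r s "Idt D (TUn C)" t] tar[of r s "TUn C" "TUn C" t "Idt D (TUn C)"]
    by (simp add: homs C.tobj_unit C.tens_unit)
  subgoal for r s by (rule J_eqI[of "TOb C r s" "TOb C r s"]) (simp_all add: homs C.tens_id)
  subgoal for r s u r' s' u' by (rule J_eqI[of "TOb C r r'" "TOb C u u'"]) (simp_all add: homs C.tens_comp)
  subgoal for r s r' s' by (rule J_eqI[of "TOb C s s'" "TOb C r r'"]) (simp_all add: homs C.tens_adj)
  subgoal for r s r' s' by (rule J_eqI[of "TOb C r r'" "TOb C s s'"]) (simp_all add: homs C.tens_add_left)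
  subgoal for r s r' s' by (rule J_eqI[of "TOb C r r'" "TOb C s s'"]) (simp_all add: homs C.tens_add_right)
  subgoal for r s r' s' t t' c
    using J_eqI[of "TOb C r r'" "TOb C s s'" "TAr D r s r' s' (Scl D r s c t) t'"
        "Scl D (TOb C r r') (TOb C s s') c (TAr D r s r' s' t t')"]
      J_eqI[of "TOb C r r'" "TOb C s s'" "TAr D r s r' s' t (Scl D r' s' c t')"
        "Scl D (TOb C r r') (TOb C s s') c (TAr D r s r' s' t t')"]
    by (simp add: homs C.tens_scale)
  done

lemma transfer_isomorphic: "tensor_cstar_isomorphic C D"
proof -
  \<comment> \<open>The isomorphism has to run from \<open>C\<close> to \<open>D\<close>, against
    the direction of \<open>J\<close>.\<close>
  define F where "F r s = inv_into (Arr D r s) (J r s)" for r s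
  have F: "F r s t \<in> Arr D r s" "J r s (F r s t) = t" if "r \<in> Obj C" "s \<in> Obj C" "t \<in> Arr C r s" for r s t
    using that bij[OF that(1,2)] unfolding F_def bij_betw_def
    by (metis inv_into_into, metis f_inv_into_f)
  have FI: "F r s t = t'" if "r \<in> Obj C" "s \<in> Obj C" "t \<in> Arr C r s" "t' \<in> Arr D r s" "J r s t' = t" for r s t t'
    by (rule J_eqI[OF that(1,2) F(1)[OF that(1-3)] that(4)]) (simp add: F(2)[OF that(1-3)] that(5))
  have "tensor_cstar_isomorphism C D (\<lambda>r. r) F"
    unfolding tensor_cstar_isomorphism_def
  proof (intro conjI ballI allI)
    show "bij_betw (\<lambda>r. r) (Obj C) (Obj D)" unfolding obj(1) bij_betw_def by simp
    show "TUn C = TUn D" by (simp add: obj)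
    show "F r r (Idt C r) = Idt D r" if "r \<in> Obj C" for r
      by (rule FI) (use that in \<open>simp_all add: homs C.id_closed\<close>)
  next
    fix r s assume o: "r \<in> Obj C" "s \<in> Obj C"
    show "TOb C r s = TOb D r s" by (simp add: obj)
    show "bij_betw (F r s) (Arr C r s) (Arr D r s)"
      unfolding F_def by (rule bij_betw_inv_into[OF bij[OF o]])
    fix t assume t: "t \<in> Arr C r s"
    note Ft = F[OF o t]
    show "F s r (Adj C r s t) = Adj D r s (F r s t)"
      by (rule FI) (use o t Ft in \<open>simp_all add: homs C.adj_closed\<close>)
    show "Nrm D r s (F r s t) = Nrm C r s t" using o Ft by (simp add: homs)
    show "F r s (Scl C r s c t) = Scl D r s c (F r s t)" for c
      by (rule FI) (use o t Ft in \<open>simp_all add: homs C.scale_closed\<close>)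
    show "F r s (Add C r s t t') = Add D r s (F r s t) (F r s t')" if t': "t' \<in> Arr C r s" for t'
      by (rule FI) (use o t t' Ft F[OF o t'] in \<open>simp_all add: homs C.add_closed\<close>)
    show "F r u (Cmp C r s u t' t) = Cmp D r s u (F s u t') (F r s t)" if u: "u \<in> Obj C" and t': "t' \<in> Arr C s u" for u t'
      by (rule FI) (use o t t' u Ft F[OF o(2) u t'] in \<open>simp_all add: homs C.comp_closed\<close>)
    show "F (TOb C r r') (TOb C s s') (TAr C r s r' s' t t') = TAr D r s r' s' (F r s t) (F r' s' t')"
      if o': "r' \<in> Obj C" "s' \<in> Obj C" and t': "t' \<in> Arr C r' s'" for r' s' t'
      by (rule FI) (use o t t' o' Ft F[OF o' t'] in \<open>simp_all add: homs C.tens_closed\<close>)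
  qed
  then show ?thesis
    unfolding tensor_cstar_isomorphic_def
    using transfer_category C.tensor_cstar_category_axioms by blast
qed

end

section \<open>The category of intertwiners and its isomorphism with the dual\<close>

context cuntz_pimsner_setup
begin

lemma intertwinerD:
  assumes "intertwiner r s t"
  shows "t \<in> OG" "a \<in> OG \<Longrightarrow> t * (\<sigma> ^^ r) a = (\<sigma> ^^ s) a * t"
  using assms by (simp_all add: intertwiner_def)

lemma intertwiner_add: "intertwiner r s t \<Longrightarrow> intertwiner r s t' \<Longrightarrow> intertwiner r s (t + t')"
  by (simp add: intertwiner_def OG_closed distrib_left distrib_right)

lemma intertwiner_scale: "intertwiner r s t \<Longrightarrow> intertwiner r s (scaleC c t)"
  by (simp add: intertwiner_def OG_closed mult_scaleC_left mult_scaleC_right)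

lemma intertwiner_mult:
  assumes t: "intertwiner r s t" and t': "intertwiner s u t'"
  shows "intertwiner r u (t' * t)"
  unfolding intertwiner_def
proof (intro conjI ballI)
  show "t' * t \<in> OG" using t t' by (simp add: intertwiner_def OG_closed)
  fix a assume a: "a \<in> OG"
  have "t' * t * (\<sigma> ^^ r) a = t' * ((\<sigma> ^^ s) a * t)" by (simp add: mult.assoc intertwinerD(2)[OF t a])
  also have "\<dots> = (\<sigma> ^^ u) a * (t' * t)" by (simp add: mult.assoc[symmetric] intertwinerD(2)[OF t' a])
  finally show "t' * t * (\<sigma> ^^ r) a = (\<sigma> ^^ u) a * (t' * t)" .
qed

lemma intertwiner_star:
  assumes t: "intertwiner r s t"
  shows "intertwiner s r (star t)"
  unfolding intertwiner_def
proof (intro conjI ballI)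
  show "star t \<in> OG" using t by (simp add: intertwiner_def OG_closed)
  fix a assume a: "a \<in> OG"
  have "star (t * (\<sigma> ^^ r) (star a)) = star ((\<sigma> ^^ s) (star a) * t)"
    using intertwinerD(2)[OF t OG_closed(5)[OF a]] by simp
  then show "star t * (\<sigma> ^^ s) a = (\<sigma> ^^ r) a * star t"
    by (simp add: star_mult sigma_pow(4) star_star)
qed

lemma intertwiner_e: "intertwiner r r e"
  by (simp add: intertwiner_def e_OG e_unit sigma_OG)

lemma intertwiner_tensor:
  assumes t: "intertwiner r s t" and t': "intertwiner r' s' t'"
  shows "intertwiner (r + r') (s + s') (t * (\<sigma> ^^ r) t')"
  unfolding intertwiner_def
proof (intro conjI ballI)
  show "t * (\<sigma> ^^ r) t' \<in> OG" by (intro OG_closed(4) sigma_OG intertwinerD(1)[OF t] intertwinerD(1)[OF t'])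
  fix a assume a: "a \<in> OG"
  have "t * (\<sigma> ^^ r) t' * (\<sigma> ^^ (r + r')) a = t * (\<sigma> ^^ r) (t' * (\<sigma> ^^ r') a)"
    by (simp add: funpow_add sigma_pow(3) mult.assoc)
  also have "\<dots> = t * (\<sigma> ^^ r) ((\<sigma> ^^ s') a) * (\<sigma> ^^ r) t'"
    unfolding intertwinerD(2)[OF t' a] by (simp add: sigma_pow(3) mult.assoc)
  also have "\<dots> = (\<sigma> ^^ (s + s')) a * (t * (\<sigma> ^^ r) t')"
    unfolding intertwinerD(2)[OF t sigma_OG[OF a]] by (simp add: funpow_add mult.assoc)
  finally show "t * (\<sigma> ^^ r) t' * (\<sigma> ^^ (r + r')) a = (\<sigma> ^^ (s + s')) a * (t * (\<sigma> ^^ r) t')" .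
qed

lemma closed_intertwiner: "closed {t. intertwiner r s t}"
proof -
  have "{t. intertwiner r s t} = OG \<inter> (\<Inter>a\<in>OG. {t. t * (\<sigma> ^^ r) a = (\<sigma> ^^ s) a * t})"
    by (auto simp: intertwiner_def)
  moreover have "closed (\<Inter>a\<in>OG. {t. t * (\<sigma> ^^ r) a = (\<sigma> ^^ s) a * t})"
    by (intro closed_INT ballI closed_Collect_eq continuous_intros)
  ultimately show ?thesis using OG_closed(1) by (simp add: closed_Int)
qed

text \<open>The powers start from \<open>e\<close>, the unit of the subalgebra. Partial sums are
  intertwiners and intertwiners form a closed set, so the inverse is an intertwiner too.\<close>

lemma neumann:
  assumes x: "intertwiner r r x" and n: "norm x < 1"
  shows "\<exists>q. intertwiner r r q \<and> (e - x) * q = e \<and> q * (e - x) = e"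
proof -
  define P where "P n = ((\<lambda>y. x * y) ^^ n) e" for n
  have P0: "P 0 = e" and PS: "P (Suc n) = x * P n" for n by (simp_all add: P_def)
  have Pi: "intertwiner r r (P n)" for n
    by (induction n) (simp_all add: P0 PS intertwiner_e intertwiner_mult[OF _ x])
  note xO = intertwinerD(1)[OF x] and PO = intertwinerD(1)[OF Pi]
  have PS': "P (Suc n) = P n * x" for n
    by (induction n) (simp add: P0 PS e_unit[OF xO], metis PS mult.assoc)
  have "norm (P n) \<le> norm x ^ n" for n
  proof (induction n)
    case 0
    show ?case by (simp add: P0 norm_e)
  next
    case (Suc n)
    have "norm (P (Suc n)) \<le> norm x * norm (P n)" unfolding PS by (rule norm_mult_ineq)
    also have "\<dots> \<le> norm x * norm x ^ n" by (rule mult_left_mono[OF Suc]) simp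
    finally show ?case by simp
  qed
  then have sm: "summable P" using n by (intro summable_comparison_test[OF _ summable_geometric[of "norm x"]]) auto
  define q where "q = suminf P"
  have lim: "(\<lambda>n. \<Sum>i<n. P i) \<longlonglongrightarrow> q" unfolding q_def by (rule summable_LIMSEQ[OF sm])
  have "intertwiner r r (\<Sum>i<n. P i)" for n
  proof (induction n)
    case 0
    show ?case using intertwiner_scale[OF intertwiner_e, of r 0] by simp
  qed (simp add: intertwiner_add Pi)
  then have qi: "intertwiner r r q"
    using closed_sequentially[OF closed_intertwiner[of r r] _ lim] by simp
  have S: "(\<lambda>n. P (Suc n)) sums (q - e)"
    using summable_sums[OF sm] sums_Suc_iff[of P "q - e"] by (simp add: P0 q_def)
  have "(\<lambda>n. x * P n) sums (x * q)" "(\<lambda>n. P n * x) sums (q * x)"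
    unfolding q_def by (rule sums_mult[OF summable_sums[OF sm]], rule sums_mult2[OF summable_sums[OF sm]])
  then have "x * q = q - e" "q * x = q - e"
    using S sums_unique2 unfolding PS[symmetric] PS'[symmetric] by blast+
  then have "(e - x) * q = e" "q * (e - x) = e"
    using e_unit[OF intertwinerD(1)[OF qi]] by (simp_all add: left_diff_distrib right_diff_distrib)
  then show ?thesis using qi by blast
qed

text \<open>Since intertwiners are known to be morphisms, the estimate on the fibres applies:
  \<open>e\<close> minus \<kappa> times \<open>p\<close> has norm below 1, and the Neumann series
  inverts \<kappa> times \<open>p\<close> among the intertwiners.\<close>

lemma positive_invertible:
  assumes t: "intertwiner r s t" and c: "\<not> (Im c = 0 \<and> 0 \<le> Re c)"
  defines "p \<equiv> star t * t - scaleC c e"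
  shows "\<exists>q. intertwiner r r q \<and> q * p = e \<and> p * q = e"
proof -
  obtain u where u: "u \<in> inv_hom r s" "t = j r s u" using t unfolding intertwiner_iff by blast
  note ut = inv_closed(1)[OF u(1)]
  obtain \<kappa> where \<kappa>: "\<kappa> \<noteq> 0" and small: "mn r r (madd (tpow E r) (tpow E r) (mscale (tpow E r) (tpow E r) (1 + \<kappa> * c) (mid (tpow E r)))
      (mscale (tpow E r) (tpow E r) (- \<kappa>) (mcomp (tpow E r) (madj (tpow E r) (tpow E s) u) u))) < 1"
    using TT.positive_contraction[OF compact_tpow ut c] by blast
  let ?a = "mcomp (tpow E r) (madj (tpow E r) (tpow E s) u) u"
  let ?w = "madd (tpow E r) (tpow E r) (mscale (tpow E r) (tpow E r) (1 + \<kappa> * c) (mid (tpow E r)))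
      (mscale (tpow E r) (tpow E r) (- \<kappa>) ?a)"
  have a: "?a \<in> thom E r r" by (intro thom_closed(3)[OF ut] thom_closed(4)[OF ut])
  have ja: "j r r ?a = star t * t"
    using j_simps(6)[OF ut thom_closed(4)[OF ut]] j_simps(3)[OF ut] by (simp add: u(2))
  have wt: "?w \<in> thom E r r" by (intro thom_closed(1,2) thom_closed(5) a)
  have jw: "j r r ?w = scaleC (1 + \<kappa> * c) e + scaleC (- \<kappa>) (star t * t)"
    unfolding j_simps(5)[OF thom_closed(2)[OF thom_closed(5)] thom_closed(2)[OF a]] j_simps(4)[OF thom_closed(5)]
      j_simps(4)[OF a] e_eq ja ..
  define x where "x = scaleC (1 + \<kappa> * c) e + scaleC (- \<kappa>) (star t * t)"
  have xi: "intertwiner r r x"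
    unfolding x_def
    by (intro intertwiner_add intertwiner_scale intertwiner_e intertwiner_mult[OF t intertwiner_star[OF t]])
  have "norm x < 1" using small j_simps(2)[OF wt] unfolding jw x_def by simp
  then obtain q where q: "intertwiner r r q" "(e - x) * q = e" "q * (e - x) = e" using neumann[OF xi] by blast
  have neg: "scaleC (- \<kappa>) y = - scaleC \<kappa> y" for y :: 'a
    using scaleC_scaleC[of "-1" \<kappa> y] by simp
  have ex: "e - x = scaleC \<kappa> p"
    unfolding x_def p_def scaleC_diff_right scaleC_scaleC scaleC_add_left neg by simp
  have "scaleC \<kappa> q * p = e" "p * scaleC \<kappa> q = e"
    using q(2,3) unfolding ex by (simp_all add: mult_scaleC_left mult_scaleC_right)
  then show ?thesis using intertwiner_scale[OF q(1), of \<kappa>] by blast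
qed

abbreviation EC :: "(nat, 'a) tensor_cat" where "EC \<equiv> endo_category OG (restrict \<sigma> OG)"

text \<open>\<sigma> maps O_G into itself, so iterating the restriction never leaves the set where
  it agrees with \<sigma>.\<close>

lemma restrict_pow: "a \<in> OG \<Longrightarrow> (restrict \<sigma> OG ^^ n) a = (\<sigma> ^^ n) a"
proof (induction n)
  case (Suc n)
  then show ?case using sigma_OG[of a n] by simp
qed simp

lemma EC_simps:
  "Obj EC = UNIV" "Cmp EC r s u t' t = t' * t" "Idt EC r = e" "Add EC r s t t' = t + t'" "Scl EC r s c t = scaleC c t"
  "Nrm EC r s t = norm t" "Adj EC r s t = star t" "TUn EC = 0" "TOb EC r s = r + s"
  "TAr EC r s r' s' t t' = t * (restrict \<sigma> OG ^^ r) t'" "Sub EC r s t t' = t - t'"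
  by (simp_all add: endo_category_def algebra_unit Sub_def)

lemma EC_Arr: "t \<in> Arr EC r s \<longleftrightarrow> intertwiner r s t"
  by (auto simp: endo_category_def intertwiner_def restrict_pow)

lemma EC_category: "tensor_cstar_category EC"
  apply unfold_locales
  unfolding EC_simps EC_Arr
  subgoal by (rule intertwiner_add)
  subgoal by (rule intertwiner_scale)
  subgoal by (rule add.assoc)
  subgoal by (rule add.commute)
  subgoal for r s using intertwiner_e intertwiner_iff[of r s] by (intro bexI[of _ 0]) (simp_all add: EC_Arr intertwiner_def OG_closed(2))
  subgoal by simp
  subgoal by (rule scaleC_scaleC)
  subgoal by (rule scaleC_add_left)
  subgoal by (rule scaleC_add_right)
  subgoal by simp
  subgoal by (rule norm_scaleC)
  subgoal by (rule norm_triangle_ineq)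
  subgoal for r s f
  proof -
    assume f: "\<And>n. intertwiner r s (f n)"
      and cau: "\<And>e. 0 < e \<Longrightarrow> \<exists>N. \<forall>m\<ge>N. \<forall>n\<ge>N. norm (f m - f n) < e"
    have "Cauchy f" unfolding Cauchy_iff using cau by blast
    then obtain t where t: "f \<longlonglongrightarrow> t" using Cauchy_convergent convergent_def by blast
    have "intertwiner r s t" using closed_sequentially[OF closed_intertwiner[of r s] _ t] f by simp
    moreover have "(\<lambda>n. norm (f n - t)) \<longlonglongrightarrow> 0" using t by (simp add: tendsto_norm_zero_iff LIM_zero_iff)
    ultimately show "\<exists>t\<in>Arr EC r s. (\<lambda>n. norm (f n - t)) \<longlonglongrightarrow> 0" by (auto simp: EC_Arr)
  qed
  subgoal by (rule intertwiner_mult)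
  subgoal by (rule mult.assoc[symmetric])
  subgoal by (rule intertwiner_e)
  subgoal by (simp add: e_unit intertwinerD(1))
  subgoal by (rule distrib_left)
  subgoal by (rule distrib_right)
  subgoal by (simp add: mult_scaleC_left mult_scaleC_right)
  subgoal by (rule norm_mult_ineq)
  subgoal by (rule intertwiner_star)
  subgoal by (rule star_star)
  subgoal by (rule star_add)
  subgoal by (rule star_scaleC)
  subgoal by (rule star_mult)
  subgoal by (rule norm_star_mult)
  subgoal using positive_invertible by (auto simp: EC_Arr Bex_def)
  subgoal by simp
  subgoal by simp
  subgoal by simp
  subgoal by simp
  subgoal by (simp add: restrict_pow intertwinerD(1) intertwiner_tensor)
  subgoal for r s r' s' r'' s'' t t' t''
    using intertwinerD(1)[of r s t] intertwinerD(1)[of r' s' t'] intertwinerD(1)[of r'' s'' t'']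
    by (simp add: restrict_pow OG_closed(4) sigma_OG funpow_add sigma_pow(3) mult.assoc)
  subgoal by (simp add: restrict_pow e_OG e_unit intertwinerD(1) sigma_e)
  subgoal by (simp add: restrict_pow e_OG e_unit sigma_e)
  \<comment> \<open>The interchange law: \<open>t2'\<close> has to pass through \<open>t1\<close>,
    which is the intertwining relation of \<open>t1\<close>.\<close>
  subgoal for r s u r' s' u' t1 t2 t1' t2'
    using intertwinerD(2)[of r s t1 t2'] intertwinerD(1)[of r' s' t1'] intertwinerD(1)[of s' u' t2']
    by (simp add: restrict_pow OG_closed(4) sigma_pow(3)) (metis mult.assoc)
  \<comment> \<open>The adjoint reverses the product; the intertwining relation of
    \<open>star t\<close> restores the order.\<close>
  subgoal for r s r' s' t t'
    using intertwinerD(2)[OF intertwiner_star, of r s t "star t'"] intertwinerD(1)[of r' s' t'] OG_closed(5)[of t']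
    by (simp add: restrict_pow star_mult sigma_pow(4)[symmetric])
  subgoal for r s r' s' t1 t2 t'
    using intertwinerD(1)[of r' s' t'] by (simp add: restrict_pow distrib_right)
  subgoal for r s r' s' t t1 t2
    using intertwinerD(1)[of r' s' t1] intertwinerD(1)[of r' s' t2]
    by (simp add: restrict_pow OG_closed(3) sigma_pow(2) distrib_left)
  subgoal for r s r' s' t t' c
    using intertwinerD(1)[of r' s' t']
    by (simp add: restrict_pow OG_closed(6) sigma_pow(5) mult_scaleC_left mult_scaleC_right)
  done

lemma DC_simps:
  "Obj (dual_category E G) = UNIV" "Arr (dual_category E G) = inv_hom"
  "Cmp (dual_category E G) r s u t' t = mcomp (tpow E r) t' t" "Idt (dual_category E G) r = mid (tpow E r)"
  "Add (dual_category E G) r s t t' = madd (tpow E r) (tpow E s) t t'"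
  "Scl (dual_category E G) r s c t = mscale (tpow E r) (tpow E s) c t"
  "Nrm (dual_category E G) r s t = mn r s t" "Adj (dual_category E G) r s t = madj (tpow E r) (tpow E s) t"
  "TUn (dual_category E G) = 0" "TOb (dual_category E G) = (\<lambda>r s. r + s)"
  "TAr (dual_category E G) r s r' s' t t' = mtensor E r s r' s' t t'"
  by (simp_all add: dual_category_def)

lemma isomorphic: "tensor_cstar_isomorphic EC (dual_category E G)"
proof -
  interpret EC: tensor_cstar_category EC by (rule EC_category)
  interpret category_transfer EC "dual_category E G" j
    apply unfold_locales
    subgoal by (simp add: EC_simps DC_simps)
    subgoal by (simp add: EC_simps DC_simps)
    subgoal by (simp add: EC_simps DC_simps fun_eq_iff)
    subgoal for r s
      unfolding bij_betw_def inj_on_def DC_simps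
      using j_inj inv_closed(1) EC_Arr intertwiner_iff by blast
    subgoal by (simp add: EC_simps DC_simps inv_closed j_simps)
    subgoal by (simp add: EC_simps DC_simps inv_closed j_simps)
    subgoal for r s u t t'
      using j_simps(6)[of t r s t' u] by (auto simp: EC_simps DC_simps inv_closed)
    subgoal by (simp add: EC_simps DC_simps inv_closed e_eq)
    subgoal by (simp add: EC_simps DC_simps inv_closed j_simps)
    subgoal by (simp add: EC_simps DC_simps inv_closed(1) j_simps)
    \<comment> \<open>The tensor product of intertwiners, \<open>t\<close> times a translate of
      \<open>t'\<close>, is the image of the tensor product of morphisms by
      \<open>j_sigma_mult\<close>.\<close>
    subgoal for r s r' s' t t'
      using j_sigma_mult(1)[of t r s t' r' s'] j_OG[of t' r' s']
      by (simp add: EC_simps DC_simps inv_closed restrict_pow)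
    done
  show ?thesis by (rule transfer_isomorphic)
qed

end

theorem corollary4p4:
  fixes E :: "('x, 'e) hbundle"
    and G :: "('e \<Rightarrow> 'e) set"
    and j :: "nat \<Rightarrow> nat \<Rightarrow> ('x \<times> 'e tensor \<Rightarrow> 'x \<times> 'e tensor) \<Rightarrow> 'a::cstar_algebra"
    and \<sigma> :: "'a \<Rightarrow> 'a"
  assumes "compact_space (bbase E)" and "Hausdorff_space (bbase E)"
    and "hermitian_bundle E" and "brank E \<ge> 2"
    and "closed_unitary_group E G"
    and "cuntz_pimsner E j"
    and "canonical_endomorphism E j \<sigma>"
  shows "tensor_cstar_isomorphic
           (endo_category (invariant_algebra E j G) (restrict \<sigma> (invariant_algebra E j G)))
           (dual_category E G)"
proof -
  interpret cuntz_pimsner_setup E G j \<sigma>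
    by unfold_locales (use assms in auto)
  show ?thesis by (rule isomorphic)
qed

end
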